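(* Let $k$ be a field of characteristic $p>0$, let $Q$ be a finite connected quiver, and let $A=kQ/\langle Z\rangle$ be a finite-dimensional monomial algebra. Let $e_{p'}$ be the number of efficient $p'$-circuits in $Q$. Then $$\dim_k HH_1(A) = s + \sum_{C \in \mathcal E} w_C - e_{p'} = |Q_1\odot B| - |Q_0\odot B| + |Q_0| - e_{p'} + s,$$ where $\mathcal E$ is the set of efficient circuits, $s$ is the number of non trivial strong circuits, and $w_C=|W\cap C|$.
   Context: Quiver: vertices $Q_0$, arrows $Q_1$, source and terminal maps $s,t:Q_1\to Q_0$. A path of length $l\ge 1$ is a sequence $a_l\cdots a_1$ of arrows with $t(a_i)=s(a_{i+1})$; its source is $s(a_1)$, its terminal vertex is $t(a_l)$. Vertices are the (trivial) paths of length $0$. A cycle is a path whose source and terminal vertex coincide. The product in $kQ$ is concatenation. $Z$ is a set of paths of length at least two, minimal for the subpath order (no strict subpath of an element of $Z$ is in $Z$), and $A=kQ/\langle Z\rangle$. $B$ is the set of paths (including vertices) containing no path of $Z$ as a subpath; it is identified with a $k$-basis of $A$. A zero path (zero cycle) is a path (cycle) containing a path of $Z$. $HH_1(A)=H_1(A,A)$ is the first Hochschild homology group $\mathrm{Tor}_1(A,A)$ over $A$-$A$-bimodules. For sets of paths $X,Y$: $X\odot Y=\{(\alpha,\beta)\in X\times Y: t(\beta)=s(\alpha),\ t(\alpha)=s(\beta)\}$. A circuit is an equivalence class of cycles under the equivalence relation generated by rotation $a_n\cdots a_1\sim a_1a_n\cdots a_2$ ($a_i$ arrows); it is trivial if it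 corresponds to a vertex. For a circuit $C$, $(X\odot Y)_C=\{(\alpha,\beta)\in X\odot Y:\alpha\beta\in C\}$. A circuit $C$ is useful if $(Q_1\odot B)_C\ne\emptyset$; strong if every cycle of $C$ belongs to $B$; efficient if it is useful, not strong, and $(Z\odot B)_C\neq\emptyset$. Multiplicity: for a non trivial circuit $C$ containing a cycle $\gamma$ of length $n$, the period $l$ is the smallest positive integer such that the $l$-th iterated rotation of $\gamma$ equals $\gamma$; then $l\mid n$ and the multiplicity is $m=n/l$. $C$ is a $p'$-circuit if its multiplicity is not divisible by $p$. $W$ is the set of cycles $\gamma$ of $Q$ of the form $\gamma=\xi\alpha$ with $\xi\in Z$ such that no other subpath of $\gamma$ (no other occurrence) belongs to $Z$; $w_C=|W\cap C|$. *)

theory Defs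
  imports
    "HOL-Algebra.QuotRing"
    "Jordan_Normal_Form.VS_Connect"
    "Graph_Theory.Digraph_Component"
    "Graph_Theory.Arc_Walk"
begin

hide_const (open) Multiset.mult Polynomial.smult Modules.module

section \<open>Vector spaces over a field given as a type\<close>

text \<open>
  Vector spaces over a field \<open>'k\<close> are records of type \<open>('k, 'm) module\<close>, to be used with the
  locale \<open>vectorspace class_ring\<close>. The ring fields \<open>mult\<close> and \<open>one\<close> of such a record are
  meaningful only where the record describes a (not necessarily commutative) algebra.
\<close>

definition unit_fun :: "'x \<Rightarrow> 'x \<Rightarrow> 'k::field" where
  "unit_fun x = (\<lambda>y. if y = x then 1 else 0)"

definition free_space :: "'x set \<Rightarrow> ('k::field, 'x \<Rightarrow> 'k) module" where
  "free_space X =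
    \<lparr>carrier = {f. finite {x. f x \<noteq> 0} \<and> {x. f x \<noteq> 0} \<subseteq> X},
     mult = (\<lambda>f g x. 0),
     one = (\<lambda>x. 0),
     zero = (\<lambda>x. 0),
     add = (\<lambda>f g x. f x + g x),
     smult = (\<lambda>c f x. c * f x)\<rparr>"

definition linear_ext :: "('x \<Rightarrow> 'y \<Rightarrow> 'k::field) \<Rightarrow> ('x \<Rightarrow> 'k) \<Rightarrow> 'y \<Rightarrow> 'k" where
  "linear_ext \<phi> f = (\<lambda>y. \<Sum>x | f x \<noteq> 0. f x * \<phi> x y)"

text \<open>
  The quotient of a vector space by a subspace, and also the quotient of an algebra by an ideal.
  The ring operations are those of \<open>Quot\<close>. A scalar acts on a coset through its elements, and
  \<open>N\<close> is added back so that the scalar 0 yields the coset \<open>N\<close> and not \<open>{0}\<close>.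
\<close>

definition quot_module :: "('k, 'm, 'z) module_scheme \<Rightarrow> 'm set \<Rightarrow> ('k, 'm set) module" where
  "quot_module V N =
    ring.extend (V Quot N) (module.fields (\<lambda>c X. \<Union>x\<in>X. N +>\<^bsub>V\<^esub> (c \<odot>\<^bsub>V\<^esub> x)))"

text \<open>
  The map from \<open>V/M\<close> to \<open>W/N\<close> induced by a linear map \<open>h\<close> from \<open>V\<close> to \<open>W\<close> that sends \<open>M\<close>
  into \<open>N\<close>. The argument \<open>X\<close> is a coset of \<open>M\<close>.
\<close>

definition quot_map :: "('w, 'z) ring_scheme \<Rightarrow> 'w set \<Rightarrow> ('v \<Rightarrow> 'w) \<Rightarrow> 'v set \<Rightarrow> 'w set" where
  "quot_map W N h X = (\<Union>x\<in>X. N +>\<^bsub>W\<^esub> h x)"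


section \<open>Hochschild homology\<close>

text \<open>
  The \<open>m\<close>-fold tensor power of \<open>A\<close> over \<open>'k\<close>: the class of \<open>unit_fun [a1, ..., am]\<close> is the
  elementary tensor of \<open>a1, ..., am\<close>.
\<close>

definition tensor_lists :: "('k::field, 'a) module \<Rightarrow> nat \<Rightarrow> 'a list set" where
  "tensor_lists A m = {xs. length xs = m \<and> set xs \<subseteq> carrier A}"

definition formal_tensors :: "('k::field, 'a) module \<Rightarrow> nat \<Rightarrow> ('k, 'a list \<Rightarrow> 'k) module" where
  "formal_tensors A m = free_space (tensor_lists A m)"

definition multilinear_rels :: "('k::field, 'a) module \<Rightarrow> nat \<Rightarrow> ('a list \<Rightarrow> 'k) set" where
  "multilinear_rels A m =
    {\<lambda>zs. unit_fun (xs @ (a \<oplus>\<^bsub>A\<^esub> b) # ys) zs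
        - unit_fun (xs @ a # ys) zs - unit_fun (xs @ b # ys) zs | xs a b ys.
        xs @ a # ys \<in> tensor_lists A m \<and> b \<in> carrier A} \<union>
    {\<lambda>zs. unit_fun (xs @ (c \<odot>\<^bsub>A\<^esub> a) # ys) zs - c * unit_fun (xs @ a # ys) zs | xs a c ys.
        xs @ a # ys \<in> tensor_lists A m}"

definition multilinear_null :: "('k::field, 'a) module \<Rightarrow> nat \<Rightarrow> ('a list \<Rightarrow> 'k) set" where
  "multilinear_null A m = LinearCombinations.module.span class_ring (formal_tensors A m) (multilinear_rels A m)"

definition tensor_power ::
    "('k::field, 'a) module \<Rightarrow> nat \<Rightarrow> ('k, ('a list \<Rightarrow> 'k) set) module" where
  "tensor_power A m = quot_module (formal_tensors A m) (multilinear_null A m)"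

definition tensor_map ::
    "('k::field, 'a) module \<Rightarrow> nat \<Rightarrow> ('a list \<Rightarrow> 'a list \<Rightarrow> 'k)
      \<Rightarrow> ('a list \<Rightarrow> 'k) set \<Rightarrow> ('a list \<Rightarrow> 'k) set" where
  "tensor_map A m \<phi> = quot_map (formal_tensors A m) (multilinear_null A m) (linear_ext \<phi>)"

record ('k, 'm, 'a) bimodule = "('k, 'm) module" +
  lact :: "'a \<Rightarrow> 'm \<Rightarrow> 'm"
  ract :: "'m \<Rightarrow> 'a \<Rightarrow> 'm"

text \<open>
  The bar resolution of \<open>A\<close>: in degree \<open>n\<close> the bimodule \<open>A \<otimes> A^n \<otimes> A\<close>, on which \<open>A\<close> acts
  through the two outer factors. It is free because \<open>'k\<close> is a field.
\<close>

definition bar_bimodule ::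
    "('k::field, 'a) module \<Rightarrow> nat \<Rightarrow> ('k, ('a list \<Rightarrow> 'k) set, 'a) bimodule" where
  "bar_bimodule A n =
    module.extend (tensor_power A (n + 2))
      (bimodule.fields
        (\<lambda>a. tensor_map A (n + 2) (\<lambda>xs. unit_fun ((a \<otimes>\<^bsub>A\<^esub> hd xs) # tl xs)))
        (\<lambda>X a. tensor_map A (n + 2) (\<lambda>xs. unit_fun (butlast xs @ [last xs \<otimes>\<^bsub>A\<^esub> a])) X))"

definition bar_face :: "('k::field, 'a) module \<Rightarrow> nat \<Rightarrow> 'a list \<Rightarrow> 'a list" where
  "bar_face A i xs = take i xs @ (xs ! i \<otimes>\<^bsub>A\<^esub> xs ! Suc i) # drop (i + 2) xs"

text \<open>The differential from degree \<open>n + 1\<close> to degree \<open>n\<close>.\<close>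

definition bar_diff ::
    "('k::field, 'a) module \<Rightarrow> nat \<Rightarrow> ('a list \<Rightarrow> 'k) set \<Rightarrow> ('a list \<Rightarrow> 'k) set" where
  "bar_diff A n =
    tensor_map A (n + 2) (\<lambda>xs ys. \<Sum>i\<le>n + 1. (- 1) ^ i * unit_fun (bar_face A i xs) ys)"

text \<open>
  The tensor product of \<open>A\<close> with a bimodule \<open>X\<close> over the enveloping algebra of \<open>A\<close>, i.e. with
  \<open>A\<close> as a right and \<open>X\<close> as a left module: \<open>a b \<otimes> x = a \<otimes> b x\<close> and \<open>b a \<otimes> x = a \<otimes> x b\<close>.
\<close>

definition env_formal ::
    "('k::field, 'a) module \<Rightarrow> ('k, 'm, 'a) bimodule \<Rightarrow> ('k, 'a \<times> 'm \<Rightarrow> 'k) module" where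
  "env_formal A X = free_space (carrier A \<times> carrier X)"

definition env_rels ::
    "('k::field, 'a) module \<Rightarrow> ('k, 'm, 'a) bimodule \<Rightarrow> ('a \<times> 'm \<Rightarrow> 'k) set" where
  "env_rels A X =
    {\<lambda>z. unit_fun (a \<oplus>\<^bsub>A\<^esub> b, x) z - unit_fun (a, x) z - unit_fun (b, x) z | a b x.
        a \<in> carrier A \<and> b \<in> carrier A \<and> x \<in> carrier X} \<union>
    {\<lambda>z. unit_fun (a, x \<oplus>\<^bsub>X\<^esub> y) z - unit_fun (a, x) z - unit_fun (a, y) z | a x y.
        a \<in> carrier A \<and> x \<in> carrier X \<and> y \<in> carrier X} \<union>
    {\<lambda>z. unit_fun (c \<odot>\<^bsub>A\<^esub> a, x) z - c * unit_fun (a, x) z | c a x.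
        a \<in> carrier A \<and> x \<in> carrier X} \<union>
    {\<lambda>z. unit_fun (a, c \<odot>\<^bsub>X\<^esub> x) z - c * unit_fun (a, x) z | c a x.
        a \<in> carrier A \<and> x \<in> carrier X} \<union>
    {\<lambda>z. unit_fun (a \<otimes>\<^bsub>A\<^esub> b, x) z - unit_fun (a, lact X b x) z | a b x.
        a \<in> carrier A \<and> b \<in> carrier A \<and> x \<in> carrier X} \<union>
    {\<lambda>z. unit_fun (b \<otimes>\<^bsub>A\<^esub> a, x) z - unit_fun (a, ract X x b) z | a b x.
        a \<in> carrier A \<and> b \<in> carrier A \<and> x \<in> carrier X}"

definition env_null ::
    "('k::field, 'a) module \<Rightarrow> ('k, 'm, 'a) bimodule \<Rightarrow> ('a \<times> 'm \<Rightarrow> 'k) set" where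
  "env_null A X = LinearCombinations.module.span class_ring (env_formal A X) (env_rels A X)"

definition env_tensor ::
    "('k::field, 'a) module \<Rightarrow> ('k, 'm, 'a) bimodule \<Rightarrow> ('k, ('a \<times> 'm \<Rightarrow> 'k) set) module" where
  "env_tensor A X = quot_module (env_formal A X) (env_null A X)"

text \<open>The map \<open>id \<otimes> f\<close> into the tensor product of \<open>A\<close> with \<open>Y\<close>.\<close>

definition env_tensor_map ::
    "('k::field, 'a) module \<Rightarrow> ('k, 'n, 'a) bimodule \<Rightarrow> ('m \<Rightarrow> 'n)
      \<Rightarrow> ('a \<times> 'm \<Rightarrow> 'k) set \<Rightarrow> ('a \<times> 'n \<Rightarrow> 'k) set" where
  "env_tensor_map A Y f =
    quot_map (env_formal A Y) (env_null A Y) (linear_ext (\<lambda>(a, x). unit_fun (a, f x)))"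

text \<open>
  \<open>hochschild_homology A n\<close> is \<open>Tor_n(A, A)\<close> over the enveloping algebra of \<open>A\<close>, computed from
  the bar resolution.
\<close>

type_synonym ('k, 'a) hochschild_chain = "('a \<times> ('a list \<Rightarrow> 'k) set \<Rightarrow> 'k) set"

definition hochschild_chains ::
    "('k::field, 'a) module \<Rightarrow> nat \<Rightarrow> ('k, ('k, 'a) hochschild_chain) module" where
  "hochschild_chains A n = env_tensor A (bar_bimodule A n)"

definition hochschild_diff ::
    "('k::field, 'a) module \<Rightarrow> nat \<Rightarrow> ('k, 'a) hochschild_chain \<Rightarrow> ('k, 'a) hochschild_chain" where
  "hochschild_diff A n = env_tensor_map A (bar_bimodule A n) (bar_diff A n)"

definition hochschild_cycles ::
    "('k::field, 'a) module \<Rightarrow> nat \<Rightarrow> ('k, 'a) hochschild_chain set" where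
  "hochschild_cycles A n =
    (case n of
      0 \<Rightarrow> carrier (hochschild_chains A 0)
    | Suc m \<Rightarrow>
        a_kernel (hochschild_chains A (Suc m)) (hochschild_chains A m) (hochschild_diff A m))"

definition hochschild_boundaries ::
    "('k::field, 'a) module \<Rightarrow> nat \<Rightarrow> ('k, 'a) hochschild_chain set" where
  "hochschild_boundaries A n = hochschild_diff A n ` carrier (hochschild_chains A (Suc n))"

definition hochschild_homology ::
    "('k::field, 'a) module \<Rightarrow> nat \<Rightarrow> ('k, ('k, 'a) hochschild_chain set) module" where
  "hochschild_homology A n =
    quot_module ((hochschild_chains A n)\<lparr>carrier := hochschild_cycles A n\<rparr>)
      (hochschild_boundaries A n)"


section \<open>Paths in a quiver\<close>

text \<open>
  A quiver is a \<open>pre_digraph\<close>, which admits loops and multiple arcs. A path is the pair of its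
  source and the list of its arrows in the order in which they are traversed: the path written
  \<open>a_l ... a_1\<close> is \<open>(tail G a_1, [a_1, ..., a_l])\<close>, and \<open>(v, [])\<close> is the vertex \<open>v\<close>.
\<close>

type_synonym ('v, 'e) qpath = "'v \<times> 'e list"

definition psource :: "('v, 'e) qpath \<Rightarrow> 'v" where
  "psource \<gamma> = fst \<gamma>"

definition ptarget :: "('v, 'e) pre_digraph \<Rightarrow> ('v, 'e) qpath \<Rightarrow> 'v" where
  "ptarget G \<gamma> = (if snd \<gamma> = [] then fst \<gamma> else head G (last (snd \<gamma>)))"

definition plength :: "('v, 'e) qpath \<Rightarrow> nat" where
  "plength \<gamma> = length (snd \<gamma>)"

definition paths :: "('v, 'e) pre_digraph \<Rightarrow> ('v, 'e) qpath set" where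
  "paths G = {\<gamma>. pre_digraph.awalk G (psource \<gamma>) (snd \<gamma>) (ptarget G \<gamma>)}"

definition vertex_paths :: "('v, 'e) pre_digraph \<Rightarrow> ('v, 'e) qpath set" where
  "vertex_paths G = (\<lambda>v. (v, [])) ` verts G"

definition arrow_paths :: "('v, 'e) pre_digraph \<Rightarrow> ('v, 'e) qpath set" where
  "arrow_paths G = (\<lambda>a. (tail G a, [a])) ` arcs G"

text \<open>The product \<open>\<alpha>\<beta>\<close>, which traverses \<open>\<beta>\<close> first.\<close>

definition pcomp :: "('v, 'e) qpath \<Rightarrow> ('v, 'e) qpath \<Rightarrow> ('v, 'e) qpath" where
  "pcomp \<alpha> \<beta> = (psource \<beta>, snd \<beta> @ snd \<alpha>)"

definition composable :: "('v, 'e) pre_digraph \<Rightarrow> ('v, 'e) qpath \<Rightarrow> ('v, 'e) qpath \<Rightarrow> bool" where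
  "composable G \<alpha> \<beta> \<longleftrightarrow> \<alpha> \<in> paths G \<and> \<beta> \<in> paths G \<and> ptarget G \<beta> = psource \<alpha>"

text \<open>
  An occurrence of \<open>\<zeta>\<close> in \<open>\<gamma>\<close> is a factorization \<open>\<gamma> = \<mu>\<zeta>\<nu>\<close>, recorded by the pair \<open>(\<mu>, \<nu>)\<close>.
\<close>

definition occurrences ::
    "('v, 'e) pre_digraph \<Rightarrow> ('v, 'e) qpath \<Rightarrow> ('v, 'e) qpath
      \<Rightarrow> (('v, 'e) qpath \<times> ('v, 'e) qpath) set" where
  "occurrences G \<zeta> \<gamma> =
    {(\<mu>, \<nu>). composable G \<zeta> \<nu> \<and> composable G \<mu> \<zeta> \<and> \<gamma> = pcomp \<mu> (pcomp \<zeta> \<nu>)}"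

definition subpath :: "('v, 'e) pre_digraph \<Rightarrow> ('v, 'e) qpath \<Rightarrow> ('v, 'e) qpath \<Rightarrow> bool" where
  "subpath G \<zeta> \<gamma> \<longleftrightarrow> occurrences G \<zeta> \<gamma> \<noteq> {}"


section \<open>Monomial algebras\<close>

definition path_algebra ::
    "('v, 'e) pre_digraph \<Rightarrow> ('k::field, ('v, 'e) qpath \<Rightarrow> 'k) module" where
  "path_algebra G = (free_space (paths G))
    \<lparr>mult := (\<lambda>f g \<gamma>. \<Sum>(\<alpha>, \<beta>) | composable G \<alpha> \<beta> \<and> pcomp \<alpha> \<beta> = \<gamma>. f \<alpha> * g \<beta>),
     one := (\<lambda>\<gamma>. if \<gamma> \<in> vertex_paths G then 1 else 0)\<rparr>"

definition monomial_relations :: "('v, 'e) pre_digraph \<Rightarrow> ('v, 'e) qpath set \<Rightarrow> bool" where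
  "monomial_relations G Z \<longleftrightarrow>
    (\<forall>\<zeta>\<in>Z. \<zeta> \<in> paths G \<and> 2 \<le> plength \<zeta>) \<and>
    (\<forall>\<zeta>\<in>Z. \<forall>\<xi>\<in>Z. subpath G \<xi> \<zeta> \<longrightarrow> \<xi> = \<zeta>)"

definition monomial_algebra ::
    "('v, 'e) pre_digraph \<Rightarrow> ('v, 'e) qpath set
      \<Rightarrow> ('k::field, (('v, 'e) qpath \<Rightarrow> 'k) set) module" where
  "monomial_algebra G Z =
    quot_module (path_algebra G) (Idl\<^bsub>path_algebra G\<^esub> (unit_fun ` Z))"

definition nonzero_paths ::
    "('v, 'e) pre_digraph \<Rightarrow> ('v, 'e) qpath set \<Rightarrow> ('v, 'e) qpath set" where
  "nonzero_paths G Z = {\<gamma> \<in> paths G. \<forall>\<zeta>\<in>Z. \<not> subpath G \<zeta> \<gamma>}"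


section \<open>Circuits\<close>

definition cycles :: "('v, 'e) pre_digraph \<Rightarrow> ('v, 'e) qpath set" where
  "cycles G = {\<gamma> \<in> paths G. psource \<gamma> = ptarget G \<gamma>}"

text \<open>
  Rotation sends \<open>a_n ... a_1\<close> to \<open>a_1 a_n ... a_2\<close>, whose source is the terminal vertex of
  \<open>a_1\<close>; it fixes the vertices.
\<close>

definition rotation :: "('v, 'e) pre_digraph \<Rightarrow> ('v, 'e) qpath \<Rightarrow> ('v, 'e) qpath" where
  "rotation G \<gamma> = (if snd \<gamma> = [] then \<gamma> else (head G (hd (snd \<gamma>)), rotate1 (snd \<gamma>)))"

definition rotation_rel :: "('v, 'e) pre_digraph \<Rightarrow> ('v, 'e) qpath rel" where
  "rotation_rel G = {(\<gamma>, rotation G \<gamma>) | \<gamma>. \<gamma> \<in> cycles G}"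

definition circuits :: "('v, 'e) pre_digraph \<Rightarrow> ('v, 'e) qpath set set" where
  "circuits G = cycles G // (rotation_rel G \<union> (rotation_rel G)\<inverse>)\<^sup>*"

definition trivial_circuit :: "('v, 'e) pre_digraph \<Rightarrow> ('v, 'e) qpath set \<Rightarrow> bool" where
  "trivial_circuit G C \<longleftrightarrow> (\<exists>v\<in>verts G. C = {(v, [])})"

definition odot ::
    "('v, 'e) pre_digraph \<Rightarrow> ('v, 'e) qpath set \<Rightarrow> ('v, 'e) qpath set
      \<Rightarrow> (('v, 'e) qpath \<times> ('v, 'e) qpath) set" where
  "odot G X Y =
    {(\<alpha>, \<beta>) \<in> X \<times> Y. ptarget G \<beta> = psource \<alpha> \<and> ptarget G \<alpha> = psource \<beta>}"

definition odot_at ::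
    "('v, 'e) pre_digraph \<Rightarrow> ('v, 'e) qpath set \<Rightarrow> ('v, 'e) qpath set \<Rightarrow> ('v, 'e) qpath set
      \<Rightarrow> (('v, 'e) qpath \<times> ('v, 'e) qpath) set" where
  "odot_at G X Y C = {(\<alpha>, \<beta>) \<in> odot G X Y. pcomp \<alpha> \<beta> \<in> C}"

definition useful ::
    "('v, 'e) pre_digraph \<Rightarrow> ('v, 'e) qpath set \<Rightarrow> ('v, 'e) qpath set \<Rightarrow> bool" where
  "useful G Z C \<longleftrightarrow> odot_at G (arrow_paths G) (nonzero_paths G Z) C \<noteq> {}"

definition strong ::
    "('v, 'e) pre_digraph \<Rightarrow> ('v, 'e) qpath set \<Rightarrow> ('v, 'e) qpath set \<Rightarrow> bool" where
  "strong G Z C \<longleftrightarrow> C \<subseteq> nonzero_paths G Z"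

definition efficient ::
    "('v, 'e) pre_digraph \<Rightarrow> ('v, 'e) qpath set \<Rightarrow> ('v, 'e) qpath set \<Rightarrow> bool" where
  "efficient G Z C \<longleftrightarrow>
    useful G Z C \<and> \<not> strong G Z C \<and> odot_at G Z (nonzero_paths G Z) C \<noteq> {}"

definition efficient_circuits ::
    "('v, 'e) pre_digraph \<Rightarrow> ('v, 'e) qpath set \<Rightarrow> ('v, 'e) qpath set set" where
  "efficient_circuits G Z = {C \<in> circuits G. efficient G Z C}"

definition nontrivial_strong_circuits ::
    "('v, 'e) pre_digraph \<Rightarrow> ('v, 'e) qpath set \<Rightarrow> ('v, 'e) qpath set set" where
  "nontrivial_strong_circuits G Z = {C \<in> circuits G. \<not> trivial_circuit G C \<and> strong G Z C}"

definition period :: "('v, 'e) pre_digraph \<Rightarrow> ('v, 'e) qpath \<Rightarrow> nat" where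
  "period G \<gamma> = (LEAST l. 0 < l \<and> (rotation G ^^ l) \<gamma> = \<gamma>)"

text \<open>For a circuit the value does not depend on the cycle chosen in it.\<close>

definition multiplicity :: "('v, 'e) pre_digraph \<Rightarrow> ('v, 'e) qpath set \<Rightarrow> nat" where
  "multiplicity G C = (let \<gamma> = (SOME \<gamma>. \<gamma> \<in> C) in plength \<gamma> div period G \<gamma>)"

definition p'_circuit :: "nat \<Rightarrow> ('v, 'e) pre_digraph \<Rightarrow> ('v, 'e) qpath set \<Rightarrow> bool" where
  "p'_circuit p G C \<longleftrightarrow> \<not> trivial_circuit G C \<and> \<not> p dvd multiplicity G C"

text \<open>
  The cycles \<open>\<gamma> = \<xi>\<alpha>\<close> with \<open>\<xi> \<in> Z\<close> in which this is the only occurrence of an element of \<open>Z\<close>.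
  Occurrences are those in the path \<open>\<gamma>\<close> itself, not in its rotations.
\<close>

definition W_cycles ::
    "('v, 'e) pre_digraph \<Rightarrow> ('v, 'e) qpath set \<Rightarrow> ('v, 'e) qpath set" where
  "W_cycles G Z =
    {\<gamma> \<in> cycles G. \<exists>\<xi>\<in>Z. \<exists>\<alpha>. composable G \<xi> \<alpha> \<and> \<gamma> = pcomp \<xi> \<alpha> \<and>
      (\<forall>\<zeta>\<in>Z. \<forall>(\<mu>, \<nu>) \<in> occurrences G \<zeta> \<gamma>. \<zeta> = \<xi> \<and> \<mu> = (ptarget G \<xi>, []) \<and> \<nu> = \<alpha>)}"

definition w_count ::
    "('v, 'e) pre_digraph \<Rightarrow> ('v, 'e) qpath set \<Rightarrow> ('v, 'e) qpath set \<Rightarrow> nat" where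
  "w_count G Z C = card (W_cycles G Z \<inter> C)"

end

theory Submission
  imports Defs "HOL-Library.Function_Algebras" "HOL-Library.Sublist"
begin

text \<open>
  In terms of the basis \<open>B\<close> of \<open>A\<close>, Hochschild chains of degree \<open>n\<close> have the basis \<open>B^(n+1)\<close>. By the
  Leibniz rule every chain \<open>b \<otimes> c\<close> of degree one is, up to boundaries and chains that come from
  non-cycles, a sum of chains \<open>\<beta> \<otimes> a\<close> with \<open>a\<close> an arrow and \<open>a\<beta>\<close> a cycle. Hence \<open>HH_1(A)\<close> can be
  computed with functions on the set of cycles \<open>a\<beta>\<close> with \<open>\<beta>\<close> in \<open>B\<close>. Such a function is a
  one-cycle iff it takes the same value at \<open>\<delta>\<close> and at the rotation of \<open>\<delta>\<close> whenever \<open>\<delta>\<close> belongs to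
  \<open>B\<close>, and the boundaries are spanned by the functions \<open>m(C) 1_C\<close>, where \<open>m(C)\<close> is the multiplicity
  of a circuit \<open>C\<close> that is not strong.

  Everything now splits over the circuits. On a strong circuit the one-cycles are the constant
  functions and there are no boundaries. On any other circuit the cycles are partitioned into runs
  of successive rotations, each of which ends in an element of \<open>W\<close>, so one-cycles have dimension
  \<open>w_C\<close>, and the boundaries have dimension one if \<open>p\<close> does not divide \<open>m(C)\<close> and zero otherwise.

  For the second formula, multiplication identifies \<open>Q_1 \<odot> B\<close> with the set of all cycles \<open>a\<beta>\<close>,
  which consists of \<open>W\<close> and of the non trivial cycles in \<open>B\<close>.
\<close>

section \<open>Linear algebra over a field given as a type\<close>

text \<open>The multiplicity comes from counting. If abc is a cycle of length n, the Leibniz rule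
  turns each term of the boundary of a \<otimes> b \<otimes> c into a sum of rotations of abc. If bc
  is nonzero, the terms cancel; if bc = 0, the sum of all n rotations is left, and these pass m(C)
  times through the n / m(C) different cycles of C. In characteristic p this is zero as soon as p
  divides m(C), so only efficient p'-circuits lose a dimension. The obstacle is that chains are
  classes of formal sums in iterated quotients, for which no basis is given in advance. Dimensions
  are therefore computed by duality: linear forms are defined on formal generators and checked on
  relations, and a finite family of forms with common kernel zero and with dual vectors has as many
  members as the dimension. For the homology the forms are the values at one cycle of each strong
  circuit and at the elements of \<open>W\<close>; in each efficient p'-circuit one element of
  \<open>W\<close> is dropped and its value is subtracted from the others.\<close>

lemma vectorspace_class_ringI:
  fixes V :: "('k::field, 'm, 'z) module_scheme"
  assumes "\<zero>\<^bsub>V\<^esub> \<in> carrier V"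
    and "\<And>x y. x \<in> carrier V \<Longrightarrow> y \<in> carrier V \<Longrightarrow> x \<oplus>\<^bsub>V\<^esub> y \<in> carrier V"
    and "\<And>c x. x \<in> carrier V \<Longrightarrow> c \<odot>\<^bsub>V\<^esub> x \<in> carrier V"
    and "\<And>x y z. x \<in> carrier V \<Longrightarrow> y \<in> carrier V \<Longrightarrow> z \<in> carrier V \<Longrightarrow>
      (x \<oplus>\<^bsub>V\<^esub> y) \<oplus>\<^bsub>V\<^esub> z = x \<oplus>\<^bsub>V\<^esub> (y \<oplus>\<^bsub>V\<^esub> z)"
    and "\<And>x y. x \<in> carrier V \<Longrightarrow> y \<in> carrier V \<Longrightarrow> x \<oplus>\<^bsub>V\<^esub> y = y \<oplus>\<^bsub>V\<^esub> x"
    and "\<And>x. x \<in> carrier V \<Longrightarrow> \<zero>\<^bsub>V\<^esub> \<oplus>\<^bsub>V\<^esub> x = x"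
    and "\<And>x. x \<in> carrier V \<Longrightarrow> 0 \<odot>\<^bsub>V\<^esub> x = \<zero>\<^bsub>V\<^esub>"
    and "\<And>x. x \<in> carrier V \<Longrightarrow> 1 \<odot>\<^bsub>V\<^esub> x = x"
    and "\<And>c d x. x \<in> carrier V \<Longrightarrow> (c + d) \<odot>\<^bsub>V\<^esub> x = c \<odot>\<^bsub>V\<^esub> x \<oplus>\<^bsub>V\<^esub> d \<odot>\<^bsub>V\<^esub> x"
    and "\<And>c x y. x \<in> carrier V \<Longrightarrow> y \<in> carrier V \<Longrightarrow>
      c \<odot>\<^bsub>V\<^esub> (x \<oplus>\<^bsub>V\<^esub> y) = c \<odot>\<^bsub>V\<^esub> x \<oplus>\<^bsub>V\<^esub> c \<odot>\<^bsub>V\<^esub> y"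
    and "\<And>c d x. x \<in> carrier V \<Longrightarrow> (c * d) \<odot>\<^bsub>V\<^esub> x = c \<odot>\<^bsub>V\<^esub> (d \<odot>\<^bsub>V\<^esub> x)"
  shows "vectorspace class_ring V"
proof -
  \<comment> \<open>Negatives are built from the scalar action: (- 1) x + x = (- 1 + 1) x =
    0.\<close>
  have inv: "\<exists>y\<in>carrier V. y \<oplus>\<^bsub>V\<^esub> x = \<zero>\<^bsub>V\<^esub>" if "x \<in> carrier V" for x
  proof
    show "(- 1) \<odot>\<^bsub>V\<^esub> x \<oplus>\<^bsub>V\<^esub> x = \<zero>\<^bsub>V\<^esub>"
      using assms(9)[OF that, of "-1" 1] assms(7,8)[OF that] by simp
  qed (use assms(3) that in auto)
  have "abelian_group V"
    by (rule abelian_groupI) (use assms inv in auto)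
  then have "Module.module class_ring V"
    by (intro Module.moduleI class_cring.cring_axioms) (use assms in \<open>auto simp: class_ring_simps\<close>)
  then show ?thesis
    by (intro vectorspace.intro class_field.field_axioms)
qed

lemma vectorspace_class_ringD:
  fixes V :: "('k::field, 'm, 'z) module_scheme"
  assumes V: "vectorspace class_ring V"
  shows "x \<in> carrier V \<Longrightarrow> c \<odot>\<^bsub>V\<^esub> x \<in> carrier V"
    and "x \<in> carrier V \<Longrightarrow> 0 \<odot>\<^bsub>V\<^esub> x = \<zero>\<^bsub>V\<^esub>"
    and "x \<in> carrier V \<Longrightarrow> 1 \<odot>\<^bsub>V\<^esub> x = x"
    and "x \<in> carrier V \<Longrightarrow> (- 1) \<odot>\<^bsub>V\<^esub> x = \<ominus>\<^bsub>V\<^esub> x"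
    and "x \<in> carrier V \<Longrightarrow> (c + d) \<odot>\<^bsub>V\<^esub> x = c \<odot>\<^bsub>V\<^esub> x \<oplus>\<^bsub>V\<^esub> d \<odot>\<^bsub>V\<^esub> x"
    and "x \<in> carrier V \<Longrightarrow> y \<in> carrier V \<Longrightarrow>
      c \<odot>\<^bsub>V\<^esub> (x \<oplus>\<^bsub>V\<^esub> y) = c \<odot>\<^bsub>V\<^esub> x \<oplus>\<^bsub>V\<^esub> c \<odot>\<^bsub>V\<^esub> y"
    and "x \<in> carrier V \<Longrightarrow> (c * d) \<odot>\<^bsub>V\<^esub> x = c \<odot>\<^bsub>V\<^esub> (d \<odot>\<^bsub>V\<^esub> x)"
    and "c \<odot>\<^bsub>V\<^esub> \<zero>\<^bsub>V\<^esub> = \<zero>\<^bsub>V\<^esub>"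
proof -
  interpret V: vectorspace class_ring V by fact
  show one: "x \<in> carrier V \<Longrightarrow> 1 \<odot>\<^bsub>V\<^esub> x = x"
    using V.smult_one by simp
  show "x \<in> carrier V \<Longrightarrow> (- 1) \<odot>\<^bsub>V\<^esub> x = \<ominus>\<^bsub>V\<^esub> x"
    using V.smult_l_minus[of 1 x] one by (simp add: class_ring_simps)
  show "x \<in> carrier V \<Longrightarrow> 0 \<odot>\<^bsub>V\<^esub> x = \<zero>\<^bsub>V\<^esub>"
    using V.smult_l_null[of x] by simp
  show "c \<odot>\<^bsub>V\<^esub> \<zero>\<^bsub>V\<^esub> = \<zero>\<^bsub>V\<^esub>"
    using V.smult_r_null[of c] by simp
qed (use vectorspace.axioms(1)[OF V] in
    \<open>auto simp: Module.module_def module_axioms_def\<close>)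

text \<open>The ring fields \<open>mult\<close> and \<open>one\<close> do not occur in the vector
  space axioms. This transfers the structure of \<open>free_space\<close> to
  \<open>path_algebra\<close>, which differs from it in these two fields only.\<close>

lemma vectorspace_fields_cong:
  fixes V :: "('k::field, 'm, 'z) module_scheme" and W :: "('k, 'm, 'y) module_scheme"
  assumes V: "vectorspace class_ring V"
    and eq: "carrier W = carrier V" "zero W = zero V" "add W = add V"
        "module.smult W = module.smult V"
  shows "vectorspace class_ring W"
proof -
  interpret V: vectorspace class_ring V by fact
  show ?thesis
    by (rule vectorspace_class_ringI)
      (auto simp: eq V.a_assoc vectorspace_class_ringD[OF V] intro: V.a_comm)
qed

text \<open>Scalars are elements of the type \<open>'k\<close> and not of a module record, so that
  values of functionals can be computed with the arithmetic of the type.\<close>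

definition linear_functional :: "('k::field, 'm, 'z) module_scheme \<Rightarrow> ('m \<Rightarrow> 'k) \<Rightarrow> bool" where
  "linear_functional V f \<longleftrightarrow>
    (\<forall>x\<in>carrier V. \<forall>y\<in>carrier V. f (x \<oplus>\<^bsub>V\<^esub> y) = f x + f y) \<and>
    (\<forall>c. \<forall>x\<in>carrier V. f (c \<odot>\<^bsub>V\<^esub> x) = c * f x)"

definition is_linear ::
    "('k::field, 'm, 'z) module_scheme \<Rightarrow> ('k, 'n, 'y) module_scheme \<Rightarrow> ('m \<Rightarrow> 'n) \<Rightarrow> bool" where
  "is_linear V W h \<longleftrightarrow>
    (\<forall>x\<in>carrier V. h x \<in> carrier W) \<and>
    (\<forall>x\<in>carrier V. \<forall>y\<in>carrier V. h (x \<oplus>\<^bsub>V\<^esub> y) = h x \<oplus>\<^bsub>W\<^esub> h y) \<and>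
    (\<forall>c. \<forall>x\<in>carrier V. h (c \<odot>\<^bsub>V\<^esub> x) = c \<odot>\<^bsub>W\<^esub> h x)"

lemma linear_functionalD:
  assumes "linear_functional V f"
  shows "x \<in> carrier V \<Longrightarrow> y \<in> carrier V \<Longrightarrow> f (x \<oplus>\<^bsub>V\<^esub> y) = f x + f y"
    and "x \<in> carrier V \<Longrightarrow> f (c \<odot>\<^bsub>V\<^esub> x) = c * f x"
  using assms by (auto simp: linear_functional_def)

lemma is_linearD:
  assumes "is_linear V W h"
  shows "x \<in> carrier V \<Longrightarrow> h x \<in> carrier W"
    and "x \<in> carrier V \<Longrightarrow> y \<in> carrier V \<Longrightarrow> h (x \<oplus>\<^bsub>V\<^esub> y) = h x \<oplus>\<^bsub>W\<^esub> h y"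
    and "x \<in> carrier V \<Longrightarrow> h (c \<odot>\<^bsub>V\<^esub> x) = c \<odot>\<^bsub>W\<^esub> h x"
  using assms by (auto simp: is_linear_def)

lemma is_linear_zero:
  fixes V :: "('k::field, 'm, 'z) module_scheme" and W :: "('k, 'n, 'y) module_scheme"
  assumes h: "is_linear V W h" and V: "vectorspace class_ring V" and W: "vectorspace class_ring W"
  shows "h \<zero>\<^bsub>V\<^esub> = \<zero>\<^bsub>W\<^esub>"
proof -
  interpret V: vectorspace class_ring V by fact
  interpret W: vectorspace class_ring W by fact
  show ?thesis
    using is_linearD(3)[OF h, of "\<zero>\<^bsub>V\<^esub>" 0] is_linearD(1)[OF h, of "\<zero>\<^bsub>V\<^esub>"]
    by (simp add: vectorspace_class_ringD[OF V] vectorspace_class_ringD[OF W])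
qed

section \<open>Subspaces, spans and quotients\<close>

lemma submodule_class_ringI:
  fixes V :: "('k::field, 'm, 'z) module_scheme"
  assumes V: "vectorspace class_ring V"
    and "N \<subseteq> carrier V" "\<zero>\<^bsub>V\<^esub> \<in> N" "\<And>x y. x \<in> N \<Longrightarrow> y \<in> N \<Longrightarrow> x \<oplus>\<^bsub>V\<^esub> y \<in> N"
    and "\<And>c x. x \<in> N \<Longrightarrow> c \<odot>\<^bsub>V\<^esub> x \<in> N"
  shows "LinearCombinations.submodule class_ring N V"
proof -
  interpret V: vectorspace class_ring V by fact
  show ?thesis
    by unfold_locales (use assms in auto)
qed

text \<open>The vectors of the carrier that satisfy \<open>P\<close> form a submodule, and the span
  is the least submodule that contains \<open>R\<close>.\<close>

lemma span_induct_class_ring [consumes 3, case_names zero base add smult]: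
  fixes V :: "('k::field, 'm, 'z) module_scheme"
  assumes V: "vectorspace class_ring V" and R: "R \<subseteq> carrier V"
    and x: "x \<in> LinearCombinations.module.span class_ring V R"
    and "P \<zero>\<^bsub>V\<^esub>" and "\<And>r. r \<in> R \<Longrightarrow> P r"
    and "\<And>x y. x \<in> carrier V \<Longrightarrow> y \<in> carrier V \<Longrightarrow> P x \<Longrightarrow> P y \<Longrightarrow> P (x \<oplus>\<^bsub>V\<^esub> y)"
    and "\<And>c x. x \<in> carrier V \<Longrightarrow> P x \<Longrightarrow> P (c \<odot>\<^bsub>V\<^esub> x)"
  shows "P x"
proof -
  interpret V: vectorspace class_ring V by fact
  have "LinearCombinations.submodule class_ring {x \<in> carrier V. P x} V"
    by (rule submodule_class_ringI[OF V]) (use assms in auto)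
  then have "LinearCombinations.module.span class_ring V R \<subseteq> {x \<in> carrier V. P x}"
    by (intro V.span_is_subset) (use assms in auto)
  then show ?thesis using x by auto
qed

lemma span_class_ring:
  fixes V :: "('k::field, 'm, 'z) module_scheme"
  assumes V: "vectorspace class_ring V" and R: "R \<subseteq> carrier V"
  shows "LinearCombinations.submodule class_ring (LinearCombinations.module.span class_ring V R) V"
    and "R \<subseteq> LinearCombinations.module.span class_ring V R"
proof -
  interpret V: vectorspace class_ring V by fact
  show "LinearCombinations.submodule class_ring (LinearCombinations.module.span class_ring V R) V"
    using R by (rule V.span_is_submodule)
  show "R \<subseteq> LinearCombinations.module.span class_ring V R"
    using R by (rule V.in_own_span)
qed

locale quotient_space = vectorspace class_ring V
  for V :: "('k::field, 'm, 'z) module_scheme" (structure) +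
  fixes N
  assumes sub: "LinearCombinations.submodule class_ring N V"
begin

lemmas vs_simps = vectorspace_class_ringD[OF vectorspace_axioms]

lemma N_sub: "N \<subseteq> carrier V"
  and N_zero: "\<zero> \<in> N"
  and N_add: "x \<in> N \<Longrightarrow> y \<in> N \<Longrightarrow> x \<oplus> y \<in> N"
  and N_smult: "x \<in> N \<Longrightarrow> c \<odot>\<^bsub>V\<^esub> x \<in> N"
  using sub by (auto simp: LinearCombinations.submodule_def)

sublocale N: abelian_subgroup N V
proof (rule abelian_subgroupI3)
  have inv: "\<ominus> x \<in> N" if "x \<in> N" for x
    using N_smult[OF that, of "-1"] vs_simps(4)[of x] that N_sub by auto
  show "additive_subgroup N V"
    by (intro additive_subgroup.intro subgroup.intro)
      (use N_sub N_zero N_add inv in \<open>auto simp: a_inv_def[symmetric]\<close>)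
qed (rule abelian_group_axioms)

lemma coset_eq_iff:
  assumes "x \<in> carrier V" "y \<in> carrier V"
  shows "N +> x = N +> y \<longleftrightarrow> x \<ominus> y \<in> N"
  using assms N.a_rcos_module[of y x] N.a_rcos_self[of x] N.a_repr_independence'[of x y]
  by (auto simp: a_minus_def)

lemma coset_zero: "N +> \<zero> = N"
  using N_sub by (simp add: a_coset_add_zero)

lemma carrier_quot_module: "carrier (quot_module V N) = (\<lambda>x. N +> x) ` carrier V"
  by (auto simp: quot_module_def ring.extend_def module.fields_def FactRing_def A_RCOSETS_def' )

lemma zero_quot_module: "\<zero>\<^bsub>quot_module V N\<^esub> = N"
  by (auto simp: quot_module_def ring.extend_def FactRing_def)

lemma add_quot_module:
  "x \<in> carrier V \<Longrightarrow> y \<in> carrier V \<Longrightarrow> (N +> x) \<oplus>\<^bsub>quot_module V N\<^esub> (N +> y) = N +> (x \<oplus> y)"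
  by (auto simp: quot_module_def ring.extend_def FactRing_def N.a_rcos_sum)

lemma coset_mem:
  assumes "x \<in> carrier V" "y \<in> N +> x"
  shows "y \<in> carrier V" "N +> y = N +> x"
  using assms a_r_coset_subset_G[OF N_sub] N.a_repr_independence'[of y x] by auto

text \<open>All members of the union that defines the scalar action are the same coset: if y - x
  lies in \<open>N\<close>, so does c (y - x).\<close>

lemma smult_quot_module:
  assumes x: "x \<in> carrier V"
  shows "c \<odot>\<^bsub>quot_module V N\<^esub> (N +> x) = N +> (c \<odot>\<^bsub>V\<^esub> x)"
proof -
  have "N +> (c \<odot>\<^bsub>V\<^esub> y) = N +> (c \<odot>\<^bsub>V\<^esub> x)" if y: "y \<in> N +> x" for y
  proof -
    have yV: "y \<in> carrier V" and eq: "N +> y = N +> x"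
      using coset_mem[OF x y] by auto
    have "y \<ominus> x \<in> N" using eq coset_eq_iff yV x by blast
    then have "c \<odot>\<^bsub>V\<^esub> (y \<ominus> x) \<in> N" by (rule N_smult)
    also have "c \<odot>\<^bsub>V\<^esub> (y \<ominus> x) = c \<odot>\<^bsub>V\<^esub> y \<ominus> c \<odot>\<^bsub>V\<^esub> x"
      using yV x smult_r_minus[of c x] by (simp add: a_minus_def vs_simps)
    finally show ?thesis using coset_eq_iff yV x by auto
  qed
  moreover have "x \<in> N +> x" using N.a_rcos_self x by blast
  ultimately have "(\<Union>y\<in>N +> x. N +> (c \<odot>\<^bsub>V\<^esub> y)) = N +> (c \<odot>\<^bsub>V\<^esub> x)" by blast
  then show ?thesis
    by (simp add: quot_module_def ring.extend_def module.fields_def)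
qed

lemma vectorspace_quot_module: "vectorspace class_ring (quot_module V N)"
proof (rule vectorspace_class_ringI)
  show "\<zero>\<^bsub>quot_module V N\<^esub> \<in> carrier (quot_module V N)"
    using coset_zero zero_quot_module carrier_quot_module by (metis imageI zero_closed)
  fix X assume X: "X \<in> carrier (quot_module V N)"
  then obtain x where x: "x \<in> carrier V" "X = N +> x" by (auto simp: carrier_quot_module)
  show "\<zero>\<^bsub>quot_module V N\<^esub> \<oplus>\<^bsub>quot_module V N\<^esub> X = X"
    using add_quot_module[of \<zero> x] x by (simp add: coset_zero zero_quot_module)
  show "0 \<odot>\<^bsub>quot_module V N\<^esub> X = \<zero>\<^bsub>quot_module V N\<^esub>"
    using x by (simp add: smult_quot_module coset_zero zero_quot_module vs_simps)
  show "1 \<odot>\<^bsub>quot_module V N\<^esub> X = X"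
    using x by (simp add: smult_quot_module vs_simps)
qed (auto simp: carrier_quot_module add_quot_module smult_quot_module a_ac
    vs_simps)

text \<open>The universal property of V/N for functionals: evaluation at a chosen representative is
  well defined because \<open>f\<close> kills \<open>N\<close>. The functionals on tensors, on
  chains and on the monomial algebra are all obtained from it.\<close>

lemma functional_quot_module:
  assumes f: "linear_functional V f" and null: "\<And>x. x \<in> N \<Longrightarrow> f x = 0"
  obtains F where "linear_functional (quot_module V N) F" "\<And>x. x \<in> carrier V \<Longrightarrow> F (N +> x) = f x"
proof -
  define F where "F X = f (SOME x. x \<in> X)" for X
  have F: "F (N +> x) = f x" if x: "x \<in> carrier V" for x
  proof -
    define y where "y = (SOME y. y \<in> N +> x)"
    have y: "y \<in> N +> x" unfolding y_def by (rule someI[of _ x]) (use N.a_rcos_self x in blast)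
    have yV: "y \<in> carrier V" using coset_mem x y by blast
    have "f (y \<ominus> x) = 0"
      using null coset_mem[OF x y] coset_eq_iff x by auto
    moreover have "f (y \<ominus> x) = f y - f x"
      using linear_functionalD(1)[OF f, of y "\<ominus> x"] linear_functionalD(2)[OF f, of x "-1"]
        vs_simps(4)[OF x] yV x by (simp add: a_minus_def)
    ultimately show ?thesis by (simp add: F_def y_def)
  qed
  have "linear_functional (quot_module V N) F"
    using linear_functionalD[OF f]
    by (auto simp: linear_functional_def carrier_quot_module add_quot_module smult_quot_module F)
  then show thesis using F that by blast
qed

end

text \<open>As for the scalar action, the cosets united in \<open>quot_map\<close> coincide, since h
  (y - x) lies in \<open>N\<close> whenever y - x lies in \<open>M\<close>.\<close>

lemma quot_map_coset:
  fixes V :: "('k::field, 'm, 'z) module_scheme" and W :: "('k, 'n, 'y) module_scheme"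
  assumes V: "quotient_space V M" and W: "quotient_space W N"
    and h: "is_linear V W h" and null: "\<And>x. x \<in> M \<Longrightarrow> h x \<in> N" and x: "x \<in> carrier V"
  shows "quot_map W N h (M +>\<^bsub>V\<^esub> x) = N +>\<^bsub>W\<^esub> h x"
proof -
  interpret V: quotient_space V M by fact
  interpret W: quotient_space W N by fact
  have "N +>\<^bsub>W\<^esub> h y = N +>\<^bsub>W\<^esub> h x" if y: "y \<in> M +>\<^bsub>V\<^esub> x" for y
  proof -
    have yV: "y \<in> carrier V" and "y \<ominus>\<^bsub>V\<^esub> x \<in> M"
      using V.coset_mem[OF x y] V.coset_eq_iff x by auto
    then have "h (y \<ominus>\<^bsub>V\<^esub> x) \<in> N" using null by blast
    moreover have "h (\<ominus>\<^bsub>V\<^esub> x) = \<ominus>\<^bsub>W\<^esub> h x"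
      using is_linearD[OF h] x V.vs_simps(4) W.vs_simps(4) by metis
    then have "h (y \<ominus>\<^bsub>V\<^esub> x) = h y \<ominus>\<^bsub>W\<^esub> h x"
      using is_linearD(2)[OF h, of y "\<ominus>\<^bsub>V\<^esub> x"] yV x by (simp add: a_minus_def)
    ultimately show ?thesis using W.coset_eq_iff is_linearD(1)[OF h] yV x by simp
  qed
  moreover have "x \<in> M +>\<^bsub>V\<^esub> x" using V.N.a_rcos_self x by blast
  ultimately show ?thesis unfolding quot_map_def by blast
qed

lemma quot_map_linear:
  fixes V :: "('k::field, 'm, 'z) module_scheme" and W :: "('k, 'n, 'y) module_scheme"
  assumes V: "quotient_space V M" and W: "quotient_space W N"
    and h: "is_linear V W h" and null: "\<And>x. x \<in> M \<Longrightarrow> h x \<in> N"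
  shows "is_linear (quot_module V M) (quot_module W N) (quot_map W N h)"
proof -
  interpret V: quotient_space V M by fact
  interpret W: quotient_space W N by fact
  note q = quot_map_coset[OF assms]
  show ?thesis
    using is_linearD[OF h]
    by (auto simp: is_linear_def V.carrier_quot_module W.carrier_quot_module q
        V.add_quot_module V.smult_quot_module W.add_quot_module W.smult_quot_module)
qed

section \<open>Free vector spaces and linear extension\<close>

definition fscale :: "'k::times \<Rightarrow> ('x \<Rightarrow> 'k) \<Rightarrow> 'x \<Rightarrow> 'k" where
  "fscale c f = (\<lambda>x. c * f x)"

lemma fscale_apply [simp]: "fscale c f x = c * f x"
  by (simp add: fscale_def)

lemma free_space_simps [simp]:
  "carrier (free_space X) = {f. finite {x. f x \<noteq> 0} \<and> {x. f x \<noteq> 0} \<subseteq> X}"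
  "f \<oplus>\<^bsub>free_space X\<^esub> g = f + g" "c \<odot>\<^bsub>free_space X\<^esub> f = fscale c f" "\<zero>\<^bsub>free_space X\<^esub> = 0"
  by (auto simp: free_space_def plus_fun_def zero_fun_def fscale_def)

lemma free_space_closed:
  "f \<in> carrier (free_space X) \<Longrightarrow> g \<in> carrier (free_space X) \<Longrightarrow> f + g \<in> carrier (free_space X)"
  "f \<in> carrier (free_space X) \<Longrightarrow> g \<in> carrier (free_space X) \<Longrightarrow> f - g \<in> carrier (free_space X)"
  "f \<in> carrier (free_space X) \<Longrightarrow> fscale c f \<in> carrier (free_space X)"
proof -
  have sub: "{x. f x + g x \<noteq> 0} \<subseteq> {x. f x \<noteq> 0} \<union> {x. g x \<noteq> 0}"
    "{x. f x \<noteq> g x} \<subseteq> {x. f x \<noteq> 0} \<union> {x. g x \<noteq> 0}" "{x. c * f x \<noteq> 0} \<subseteq> {x. f x \<noteq> 0}" by auto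
  note sub[THEN finite_subset]
  with sub show
    "f \<in> carrier (free_space X) \<Longrightarrow> g \<in> carrier (free_space X) \<Longrightarrow> f + g \<in> carrier (free_space X)"
    "f \<in> carrier (free_space X) \<Longrightarrow> g \<in> carrier (free_space X) \<Longrightarrow> f - g \<in> carrier (free_space X)"
    "f \<in> carrier (free_space X) \<Longrightarrow> fscale c f \<in> carrier (free_space X)"
    by auto
qed

lemma zero_in_free_space: "0 \<in> carrier (free_space X)"
  by auto

lemma unit_fun_in_free_space: "x \<in> X \<Longrightarrow> unit_fun x \<in> carrier (free_space X)"
  by (auto simp: unit_fun_def)

lemma vectorspace_free_space: "vectorspace class_ring (free_space X :: ('k::field, 'x \<Rightarrow> 'k) module)"
  by (rule vectorspace_class_ringI)
    (use free_space_closed[where X = X] in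
        \<open>auto simp del: free_space_simps(1) simp: zero_in_free_space
      fun_eq_iff algebra_simps\<close>)

text \<open>Induction on the support: a point \<open>s\<close> is split off by writing
  \<open>f\<close> as f(s := 0) plus a multiple of the unit function at \<open>s\<close>.\<close>

lemma free_space_induct [consumes 1, case_names zero add unit]:
  fixes f :: "'x \<Rightarrow> 'k::field"
  assumes f: "f \<in> carrier (free_space X)" and zero: "P 0"
    and add: "\<And>f g. f \<in> carrier (free_space X) \<Longrightarrow> g \<in> carrier (free_space X) \<Longrightarrow> P f \<Longrightarrow> P g \<Longrightarrow> P (f + g)"
    and unit: "\<And>c x. x \<in> X \<Longrightarrow> P (fscale c (unit_fun x))"
  shows "P f"
proof -
  have "finite {x. f x \<noteq> 0}" using f by simp
  moreover have "\<forall>f. {x. f x \<noteq> 0} = S \<longrightarrow> S \<subseteq> X \<longrightarrow> P f" if "finite S" for S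
    using that
  proof induction
    case empty
    have "f = 0" if "{x. f x \<noteq> 0} = {}" for f :: "'x \<Rightarrow> 'k" using that by (auto simp: fun_eq_iff)
    then show ?case using zero by metis
  next
    case (insert s S)
    show ?case
    proof (intro allI impI)
      fix f :: "'x \<Rightarrow> 'k" assume f: "{x. f x \<noteq> 0} = insert s S" and sub: "insert s S \<subseteq> X"
      have supp: "{x. (f(s := 0)) x \<noteq> 0} = S" using f insert by auto
      then have "P (f(s := 0))" using insert sub by blast
      moreover have "P (fscale (f s) (unit_fun s))" using unit sub by blast
      moreover have "fscale (f s) (unit_fun s) \<in> carrier (free_space X)"
        using unit_fun_in_free_space[of s X] sub free_space_closed(3) by blast
      moreover have "f(s := 0) \<in> carrier (free_space X)"
        using supp sub insert(1) by auto
      ultimately have "P (f(s := 0) + fscale (f s) (unit_fun s))" by (intro add)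
      moreover have "f(s := 0) + fscale (f s) (unit_fun s) = f" by (auto simp: unit_fun_def)
      ultimately show "P f" by simp
    qed
  qed
  ultimately show ?thesis using f by auto
qed

text \<open>The scalar-valued counterpart of \<open>linear_ext\<close>. The value of
  \<open>linear_ext\<close> at each point has this form, so linearity is proved once for
  both.\<close>

definition functional_ext :: "('x \<Rightarrow> 'k::field) \<Rightarrow> ('x \<Rightarrow> 'k) \<Rightarrow> 'k" where
  "functional_ext \<phi> f = (\<Sum>x | f x \<noteq> 0. f x * \<phi> x)"

lemma linear_ext_apply: "linear_ext \<phi> f y = functional_ext (\<lambda>x. \<phi> x y) f"
  by (simp add: linear_ext_def functional_ext_def)

lemma functional_ext_eq_sum:
  assumes "finite S" "{x. f x \<noteq> 0} \<subseteq> S"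
  shows "functional_ext \<phi> f = (\<Sum>x\<in>S. f x * \<phi> x)"
  unfolding functional_ext_def by (rule sum.mono_neutral_left) (use assms in auto)

lemma functional_ext_fscale [simp]: "functional_ext \<phi> (fscale c f) = c * functional_ext \<phi> f"
  by (cases "c = 0") (auto simp: functional_ext_def sum_distrib_left mult.assoc)

lemma functional_ext_simps:
  assumes "f \<in> carrier (free_space X)" "g \<in> carrier (free_space X)"
  shows "functional_ext \<phi> (f + g) = functional_ext \<phi> f + functional_ext \<phi> g"
    "functional_ext \<phi> (f - g) = functional_ext \<phi> f - functional_ext \<phi> g"
proof -
  \<comment> \<open>A common finite support, so that all the sums to be compared range over the same
    set.\<close>
  define S where "S = {x. f x \<noteq> 0} \<union> {x. g x \<noteq> 0}"
  have *: "functional_ext \<phi> h = (\<Sum>x\<in>S. h x * \<phi> x)" if "\<And>x. f x = 0 \<Longrightarrow> g x = 0 \<Longrightarrow> h x = 0" for h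
    by (rule functional_ext_eq_sum) (use assms that in \<open>auto simp: S_def\<close>)
  have "functional_ext \<phi> f = (\<Sum>x\<in>S. f x * \<phi> x)" "functional_ext \<phi> g = (\<Sum>x\<in>S. g x * \<phi> x)"
    "functional_ext \<phi> (f + g) = (\<Sum>x\<in>S. (f + g) x * \<phi> x)"
    "functional_ext \<phi> (f - g) = (\<Sum>x\<in>S. (f - g) x * \<phi> x)"
    by (rule *; simp)+
  then show "functional_ext \<phi> (f + g) = functional_ext \<phi> f + functional_ext \<phi> g"
    "functional_ext \<phi> (f - g) = functional_ext \<phi> f - functional_ext \<phi> g"
    by (simp_all add: algebra_simps sum.distrib sum_subtractf)
qed

lemma functional_ext_unit [simp]: "functional_ext \<phi> (unit_fun x) = \<phi> x"
proof -
  have "{y. unit_fun x y \<noteq> (0::'a)} = {x}" by (auto simp: unit_fun_def)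
  then show ?thesis by (simp add: functional_ext_def unit_fun_def)
qed

lemma linear_functional_ext: "linear_functional (free_space X) (functional_ext \<phi>)"
  unfolding linear_functional_def
  by (auto simp: functional_ext_simps[where X = X] simp del: free_space_simps(1))

lemma linear_ext_fscale [simp]: "linear_ext \<phi> (fscale c f) = fscale c (linear_ext \<phi> f)"
  by (simp add: linear_ext_apply fun_eq_iff)

lemma linear_ext_simps:
  assumes "f \<in> carrier (free_space X)" "g \<in> carrier (free_space X)"
  shows "linear_ext \<phi> (f + g) = linear_ext \<phi> f + linear_ext \<phi> g"
    "linear_ext \<phi> (f - g) = linear_ext \<phi> f - linear_ext \<phi> g"
  using functional_ext_simps[OF assms] by (auto simp: linear_ext_apply fun_eq_iff)

lemma linear_ext_zero [simp]: "linear_ext \<phi> 0 = 0"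
  by (auto simp: linear_ext_def)

lemma linear_ext_unit [simp]: "linear_ext \<phi> (unit_fun x) = \<phi> x"
  by (simp add: linear_ext_apply fun_eq_iff)

lemma is_linear_linear_ext:
  assumes "\<And>x. x \<in> X \<Longrightarrow> \<phi> x \<in> carrier (free_space Y)"
  shows "is_linear (free_space X) (free_space Y) (linear_ext \<phi>)"
proof -
  have "linear_ext \<phi> f \<in> carrier (free_space Y)" if "f \<in> carrier (free_space X)" for f
    using that
  proof (induction f rule: free_space_induct)
    case (add f g)
    then show ?case using free_space_closed(1) linear_ext_simps(1) by metis
  next
    case (unit c x)
    then show ?case
      using assms[of x] unit_fun_in_free_space[of x X] free_space_closed(3)
      by (metis linear_ext_fscale linear_ext_unit)
  qed (simp only: linear_ext_zero zero_in_free_space)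
  then show ?thesis
    by (auto simp: is_linear_def linear_ext_simps[where X = X] simp del: free_space_simps(1))
qed

section \<open>Dimensions from dual families\<close>

lemma linear_functional_finsum:
  fixes V :: "('k::field, 'm, 'z) module_scheme"
  assumes V: "vectorspace class_ring V" and f: "linear_functional V f"
    and A: "finite A" "g \<in> A \<rightarrow> carrier V"
  shows "f (finsum V g A) = (\<Sum>a\<in>A. f (g a))"
proof -
  interpret V: vectorspace class_ring V by fact
  have zero: "f \<zero>\<^bsub>V\<^esub> = 0"
    using linear_functionalD(2)[OF f, of "\<zero>\<^bsub>V\<^esub>" 0] vectorspace_class_ringD(2)[OF V, of "\<zero>\<^bsub>V\<^esub>"]
        by simp
  show ?thesis
    using A
  proof (induction A rule: finite_induct)
    case (insert a A)
    then have "finsum V g A \<in> carrier V" by auto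
    then show ?case using insert linear_functionalD(1)[OF f] by (simp add: Pi_iff)
  qed (simp add: zero)
qed

lemma linear_functional_minus:
  fixes V :: "('k::field, 'm, 'z) module_scheme"
  assumes V: "vectorspace class_ring V" and f: "linear_functional V f"
    and x: "x \<in> carrier V" and y: "y \<in> carrier V"
  shows "f (x \<ominus>\<^bsub>V\<^esub> y) = f x - f y"
proof -
  interpret V: vectorspace class_ring V by fact
  show ?thesis
    using linear_functionalD(1)[OF f, of x "\<ominus>\<^bsub>V\<^esub> y"] linear_functionalD(2)[OF f y, of "-1"]
      vectorspace_class_ringD(4)[OF V y] x y by (simp add: a_minus_def)
qed

text \<open>The dual vectors \<open>u s\<close> form a basis. They are independent because the
  functional with index \<open>t\<close> reads off the coefficient of \<open>u t\<close> in a linear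
  combination. They span because \<open>x\<close> minus the combination with coefficients
  \<open>T x s\<close> is killed by every functional, hence is zero by \<open>inj\<close>.\<close>

lemma dim_eq_card_dual:
  fixes V :: "('k::field, 'm, 'z) module_scheme" and T :: "'m \<Rightarrow> 's \<Rightarrow> 'k"
  assumes V: "vectorspace class_ring V" and S: "finite S"
    and lin: "\<And>s. s \<in> S \<Longrightarrow> linear_functional V (\<lambda>x. T x s)"
    and inj: "\<And>x. x \<in> carrier V \<Longrightarrow> (\<And>s. s \<in> S \<Longrightarrow> T x s = 0) \<Longrightarrow> x = \<zero>\<^bsub>V\<^esub>"
    and dual: "\<And>s. s \<in> S \<Longrightarrow> \<exists>u\<in>carrier V. \<forall>t\<in>S. T u t = (if t = s then 1 else 0)"
  shows "vectorspace.fin_dim class_ring V \<and> vectorspace.dim class_ring V = card S"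
proof -
  interpret V: vectorspace class_ring V by fact
  obtain u where u: "\<And>s. s \<in> S \<Longrightarrow> u s \<in> carrier V"
    "\<And>s t. s \<in> S \<Longrightarrow> t \<in> S \<Longrightarrow> T (u s) t = (if t = s then 1 else 0)"
    using dual by metis
  have inju: "inj_on u S"
    by (rule inj_onI) (metis u(2) zero_neq_one)
  have uV: "u ` S \<subseteq> carrier V" "finite (u ` S)" using u S by auto
  have T: "T (V.lincomb a (u ` S)) t = a (u t)" if t: "t \<in> S" for a t
  proof -
    have "T (V.lincomb a (u ` S)) t = (\<Sum>v\<in>u ` S. T (a v \<odot>\<^bsub>V\<^esub> v) t)"
      unfolding V.lincomb_def
      by (rule linear_functional_finsum[OF V lin[OF t]]) (use uV in auto)
    also have "\<dots> = (\<Sum>s\<in>S. T (a (u s) \<odot>\<^bsub>V\<^esub> u s) t)"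
      by (rule sum.reindex_cong[OF inju]) auto
    also have "\<dots> = (\<Sum>s\<in>S. if s = t then a (u s) else 0)"
      by (rule sum.cong) (use linear_functionalD(2)[OF lin[OF t]] u t in auto)
    finally show ?thesis using S t by simp
  qed
  have zero: "T \<zero>\<^bsub>V\<^esub> t = 0" if "t \<in> S" for t
    using linear_functionalD(2)[OF lin[OF that], of "\<zero>\<^bsub>V\<^esub>" 0]
      vectorspace_class_ringD(2)[OF V, of "\<zero>\<^bsub>V\<^esub>"] by simp
  have li: "V.lin_indpt (u ` S)"
  proof (rule V.finite_lin_indpt2)
    fix a assume "V.lincomb a (u ` S) = \<zero>\<^bsub>V\<^esub>"
    then show "\<forall>v\<in>u ` S. a v = \<zero>\<^bsub>class_ring\<^esub>" using T[of _ a] zero by auto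
  qed (use uV in auto)
  have "x \<in> V.span (u ` S)" if x: "x \<in> carrier V" for x
  proof -
    \<comment> \<open>Coefficients have to be indexed by vectors; \<open>inv_into S u\<close>
      recovers the index \<open>s\<close> from the vector \<open>u s\<close>.\<close>
    define a where "a v = T x (inv_into S u v)" for v
    have cl: "V.lincomb a (u ` S) \<in> carrier V" using uV by auto
    have "x \<ominus>\<^bsub>V\<^esub> V.lincomb a (u ` S) = \<zero>\<^bsub>V\<^esub>"
    proof (rule inj)
      fix s assume s: "s \<in> S"
      show "T (x \<ominus>\<^bsub>V\<^esub> V.lincomb a (u ` S)) s = 0"
        using linear_functional_minus[OF V lin[OF s] x cl] T[OF s] s inju by (simp add: a_def)
    qed (use x cl in auto)
    then have "x = V.lincomb a (u ` S)" using x cl V.minus_equality[of x "\<ominus>\<^bsub>V\<^esub> V.lincomb a (u ` S)"]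
      by (simp add: a_minus_def)
    then show ?thesis using uV(2) unfolding V.span_def
        by (auto intro!: exI[of _ a] exI[of _ "u ` S"])
  qed
  then have gen: "V.gen_set (u ` S)" using V.span_is_subset2[OF uV(1)] by auto
  then have "V.basis (u ` S)" using li uV by (simp add: V.basis_def)
  then have "V.dim = card (u ` S)" using uV by (intro V.dim_basis)
  moreover have "V.fin_dim" using gen uV unfolding V.fin_dim_def by auto
  ultimately show ?thesis using card_image[OF inju] by simp
qed

text \<open>Meant for cycles modulo boundaries. By \<open>ker\<close> the common kernel of the
  functionals is exactly \<open>N\<close>, so they descend to V/N and separate its elements.\<close>

lemma (in quotient_space) dim_quot_module_dual:
  fixes T :: "'m \<Rightarrow> 's \<Rightarrow> 'k"
  assumes S: "finite S"
    and lin: "\<And>s. s \<in> S \<Longrightarrow> linear_functional V (\<lambda>x. T x s)"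
    and ker: "\<And>x. x \<in> carrier V \<Longrightarrow> (\<forall>s\<in>S. T x s = 0) \<longleftrightarrow> x \<in> N"
    and dual: "\<And>s. s \<in> S \<Longrightarrow> \<exists>u\<in>carrier V. \<forall>t\<in>S. T u t = (if t = s then 1 else 0)"
  shows "vectorspace.fin_dim class_ring (quot_module V N) \<and>
    vectorspace.dim class_ring (quot_module V N) = card S"
proof -
  have "\<exists>F. linear_functional (quot_module V N) F \<and> (\<forall>x\<in>carrier V. F (N +> x) = T x s)"
      if "s \<in> S" for s
    using functional_quot_module[OF lin[OF that]] ker that N_sub by (metis subsetD)
  then obtain F where F: "\<And>s. s \<in> S \<Longrightarrow> linear_functional (quot_module V N) (F s)"
    "\<And>s x. s \<in> S \<Longrightarrow> x \<in> carrier V \<Longrightarrow> F s (N +> x) = T x s"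
    by metis
  show ?thesis
  proof (rule dim_eq_card_dual[OF vectorspace_quot_module S, where T = "\<lambda>X s. F s X"])
    fix X assume X: "X \<in> carrier (quot_module V N)" and zero: "\<And>s. s \<in> S \<Longrightarrow> F s X = 0"
    obtain x where x: "x \<in> carrier V" "X = N +> x" using X by (auto simp: carrier_quot_module)
    then have "x \<in> N" using ker zero F(2) by metis
    then show "X = \<zero>\<^bsub>quot_module V N\<^esub>"
      using x coset_eq_iff[of x \<zero>] coset_zero by (simp add: zero_quot_module a_minus_def)
  next
    fix s assume s: "s \<in> S"
    from dual[OF s] obtain u where "u \<in> carrier V" "\<forall>t\<in>S. T u t = (if t = s then 1 else 0)" by blast
    then show "\<exists>U\<in>carrier (quot_module V N). \<forall>t\<in>S. F t U = (if t = s then 1 else 0)"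
      by (intro bexI[of _ "N +> u"]) (auto simp: F(2) carrier_quot_module)
  qed (use F in auto)
qed

text \<open>The map that sends \<open>u\<close> to the sum of the \<kappa> x u times v x is linear
  and fixes every \<open>v y\<close>, hence fixes the whole span; if all coordinates of
  \<open>u\<close> vanish, so does \<open>u\<close>. This gives coordinates on spaces of chains,
  which are at first only known to be spanned by the basis chains.\<close>

lemma zero_if_dual_zero:
  fixes V :: "('k::field, 'm, 'z) module_scheme"
  assumes V: "vectorspace class_ring V" and X: "finite X" "v ` X \<subseteq> carrier V"
    and gen: "carrier V \<subseteq> LinearCombinations.module.span class_ring V (v ` X)"
    and lin: "\<And>x. x \<in> X \<Longrightarrow> linear_functional V (\<kappa> x)"
    and dual: "\<And>x y. x \<in> X \<Longrightarrow> y \<in> X \<Longrightarrow> \<kappa> x (v y) = (if x = y then 1 else 0)"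
    and u: "u \<in> carrier V" "\<And>x. x \<in> X \<Longrightarrow> \<kappa> x u = 0"
  shows "u = \<zero>\<^bsub>V\<^esub>"
proof -
  interpret V: vectorspace class_ring V by fact
  note [simp] = vectorspace_class_ringD[OF V] V.finsum_smult_ldistr[simplified]
  have kz: "\<kappa> x \<zero>\<^bsub>V\<^esub> = 0" if "x \<in> X" for x
    using linear_functionalD(2)[OF lin[OF that], of "\<zero>\<^bsub>V\<^esub>" 0] by simp
  have v: "x \<in> X \<Longrightarrow> v x \<in> carrier V" for x using X by auto
  define L where "L u = finsum V (\<lambda>x. \<kappa> x u \<odot>\<^bsub>V\<^esub> v x) X" for u
  have "u \<in> LinearCombinations.module.span class_ring V (v ` X)" using gen u by blast
  then have "u = L u"
  proof (induction rule: span_induct_class_ring[OF V X(2), consumes 1, case_names zero base add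
      smult])
    case zero
    have "L \<zero>\<^bsub>V\<^esub> = finsum V (\<lambda>x. \<zero>\<^bsub>V\<^esub>) X"
      unfolding L_def by (rule V.finsum_cong) (auto simp: kz v)
    then show ?case by (simp add: V.finsum_zero)
  next
    case (base r)
    then obtain y where y: "y \<in> X" "r = v y" by auto
    have "L r = finsum V (\<lambda>x. if x = y then v x else \<zero>\<^bsub>V\<^esub>) X"
      unfolding L_def by (rule V.finsum_cong) (auto simp: simp_implies_def dual y v)
    also have "\<dots> = v y"
      using V.finsum_singleton[of y X v] X y v by (auto simp: eq_commute)
    finally show ?case using y by simp
  next
    case (add a b)
    have "L (a \<oplus>\<^bsub>V\<^esub> b) = finsum V (\<lambda>x. \<kappa> x a \<odot>\<^bsub>V\<^esub> v x \<oplus>\<^bsub>V\<^esub> \<kappa> x b \<odot>\<^bsub>V\<^esub> v x) X"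
      unfolding L_def
      by (rule V.finsum_cong) (use add v lin in \<open>auto simp: linear_functionalD(1)[OF lin]\<close>)
    also have "\<dots> = L a \<oplus>\<^bsub>V\<^esub> L b"
      unfolding L_def by (rule V.finsum_addf) (use v in auto)
    finally show ?case using add by simp
  next
    case (smult c a)
    have "L (c \<odot>\<^bsub>V\<^esub> a) = finsum V (\<lambda>x. c \<odot>\<^bsub>V\<^esub> (\<kappa> x a \<odot>\<^bsub>V\<^esub> v x)) X"
      unfolding L_def
      by (rule V.finsum_cong) (use smult v lin in \<open>auto simp: linear_functionalD(2)[OF lin]\<close>)
    also have "\<dots> = c \<odot>\<^bsub>V\<^esub> L a"
      unfolding L_def using V.finsum_smult_ldistr[of X c "\<lambda>x. \<kappa> x a \<odot>\<^bsub>V\<^esub> v x"] X v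
          by (simp add: Pi_iff)
    finally show ?case using smult by simp
  qed
  also have "L u = finsum V (\<lambda>x. \<zero>\<^bsub>V\<^esub>) X"
    unfolding L_def by (rule V.finsum_cong) (auto simp: u v)
  finally show ?thesis by simp
qed

section \<open>Tensor powers and the bar resolution\<close>

text \<open>The relations are written pointwise; as sums of functions they match the linearity
  lemmas for \<open>functional_ext\<close> and \<open>linear_ext\<close>.\<close>

lemma unit_rel_simps:
  "(\<lambda>z. unit_fun a z - unit_fun b z - unit_fun c z) = unit_fun a - unit_fun b - unit_fun c"
  "(\<lambda>z. unit_fun a z - d * unit_fun b z) = unit_fun a - fscale d (unit_fun b)"
  "(\<lambda>z. unit_fun a z - unit_fun b z) = unit_fun a - unit_fun b"
  by (auto simp: fun_eq_iff)

locale unital_algebra = vectorspace class_ring A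
  for A :: "('k::field, 'a) module" (structure) +
  assumes mult_closed: "a \<in> carrier A \<Longrightarrow> b \<in> carrier A \<Longrightarrow> a \<otimes> b \<in> carrier A"
    and unit_closed: "\<one> \<in> carrier A"
    and mult_assoc: "a \<in> carrier A \<Longrightarrow> b \<in> carrier A \<Longrightarrow> c \<in> carrier A \<Longrightarrow> (a \<otimes> b) \<otimes> c = a \<otimes> (b \<otimes> c)"
    and unit_left: "a \<in> carrier A \<Longrightarrow> \<one> \<otimes> a = a"
    and unit_right: "a \<in> carrier A \<Longrightarrow> a \<otimes> \<one> = a"
    and left_linear: "b \<in> carrier A \<Longrightarrow> is_linear A A (\<lambda>a. a \<otimes> b)"
    and right_linear: "a \<in> carrier A \<Longrightarrow> is_linear A A (\<lambda>b. a \<otimes> b)"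
begin

lemmas algebra_vs = vectorspace_axioms

lemma identity_linear: "is_linear A A (\<lambda>a. a)"
  using vectorspace_class_ringD(1)[OF algebra_vs] by (auto simp: is_linear_def)

lemma multilinear_rels_cases:
  assumes "r \<in> multilinear_rels A m"
  obtains xs a b ys where "xs @ a # ys \<in> tensor_lists A m" "b \<in> carrier A"
    "r = unit_fun (xs @ (a \<oplus> b) # ys) - unit_fun (xs @ a # ys) - unit_fun (xs @ b # ys)"
  | xs a c ys where "xs @ a # ys \<in> tensor_lists A m"
    "r = unit_fun (xs @ (c \<odot>\<^bsub>A\<^esub> a) # ys) - fscale c (unit_fun (xs @ a # ys))"
  using assms by (auto simp: multilinear_rels_def unit_rel_simps)

lemma tensor_lists_slot:
  "xs @ a # ys \<in> tensor_lists A m \<longleftrightarrow>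
    Suc (length xs + length ys) = m \<and> set xs \<subseteq> carrier A \<and> set ys \<subseteq> carrier A \<and> a \<in> carrier A"
  by (auto simp: tensor_lists_def)

lemma multilinear_rels_carrier: "multilinear_rels A m \<subseteq> carrier (formal_tensors A m)"
proof
  fix r assume "r \<in> multilinear_rels A m"
  then show "r \<in> carrier (formal_tensors A m)"
    unfolding formal_tensors_def
    by (cases rule: multilinear_rels_cases)
      (auto intro!: free_space_closed unit_fun_in_free_space simp del: free_space_simps(1)
        simp: tensor_lists_slot a_closed vectorspace_class_ringD(1)[OF algebra_vs])
qed

lemma tensor_quotient: "quotient_space (formal_tensors A m) (multilinear_null A m)"
  unfolding quotient_space_def quotient_space_axioms_def multilinear_null_def
  using vectorspace_free_space span_class_ring[OF _ multilinear_rels_carrier]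
  by (auto simp: formal_tensors_def)

definition tensor :: "nat \<Rightarrow> 'a list \<Rightarrow> ('a list \<Rightarrow> 'k) set" where
  "tensor m xs = multilinear_null A m +>\<^bsub>formal_tensors A m\<^esub> unit_fun xs"

lemma tensor_vs: "vectorspace class_ring (tensor_power A m)"
  unfolding tensor_power_def by (rule quotient_space.vectorspace_quot_module[OF tensor_quotient])

lemma tensor_carrier: "xs \<in> tensor_lists A m \<Longrightarrow> tensor m xs \<in> carrier (tensor_power A m)"
  unfolding tensor_power_def tensor_def quotient_space.carrier_quot_module[OF tensor_quotient]
  by (rule imageI)
      (auto simp: formal_tensors_def unit_fun_in_free_space simp del: free_space_simps(1))

lemma tensor_induct [consumes 1, case_names zero add smult tensor]:
  assumes t: "t \<in> carrier (tensor_power A m)" and zero: "P \<zero>\<^bsub>tensor_power A m\<^esub>"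
    and add: "\<And>x y. x \<in> carrier (tensor_power A m) \<Longrightarrow> y \<in> carrier (tensor_power A m) \<Longrightarrow>
      P x \<Longrightarrow> P y \<Longrightarrow> P (x \<oplus>\<^bsub>tensor_power A m\<^esub> y)"
    and smult: "\<And>c x. x \<in> carrier (tensor_power A m) \<Longrightarrow> P x \<Longrightarrow> P (c \<odot>\<^bsub>tensor_power A m\<^esub> x)"
    and tensor: "\<And>xs. xs \<in> tensor_lists A m \<Longrightarrow> P (tensor m xs)"
  shows "P t"
proof -
  interpret Q: quotient_space "formal_tensors A m" "multilinear_null A m" by (rule tensor_quotient)
  let ?cl = "\<lambda>f. multilinear_null A m +>\<^bsub>formal_tensors A m\<^esub> f"
  have cl: "f \<in> carrier (formal_tensors A m) \<Longrightarrow> ?cl f \<in> carrier (tensor_power A m)" for f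
    by (auto simp: tensor_power_def Q.carrier_quot_module)
  have "P (?cl f)" if "f \<in> carrier (formal_tensors A m)" for f
    using that unfolding formal_tensors_def
  proof (induction f rule: free_space_induct)
    case zero
    then show ?case
      using \<open>P \<zero>\<^bsub>tensor_power A m\<^esub>\<close> Q.coset_zero
      by (metis Q.zero_quot_module tensor_power_def formal_tensors_def free_space_simps(4))
  next
    case (add f g)
    then show ?case
      using assms(3)[OF cl[of f] cl[of g]] Q.add_quot_module[of f g]
      by (simp add: tensor_power_def formal_tensors_def plus_fun_def del: free_space_simps(1))
  next
    case (unit c xs)
    have "unit_fun xs \<in> carrier (formal_tensors A m)"
      using unit by
          (auto simp: formal_tensors_def intro: unit_fun_in_free_space simp del:
              free_space_simps(1))
    then show ?case
      using assms(4)[OF cl[of "unit_fun xs"], of c] assms(5)[OF unit]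
          Q.smult_quot_module[of "unit_fun xs" c]
      by (simp add: tensor_power_def formal_tensors_def tensor_def fscale_def del:
          free_space_simps(1))
  qed
  then show ?thesis using t by (auto simp: tensor_power_def Q.carrier_quot_module)
qed

definition slotwise_linear :: "nat \<Rightarrow> ('a list \<Rightarrow> 'k) \<Rightarrow> bool" where
  "slotwise_linear m \<phi> \<longleftrightarrow>
    (\<forall>xs ys. Suc (length xs + length ys) = m \<longrightarrow> set xs \<subseteq> carrier A \<longrightarrow> set ys \<subseteq> carrier A \<longrightarrow>
      linear_functional A (\<lambda>z. \<phi> (xs @ z # ys)))"

text \<open>The universal property of the tensor power for scalar-valued multilinear maps:
  additivity and homogeneity in the varied slot make the linear extension of \<phi> vanish on the
  two kinds of relations.\<close>

lemma tensor_functional: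
  assumes \<phi>: "slotwise_linear m \<phi>"
  obtains F where "linear_functional (tensor_power A m) F"
    "\<And>xs. xs \<in> tensor_lists A m \<Longrightarrow> F (tensor m xs) = \<phi> xs"
proof -
  interpret Q: quotient_space "formal_tensors A m" "multilinear_null A m" by (rule tensor_quotient)
  have lin: "linear_functional (formal_tensors A m) (functional_ext \<phi>)"
    unfolding formal_tensors_def by (rule linear_functional_ext)
  have unit: "xs \<in> tensor_lists A m \<Longrightarrow>
      unit_fun xs \<in> carrier (free_space (tensor_lists A m) :: ('k, _) module)" for xs
    by (rule unit_fun_in_free_space)
  note fs = free_space_closed[where X = "tensor_lists A m"]
      functional_ext_simps[where X = "tensor_lists A m"]
  have rel: "functional_ext \<phi> r = 0" if "r \<in> multilinear_rels A m" for r
    using that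
  proof (cases rule: multilinear_rels_cases)
    case (1 xs a b ys)
    then have "linear_functional A (\<lambda>z. \<phi> (xs @ z # ys))" "a \<in> carrier A"
      using \<phi> by (auto simp: slotwise_linear_def tensor_lists_slot)
    moreover have "xs @ (a \<oplus> b) # ys \<in> tensor_lists A m" "xs @ b # ys \<in> tensor_lists A m"
      using 1 by (auto simp: tensor_lists_slot)
    ultimately show ?thesis
      using 1 by (simp add: fs unit linear_functionalD(1)[where f = "\<lambda>z. \<phi> (xs @ z # ys)"]
          del: free_space_simps(1))
  next
    case (2 xs a c ys)
    then have "linear_functional A (\<lambda>z. \<phi> (xs @ z # ys))" "a \<in> carrier A"
      using \<phi> by (auto simp: slotwise_linear_def tensor_lists_slot)
    moreover have "xs @ (c \<odot>\<^bsub>A\<^esub> a) # ys \<in> tensor_lists A m"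
      using 2 by (auto simp: tensor_lists_slot vectorspace_class_ringD(1)[OF algebra_vs])
    ultimately show ?thesis
      using 2 by (simp add: fs unit linear_functionalD(2)[where f = "\<lambda>z. \<phi> (xs @ z # ys)"]
          del: free_space_simps(1))
  qed
  have null: "functional_ext \<phi> r = 0" if "r \<in> multilinear_null A m" for r
  proof -
    from that[unfolded multilinear_null_def] show ?thesis
    proof (rule span_induct_class_ring[OF Q.vectorspace_axioms multilinear_rels_carrier])
      show "functional_ext \<phi> \<zero>\<^bsub>formal_tensors A m\<^esub> = 0"
        by (simp add: formal_tensors_def functional_ext_def)
    qed (use rel linear_functionalD[OF lin] in auto)
  qed
  obtain F where F: "linear_functional (quot_module (formal_tensors A m) (multilinear_null A m)) F"
    "\<And>x. x \<in> carrier (formal_tensors A m) \<Longrightarrow>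
      F (multilinear_null A m +>\<^bsub>formal_tensors A m\<^esub> x) = functional_ext \<phi> x"
    using Q.functional_quot_module[OF lin null] by metis
  show thesis
    by (rule that[of F]) (use F unit in \<open>auto simp: tensor_power_def tensor_def formal_tensors_def
      simp del: free_space_simps(1)\<close>)
qed

text \<open>
  The lengths \<open>m\<close> and \<open>m'\<close> may differ because a face of the bar complex, which multiplies two
  neighbours, is still linear in each slot.
\<close>

definition slot_map :: "nat \<Rightarrow> nat \<Rightarrow> ('a list \<Rightarrow> 'a list) \<Rightarrow> bool" where
  "slot_map m m' g \<longleftrightarrow>
    (\<forall>xs\<in>tensor_lists A m. g xs \<in> tensor_lists A m') \<and>
    (\<forall>xs ys. Suc (length xs + length ys) = m \<longrightarrow> set xs \<subseteq> carrier A \<longrightarrow> set ys \<subseteq> carrier A \<longrightarrow>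
      (\<exists>xs' h ys'. is_linear A A h \<and> (\<forall>z\<in>carrier A. g (xs @ z # ys) = xs' @ h z # ys')))"

lemma slot_map_linear:
  assumes "slot_map m m' g"
  shows "is_linear (formal_tensors A m) (formal_tensors A m') (linear_ext (\<lambda>xs. unit_fun (g xs)))"
  unfolding formal_tensors_def
  by (rule is_linear_linear_ext)
      (use assms in \<open>auto simp: slot_map_def intro!: unit_fun_in_free_space
    simp del: free_space_simps(1)\<close>)

text \<open>A generating relation varies one slot only, and there \<open>g\<close> acts through a
  linear map \<open>h\<close>; so \<open>g\<close> turns it into a relation of the same
  kind.\<close>

lemma slot_map_null:
  assumes g: "slot_map m m' g" and r: "r \<in> multilinear_null A m"
  shows "linear_ext (\<lambda>xs. unit_fun (g xs)) r \<in> multilinear_null A m'"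
proof -
  interpret Q: quotient_space "formal_tensors A m" "multilinear_null A m" by (rule tensor_quotient)
  interpret Q': quotient_space "formal_tensors A m'" "multilinear_null A m'"
      by (rule tensor_quotient)
  let ?g = "linear_ext (\<lambda>xs. unit_fun (g xs))"
  have unit: "xs \<in> tensor_lists A m \<Longrightarrow>
      unit_fun xs \<in> carrier (free_space (tensor_lists A m) :: ('k, _) module)" for xs
    by (rule unit_fun_in_free_space)
  note fs = free_space_closed[where X = "tensor_lists A m"]
      linear_ext_simps[where X = "tensor_lists A m"]
  have rel: "?g r \<in> multilinear_null A m'" if "r \<in> multilinear_rels A m" for r
  proof -
    from that have "?g r \<in> multilinear_rels A m'"
    proof (cases rule: multilinear_rels_cases)
      case (1 xs a b ys)
      then obtain xs' h ys' where h: "is_linear A A h"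
          "\<And>z. z \<in> carrier A \<Longrightarrow> g (xs @ z # ys) = xs' @ h z # ys'"
        using g by (auto simp: slot_map_def tensor_lists_slot; metis)
      have ab: "xs @ (a \<oplus> b) # ys \<in> tensor_lists A m" "xs @ b # ys \<in> tensor_lists A m"
          "a \<in> carrier A"
        using 1 by (auto simp: tensor_lists_slot)
      have "?g r =
          unit_fun (xs' @ (h a \<oplus> h b) # ys') - unit_fun (xs' @ h a # ys') - unit_fun
              (xs' @ h b # ys')"
        using 1 ab h is_linearD[OF h(1)] by (simp add: fs unit del: free_space_simps(1))
      moreover have "xs' @ h a # ys' \<in> tensor_lists A m'" "h b \<in> carrier A"
        using g 1 ab h is_linearD[OF h(1)] by (metis slot_map_def)+
      ultimately show ?thesis unfolding multilinear_rels_def unit_rel_simps by blast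
    next
      case (2 xs a c ys)
      then obtain xs' h ys' where h: "is_linear A A h"
          "\<And>z. z \<in> carrier A \<Longrightarrow> g (xs @ z # ys) = xs' @ h z # ys'"
        using g by (auto simp: slot_map_def tensor_lists_slot; metis)
      have ca: "xs @ (c \<odot>\<^bsub>A\<^esub> a) # ys \<in> tensor_lists A m" "a \<in> carrier A" "c \<odot>\<^bsub>A\<^esub> a \<in> carrier A"
        using 2 by (auto simp: tensor_lists_slot vectorspace_class_ringD(1)[OF algebra_vs])
      have "?g r = unit_fun (xs' @ (c \<odot>\<^bsub>A\<^esub> h a) # ys') - fscale c (unit_fun (xs' @ h a # ys'))"
        using 2 ca h is_linearD[OF h(1)] by (simp add: fs unit del: free_space_simps(1))
      moreover have "xs' @ h a # ys' \<in> tensor_lists A m'"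
        using g 2 ca h by (metis slot_map_def)
      ultimately show ?thesis unfolding multilinear_rels_def unit_rel_simps by blast
    qed
    then show ?thesis
      using span_class_ring(2)[OF Q'.vectorspace_axioms multilinear_rels_carrier]
      unfolding multilinear_null_def by blast
  qed
  from r[unfolded multilinear_null_def] show ?thesis
  proof (rule span_induct_class_ring[OF Q.vectorspace_axioms multilinear_rels_carrier])
    show "?g \<zero>\<^bsub>formal_tensors A m\<^esub> \<in> multilinear_null A m'"
      using Q'.N_zero by (simp add: formal_tensors_def)
    fix x y assume "x \<in> carrier (formal_tensors A m)" "y \<in> carrier (formal_tensors A m)"
      "?g x \<in> multilinear_null A m'" "?g y \<in> multilinear_null A m'"
    then show "?g (x \<oplus>\<^bsub>formal_tensors A m\<^esub> y) \<in> multilinear_null A m'"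
      using is_linearD(2)[OF slot_map_linear[OF g]] Q'.N_add by metis
  next
    fix c x assume "x \<in> carrier (formal_tensors A m)" "?g x \<in> multilinear_null A m'"
    then show "?g (c \<odot>\<^bsub>formal_tensors A m\<^esub> x) \<in> multilinear_null A m'"
      using is_linearD(3)[OF slot_map_linear[OF g]] Q'.N_smult by metis
  qed (rule rel)
qed

lemma tensor_map_slot_map:
  assumes g: "slot_map m m' g"
  shows "is_linear (tensor_power A m) (tensor_power A m') (tensor_map A m' (\<lambda>xs. unit_fun (g xs)))"
    and "xs \<in> tensor_lists A m \<Longrightarrow> tensor_map A m' (\<lambda>xs. unit_fun (g xs)) (tensor m xs) =
        tensor m' (g xs)"
proof -
  show "is_linear (tensor_power A m) (tensor_power A m') (tensor_map A m' (\<lambda>xs. unit_fun (g xs)))"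
    unfolding tensor_power_def tensor_map_def
    by (rule quot_map_linear[OF tensor_quotient tensor_quotient slot_map_linear[OF g]
        slot_map_null[OF g]])
  assume "xs \<in> tensor_lists A m"
  then have "unit_fun xs \<in> carrier (formal_tensors A m)"
    by (auto simp: formal_tensors_def intro: unit_fun_in_free_space simp del: free_space_simps(1))
  then show "tensor_map A m' (\<lambda>xs. unit_fun (g xs)) (tensor m xs) = tensor m' (g xs)"
    unfolding tensor_def tensor_map_def
    by (subst quot_map_coset[OF tensor_quotient tensor_quotient slot_map_linear[OF g]
        slot_map_null[OF g]]) auto
qed

lemma slot_map_left:
  assumes "a \<in> carrier A"
  shows "slot_map (Suc m) (Suc m) (\<lambda>xs. (a \<otimes> hd xs) # tl xs)"
  unfolding slot_map_def
proof (intro conjI ballI allI impI)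
  fix xs ys assume "Suc (length xs + length ys) = Suc m" "set xs \<subseteq> carrier A" "set ys \<subseteq> carrier A"
  show "\<exists>xs' h ys'. is_linear A A h \<and>
    (\<forall>z\<in>carrier A. (a \<otimes> hd (xs @ z # ys)) # tl (xs @ z # ys) = xs' @ h z # ys')"
  proof (cases xs)
    case Nil
    then show ?thesis using right_linear[OF assms]
      by (intro exI[of _ "[]"] exI[of _ "\<lambda>b. a \<otimes> b"] exI[of _ ys]) simp
  next
    case (Cons x xs')
    then show ?thesis using identity_linear
      by (intro exI[of _ "(a \<otimes> x) # xs'"] exI[of _ "\<lambda>b. b"] exI[of _ ys]) simp
  qed
next
  fix xs assume "xs \<in> tensor_lists A (Suc m)"
  then show "(a \<otimes> hd xs) # tl xs \<in> tensor_lists A (Suc m)"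
    using assms by (cases xs) (auto simp: tensor_lists_def mult_closed)
qed

lemma slot_map_right:
  assumes "a \<in> carrier A"
  shows "slot_map (Suc m) (Suc m) (\<lambda>xs. butlast xs @ [last xs \<otimes> a])"
  unfolding slot_map_def
proof (intro conjI ballI allI impI)
  fix xs ys assume "Suc (length xs + length ys) = Suc m" "set xs \<subseteq> carrier A" "set ys \<subseteq> carrier A"
  show "\<exists>xs' h ys'. is_linear A A h \<and>
    (\<forall>z\<in>carrier A. butlast (xs @ z # ys) @ [last (xs @ z # ys) \<otimes> a] = xs' @ h z # ys')"
  proof (cases ys rule: rev_cases)
    case Nil
    then show ?thesis using left_linear[OF assms]
      by (intro exI[of _ xs] exI[of _ "\<lambda>b. b \<otimes> a"] exI[of _ "[]"]) (simp add: butlast_append)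
  next
    case (snoc ys' y)
    then show ?thesis using identity_linear
      by (intro exI[of _ xs] exI[of _ "\<lambda>b. b"] exI[of _ "ys' @ [y \<otimes> a]"]) (simp add: butlast_append)
  qed
next
  fix xs assume "xs \<in> tensor_lists A (Suc m)"
  then show "butlast xs @ [last xs \<otimes> a] \<in> tensor_lists A (Suc m)"
    using assms by (cases xs rule: rev_cases) (auto simp: tensor_lists_def mult_closed)
qed

lemma bar_face_simps:
  "bar_face A 0 (x # y # zs) = (x \<otimes> y) # zs"
  "bar_face A (Suc i) (x # xs) = x # bar_face A i xs"
  "Suc i < length xs \<Longrightarrow> bar_face A i (xs @ ys) = bar_face A i xs @ ys"
  "bar_face A (length xs) (xs @ x # y # ys) = xs @ (x \<otimes> y) # ys"
  by (auto simp: bar_face_def nth_append)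

lemma bar_face_carrier:
  assumes "Suc i < m" "xs \<in> tensor_lists A m"
  shows "bar_face A i xs \<in> tensor_lists A (m - 1)"
  using assms set_take_subset[of i xs] set_drop_subset[of "i + 2" xs]
  by (auto simp: tensor_lists_def bar_face_def mult_closed subset_iff)

lemma slot_map_face:
  assumes i: "i \<le> m"
  shows "slot_map (m + 2) (m + 1) (bar_face A i)"
  unfolding slot_map_def
proof (intro conjI ballI allI impI)
  fix xs ys assume len: "Suc (length xs + length ys) = m + 2" and s: "set xs \<subseteq> carrier A"
      "set ys \<subseteq> carrier A"
  \<comment> \<open>The varied slot has position \<open>length xs\<close>, and the face multiplies
    the positions \<open>i\<close> and \<open>Suc i\<close>. The slot lies to the right of both, is
    the right factor, is the left factor, or lies to the left of both.\<close>
  consider "Suc i < length xs" | "Suc i = length xs" | "i = length xs" | "length xs < i" by linarith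
  then show "\<exists>xs' h ys'. is_linear A A h \<and> (\<forall>z\<in>carrier A. bar_face A i (xs @ z # ys) =
      xs' @ h z # ys')"
  proof cases
    case 1
    then show ?thesis using identity_linear
      by (intro exI[of _ "bar_face A i xs"] exI[of _ "\<lambda>b. b"] exI[of _ ys])
          (simp add: bar_face_simps)
  next
    case 2
    then obtain xs' x where xs: "xs = xs' @ [x]" by (cases xs rule: rev_cases) auto
    then show ?thesis using right_linear[of x] s 2
      by (intro exI[of _ xs'] exI[of _ "\<lambda>b. x \<otimes> b"] exI[of _ ys])
          (use bar_face_simps(4)[of xs' x] in auto)
  next
    case 3
    then obtain y ys' where ys: "ys = y # ys'" using len i by (cases ys) auto
    then show ?thesis using left_linear[of y] s 3
      by (intro exI[of _ xs] exI[of _ "\<lambda>b. b \<otimes> y"] exI[of _ ys'])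
          (use bar_face_simps(4)[of xs] in auto)
  next
    case 4
    have "bar_face A i (xs @ z # ys) = xs @ z # bar_face A (i - length xs - 1) ys" for z
      using 4
    proof (induction xs arbitrary: i)
      case Nil
      then show ?case by (cases i) (auto simp: bar_face_simps)
    next
      case (Cons x xs)
      then show ?case by (cases i) (auto simp: bar_face_simps)
    qed
    then show ?thesis using identity_linear by blast
  qed
next
  fix xs assume "xs \<in> tensor_lists A (m + 2)"
  then show "bar_face A i xs \<in> tensor_lists A (m + 1)"
    using bar_face_carrier[of i "m + 2" xs] i by simp
qed

lemma fun_sum_apply: "(\<Sum>i\<in>I. f i) x = (\<Sum>i\<in>I. f i x :: 'b :: comm_monoid_add)"
  by (induction I rule: infinite_finite_induct) auto

lemma sum_in_free_space:
  "(\<And>i. i \<in> I \<Longrightarrow> f i \<in> carrier (free_space X)) \<Longrightarrow> (\<Sum>i\<in>I. f i) \<in> carrier (free_space X)"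
proof (induction I rule: infinite_finite_induct)
  case (insert i I)
  then have "f i + (\<Sum>i\<in>I. f i) \<in> carrier (free_space X)" by (intro free_space_closed) auto
  then show ?case by (simp only: sum.insert[OF insert(1,2)])
next
  case (infinite I)
  show ?case unfolding sum.infinite[OF infinite(1)] by (rule zero_in_free_space)
qed (simp only: sum.empty zero_in_free_space)

text \<open>The alternating sum of the faces on the level of formal sums. A value of the bar
  differential is in general not the class of a single list, so it is handled as the class of this
  sum.\<close>

definition bar_chain :: "nat \<Rightarrow> 'a list \<Rightarrow> 'a list \<Rightarrow> 'k" where
  "bar_chain n xs = (\<Sum>i\<le>n + 1. fscale ((- 1) ^ i) (unit_fun (bar_face A i xs)))"

lemma linear_ext_bar_chain:
  "linear_ext (\<lambda>xs ys. \<Sum>i\<le>n + 1. (- 1) ^ i * unit_fun (bar_face A i xs) ys) f =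
    (\<Sum>i\<le>n + 1. fscale ((- 1) ^ i) (linear_ext (\<lambda>xs. unit_fun (bar_face A i xs)) f))"
proof
  fix y
  have "linear_ext (\<lambda>xs ys. \<Sum>i\<le>n + 1. (- 1) ^ i * unit_fun (bar_face A i xs) ys) f y =
      (\<Sum>x | f x \<noteq> 0. \<Sum>i\<le>n + 1. (- 1) ^ i * (f x * unit_fun (bar_face A i x) y))"
    unfolding linear_ext_def by (simp only: sum_distrib_left mult.left_commute)
  also have "\<dots> = (\<Sum>i\<le>n + 1. \<Sum>x | f x \<noteq> 0. (- 1) ^ i * (f x * unit_fun (bar_face A i x) y))"
    by (rule sum.swap)
  also have "\<dots> = (\<Sum>i\<le>n + 1. fscale ((- 1) ^ i) (linear_ext (\<lambda>xs. unit_fun (bar_face A i xs)) f)) y"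
    unfolding fun_sum_apply by (simp only: fscale_apply linear_ext_def sum_distrib_left)
  finally show "linear_ext (\<lambda>xs ys. \<Sum>i\<le>n + 1. (- 1) ^ i * unit_fun (bar_face A i xs) ys) f y =
    (\<Sum>i\<le>n + 1. fscale ((- 1) ^ i) (linear_ext (\<lambda>xs. unit_fun (bar_face A i xs)) f)) y" .
qed

abbreviation "bar_op n \<equiv> linear_ext (\<lambda>xs ys. \<Sum>i\<le>n + 1. (- 1) ^ i * unit_fun (bar_face A i xs) ys)"

lemma bar_op_linear: "is_linear (formal_tensors A (n + 3)) (formal_tensors A (n + 2)) (bar_op n)"
  unfolding formal_tensors_def
proof (rule is_linear_linear_ext)
  fix xs assume xs: "xs \<in> tensor_lists A (n + 3)"
  have "(\<lambda>ys. \<Sum>i\<le>n + 1. (- 1) ^ i * unit_fun (bar_face A i xs) ys) =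
    (\<Sum>i\<le>n + 1. fscale ((- 1) ^ i) (unit_fun (bar_face A i xs)) :: 'a list \<Rightarrow> 'k)"
    by (auto simp: fun_sum_apply)
  also have "\<dots> \<in> carrier (free_space (tensor_lists A (n + 2)))"
    using bar_face_carrier[of _ "n + 3" xs] xs
    by (intro sum_in_free_space free_space_closed unit_fun_in_free_space) auto
  finally show "(\<lambda>ys. \<Sum>i\<le>n + 1. (- 1) ^ i * unit_fun (bar_face A i xs) ys)
    \<in> carrier (free_space (tensor_lists A (n + 2)) :: ('k, _) module)" .
qed

lemma bar_op_null:
  assumes r: "r \<in> multilinear_null A (n + 3)"
  shows "bar_op n r \<in> multilinear_null A (n + 2)"
proof -
  interpret Q: quotient_space "formal_tensors A (n + 2)" "multilinear_null A (n + 2)"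
      by (rule tensor_quotient)
  have add: "x + y \<in> multilinear_null A (n + 2)"
      if "x \<in> multilinear_null A (n + 2)" "y \<in> multilinear_null A (n + 2)" for x y
    using Q.N_add[OF that] by (simp add: formal_tensors_def)
  have zero: "0 \<in> multilinear_null A (n + 2)" using Q.N_zero by (simp add: formal_tensors_def)
  \<comment> \<open>The differential preserves the relations because each face does. The faces go
    from n + 3 to n + 2 factors, which is the instance n + 1 of
    \<open>slot_map_face\<close>.\<close>
  have face: "linear_ext (\<lambda>xs. unit_fun (bar_face A i xs)) r \<in> multilinear_null A (n + 2)"
      if "i \<le> n + 1" for i
    using slot_map_null[OF slot_map_face[of i "n + 1"]] r that by (simp add: numeral_3_eq_3)
  have "fscale c (linear_ext (\<lambda>xs. unit_fun (bar_face A i xs)) r) \<in> multilinear_null A (n + 2)"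
      if "i \<le> n + 1" for c i
    using Q.N_smult[OF face[OF that]] by (simp add: formal_tensors_def)
  then have "(\<Sum>i\<in>I. fscale ((- 1) ^ i) (linear_ext (\<lambda>xs. unit_fun (bar_face A i xs)) r)) \<in>
      multilinear_null A (n + 2)"
    if "I \<subseteq> {..n + 1}" for I
    using that
  proof (induction I rule: infinite_finite_induct)
    case (insert i I)
    show ?case unfolding sum.insert[OF insert(1,2)]
      by (rule add) (use insert in blast)+
  next
    case (infinite I)
    show ?case unfolding sum.infinite[OF infinite(1)] by (rule zero)
  qed (simp only: sum.empty zero)
  then show ?thesis unfolding linear_ext_bar_chain by blast
qed

lemma bar_diff_linear:
  "is_linear (tensor_power A (n + 3)) (tensor_power A (n + 2)) (bar_diff A n)"
  unfolding bar_diff_def tensor_power_def tensor_map_def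
  by (rule quot_map_linear[OF tensor_quotient tensor_quotient bar_op_linear bar_op_null])

lemma bar_diff_tensor:
  assumes xs: "xs \<in> tensor_lists A (n + 3)"
  shows "bar_diff A n (tensor (n + 3) xs) =
    multilinear_null A (n + 2) +>\<^bsub>formal_tensors A (n + 2)\<^esub> bar_chain n xs"
proof -
  have "unit_fun xs \<in> carrier (formal_tensors A (n + 3))"
    using xs by
        (auto simp: formal_tensors_def intro: unit_fun_in_free_space simp del: free_space_simps(1))
  then have "bar_diff A n (tensor (n + 3) xs) =
    multilinear_null A (n + 2) +>\<^bsub>formal_tensors A (n + 2)\<^esub> bar_op n (unit_fun xs)"
    unfolding tensor_def tensor_map_def bar_diff_def
    by (intro quot_map_coset[OF tensor_quotient tensor_quotient bar_op_linear bar_op_null])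
  then show ?thesis by (simp only: linear_ext_bar_chain linear_ext_unit bar_chain_def)
qed

lemma bar_chain_carrier:
  "xs \<in> tensor_lists A (n + 3) \<Longrightarrow> bar_chain n xs \<in> carrier (formal_tensors A (n + 2))"
  unfolding bar_chain_def formal_tensors_def using bar_face_carrier[of _ "n + 3" xs]
  by (intro sum_in_free_space free_space_closed unit_fun_in_free_space) auto

lemma linear_ext_sum:
  "(\<And>i. i \<in> I \<Longrightarrow> f i \<in> carrier (free_space X)) \<Longrightarrow>
    linear_ext \<phi> (\<Sum>i\<in>I. f i) = (\<Sum>i\<in>I. linear_ext \<phi> (f i))"
proof (induction I rule: infinite_finite_induct)
  case (insert i I)
  then have "linear_ext \<phi> (f i + (\<Sum>i\<in>I. f i)) = linear_ext \<phi> (f i) + linear_ext \<phi> (\<Sum>i\<in>I. f i)"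
    by (intro linear_ext_simps[where X = X] sum_in_free_space) auto
  also have "linear_ext \<phi> (\<Sum>i\<in>I. f i) = (\<Sum>i\<in>I. linear_ext \<phi> (f i))" using insert by simp
  finally show ?case by (simp only: sum.insert[OF insert(1,2)])
qed simp_all

text \<open>Bimodule linearity of the differential for both sides at once: \<open>g\<close> stands
  for multiplication on the first or on the last factor, on lists of length n + 3 as well as n + 2.
  What commutes with every face commutes with the alternating sum.\<close>

lemma bar_diff_commute:
  assumes g: "slot_map (n + 3) (n + 3) g" and g': "slot_map (n + 2) (n + 2) g"
    and comm: "\<And>xs i. xs \<in> tensor_lists A (n + 3) \<Longrightarrow> i \<le> n + 1 \<Longrightarrow> bar_face A i (g xs) =
        g (bar_face A i xs)"
    and t: "t \<in> carrier (tensor_power A (n + 3))"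
  shows "bar_diff A n (tensor_map A (n + 3) (\<lambda>xs. unit_fun (g xs)) t) =
    tensor_map A (n + 2) (\<lambda>xs. unit_fun (g xs)) (bar_diff A n t)"
  using t
proof (induction t rule: tensor_induct)
  case zero
  show ?case
    using is_linear_zero[OF bar_diff_linear tensor_vs tensor_vs]
        is_linear_zero[OF tensor_map_slot_map(1)[OF g] tensor_vs tensor_vs]
      is_linear_zero[OF tensor_map_slot_map(1)[OF g'] tensor_vs tensor_vs] by simp
next
  case (add x y)
  then show ?case
    using is_linearD(1,2)[OF bar_diff_linear[of n]] is_linearD(1,2)[OF tensor_map_slot_map(1)[OF g]]
      is_linearD(2)[OF tensor_map_slot_map(1)[OF g']] by simp
next
  case (smult c x)
  then show ?case
    using is_linearD(1,3)[OF bar_diff_linear[of n]] is_linearD(1,3)[OF tensor_map_slot_map(1)[OF g]]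
      is_linearD(3)[OF tensor_map_slot_map(1)[OF g']] by simp
next
  case (tensor xs)
  have gxs: "g xs \<in> tensor_lists A (n + 3)" using g tensor by (simp add: slot_map_def)
  have faces:
      "fscale c (unit_fun (bar_face A i xs)) \<in> carrier (free_space (tensor_lists A (n + 2)) :: ('k,
          _) module)"
    if "i \<le> n + 1" for i c
    using bar_face_carrier[of i "n + 3" xs] tensor that
        by (intro free_space_closed unit_fun_in_free_space) auto
  have "linear_ext (\<lambda>xs. unit_fun (g xs)) (bar_chain n xs) =
      (\<Sum>i\<le>n + 1. linear_ext (\<lambda>xs. unit_fun (g xs)) (fscale ((- 1) ^ i) (unit_fun (bar_face A i xs))))"
    unfolding bar_chain_def by (rule linear_ext_sum) (rule faces, simp)
  also have "\<dots> = bar_chain n (g xs)"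
    unfolding bar_chain_def
        by (rule sum.cong)
            (simp_all only: linear_ext_fscale linear_ext_unit comm[OF tensor] atMost_iff)
  finally have eq: "linear_ext (\<lambda>xs. unit_fun (g xs)) (bar_chain n xs) = bar_chain n (g xs)" .
  have "tensor_map A (n + 2) (\<lambda>xs. unit_fun (g xs)) (bar_diff A n (tensor (n + 3) xs)) =
    multilinear_null A (n + 2) +>\<^bsub>formal_tensors A (n + 2)\<^esub> linear_ext (\<lambda>xs. unit_fun (g xs)) (bar_chain n xs)"
    unfolding bar_diff_tensor[OF tensor] tensor_map_def
    by (rule quot_map_coset[OF tensor_quotient tensor_quotient slot_map_linear[OF g']
        slot_map_null[OF g']
          bar_chain_carrier[OF tensor]])
  also have "\<dots> = bar_diff A n (tensor (n + 3) (g xs))"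
    unfolding bar_diff_tensor[OF gxs] eq ..
  also have "tensor (n + 3) (g xs) =
      tensor_map A (n + 3) (\<lambda>xs. unit_fun (g xs)) (tensor (n + 3) xs)"
    using tensor_map_slot_map(2)[OF g tensor] by simp
  finally show ?case by simp
qed

end

section \<open>Hochschild chains\<close>

lemma free_space_minus:
  assumes "x \<in> carrier (free_space X)" "y \<in> carrier (free_space X)"
  shows "x \<ominus>\<^bsub>free_space X\<^esub> y = x - (y :: 'x \<Rightarrow> 'k::field)"
proof -
  have "\<ominus>\<^bsub>free_space X\<^esub> y = fscale (- 1) y"
    using vectorspace_class_ringD(4)[OF vectorspace_free_space assms(2)] by simp
  then show ?thesis by (auto simp: a_minus_def)
qed

lemma (in quotient_space) coset_zero_iff: "x \<in> carrier V \<Longrightarrow> N +> x = \<zero>\<^bsub>quot_module V N\<^esub> \<longleftrightarrow> x \<in> N"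
  unfolding zero_quot_module using a_coset_join2[OF _ N.a_subgroup, of x] N.a_rcos_self[of x]
      by auto

context unital_algebra begin

lemma bar_bimodule_simps [simp]:
  "carrier (bar_bimodule A n) = carrier (tensor_power A (n + 2))"
  "add (bar_bimodule A n) = add (tensor_power A (n + 2))"
  "module.smult (bar_bimodule A n) = module.smult (tensor_power A (n + 2))"
  "lact (bar_bimodule A n) a = tensor_map A (n + 2) (\<lambda>xs. unit_fun ((a \<otimes> hd xs) # tl xs))"
  "ract (bar_bimodule A n) X a =
      tensor_map A (n + 2) (\<lambda>xs. unit_fun (butlast xs @ [last xs \<otimes> a])) X"
  by (simp_all add: bar_bimodule_def module.extend_def bimodule.fields_def)

lemma lact_linear:
  assumes "a \<in> carrier A"
  shows "is_linear (tensor_power A (n + 2)) (tensor_power A (n + 2)) (lact (bar_bimodule A n) a)"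
    and "x \<in> carrier A \<Longrightarrow> xs \<in> tensor_lists A (n + 1) \<Longrightarrow>
      lact (bar_bimodule A n) a (tensor (n + 2) (x # xs)) = tensor (n + 2) ((a \<otimes> x) # xs)"
proof -
  show "is_linear (tensor_power A (n + 2)) (tensor_power A (n + 2)) (lact (bar_bimodule A n) a)"
    using tensor_map_slot_map(1)[OF slot_map_left[OF assms, of "n + 1"]] by simp
  assume "x \<in> carrier A" "xs \<in> tensor_lists A (n + 1)"
  then have "x # xs \<in> tensor_lists A (Suc (n + 1))" by (auto simp: tensor_lists_def)
  from tensor_map_slot_map(2)[OF slot_map_left[OF assms, of "n + 1"] this]
  show "lact (bar_bimodule A n) a (tensor (n + 2) (x # xs)) = tensor (n + 2) ((a \<otimes> x) # xs)" by simp
qed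

lemma ract_linear:
  assumes "a \<in> carrier A"
  shows "is_linear (tensor_power A (n + 2)) (tensor_power A (n +
      2)) (\<lambda>t. ract (bar_bimodule A n) t a)"
    and "x \<in> carrier A \<Longrightarrow> xs \<in> tensor_lists A (n + 1) \<Longrightarrow>
      ract (bar_bimodule A n) (tensor (n + 2) (xs @ [x])) a = tensor (n + 2) (xs @ [x \<otimes> a])"
proof -
  show "is_linear (tensor_power A (n + 2)) (tensor_power A (n +
      2)) (\<lambda>t. ract (bar_bimodule A n) t a)"
    using tensor_map_slot_map(1)[OF slot_map_right[OF assms, of "n + 1"]] by simp
  assume "x \<in> carrier A" "xs \<in> tensor_lists A (n + 1)"
  then have "xs @ [x] \<in> tensor_lists A (Suc (n + 1))" by (auto simp: tensor_lists_def)
  from tensor_map_slot_map(2)[OF slot_map_right[OF assms, of "n + 1"] this]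
  show "ract (bar_bimodule A n) (tensor (n + 2) (xs @ [x])) a = tensor (n + 2) (xs @ [x \<otimes> a])"
      by simp
qed

lemma act_closed:
  assumes "a \<in> carrier A" "t \<in> carrier (tensor_power A (n + 2))"
  shows "lact (bar_bimodule A n) a t \<in> carrier (tensor_power A (n + 2))"
    and "ract (bar_bimodule A n) t a \<in> carrier (tensor_power A (n + 2))"
  by (rule is_linearD(1)[OF lact_linear(1)[OF assms(1)] assms(2)])
    (rule is_linearD(1)[OF ract_linear(1)[OF assms(1)] assms(2)])

lemma env_rels_cases:
  assumes "r \<in> env_rels A (bar_bimodule A n)"
  obtains a b t where "a \<in> carrier A" "b \<in> carrier A" "t \<in> carrier (tensor_power A (n + 2))"
      "r = unit_fun (a \<oplus> b, t) - unit_fun (a, t) - unit_fun (b, t)"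
  | a s t where "a \<in> carrier A" "s \<in> carrier (tensor_power A (n + 2))"
      "t \<in> carrier (tensor_power A (n + 2))"
      "r = unit_fun (a, s \<oplus>\<^bsub>tensor_power A (n + 2)\<^esub> t) - unit_fun (a, s) - unit_fun (a, t)"
  | c a t where "a \<in> carrier A" "t \<in> carrier (tensor_power A (n + 2))"
      "r = unit_fun (c \<odot>\<^bsub>A\<^esub> a, t) - fscale c (unit_fun (a, t))"
  | c a t where "a \<in> carrier A" "t \<in> carrier (tensor_power A (n + 2))"
      "r = unit_fun (a, c \<odot>\<^bsub>tensor_power A (n + 2)\<^esub> t) - fscale c (unit_fun (a, t))"
  | a b t where "a \<in> carrier A" "b \<in> carrier A" "t \<in> carrier (tensor_power A (n + 2))"
      "r = unit_fun (a \<otimes> b, t) - unit_fun (a, lact (bar_bimodule A n) b t)"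
  | a b t where "a \<in> carrier A" "b \<in> carrier A" "t \<in> carrier (tensor_power A (n + 2))"
      "r = unit_fun (b \<otimes> a, t) - unit_fun (a, ract (bar_bimodule A n) t b)"
  using assms unfolding env_rels_def unit_rel_simps bar_bimodule_simps(1-3)
  by (elim UnE CollectE exE conjE)
    (rule that(1), assumption+ | rule that(2), assumption+ | rule that(3), assumption+ |
      rule that(4), assumption+ | rule that(5), assumption+ | rule that(6), assumption+)+

lemma env_rels_memb:
  assumes a: "a \<in> carrier A" and t: "t \<in> carrier (tensor_power A (n + 2))"
  shows "b \<in> carrier A \<Longrightarrow>
      unit_fun (a \<oplus> b, t) - unit_fun (a, t) - unit_fun (b, t) \<in> env_rels A (bar_bimodule A n)"
    and "s \<in> carrier (tensor_power A (n + 2)) \<Longrightarrow>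
      unit_fun (a, s \<oplus>\<^bsub>tensor_power A (n + 2)\<^esub> t) - unit_fun (a, s) - unit_fun (a, t) \<in> env_rels A (bar_bimodule A n)"
    and "unit_fun (c \<odot>\<^bsub>A\<^esub> a, t) - fscale c (unit_fun (a, t)) \<in> env_rels A (bar_bimodule A n)"
    and "unit_fun (a, c \<odot>\<^bsub>tensor_power A (n + 2)\<^esub> t) - fscale c (unit_fun (a,
        t)) \<in> env_rels A (bar_bimodule A n)"
    and "b \<in> carrier A \<Longrightarrow>
        unit_fun (a \<otimes> b, t) - unit_fun (a, lact (bar_bimodule A n) b t) \<in> env_rels A
            (bar_bimodule A n)"
    and "b \<in> carrier A \<Longrightarrow>
        unit_fun (b \<otimes> a, t) - unit_fun (a, ract (bar_bimodule A n) t b) \<in> env_rels A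
            (bar_bimodule A n)"
  using a t unfolding env_rels_def unit_rel_simps bar_bimodule_simps(1-3) by blast+

lemma unit_in_env_formal:
  "a \<in> carrier A \<Longrightarrow> t \<in> carrier (tensor_power A (n + 2)) \<Longrightarrow>
    unit_fun (a, t) \<in> carrier (env_formal A (bar_bimodule A n))"
  unfolding env_formal_def by (rule unit_fun_in_free_space) simp

lemmas tensor_closed = vectorspace_class_ringD(1)[OF tensor_vs]
  abelian_monoid.a_closed[OF abelian_group.axioms(1)[OF Module.module.axioms(2)[OF
      vectorspace.axioms(1)[OF tensor_vs]]]]
lemmas alg_closed = vectorspace_class_ringD(1)[OF algebra_vs] a_closed mult_closed unit_closed

lemma env_rels_carrier: "env_rels A (bar_bimodule A n) \<subseteq> carrier (env_formal A (bar_bimodule A n))"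
proof
  fix r assume "r \<in> env_rels A (bar_bimodule A n)"
  then show "r \<in> carrier (env_formal A (bar_bimodule A n))"
  proof (cases rule: env_rels_cases)
    case (1 a b t)
    then show ?thesis unfolding 1(4) using unit_in_env_formal[of _ t n] alg_closed
      unfolding env_formal_def by (intro free_space_closed) blast+
  next
    case (2 a s t)
    then show ?thesis unfolding 2(4) using unit_in_env_formal[of a _ n] tensor_closed
      unfolding env_formal_def by (intro free_space_closed) blast+
  next
    case (3 c a t)
    then show ?thesis unfolding 3(3) using unit_in_env_formal[of _ t n] alg_closed
      unfolding env_formal_def by (intro free_space_closed) blast+
  next
    case (4 c a t)
    then show ?thesis unfolding 4(3) using unit_in_env_formal[of a _ n] tensor_closed
      unfolding env_formal_def by (intro free_space_closed) blast+
  next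
    case (5 a b t)
    then show ?thesis unfolding 5(4) env_formal_def
      by (intro free_space_closed unit_in_env_formal[unfolded env_formal_def] act_closed alg_closed)
  next
    case (6 a b t)
    then show ?thesis unfolding 6(4) env_formal_def
      by (intro free_space_closed unit_in_env_formal[unfolded env_formal_def] act_closed alg_closed)
  qed
qed

lemma env_formal_vs: "vectorspace class_ring (env_formal A (bar_bimodule A n))"
  unfolding env_formal_def by (rule vectorspace_free_space)

lemma env_quotient:
    "quotient_space (env_formal A (bar_bimodule A n)) (env_null A (bar_bimodule A n))"
  unfolding env_null_def
  by (intro quotient_space.intro quotient_space_axioms.intro env_formal_vs
      span_class_ring(1)[OF env_formal_vs env_rels_carrier])

lemma env_rels_null: "env_rels A (bar_bimodule A n) \<subseteq> env_null A (bar_bimodule A n)"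
  unfolding env_null_def by (rule span_class_ring(2)[OF env_formal_vs env_rels_carrier])

lemma chains_eq: "hochschild_chains A n =
    quot_module (env_formal A (bar_bimodule A n)) (env_null A (bar_bimodule A n))"
  by (simp add: hochschild_chains_def env_tensor_def)

lemma chains_vs: "vectorspace class_ring (hochschild_chains A n)"
  unfolding chains_eq by (rule quotient_space.vectorspace_quot_module[OF env_quotient])

definition elem :: "nat \<Rightarrow> 'a \<Rightarrow> ('a list \<Rightarrow> 'k) set \<Rightarrow> ('k, 'a) hochschild_chain" where
  "elem n a t = env_null A (bar_bimodule A n) +>\<^bsub>env_formal A (bar_bimodule A n)\<^esub> unit_fun (a, t)"

lemma elem_carrier:
  "a \<in> carrier A \<Longrightarrow> t \<in> carrier (tensor_power A (n + 2)) \<Longrightarrow>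
      elem n a t \<in> carrier (hochschild_chains A n)"
  unfolding chains_eq elem_def quotient_space.carrier_quot_module[OF env_quotient]
  by (rule imageI) (rule unit_in_env_formal)

text \<open>Each equation is the class of one of the six families of relations in
  \<open>env_rels\<close>.\<close>

lemma elem_eqs:
  assumes a: "a \<in> carrier A" and t: "t \<in> carrier (tensor_power A (n + 2))"
  shows "b \<in> carrier A \<Longrightarrow> elem n (a \<oplus> b) t = elem n a t \<oplus>\<^bsub>hochschild_chains A n\<^esub> elem n b t"
    and "s \<in> carrier (tensor_power A (n + 2)) \<Longrightarrow>
      elem n a (s \<oplus>\<^bsub>tensor_power A (n + 2)\<^esub> t) = elem n a s \<oplus>\<^bsub>hochschild_chains A n\<^esub> elem n a t"
    and "elem n (c \<odot>\<^bsub>A\<^esub> a) t = c \<odot>\<^bsub>hochschild_chains A n\<^esub> elem n a t"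
    and "elem n a (c \<odot>\<^bsub>tensor_power A (n + 2)\<^esub> t) = c \<odot>\<^bsub>hochschild_chains A n\<^esub> elem n a t"
    and "b \<in> carrier A \<Longrightarrow> elem n (a \<otimes> b) t = elem n a (lact (bar_bimodule A n) b t)"
    and "b \<in> carrier A \<Longrightarrow> elem n (b \<otimes> a) t = elem n a (ract (bar_bimodule A n) t b)"
proof -
  let ?F = "env_formal A (bar_bimodule A n)" and ?N = "env_null A (bar_bimodule A n)"
  interpret Q: quotient_space ?F ?N by (rule env_quotient)
  note rels = subsetD[OF env_rels_null env_rels_memb(1)] subsetD[OF env_rels_null env_rels_memb(2)]
    subsetD[OF env_rels_null env_rels_memb(3)] subsetD[OF env_rels_null env_rels_memb(4)]
    subsetD[OF env_rels_null env_rels_memb(5)] subsetD[OF env_rels_null env_rels_memb(6)]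
  have minus: "x \<ominus>\<^bsub>?F\<^esub> y = x - y" if "x \<in> carrier ?F" "y \<in> carrier ?F" for x y
    using that free_space_minus unfolding env_formal_def by blast
  have add: "x + y \<in> carrier ?F" if "x \<in> carrier ?F" "y \<in> carrier ?F" for x y
    using that free_space_closed(1) unfolding env_formal_def by blast
  have scale: "fscale c x \<in> carrier ?F" if "x \<in> carrier ?F" for c x
    using that free_space_closed(3) unfolding env_formal_def by blast
  have two: "?N +>\<^bsub>?F\<^esub> x = ?N +>\<^bsub>?F\<^esub> y" if "x \<in> carrier ?F" "y \<in> carrier ?F" "x - y \<in> ?N" for x y
    using Q.coset_eq_iff[of x y] minus[of x y] that by simp
  have three: "?N +>\<^bsub>?F\<^esub> x = (?N +>\<^bsub>?F\<^esub> y) \<oplus>\<^bsub>hochschild_chains A n\<^esub> (?N +>\<^bsub>?F\<^esub> z)"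
    if "x \<in> carrier ?F" "y \<in> carrier ?F" "z \<in> carrier ?F" "x - y - z \<in> ?N" for x y z
  proof -
    have "y \<oplus>\<^bsub>?F\<^esub> z = y + z" by (simp add: env_formal_def)
    then show ?thesis
      unfolding chains_eq using Q.add_quot_module[of y z] two[of x "y + z"] add[of y z] that
      by (simp add: diff_diff_add)
  qed
  have scl: "?N +>\<^bsub>?F\<^esub> x = c \<odot>\<^bsub>hochschild_chains A n\<^esub> (?N +>\<^bsub>?F\<^esub> y)"
    if "x \<in> carrier ?F" "y \<in> carrier ?F" "x - fscale c y \<in> ?N" for c x y
  proof -
    have "c \<odot>\<^bsub>?F\<^esub> y = fscale c y" by (simp add: env_formal_def)
    then show ?thesis
      unfolding chains_eq
          using Q.smult_quot_module[of y c] two[of x "fscale c y"] scale[of y c] that by simp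
  qed
  note unit = unit_in_env_formal[of _ _ n]
  show "b \<in> carrier A \<Longrightarrow> elem n (a \<oplus> b) t = elem n a t \<oplus>\<^bsub>hochschild_chains A n\<^esub> elem n b t"
    unfolding elem_def using a t alg_closed by (intro three unit rels) blast+
  show "s \<in> carrier (tensor_power A (n + 2)) \<Longrightarrow>
      elem n a (s \<oplus>\<^bsub>tensor_power A (n + 2)\<^esub> t) = elem n a s \<oplus>\<^bsub>hochschild_chains A n\<^esub> elem n a t"
    unfolding elem_def using a t tensor_closed by (intro three unit rels) blast+
  show "elem n (c \<odot>\<^bsub>A\<^esub> a) t = c \<odot>\<^bsub>hochschild_chains A n\<^esub> elem n a t"
    unfolding elem_def using a t alg_closed by (intro scl unit rels) blast+
  show "elem n a (c \<odot>\<^bsub>tensor_power A (n + 2)\<^esub> t) = c \<odot>\<^bsub>hochschild_chains A n\<^esub> elem n a t"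
    unfolding elem_def using a t tensor_closed by (intro scl unit rels) blast+
  show "b \<in> carrier A \<Longrightarrow> elem n (a \<otimes> b) t = elem n a (lact (bar_bimodule A n) b t)"
    unfolding elem_def by (intro two unit rels a t alg_closed act_closed)
  show "b \<in> carrier A \<Longrightarrow> elem n (b \<otimes> a) t = elem n a (ract (bar_bimodule A n) t b)"
    unfolding elem_def by (intro two unit rels a t alg_closed act_closed)
qed

text \<open>The universal property of the tensor product over the enveloping algebra: a form that is
  linear in both arguments and balanced for the left and the right action vanishes on all six
  families of relations.\<close>

lemma chain_functional:
  assumes l: "\<And>t. t \<in> carrier (tensor_power A (n + 2)) \<Longrightarrow> linear_functional A (\<lambda>a. \<Phi> a t)"
    and r: "\<And>a. a \<in> carrier A \<Longrightarrow> linear_functional (tensor_power A (n + 2)) (\<Phi> a)"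
    and bl: "\<And>a b t. a \<in> carrier A \<Longrightarrow> b \<in> carrier A \<Longrightarrow> t \<in> carrier (tensor_power A (n + 2)) \<Longrightarrow>
      \<Phi> (a \<otimes> b) t = \<Phi> a (lact (bar_bimodule A n) b t)"
    and br: "\<And>a b t. a \<in> carrier A \<Longrightarrow> b \<in> carrier A \<Longrightarrow> t \<in> carrier (tensor_power A (n + 2)) \<Longrightarrow>
      \<Phi> (b \<otimes> a) t = \<Phi> a (ract (bar_bimodule A n) t b)"
  obtains F where "linear_functional (hochschild_chains A n) F"
    "\<And>a t. a \<in> carrier A \<Longrightarrow> t \<in> carrier (tensor_power A (n + 2)) \<Longrightarrow> F (elem n a t) = \<Phi> a t"
proof -
  let ?F = "env_formal A (bar_bimodule A n)" and ?N = "env_null A (bar_bimodule A n)"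
  let ?\<Phi> = "functional_ext (\<lambda>(a, t). \<Phi> a t)"
  interpret Q: quotient_space ?F ?N by (rule env_quotient)
  have lin: "linear_functional ?F ?\<Phi>"
    unfolding env_formal_def by (rule linear_functional_ext)
  have minus: "?\<Phi> (x - y) = ?\<Phi> x - ?\<Phi> y" if "x \<in> carrier ?F" "y \<in> carrier ?F" for x y
    using that functional_ext_simps(2) unfolding env_formal_def by blast
  have diff: "x - y \<in> carrier ?F" if "x \<in> carrier ?F" "y \<in> carrier ?F" for x y
    using that free_space_closed(2) unfolding env_formal_def by blast
  have scale: "fscale c x \<in> carrier ?F" if "x \<in> carrier ?F" for c x
    using that free_space_closed(3) unfolding env_formal_def by blast
  note unit = unit_in_env_formal[of _ _ n]
  have rel: "?\<Phi> x = 0" if "x \<in> env_rels A (bar_bimodule A n)" for x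
    using that
  proof (cases rule: env_rels_cases)
    case (1 a b t)
    then show ?thesis
      using linear_functionalD(1)[OF l]
          by (simp add: minus diff unit alg_closed del: plus_fun_apply minus_apply)
  next
    case (2 a s t)
    then show ?thesis
      using linear_functionalD(1)[OF r]
          by (simp add: minus diff unit tensor_closed del: add_2_eq_Suc')
  next
    case (3 c a t)
    then show ?thesis
      using linear_functionalD(2)[OF l]
          by (simp add: minus scale unit alg_closed del: add_2_eq_Suc')
  next
    case (4 c a t)
    then show ?thesis
      using linear_functionalD(2)[OF r]
          by (simp add: minus scale unit tensor_closed del: add_2_eq_Suc')
  next
    case (5 a b t)
    then show ?thesis
      using bl
      by (simp add: minus unit alg_closed act_closed del: add_2_eq_Suc' bar_bimodule_simps)
  next
    case (6 a b t)
    then show ?thesis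
      using br
      by (simp add: minus unit alg_closed act_closed del: add_2_eq_Suc' bar_bimodule_simps)
  qed
  have null: "?\<Phi> x = 0" if "x \<in> ?N" for x
    using that[unfolded env_null_def]
  proof (rule span_induct_class_ring[OF Q.vectorspace_axioms env_rels_carrier])
    show "?\<Phi> \<zero>\<^bsub>?F\<^esub> = 0" by (simp add: env_formal_def functional_ext_def)
  qed (use rel linear_functionalD[OF lin] in auto)
  obtain F where F: "linear_functional (quot_module ?F ?N) F"
    "\<And>x. x \<in> carrier ?F \<Longrightarrow> F (?N +>\<^bsub>?F\<^esub> x) = ?\<Phi> x"
    using Q.functional_quot_module[OF lin null] by metis
  show thesis
    by (rule that[of F])
        (use F unit in \<open>auto simp: chains_eq elem_def simp del: bar_bimodule_simps add_2_eq_Suc'\<close>)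
qed

lemma chain_induct [consumes 1, case_names zero add smult elem]:
  assumes x: "x \<in> carrier (hochschild_chains A n)" and zero: "P \<zero>\<^bsub>hochschild_chains A n\<^esub>"
    and add: "\<And>x y. x \<in> carrier (hochschild_chains A n) \<Longrightarrow> y \<in> carrier (hochschild_chains A n) \<Longrightarrow>
      P x \<Longrightarrow> P y \<Longrightarrow> P (x \<oplus>\<^bsub>hochschild_chains A n\<^esub> y)"
    and smult: "\<And>c x. x \<in> carrier (hochschild_chains A n) \<Longrightarrow> P x \<Longrightarrow> P (c \<odot>\<^bsub>hochschild_chains A n\<^esub> x)"
    and elem: "\<And>a t. a \<in> carrier A \<Longrightarrow> t \<in> carrier (tensor_power A (n + 2)) \<Longrightarrow> P (elem n a t)"
  shows "P x"
proof -
  let ?F = "env_formal A (bar_bimodule A n)" and ?N = "env_null A (bar_bimodule A n)"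
  interpret Q: quotient_space ?F ?N by (rule env_quotient)
  let ?cl = "\<lambda>f. ?N +>\<^bsub>?F\<^esub> f"
  have cl: "f \<in> carrier ?F \<Longrightarrow> ?cl f \<in> carrier (hochschild_chains A n)" for f
    unfolding chains_eq Q.carrier_quot_module by blast
  have F_ops: "x \<oplus>\<^bsub>?F\<^esub> y = x + y" "c \<odot>\<^bsub>?F\<^esub> x = fscale c x" for x y c
      by (simp_all add: env_formal_def)
  have "P (?cl f)" if "f \<in> carrier ?F" for f
    using that[unfolded env_formal_def]
  proof (rule free_space_induct)
    show "P (?cl 0)"
      using \<open>P \<zero>\<^bsub>hochschild_chains A n\<^esub>\<close> Q.coset_zero
      by (metis Q.zero_quot_module chains_eq env_formal_def free_space_simps(4))
  next
    fix f g assume f: "f \<in> carrier (free_space (carrier A \<times> carrier (bar_bimodule A n)))"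
      and g: "g \<in> carrier (free_space (carrier A \<times> carrier (bar_bimodule A n)))"
      and P: "P (?cl f)" "P (?cl g)"
    have fg: "f \<in> carrier ?F" "g \<in> carrier ?F" unfolding env_formal_def by (fact f, fact g)
    show "P (?cl (f + g))"
      using assms(3)[OF cl[OF fg(1)] cl[OF fg(2)] P] Q.add_quot_module[OF fg]
      unfolding chains_eq F_ops by simp
  next
    fix c and z :: "'a \<times> ('a list \<Rightarrow> 'k) set" assume "z \<in> carrier A \<times> carrier (bar_bimodule A n)"
    then obtain a t where z: "z = (a, t)" "a \<in> carrier A" "t \<in> carrier (tensor_power A (n + 2))"
      unfolding bar_bimodule_simps by auto
    have u: "unit_fun (a, t) \<in> carrier ?F" using z(2,3) by (rule unit_in_env_formal)
    have "c \<odot>\<^bsub>hochschild_chains A n\<^esub> elem n a t = ?cl (fscale c (unit_fun z))"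
      unfolding chains_eq elem_def z(1) Q.smult_quot_module[OF u] F_ops ..
    then show "P (?cl (fscale c (unit_fun z)))"
      using assms(4)[OF elem_carrier[OF z(2,3)] assms(5)[OF z(2,3)], of c] by simp
  qed
  then show ?thesis using x unfolding chains_eq Q.carrier_quot_module by blast
qed

end

section \<open>Hochschild chains in their usual form\<close>

lemma linear_functional_comp:
  assumes "is_linear V W h" "linear_functional W f"
  shows "linear_functional V (\<lambda>x. f (h x))"
  using is_linearD[OF assms(1)] linear_functionalD[OF assms(2)] by (simp add: linear_functional_def)

lemma is_linear_comp:
  assumes "is_linear V W h" "is_linear W U g"
  shows "is_linear V U (\<lambda>x. g (h x))"
  using is_linearD[OF assms(1)] is_linearD[OF assms(2)] by (simp add: is_linear_def)

context unital_algebra begin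

lemma tensor_listsE:
  assumes "xs \<in> tensor_lists A (n + 2)"
  obtains x ys z where "xs = x # ys @ [z]" "x \<in> carrier A" "z \<in> carrier A" "ys \<in> tensor_lists A n"
proof -
  obtain x xs' where x: "xs = x # xs'" using assms by (cases xs) (auto simp: tensor_lists_def)
  moreover obtain ys z where "xs' = ys @ [z]"
    using assms x by (cases xs' rule: rev_cases) (auto simp: tensor_lists_def)
  ultimately show thesis using that assms by (auto simp: tensor_lists_def)
qed

lemma slotwise_linearD:
  "slotwise_linear m \<phi> \<Longrightarrow> Suc (length xs + length ys) = m \<Longrightarrow> set xs \<subseteq> carrier A \<Longrightarrow> set ys \<subseteq> carrier A \<Longrightarrow>
    linear_functional A (\<lambda>z. \<phi> (xs @ z # ys))"
  by (simp add: slotwise_linear_def)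

text \<open>The list x, ys, z stands for a bar tensor whose outer factors are moved onto
  \<open>a\<close>, giving zax. A varied first or last entry passes through multiplication by fixed
  elements before it reaches \<open>f\<close>; an inner entry reaches \<open>f\<close>
  directly.\<close>

lemma slotwise_linear_wrap:
  assumes f: "slotwise_linear (n + 1) f" and a: "a \<in> carrier A"
  shows "slotwise_linear (n + 2) (\<lambda>xs. f ((last xs \<otimes> a \<otimes> hd xs) # butlast (tl xs)))"
  unfolding slotwise_linear_def
proof (intro allI impI)
  fix xs ys assume len: "Suc (length xs + length ys) = n + 2" and xs: "set xs \<subseteq> carrier A" and ys:
      "set ys \<subseteq> carrier A"
  show "linear_functional A (\<lambda>z. f ((last (xs @ z # ys) \<otimes> a \<otimes> hd (xs @ z # ys)) # butlast (tl (xs @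
      z # ys))))"
  proof (cases xs)
    case Nil
    then obtain ys' y where y: "ys = ys' @ [y]" using len by (cases ys rule: rev_cases) auto
    then have ya: "y \<otimes> a \<in> carrier A" using ys a alg_closed by auto
    have "linear_functional A (\<lambda>z. f ([] @ z # ys'))"
      by (rule slotwise_linearD[OF f]) (use len y Nil ys in auto)
    from linear_functional_comp[OF right_linear[OF ya] this] show ?thesis
        by (simp add: Nil y butlast_append)
  next
    case (Cons x xs')
    note Cons1 = this
    show ?thesis
    proof (cases ys rule: rev_cases)
      case Nil
      have "linear_functional A (\<lambda>z. f ([] @ z # xs'))"
        by (rule slotwise_linearD[OF f]) (use len Cons1 Nil xs in auto)
      moreover have "is_linear A A (\<lambda>z. z \<otimes> a \<otimes> x)"
        using is_linear_comp[OF left_linear[OF a] left_linear] xs Cons1 by auto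
      ultimately show ?thesis
        using linear_functional_comp by (fastforce simp: Nil Cons1)
    next
      case (snoc ys' y)
      have "linear_functional A (\<lambda>z. f (((y \<otimes> a \<otimes> x) # xs') @ z # ys'))"
        by (rule slotwise_linearD[OF f]) (use len Cons1 snoc xs ys a alg_closed in auto)
      then show ?thesis by (simp add: snoc Cons1 butlast_append)
    qed
  qed
qed

text \<open>Over the enveloping algebra, the tensor product of A with A \<otimes> A^n \<otimes> A is
  A \<otimes> A^n, by sending a \<otimes> (x \<otimes> ys \<otimes> z) to zax \<otimes> ys. This is
  that isomorphism seen through functionals: every multilinear form in n + 1 arguments becomes a
  functional on chains.\<close>

lemma hochschild_functional:
  assumes f: "slotwise_linear (n + 1) f"
  obtains F where "linear_functional (hochschild_chains A n) F"
    "\<And>a x ys z. a \<in> carrier A \<Longrightarrow> x \<in> carrier A \<Longrightarrow> z \<in> carrier A \<Longrightarrow> ys \<in> tensor_lists A n \<Longrightarrow>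
      F (elem n a (tensor (n + 2) (x # ys @ [z]))) = f ((z \<otimes> a \<otimes> x) # ys)"
proof -
  let ?\<phi> = "\<lambda>a xs. f ((last xs \<otimes> a \<otimes> hd xs) # butlast (tl xs))"
  have "\<exists>G. linear_functional (tensor_power A (n + 2)) G \<and> (\<forall>xs\<in>tensor_lists A (n +
      2). G (tensor (n + 2) xs) = ?\<phi> a xs)"
    if "a \<in> carrier A" for a
    using tensor_functional[OF slotwise_linear_wrap[OF f that]] by metis
  then obtain G where G: "\<And>a. a \<in> carrier A \<Longrightarrow> linear_functional (tensor_power A (n + 2)) (G a)"
    "\<And>a xs. a \<in> carrier A \<Longrightarrow> xs \<in> tensor_lists A (n + 2) \<Longrightarrow> G a (tensor (n + 2) xs) = ?\<phi> a xs"
    by metis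
  have Gt: "G a (tensor (n + 2) (x # ys @ [z])) = f ((z \<otimes> a \<otimes> x) # ys)"
    if "a \<in> carrier A" "x \<in> carrier A" "z \<in> carrier A" "ys \<in> tensor_lists A n" for a x ys z
    using that by (subst G(2)) (auto simp: tensor_lists_def)
  have G0: "G a \<zero>\<^bsub>tensor_power A (n + 2)\<^esub> = 0" if "a \<in> carrier A" for a
  proof -
    interpret T: vectorspace class_ring "tensor_power A (n + 2)" by (rule tensor_vs)
    show ?thesis
      using linear_functionalD(2)[OF G(1)[OF that] T.zero_closed, of 0]
        vectorspace_class_ringD(2)[OF tensor_vs T.zero_closed] by simp
  qed
  have l: "linear_functional A (\<lambda>a. G a t)" if "t \<in> carrier (tensor_power A (n + 2))" for t
    using that
  proof (induction t rule: tensor_induct)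
    case zero
    then show ?case using G0 alg_closed by (simp add: linear_functional_def)
  next
    case (add s t)
    then show ?case using linear_functionalD(1)[OF G(1)] alg_closed
      by (simp add: linear_functional_def algebra_simps)
  next
    case (smult c t)
    then show ?case using linear_functionalD(2)[OF G(1)] alg_closed
      by (simp add: linear_functional_def algebra_simps)
  next
    case (tensor xs)
    then obtain x ys z where xs: "xs = x # ys @ [z]" "x \<in> carrier A" "z \<in> carrier A"
        "ys \<in> tensor_lists A n"
      by (rule tensor_listsE)
    have "linear_functional A (\<lambda>z. f ([] @ z # ys))"
      by (rule slotwise_linearD[OF f]) (use xs(4) in \<open>auto simp: tensor_lists_def\<close>)
    from linear_functional_comp[OF is_linear_comp[OF right_linear[OF xs(3)] left_linear[OF xs(2)]]
        this]
    have "linear_functional A (\<lambda>a. f ((z \<otimes> a \<otimes> x) # ys))" by simp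
    then show ?case unfolding xs(1) using Gt xs alg_closed by (simp add: linear_functional_def)
  qed
  have bl: "G (a \<otimes> b) t = G a (lact (bar_bimodule A n) b t)"
    if "a \<in> carrier A" "b \<in> carrier A" "t \<in> carrier (tensor_power A (n + 2))" for a b t
    using that(3)
  proof (induction t rule: tensor_induct)
    case zero
    then show ?case
      using is_linear_zero[OF lact_linear(1)[OF that(2)] tensor_vs tensor_vs] G0 alg_closed that
      by (simp del: bar_bimodule_simps)
  next
    case (add s t)
    then show ?case
      using linear_functionalD(1)[OF G(1)] that alg_closed is_linearD[OF lact_linear(1)[OF that(2)]]
          by (simp del: bar_bimodule_simps)
  next
    case (smult c t)
    then show ?case
      using linear_functionalD(2)[OF G(1)] that alg_closed is_linearD[OF lact_linear(1)[OF that(2)]]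
          by (simp del: bar_bimodule_simps)
  next
    case (tensor xs)
    then obtain x ys z where xs: "xs = x # ys @ [z]" "x \<in> carrier A" "z \<in> carrier A"
        "ys \<in> tensor_lists A n"
      by (rule tensor_listsE)
    have "ys @ [z] \<in> tensor_lists A (n + 1)" using xs by (auto simp: tensor_lists_def)
    then have "lact (bar_bimodule A n) b (tensor (n + 2) xs) = tensor (n + 2) ((b \<otimes> x) # ys @ [z])"
      unfolding xs(1) by (rule lact_linear(2)[OF that(2) xs(2)])
    then show ?case
      using Gt[of "a \<otimes> b" x z ys] Gt[of a "b \<otimes> x" z ys] xs that alg_closed
      by (simp add: mult_assoc del: bar_bimodule_simps)
  qed
  have br: "G (b \<otimes> a) t = G a (ract (bar_bimodule A n) t b)"
    if "a \<in> carrier A" "b \<in> carrier A" "t \<in> carrier (tensor_power A (n + 2))" for a b t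
    using that(3)
  proof (induction t rule: tensor_induct)
    case zero
    then show ?case
      using is_linear_zero[OF ract_linear(1)[OF that(2)] tensor_vs tensor_vs] G0 alg_closed that
      by (simp del: bar_bimodule_simps)
  next
    case (add s t)
    then show ?case
      using linear_functionalD(1)[OF G(1)] that alg_closed is_linearD[OF ract_linear(1)[OF that(2)]]
          by (simp del: bar_bimodule_simps)
  next
    case (smult c t)
    then show ?case
      using linear_functionalD(2)[OF G(1)] that alg_closed is_linearD[OF ract_linear(1)[OF that(2)]]
          by (simp del: bar_bimodule_simps)
  next
    case (tensor xs)
    then obtain x ys z where xs: "xs = x # ys @ [z]" "x \<in> carrier A" "z \<in> carrier A"
        "ys \<in> tensor_lists A n"
      by (rule tensor_listsE)
    have "x # ys \<in> tensor_lists A (n + 1)" using xs by (auto simp: tensor_lists_def)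
    from ract_linear(2)[OF that(2) xs(3) this]
    have "ract (bar_bimodule A n) (tensor (n + 2) xs) b = tensor (n + 2) (x # ys @ [z \<otimes> b])"
      by (simp add: xs(1) del: bar_bimodule_simps)
    then show ?case
      using Gt[of "b \<otimes> a" x z ys] Gt[of a x "z \<otimes> b" ys] xs that alg_closed
      by (simp add: mult_assoc del: bar_bimodule_simps)
  qed
  obtain F where "linear_functional (hochschild_chains A n) F"
    "\<And>a t. a \<in> carrier A \<Longrightarrow> t \<in> carrier (tensor_power A (n + 2)) \<Longrightarrow> F (elem n a t) = G a t"
    by (rule chain_functional[of n G]) (erule l, erule G(1), erule (2) bl, erule (2) br, blast)
  moreover have "x # ys @ [z] \<in> tensor_lists A (n + 2)"
    if "x \<in> carrier A" "z \<in> carrier A" "ys \<in> tensor_lists A n" for x ys z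
    using that by (auto simp: tensor_lists_def)
  ultimately show thesis using Gt tensor_carrier that by metis
qed

lemma bar_diff_linear':
    "is_linear (tensor_power A (Suc n + 2)) (tensor_power A (n + 2)) (bar_diff A n)"
  using bar_diff_linear[of n] by (simp add: numeral_3_eq_3)

lemma bar_diff_lact:
  assumes b: "b \<in> carrier A" and t: "t \<in> carrier (tensor_power A (Suc n + 2))"
  shows "bar_diff A n (lact (bar_bimodule A (Suc n)) b t) =
      lact (bar_bimodule A n) b (bar_diff A n t)"
proof -
  have eq: "Suc n + 2 = n + 3" by simp
  have g: "slot_map (n + 3) (n + 3) (\<lambda>xs. (b \<otimes> hd xs) # tl xs)"
      "slot_map (n + 2) (n + 2) (\<lambda>xs. (b \<otimes> hd xs) # tl xs)"
    using slot_map_left[OF b, of "n + 2"] slot_map_left[OF b, of "n + 1"]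
        by (simp_all add: numeral_3_eq_3)
  show ?thesis
    unfolding bar_bimodule_simps eq
  proof (rule bar_diff_commute[OF g])
    fix xs and i :: nat assume "xs \<in> tensor_lists A (n + 3)"
    then obtain x y zs where "xs = x # y # zs" "x \<in> carrier A" "y \<in> carrier A"
      by (cases xs rule: remdups_adj.cases) (auto simp: tensor_lists_def)
    then show "bar_face A i ((b \<otimes> hd xs) # tl xs) =
        (b \<otimes> hd (bar_face A i xs)) # tl (bar_face A i xs)"
      using b by (cases i) (auto simp: bar_face_simps mult_assoc)
  qed (use t[unfolded eq] in simp)
qed

lemma bar_diff_ract:
  assumes b: "b \<in> carrier A" and t: "t \<in> carrier (tensor_power A (Suc n + 2))"
  shows "bar_diff A n (ract (bar_bimodule A (Suc n)) t b) =
      ract (bar_bimodule A n) (bar_diff A n t) b"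
proof -
  have eq: "Suc n + 2 = n + 3" by simp
  let ?g = "\<lambda>xs. butlast xs @ [last xs \<otimes> b]"
  have g: "slot_map (n + 3) (n + 3) ?g" "slot_map (n + 2) (n + 2) ?g"
    using slot_map_right[OF b, of "n + 2"] slot_map_right[OF b, of "n + 1"]
        by (simp_all add: numeral_3_eq_3)
  show ?thesis
    unfolding bar_bimodule_simps eq
  proof (rule bar_diff_commute[OF g])
    fix xs and i :: nat assume xs: "xs \<in> tensor_lists A (n + 3)" and i: "i \<le> n + 1"
    obtain xs' z where z: "xs = xs' @ [z]" using xs
        by (cases xs rule: rev_cases) (auto simp: tensor_lists_def)
    obtain ys y where y: "xs' = ys @ [y]" using xs z
        by (cases xs' rule: rev_cases) (auto simp: tensor_lists_def)
    have len: "length ys = n + 1" "y \<in> carrier A" "z \<in> carrier A" using xs y z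
        by (auto simp: tensor_lists_def)
    show "bar_face A i (?g xs) = ?g (bar_face A i xs)"
    proof (cases "i = n + 1")
      \<comment> \<open>This is the last face, as the list has n + 3 entries. It is the only one
        that involves the entry multiplied by \<open>b\<close>, and associativity moves
        \<open>b\<close> out of the product.\<close>
      case True
      then show ?thesis
        using bar_face_simps(4)[of ys y z "[]"] bar_face_simps(4)[of ys y "z \<otimes> b" "[]"] b len
        by (simp add: y z butlast_append mult_assoc)
    next
      case False
      then have "Suc i < length (ys @ [y])" using len i by simp
      then show ?thesis
        using bar_face_simps(3)[of i "ys @ [y]" "[z]"] bar_face_simps(3)[of i "ys @ [y]" "[z \<otimes> b]"]
        by (simp add: y z butlast_append)
    qed
  qed (use t[unfolded eq] in simp)
qed

text \<open>The map id \<otimes> d is well defined: it sends each of the six families of relations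
  into the family of the same kind. For the two balancing families this is the bimodule linearity of
  \<open>bar_diff\<close>.\<close>

lemma hochschild_diff_spec:
  shows "is_linear (hochschild_chains A (Suc n)) (hochschild_chains A n) (hochschild_diff A n)"
    and "a \<in> carrier A \<Longrightarrow> t \<in> carrier (tensor_power A (Suc n + 2)) \<Longrightarrow>
      hochschild_diff A n (elem (Suc n) a t) = elem n a (bar_diff A n t)"
proof -
  let ?X = "bar_bimodule A (Suc n)" and ?Y = "bar_bimodule A n"
  let ?D = "linear_ext (\<lambda>(a, t). unit_fun (a, bar_diff A n t)) :: ('a \<times> ('a list \<Rightarrow> 'k) set \<Rightarrow> 'k) \<Rightarrow>
      _"
  interpret Q: quotient_space "env_formal A ?X" "env_null A ?X" by (rule env_quotient)
  interpret Q': quotient_space "env_formal A ?Y" "env_null A ?Y" by (rule env_quotient)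
  note bc = is_linearD(1)[OF bar_diff_linear'[of n]]
  have D: "is_linear (env_formal A ?X) (env_formal A ?Y) ?D"
    unfolding env_formal_def
  proof (rule is_linear_linear_ext)
    fix z assume "z \<in> carrier A \<times> carrier ?X"
    then obtain a t where "z = (a, t)" "a \<in> carrier A" "t \<in> carrier (tensor_power A (Suc n + 2))"
      unfolding bar_bimodule_simps by auto
    then show "(\<lambda>(a, t). unit_fun (a,
        bar_diff A n t)) z \<in> carrier (free_space (carrier A \<times> carrier ?Y) :: ('k, _) module)"
      using unit_in_env_formal[of a "bar_diff A n t" n] bc
      unfolding env_formal_def by (simp del: free_space_simps)
  qed
  have minus: "?D (x - y) = ?D x - ?D y"
      if "x \<in> carrier (env_formal A ?X)" "y \<in> carrier (env_formal A ?X)" for x y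
    using that linear_ext_simps(2) unfolding env_formal_def by blast
  have diff: "x - y \<in> carrier (env_formal A ?X)"
      if "x \<in> carrier (env_formal A ?X)" "y \<in> carrier (env_formal A ?X)" for x y
    using that free_space_closed(2) unfolding env_formal_def by blast
  have scale: "fscale c x \<in> carrier (env_formal A ?X)" if "x \<in> carrier (env_formal A ?X)" for c x
    using that free_space_closed(3) unfolding env_formal_def by blast
  note unit = unit_in_env_formal[of _ _ "Suc n"]
  have rel: "?D r \<in> env_null A ?Y" if "r \<in> env_rels A ?X" for r
  proof -
    have "?D r \<in> env_rels A ?Y"
      using that
    proof (cases rule: env_rels_cases)
      case (1 a b t)
      have "?D r =
          unit_fun (a \<oplus> b, bar_diff A n t) - unit_fun (a, bar_diff A n t) - unit_fun
              (b, bar_diff A n t)"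
        unfolding 1(4) using 1 alg_closed by (simp only: minus diff unit linear_ext_unit prod.case)
      then show ?thesis using env_rels_memb(1)[OF 1(1) bc[OF 1(3)] 1(2)] by simp
    next
      case (2 a s t)
      have "?D r = unit_fun (a, bar_diff A n s \<oplus>\<^bsub>tensor_power A (n + 2)\<^esub> bar_diff A n t)
        - unit_fun (a, bar_diff A n s) - unit_fun (a, bar_diff A n t)"
        unfolding 2(4) is_linearD(2)[OF bar_diff_linear'[of n] 2(2,3), symmetric]
        using 2 tensor_closed by (simp only: minus diff unit linear_ext_unit prod.case)
      then show ?thesis using env_rels_memb(2)[OF 2(1) bc[OF 2(3)] bc[OF 2(2)]] by simp
    next
      case (3 c a t)
      have "?D r = unit_fun (c \<odot>\<^bsub>A\<^esub> a, bar_diff A n t) - fscale c (unit_fun (a, bar_diff A n t))"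
        unfolding 3(3) using 3 alg_closed
        by (simp only: minus scale unit linear_ext_unit linear_ext_fscale prod.case)
      then show ?thesis using env_rels_memb(3)[OF 3(1) bc[OF 3(2)]] by simp
    next
      case (4 c a t)
      have "?D r =
          unit_fun (a, c \<odot>\<^bsub>tensor_power A (n + 2)\<^esub> bar_diff A n t) - fscale c
              (unit_fun (a, bar_diff A n t))"
        unfolding 4(3) is_linearD(3)[OF bar_diff_linear'[of n] 4(2), symmetric]
        using 4 tensor_closed
            by (simp only: minus scale unit linear_ext_unit linear_ext_fscale prod.case)
      then show ?thesis using env_rels_memb(4)[OF 4(1) bc[OF 4(2)]] by simp
    next
      case (5 a b t)
      have "?D r = unit_fun (a \<otimes> b, bar_diff A n t) - unit_fun (a, lact ?Y b (bar_diff A n t))"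
        unfolding 5(4) bar_diff_lact[OF 5(2,3), symmetric]
        using 5 alg_closed act_closed by (simp only: minus unit linear_ext_unit prod.case)
      then show ?thesis using env_rels_memb(5)[OF 5(1) bc[OF 5(3)] 5(2)] by (simp only:)
    next
      case (6 a b t)
      have "?D r = unit_fun (b \<otimes> a, bar_diff A n t) - unit_fun (a, ract ?Y (bar_diff A n t) b)"
        unfolding 6(4) bar_diff_ract[OF 6(2,3), symmetric]
        using 6 alg_closed act_closed by (simp only: minus unit linear_ext_unit prod.case)
      then show ?thesis using env_rels_memb(6)[OF 6(1) bc[OF 6(3)] 6(2)] by (simp only:)
    qed
    then show ?thesis using env_rels_null by blast
  qed
  have null: "?D r \<in> env_null A ?Y" if "r \<in> env_null A ?X" for r
    using that[unfolded env_null_def[of A ?X]]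
  proof (rule span_induct_class_ring[OF Q.vectorspace_axioms env_rels_carrier])
    show "?D \<zero>\<^bsub>env_formal A ?X\<^esub> \<in> env_null A ?Y"
      using is_linear_zero[OF D Q.vectorspace_axioms Q'.vectorspace_axioms] Q'.N_zero by simp
  next
    fix x y assume "x \<in> carrier (env_formal A ?X)" "y \<in> carrier (env_formal A ?X)"
      "?D x \<in> env_null A ?Y" "?D y \<in> env_null A ?Y"
    then show "?D (x \<oplus>\<^bsub>env_formal A ?X\<^esub> y) \<in> env_null A ?Y"
      using is_linearD(2)[OF D] Q'.N_add by metis
  next
    fix c x assume "x \<in> carrier (env_formal A ?X)" "?D x \<in> env_null A ?Y"
    then show "?D (c \<odot>\<^bsub>env_formal A ?X\<^esub> x) \<in> env_null A ?Y"
      using is_linearD(3)[OF D] Q'.N_smult by metis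
  qed (rule rel)
  show "is_linear (hochschild_chains A (Suc n)) (hochschild_chains A n) (hochschild_diff A n)"
    unfolding chains_eq hochschild_diff_def env_tensor_map_def
    by (rule quot_map_linear[OF env_quotient env_quotient D null])
  show "hochschild_diff A n (elem (Suc n) a t) = elem n a (bar_diff A n t)"
    if "a \<in> carrier A" "t \<in> carrier (tensor_power A (Suc n + 2))"
    unfolding elem_def hochschild_diff_def env_tensor_map_def
    by (subst quot_map_coset[OF env_quotient env_quotient D null unit[OF that]])
      (simp_all only: linear_ext_unit prod.case)
qed

text \<open>
  The chain \<open>a \<otimes> (1 \<otimes> b1 \<otimes> ... \<otimes> bn \<otimes> 1)\<close>, which corresponds to \<open>a \<otimes> b1 \<otimes> ... \<otimes> bn\<close> in the
  usual Hochschild complex.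
\<close>

definition sigma :: "nat \<Rightarrow> 'a \<Rightarrow> 'a list \<Rightarrow> ('k, 'a) hochschild_chain" where
  "sigma n a bs = elem n a (tensor (n + 2) (\<one> # bs @ [\<one>]))"

lemma wrap_tensor_lists:
  "x \<in> carrier A \<Longrightarrow> z \<in> carrier A \<Longrightarrow> bs \<in> tensor_lists A n \<Longrightarrow> x # bs @ [z] \<in> tensor_lists A (n + 2)"
  by (auto simp: tensor_lists_def)

lemma sigma_carrier:
    "a \<in> carrier A \<Longrightarrow> bs \<in> tensor_lists A n \<Longrightarrow> sigma n a bs \<in> carrier (hochschild_chains A n)"
  unfolding sigma_def by (intro elem_carrier tensor_carrier wrap_tensor_lists unit_closed)

text \<open>Since x = x 1 and z = 1 z, the balancing relations move \<open>x\<close> to the right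
  and \<open>z\<close> to the left of \<open>a\<close> and leave units at both ends.\<close>

lemma elem_eq_sigma:
  assumes a: "a \<in> carrier A" and x: "x \<in> carrier A" and z: "z \<in> carrier A" and bs:
      "bs \<in> tensor_lists A n"
  shows "elem n a (tensor (n + 2) (x # bs @ [z])) = sigma n (z \<otimes> a \<otimes> x) bs"
proof -
  have l: "lact (bar_bimodule A n) x (tensor (n + 2) (\<one> # bs @ [z])) =
      tensor (n + 2) (x # bs @ [z])"
    using lact_linear(2)[OF x unit_closed, of "bs @ [z]" n] bs z x
    by (simp add: tensor_lists_def unit_right del: bar_bimodule_simps)
  have r: "ract (bar_bimodule A n) (tensor (n + 2) (\<one> # bs @ [\<one>])) z =
      tensor (n + 2) (\<one> # bs @ [z])"
    using ract_linear(2)[OF z unit_closed, of "\<one> # bs" n] bs z unit_closed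
    by (simp add: tensor_lists_def unit_left del: bar_bimodule_simps)
  have t: "tensor (n + 2) (\<one> # bs @ [z]) \<in> carrier (tensor_power A (n + 2))"
    "tensor (n + 2) (\<one> # bs @ [\<one>]) \<in> carrier (tensor_power A (n + 2))"
    by (intro tensor_carrier wrap_tensor_lists unit_closed z bs)+
  show ?thesis
    using elem_eqs(5)[OF a t(1) x] elem_eqs(6)[OF mult_closed[OF a x] t(2) z] a x z
    unfolding l r sigma_def by (simp only: mult_assoc)
qed

lemma elem_linear:
  "a \<in> carrier A \<Longrightarrow> is_linear (tensor_power A (n + 2)) (hochschild_chains A n) (elem n a)"
  "t \<in> carrier (tensor_power A (n + 2)) \<Longrightarrow> is_linear A (hochschild_chains A n) (\<lambda>a. elem n a t)"
  unfolding is_linear_def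
  by (intro conjI ballI allI elem_carrier elem_eqs(2,4), assumption+)
    (intro conjI ballI allI elem_carrier elem_eqs(1,3), assumption+)

lemma tensor_slot_linear:
  assumes xs: "set xs \<subseteq> carrier A" and ys: "set ys \<subseteq> carrier A" and len:
      "Suc (length xs + length ys) = m"
  shows "is_linear A (tensor_power A m) (\<lambda>z. tensor m (xs @ z # ys))"
proof -
  let ?F = "formal_tensors A m" and ?N = "multilinear_null A m"
  interpret Q: quotient_space ?F ?N by (rule tensor_quotient)
  have mem: "z \<in> carrier A \<Longrightarrow> xs @ z # ys \<in> tensor_lists A m" for z
    using assms by (simp add: tensor_lists_slot)
  have unit: "z \<in> carrier A \<Longrightarrow> unit_fun (xs @ z # ys) \<in> carrier ?F" for z
    unfolding formal_tensors_def by (rule unit_fun_in_free_space[OF mem])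
  have minus: "x \<ominus>\<^bsub>?F\<^esub> y = x - y" if "x \<in> carrier ?F" "y \<in> carrier ?F" for x y
    using that free_space_minus unfolding formal_tensors_def by blast
  have ops: "x \<oplus>\<^bsub>?F\<^esub> y = x + y" "c \<odot>\<^bsub>?F\<^esub> x = fscale c x" for x y c
      by (simp_all add: formal_tensors_def)
  have null: "multilinear_rels A m \<subseteq> ?N"
    unfolding multilinear_null_def
        by (rule span_class_ring(2)[OF Q.vectorspace_axioms multilinear_rels_carrier])
  have add: "tensor m (xs @ (a \<oplus> b) # ys) =
      tensor m (xs @ a # ys) \<oplus>\<^bsub>tensor_power A m\<^esub> tensor m (xs @ b # ys)"
    if "a \<in> carrier A" "b \<in> carrier A" for a b
  proof -
    have "unit_fun (xs @ (a \<oplus> b) # ys) - unit_fun (xs @ a # ys) - unit_fun (xs @ b # ys) \<in> ?N"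
      using null mem[OF that(1)] that(2) unfolding multilinear_rels_def unit_rel_simps by blast
    then have "unit_fun (xs @ (a \<oplus> b) # ys) \<ominus>\<^bsub>?F\<^esub> (unit_fun (xs @ a # ys) \<oplus>\<^bsub>?F\<^esub> unit_fun (xs @ b #
        ys)) \<in> ?N"
      using minus[OF unit Q.a_closed[OF unit unit]] that alg_closed
          by (simp only: ops diff_diff_add)
    then show ?thesis
      unfolding tensor_power_def tensor_def
      using Q.add_quot_module[OF unit unit] Q.coset_eq_iff[OF unit Q.a_closed[OF unit unit]] that
          alg_closed by metis
  qed
  have scl: "tensor m (xs @ (c \<odot>\<^bsub>A\<^esub> a) # ys) = c \<odot>\<^bsub>tensor_power A m\<^esub> tensor m (xs @ a # ys)"
    if "a \<in> carrier A" for a c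
  proof -
    have cl: "c \<odot>\<^bsub>?F\<^esub> unit_fun (xs @ a # ys) \<in> carrier ?F"
      using Q.vs_simps(1) unit that by blast
    have "unit_fun (xs @ (c \<odot>\<^bsub>A\<^esub> a) # ys) - fscale c (unit_fun (xs @ a # ys)) \<in> ?N"
      using null mem[OF that] unfolding multilinear_rels_def unit_rel_simps by blast
    then have "unit_fun (xs @ (c \<odot>\<^bsub>A\<^esub> a) # ys) \<ominus>\<^bsub>?F\<^esub> (c \<odot>\<^bsub>?F\<^esub> unit_fun (xs @ a # ys)) \<in> ?N"
      using minus[OF unit cl] that alg_closed by (simp only: ops)
    then show ?thesis
      unfolding tensor_power_def tensor_def
      using Q.smult_quot_module[OF unit] Q.coset_eq_iff[OF unit cl] that alg_closed by metis
  qed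
  show ?thesis unfolding is_linear_def by (intro conjI ballI allI tensor_carrier mem add scl)
qed

lemma sigma_linear:
  "bs \<in> tensor_lists A n \<Longrightarrow> is_linear A (hochschild_chains A n) (\<lambda>a. sigma n a bs)"
  "a \<in> carrier A \<Longrightarrow> set bs \<subseteq> carrier A \<Longrightarrow> set cs \<subseteq> carrier A \<Longrightarrow> Suc (length bs + length cs) = n \<Longrightarrow>
    is_linear A (hochschild_chains A n) (\<lambda>b. sigma n a (bs @ b # cs))"
proof -
  show "bs \<in> tensor_lists A n \<Longrightarrow> is_linear A (hochschild_chains A n) (\<lambda>a. sigma n a bs)"
    unfolding sigma_def by (intro elem_linear tensor_carrier wrap_tensor_lists unit_closed)
  assume a: "a \<in> carrier A" and bs: "set bs \<subseteq> carrier A" "set cs \<subseteq> carrier A"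
      "Suc (length bs + length cs) = n"
  have "is_linear A (tensor_power A (n + 2)) (\<lambda>b. tensor (n + 2) ((\<one> # bs) @ b # (cs @ [\<one>])))"
    by (rule tensor_slot_linear) (use bs unit_closed in auto)
  from is_linear_comp[OF this elem_linear(1)[OF a]]
  show "is_linear A (hochschild_chains A n) (\<lambda>b. sigma n a (bs @ b # cs))"
    by (simp add: sigma_def)
qed

lemma chain_sigma_induct [consumes 1, case_names zero add smult sigma]:
  assumes x: "x \<in> carrier (hochschild_chains A n)" and zero: "P \<zero>\<^bsub>hochschild_chains A n\<^esub>"
    and add: "\<And>x y. x \<in> carrier (hochschild_chains A n) \<Longrightarrow> y \<in> carrier (hochschild_chains A n) \<Longrightarrow>
      P x \<Longrightarrow> P y \<Longrightarrow> P (x \<oplus>\<^bsub>hochschild_chains A n\<^esub> y)"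
    and smult: "\<And>c x. x \<in> carrier (hochschild_chains A n) \<Longrightarrow> P x \<Longrightarrow> P (c \<odot>\<^bsub>hochschild_chains A n\<^esub> x)"
    and sigma: "\<And>a bs. a \<in> carrier A \<Longrightarrow> bs \<in> tensor_lists A n \<Longrightarrow> P (sigma n a bs)"
  shows "P x"
  using x
proof (induction x rule: chain_induct)
  case (elem a t)
  note a = elem(1)
  note lin = elem_linear(1)[OF a, of n]
  note cl = elem_carrier[OF a, of _ n]
  from elem(2) show ?case
  proof (induction t rule: tensor_induct)
    case zero
    then show ?case using is_linear_zero[OF lin tensor_vs chains_vs] assms(2) by metis
  next
    case (add s t)
    then show ?case using assms(3)[OF cl cl] elem_eqs(2)[OF a] by metis
  next
    case (smult c t)
    then show ?case using assms(4)[OF cl] elem_eqs(4)[OF a] by metis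
  next
    case (tensor xs)
    then obtain x ys z where "xs = x # ys @ [z]" "x \<in> carrier A" "z \<in> carrier A"
        "ys \<in> tensor_lists A n"
      by (rule tensor_listsE)
    then show ?case using elem_eq_sigma[OF a] assms(5) mult_closed a by metis
  qed
qed (use assms in auto)

lemma sigma_functional:
  assumes f: "slotwise_linear (n + 1) f"
  obtains F where "linear_functional (hochschild_chains A n) F"
    "\<And>a bs. a \<in> carrier A \<Longrightarrow> bs \<in> tensor_lists A n \<Longrightarrow> F (sigma n a bs) = f (a # bs)"
proof -
  from hochschild_functional[OF f] obtain F where F: "linear_functional (hochschild_chains A n) F"
    "\<And>a x ys z. a \<in> carrier A \<Longrightarrow> x \<in> carrier A \<Longrightarrow> z \<in> carrier A \<Longrightarrow> ys \<in> tensor_lists A n \<Longrightarrow>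
      F (elem n a (tensor (n + 2) (x # ys @ [z]))) = f ((z \<otimes> a \<otimes> x) # ys)" by metis
  show thesis
    by (rule that[OF F(1)]) (simp only: sigma_def F(2) unit_closed unit_left unit_right mult_closed)
qed

section \<open>The differentials into degrees zero and one\<close>

lemma bar_chain_0: "bar_chain 0 xs = unit_fun (bar_face A 0 xs) - unit_fun (bar_face A 1 xs)"
  unfolding bar_chain_def by (auto simp: fun_eq_iff)

lemma bar_chain_1:
  "bar_chain 1 xs =
      unit_fun (bar_face A 0 xs) - unit_fun (bar_face A 1 xs) + unit_fun (bar_face A 2 xs)"
  unfolding bar_chain_def by (auto simp: fun_eq_iff numeral_2_eq_2)

lemma tensor_diff:
  assumes "xs \<in> tensor_lists A m" "ys \<in> tensor_lists A m"
  shows "multilinear_null A m +>\<^bsub>formal_tensors A m\<^esub> (unit_fun xs - unit_fun ys) =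
      tensor m xs \<oplus>\<^bsub>tensor_power A m\<^esub> (- 1) \<odot>\<^bsub>tensor_power A m\<^esub> tensor m ys"
    and "zs \<in> tensor_lists A m \<Longrightarrow>
      multilinear_null A m +>\<^bsub>formal_tensors A m\<^esub> (unit_fun xs - unit_fun ys + unit_fun zs) =
      (tensor m xs \<oplus>\<^bsub>tensor_power A m\<^esub> (- 1) \<odot>\<^bsub>tensor_power A m\<^esub> tensor m ys)
        \<oplus>\<^bsub>tensor_power A m\<^esub> tensor m zs"
proof -
  let ?F = "formal_tensors A m" and ?N = "multilinear_null A m"
  interpret Q: quotient_space ?F ?N by (rule tensor_quotient)
  have unit: "xs \<in> tensor_lists A m \<Longrightarrow> unit_fun xs \<in> carrier ?F" for xs
    unfolding formal_tensors_def by (rule unit_fun_in_free_space)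
  have diff: "unit_fun xs \<oplus>\<^bsub>?F\<^esub> (- 1) \<odot>\<^bsub>?F\<^esub> unit_fun ys = unit_fun xs - unit_fun ys" for xs ys
    by (auto simp: formal_tensors_def)
  have plus: "x \<oplus>\<^bsub>?F\<^esub> y = x + y" for x y by (simp add: formal_tensors_def)
  have c: "(- 1) \<odot>\<^bsub>?F\<^esub> unit_fun ys \<in> carrier ?F" "unit_fun xs - unit_fun ys \<in> carrier ?F"
    using Q.vs_simps(1)[OF unit] assms Q.a_closed[OF unit Q.vs_simps(1)[OF unit]]
        unfolding diff[symmetric] by blast+
  show *: "?N +>\<^bsub>?F\<^esub> (unit_fun xs - unit_fun ys) =
      tensor m xs \<oplus>\<^bsub>tensor_power A m\<^esub> (- 1) \<odot>\<^bsub>tensor_power A m\<^esub> tensor m ys"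
    unfolding tensor_power_def tensor_def Q.smult_quot_module[OF unit[OF assms(2)]]
      Q.add_quot_module[OF unit[OF assms(1)] c(1)] diff ..
  assume zs: "zs \<in> tensor_lists A m"
  show "?N +>\<^bsub>?F\<^esub> (unit_fun xs - unit_fun ys + unit_fun zs) =
      (tensor m xs \<oplus>\<^bsub>tensor_power A m\<^esub> (- 1) \<odot>\<^bsub>tensor_power A m\<^esub> tensor m ys)
        \<oplus>\<^bsub>tensor_power A m\<^esub> tensor m zs"
    unfolding *[symmetric]
        unfolding tensor_power_def tensor_def Q.add_quot_module[OF c(2) unit[OF zs]] plus ..
qed

text \<open>The faces of 1 \<otimes> b \<otimes> 1 are b \<otimes> 1 and 1 \<otimes> b; moving their
  outer factors onto \<open>a\<close> gives ab - ba.\<close>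

lemma hochschild_diff_0:
  assumes a: "a \<in> carrier A" and b: "b \<in> carrier A"
  shows "hochschild_diff A 0 (sigma 1 a [b]) =
    sigma 0 (a \<otimes> b) [] \<oplus>\<^bsub>hochschild_chains A 0\<^esub> (- 1) \<odot>\<^bsub>hochschild_chains A 0\<^esub> sigma 0 (b \<otimes> a) []"
proof -
  let ?t = "\<lambda>xs. tensor (0 + 2) xs"
  have l: "[\<one>, b, \<one>] \<in> tensor_lists A (0 + 3)" "[b, \<one>] \<in> tensor_lists A (0 + 2)"
      "[\<one>, b] \<in> tensor_lists A (0 + 2)"
    using b unit_closed by (auto simp: tensor_lists_def)
  have n: "[] \<in> tensor_lists A 0" by (simp add: tensor_lists_def)
  have f: "bar_face A 0 [\<one>, b, \<one>] = [b, \<one>]" "bar_face A 1 [\<one>, b, \<one>] = [\<one>, b]"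
    using b by (simp_all add: bar_face_def unit_left unit_right)
  have c: "tensor (Suc 0 + 2) (\<one> # [b] @ [\<one>]) \<in> carrier (tensor_power A (Suc 0 + 2))"
    using tensor_carrier[OF l(1)] by (simp add: numeral_3_eq_3)
  have "hochschild_diff A 0 (sigma 1 a [b]) = elem 0 a (bar_diff A 0 (tensor (0 + 3) [\<one>, b, \<one>]))"
    using hochschild_diff_spec(2)[OF a c] by (simp add: sigma_def numeral_3_eq_3)
  also have "bar_diff A 0 (tensor (0 + 3) [\<one>, b, \<one>]) =
      ?t [b, \<one>] \<oplus>\<^bsub>tensor_power A (0 + 2)\<^esub> (- 1) \<odot>\<^bsub>tensor_power A (0 + 2)\<^esub> ?t [\<one>, b]"
    unfolding bar_diff_tensor[OF l(1)] bar_chain_0 f tensor_diff(1)[OF l(2,3)] ..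
  also have "elem 0 a \<dots> =
      elem 0 a (?t [b, \<one>]) \<oplus>\<^bsub>hochschild_chains A 0\<^esub> (- 1) \<odot>\<^bsub>hochschild_chains A 0\<^esub> elem 0 a
          (?t [\<one>, b])"
    using is_linearD(2,3)[OF elem_linear(1)[OF a, of 0]] tensor_carrier[OF l(2)]
        tensor_carrier[OF l(3)] tensor_closed
    by metis
  also have "elem 0 a (?t [b, \<one>]) = sigma 0 (a \<otimes> b) []"
    using elem_eq_sigma[OF a b unit_closed n] a by (simp add: unit_left)
  also have "elem 0 a (?t [\<one>, b]) = sigma 0 (b \<otimes> a) []"
    using elem_eq_sigma[OF a unit_closed b n] a b by (simp add: unit_right mult_closed)
  finally show ?thesis .
qed

text \<open>The faces of 1 \<otimes> b \<otimes> c \<otimes> 1 are b \<otimes> c \<otimes> 1, 1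
  \<otimes> bc \<otimes> 1 and 1 \<otimes> b \<otimes> c. The last one produces the cyclic term: its
  outer factor \<open>c\<close> moves to the left of \<open>a\<close>.\<close>

lemma hochschild_diff_1:
  assumes a: "a \<in> carrier A" and b: "b \<in> carrier A" and c: "c \<in> carrier A"
  shows "hochschild_diff A 1 (sigma 2 a [b, c]) =
    (sigma 1 (a \<otimes> b) [c] \<oplus>\<^bsub>hochschild_chains A 1\<^esub> (- 1) \<odot>\<^bsub>hochschild_chains A 1\<^esub> sigma 1 a [b \<otimes> c])
      \<oplus>\<^bsub>hochschild_chains A 1\<^esub> sigma 1 (c \<otimes> a) [b]"
proof -
  let ?t = "\<lambda>xs. tensor (1 + 2) xs"
  have l: "[\<one>, b, c, \<one>] \<in> tensor_lists A (1 + 3)" "[b, c, \<one>] \<in> tensor_lists A (1 + 2)"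
    "[\<one>, b \<otimes> c, \<one>] \<in> tensor_lists A (1 + 2)" "[\<one>, b, c] \<in> tensor_lists A (1 + 2)"
    using b c unit_closed mult_closed by (auto simp: tensor_lists_def)
  have n: "[b] \<in> tensor_lists A 1" "[c] \<in> tensor_lists A 1" "[b \<otimes> c] \<in> tensor_lists A 1"
    using b c mult_closed by (auto simp: tensor_lists_def)
  have f: "bar_face A 0 [\<one>, b, c, \<one>] = [b, c, \<one>]" "bar_face A 1 [\<one>, b, c, \<one>] = [\<one>, b \<otimes> c, \<one>]"
    "bar_face A 2 [\<one>, b, c, \<one>] = [\<one>, b, c]"
    using b c by (simp_all add: bar_face_def unit_left unit_right)
  have cc: "tensor (Suc 1 + 2) (\<one> # [b, c] @ [\<one>]) \<in> carrier (tensor_power A (Suc 1 + 2))"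
    using tensor_carrier[OF l(1)] by (simp add: numeral_3_eq_3)
  have "hochschild_diff A 1 (sigma 2 a [b, c]) =
      elem 1 a (bar_diff A 1 (tensor (1 + 3) [\<one>, b, c, \<one>]))"
    using hochschild_diff_spec(2)[OF a cc] by (simp add: sigma_def numeral_eq_Suc)
  also have "bar_diff A 1 (tensor (1 + 3) [\<one>, b, c, \<one>]) =
      (?t [b, c, \<one>] \<oplus>\<^bsub>tensor_power A (1 + 2)\<^esub> (- 1) \<odot>\<^bsub>tensor_power A (1 + 2)\<^esub> ?t [\<one>, b \<otimes> c, \<one>])
        \<oplus>\<^bsub>tensor_power A (1 + 2)\<^esub> ?t [\<one>, b, c]"
    unfolding bar_diff_tensor[OF l(1)] bar_chain_1 f tensor_diff(2)[OF l(2-4)] ..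
  also have "elem 1 a \<dots> = (elem 1 a (?t [b, c, \<one>]) \<oplus>\<^bsub>hochschild_chains A 1\<^esub>
        (- 1) \<odot>\<^bsub>hochschild_chains A 1\<^esub> elem 1 a (?t [\<one>, b \<otimes> c, \<one>])) \<oplus>\<^bsub>hochschild_chains A 1\<^esub> elem 1 a (?t [\<one>, b, c])"
    using is_linearD(2,3)[OF elem_linear(1)[OF a, of 1]] tensor_carrier[OF l(2)]
        tensor_carrier[OF l(3)] tensor_carrier[OF l(4)] tensor_closed
    by metis
  also have "elem 1 a (?t [b, c, \<one>]) = sigma 1 (a \<otimes> b) [c]"
    using elem_eq_sigma[OF a b unit_closed n(2)] a by (simp add: unit_left)
  also have "elem 1 a (?t [\<one>, b, c]) = sigma 1 (c \<otimes> a) [b]"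
    using elem_eq_sigma[OF a unit_closed c n(1)] a c by (simp add: unit_right mult_closed)
  also have "elem 1 a (?t [\<one>, b \<otimes> c, \<one>]) = sigma 1 a [b \<otimes> c]"
    by (simp add: sigma_def)
  finally show ?thesis .
qed

end

section \<open>The first Hochschild homology group in coordinates\<close>

text \<open>The functionals \<open>coef\<close> dual to \<open>e\<close> express linear
  independence; with \<open>e_span\<close> they make \<open>e\<close> a finite basis indexed by
  \<open>B\<close>.\<close>

locale based_algebra = unital_algebra A
  for A :: "('k::field, 'a) module" (structure) +
  fixes B :: "'b set" and e :: "'b \<Rightarrow> 'a" and coef :: "'b \<Rightarrow> 'a \<Rightarrow> 'k"
  assumes finite_B: "finite B"
    and e_closed: "b \<in> B \<Longrightarrow> e b \<in> carrier A"
    and e_span: "carrier A \<subseteq> LinearCombinations.module.span class_ring A (e ` B)"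
    and coef_linear: "b \<in> B \<Longrightarrow> linear_functional A (coef b)"
    and coef_e: "b \<in> B \<Longrightarrow> c \<in> B \<Longrightarrow> coef b (e c) = (if b = c then 1 else 0)"
begin

text \<open>The structure constants of the algebra with respect to \<open>e\<close>.\<close>

definition mu :: "'b \<Rightarrow> 'b \<Rightarrow> 'b \<Rightarrow> 'k" where
  "mu b c x = coef x (e b \<otimes> e c)"

text \<open>The differential sends b \<otimes> c to bc - cb; its coefficient is tested at every
  basis element.\<close>

definition one_cycle :: "('b \<times> 'b \<Rightarrow> 'k) \<Rightarrow> bool" where
  "one_cycle f \<longleftrightarrow> f \<in> carrier (free_space (B \<times> B)) \<and>
    (\<forall>x\<in>B. functional_ext (\<lambda>(b, c). mu b c x - mu c b x) f = 0)"

text \<open>The coordinates of the Hochschild boundary \<open>ab \<otimes> c - a \<otimes> bc + ca \<otimes> b\<close> of \<open>a \<otimes> b \<otimes> c\<close>.\<close>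

definition two_boundary :: "'b \<Rightarrow> 'b \<Rightarrow> 'b \<Rightarrow> 'b \<times> 'b \<Rightarrow> 'k" where
  "two_boundary a b c = (\<lambda>(x, y). if x \<in> B \<and> y \<in> B then
    (if y = c then mu a b x else 0) - (if x = a then mu b c y else 0) + (if y = b then mu c a x else 0) else 0)"

definition one_boundaries :: "('b \<times> 'b \<Rightarrow> 'k) set" where
  "one_boundaries = LinearCombinations.module.span class_ring (free_space (B \<times> B))
    {two_boundary a b c | a b c. a \<in> B \<and> b \<in> B \<and> c \<in> B}"

text \<open>The elements that \<open>h\<close> maps into \<open>N\<close> form a subspace. Applied
  to one slot after the other, this extends statements from basis chains to all chains.\<close>

lemma basis_induct:
  assumes W: "vectorspace class_ring W" and h: "is_linear A W h"
    and N: "LinearCombinations.submodule class_ring N W" and e: "\<And>b. b \<in> B \<Longrightarrow> h (e b) \<in> N"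
    and a: "a \<in> carrier A"
  shows "h a \<in> N"
proof -
  interpret Q: quotient_space W N by (intro quotient_space.intro quotient_space_axioms.intro W N)
  have eB: "e ` B \<subseteq> carrier A" using e_closed by auto
  have "a \<in> LinearCombinations.module.span class_ring A (e ` B)" using a e_span by blast
  then show ?thesis
  proof (rule span_induct_class_ring[OF algebra_vs eB])
    show "h \<zero> \<in> N" using is_linear_zero[OF h algebra_vs W] Q.N_zero by simp
  qed (use e is_linearD[OF h] Q.N_add Q.N_smult in auto)
qed

lemma chain1_span:
  "carrier (hochschild_chains A 1) \<subseteq> LinearCombinations.module.span class_ring (hochschild_chains A 1)
    ((\<lambda>(b, c). sigma 1 (e b) [e c]) ` (B \<times> B))"
proof
  let ?C = "hochschild_chains A 1"
  define N where
      "N = LinearCombinations.module.span class_ring ?C ((\<lambda>(b, c). sigma 1 (e b) [e c]) ` (B \<times> B))"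
  have l1: "[b] \<in> tensor_lists A 1" if "b \<in> carrier A" for b using that
      by (auto simp: tensor_lists_def)
  have sub: "(\<lambda>(b, c). sigma 1 (e b) [e c]) ` (B \<times> B) \<subseteq> carrier ?C"
    using sigma_carrier[OF e_closed l1[OF e_closed]] by auto
  note sp = span_class_ring[OF chains_vs sub, folded N_def]
  interpret Q: quotient_space ?C N
      by (intro quotient_space.intro quotient_space_axioms.intro chains_vs sp)
  have 1: "sigma 1 (e b) [c] \<in> N" if "b \<in> B" "c \<in> carrier A" for b c
  proof (rule basis_induct[OF chains_vs _ sp(1) _ that(2)])
    show "is_linear A ?C (\<lambda>c. sigma 1 (e b) [c])"
      using sigma_linear(2)[OF e_closed[OF that(1)], of "[]" "[]" 1] by simp
  qed (use sp(2) that in auto)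
  have 2: "sigma 1 a [c] \<in> N" if "a \<in> carrier A" "c \<in> carrier A" for a c
    by (rule basis_induct[OF chains_vs sigma_linear(1)[OF l1[OF that(2)]] sp(1) _ that(1)])
        (rule 1[OF _ that(2)])
  fix x assume "x \<in> carrier ?C"
  then have "x \<in> N"
  proof (induction x rule: chain_sigma_induct)
    case (sigma a bs)
    then obtain b where "bs = [b]" "b \<in> carrier A" by (auto simp: tensor_lists_def length_Suc_conv)
    then show ?case using 2 sigma by simp
  qed (use Q.N_zero Q.N_add Q.N_smult in auto)
  then show "x \<in> LinearCombinations.module.span class_ring ?C ((\<lambda>(b,
      c). sigma 1 (e b) [e c]) ` (B \<times> B))"
    by (simp add: N_def)
qed

lemma chain0_span:
  "carrier (hochschild_chains A 0) \<subseteq> LinearCombinations.module.span class_ring (hochschild_chains A 0)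
    ((\<lambda>b. sigma 0 (e b) []) ` B)"
proof
  let ?C = "hochschild_chains A 0"
  define N where "N = LinearCombinations.module.span class_ring ?C ((\<lambda>b. sigma 0 (e b) []) ` B)"
  have l0: "[] \<in> tensor_lists A 0" by (auto simp: tensor_lists_def)
  have sub: "(\<lambda>b. sigma 0 (e b) []) ` B \<subseteq> carrier ?C"
    using sigma_carrier[OF e_closed l0] by auto
  note sp = span_class_ring[OF chains_vs sub, folded N_def]
  interpret Q: quotient_space ?C N
      by (intro quotient_space.intro quotient_space_axioms.intro chains_vs sp)
  have 1: "sigma 0 a [] \<in> N" if "a \<in> carrier A" for a
    by (rule basis_induct[OF chains_vs sigma_linear(1)[OF l0] sp(1) _ that]) (use sp(2) in auto)
  fix x assume "x \<in> carrier ?C"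
  then have "x \<in> N"
  proof (induction x rule: chain_sigma_induct)
    case (sigma a bs)
    then show ?case using 1 by (simp add: tensor_lists_def)
  qed (use Q.N_zero Q.N_add Q.N_smult in auto)
  then show "x \<in> LinearCombinations.module.span class_ring ?C ((\<lambda>b. sigma 0 (e b) []) ` B)"
    by (simp add: N_def)
qed

text \<open>Boundaries are an image, so in degree two it suffices to know that the basis chains
  generate; chains of degree two never have to be told apart.\<close>

lemma chain2_induct:
  assumes N: "LinearCombinations.submodule class_ring N (hochschild_chains A 2)"
    and s: "\<And>a b c. a \<in> B \<Longrightarrow> b \<in> B \<Longrightarrow> c \<in> B \<Longrightarrow> sigma 2 (e a) [e b, e c] \<in> N"
    and x: "x \<in> carrier (hochschild_chains A 2)"
  shows "x \<in> N"
proof -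
  let ?C = "hochschild_chains A 2"
  interpret Q: quotient_space ?C N
      by (intro quotient_space.intro quotient_space_axioms.intro chains_vs N)
  have l2: "[b, c] \<in> tensor_lists A 2" if "b \<in> carrier A" "c \<in> carrier A" for b c
    using that by (auto simp: tensor_lists_def)
  have 1: "sigma 2 (e a) [e b, c] \<in> N" if "a \<in> B" "b \<in> B" "c \<in> carrier A" for a b c
  proof (rule basis_induct[OF chains_vs _ N _ that(3)])
    show "is_linear A ?C (\<lambda>c. sigma 2 (e a) [e b, c])"
      using sigma_linear(2)[OF e_closed[OF that(1)], of "[e b]" "[]" 2] e_closed[OF that(2)] by simp
  qed (use s that in auto)
  have 2: "sigma 2 (e a) [b, c] \<in> N" if "a \<in> B" "b \<in> carrier A" "c \<in> carrier A" for a b c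
  proof (rule basis_induct[OF chains_vs _ N _ that(2)])
    show "is_linear A ?C (\<lambda>b. sigma 2 (e a) [b, c])"
      using sigma_linear(2)[OF e_closed[OF that(1)], of "[]" "[c]" 2] that(3) by simp
  qed (use 1 that in auto)
  have 3: "sigma 2 a [b, c] \<in> N" if "a \<in> carrier A" "b \<in> carrier A" "c \<in> carrier A" for a b c
    by (rule basis_induct[OF chains_vs sigma_linear(1)[OF l2[OF that(2,3)]] N _ that(1)])
        (rule 2[OF _ that(2,3)])
  from x show ?thesis
  proof (induction x rule: chain_sigma_induct)
    case (sigma a bs)
    then obtain b c where "bs = [b, c]" "b \<in> carrier A" "c \<in> carrier A"
      by (auto simp: tensor_lists_def length_Suc_conv numeral_2_eq_2)
    then show ?case using 3 sigma by simp
  qed (use Q.N_zero Q.N_add Q.N_smult in auto)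
qed

lemma coef_functionals:
  obtains F G where
    "\<And>x y. x \<in> B \<Longrightarrow> y \<in> B \<Longrightarrow> linear_functional (hochschild_chains A 1) (F x y)"
    "\<And>x y a b. x \<in> B \<Longrightarrow> y \<in> B \<Longrightarrow> a \<in> carrier A \<Longrightarrow> b \<in> carrier A \<Longrightarrow>
      F x y (sigma 1 a [b]) = coef x a * coef y b"
    "\<And>x. x \<in> B \<Longrightarrow> linear_functional (hochschild_chains A 0) (G x)"
    "\<And>x a. x \<in> B \<Longrightarrow> a \<in> carrier A \<Longrightarrow> G x (sigma 0 a []) = coef x a"
proof -
  have "\<exists>F. linear_functional (hochschild_chains A 1) F \<and>
      (\<forall>a\<in>carrier A. \<forall>b\<in>carrier A. F (sigma 1 a [b]) = coef x a * coef y b)"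
    if xy: "x \<in> B" "y \<in> B" for x y
  proof -
    have "slotwise_linear (1 + 1) (\<lambda>xs. coef x (xs ! 0) * coef y (xs ! 1))"
      unfolding slotwise_linear_def
    proof (intro allI impI)
      fix xs ys :: "'a list" assume len: "Suc (length xs + length ys) = 1 + 1"
      show "linear_functional A (\<lambda>z. coef x ((xs @ z # ys) ! 0) * coef y ((xs @ z # ys) ! 1))"
        using linear_functionalD[OF coef_linear[OF xy(1)]]
            linear_functionalD[OF coef_linear[OF xy(2)]] len
        by (cases xs) (auto simp: linear_functional_def algebra_simps)
    qed
    from sigma_functional[OF this] obtain F where
      "linear_functional (hochschild_chains A 1) F"
      "\<And>a bs. a \<in> carrier A \<Longrightarrow> bs \<in> tensor_lists A 1 \<Longrightarrow> F (sigma 1 a bs) =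
          coef x ((a # bs) ! 0) * coef y ((a # bs) ! 1)"
      by blast
    then show ?thesis by (intro exI[of _ F]) (auto simp: tensor_lists_def)
  qed
  then obtain F where F: "\<And>x y. x \<in> B \<Longrightarrow> y \<in> B \<Longrightarrow> linear_functional (hochschild_chains A 1) (F x y)"
    "\<And>x y a b. x \<in> B \<Longrightarrow> y \<in> B \<Longrightarrow> a \<in> carrier A \<Longrightarrow> b \<in> carrier A \<Longrightarrow>
      F x y (sigma 1 a [b]) = coef x a * coef y b" by metis
  have "\<exists>F. linear_functional (hochschild_chains A 0) F \<and> (\<forall>a\<in>carrier A. F (sigma 0 a []) =
      coef x a)"
    if x: "x \<in> B" for x
  proof -
    have "slotwise_linear (0 + 1) (\<lambda>xs. coef x (xs ! 0))"
      using coef_linear[OF x] unfolding slotwise_linear_def by auto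
    from sigma_functional[OF this] obtain F where
      "linear_functional (hochschild_chains A 0) F"
      "\<And>a bs. a \<in> carrier A \<Longrightarrow> bs \<in> tensor_lists A 0 \<Longrightarrow> F (sigma 0 a bs) = coef x ((a # bs) ! 0)"
      by blast
    then show ?thesis by (intro exI[of _ F]) (auto simp: tensor_lists_def)
  qed
  then obtain G where "\<And>x. x \<in> B \<Longrightarrow> linear_functional (hochschild_chains A 0) (G x)"
    "\<And>x a. x \<in> B \<Longrightarrow> a \<in> carrier A \<Longrightarrow> G x (sigma 0 a []) = coef x a" by metis
  with F show thesis using that by blast
qed

lemma functional_lincomb:
  fixes V :: "('k, 'v, 'z) module_scheme"
  assumes V: "vectorspace class_ring V" and f: "linear_functional V f" and "x \<in> carrier V"
      "y \<in> carrier V"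
  shows "f (x \<oplus>\<^bsub>V\<^esub> (- 1) \<odot>\<^bsub>V\<^esub> y) = f x - f y"
  using linear_functionalD[OF f] vectorspace_class_ringD(1)[OF V] assms(3,4) by simp

context
  notes One_nat_def [simp del]
begin

text \<open>The passage from chains to functions on B \<times> B. The map is injective by
  \<open>zero_if_dual_zero\<close> and onto because basis chains go to unit functions. One-cycles
  are recognized by the functionals \<open>G\<close>, which separate chains of degree zero.
  Boundaries correspond because the differential of a basis chain goes to a
  \<open>two_boundary\<close>, and both sides are generated by these.\<close>

lemma chain1_coordinates:
  obtains \<phi> :: "('k, 'a) hochschild_chain \<Rightarrow> 'b \<times> 'b \<Rightarrow> 'k" where
    "is_linear (hochschild_chains A 1) (free_space (B \<times> B)) \<phi>"
    "inj_on \<phi> (carrier (hochschild_chains A 1))"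
    "\<phi> ` carrier (hochschild_chains A 1) = carrier (free_space (B \<times> B))"
    "\<And>u. u \<in> carrier (hochschild_chains A 1) \<Longrightarrow>
      hochschild_diff A 0 u = \<zero>\<^bsub>hochschild_chains A 0\<^esub> \<longleftrightarrow> one_cycle (\<phi> u)"
    "\<And>u. u \<in> carrier (hochschild_chains A 1) \<Longrightarrow>
      u \<in> hochschild_boundaries A 1 \<longleftrightarrow> \<phi> u \<in> one_boundaries"
    "\<And>u. u \<in> hochschild_boundaries A 1 \<Longrightarrow> hochschild_diff A 0 u = \<zero>\<^bsub>hochschild_chains A 0\<^esub>"
proof -
  let ?C0 = "hochschild_chains A 0" and ?C1 = "hochschild_chains A 1" and ?C2 =
      "hochschild_chains A 2"
  let ?d0 = "hochschild_diff A 0" and ?d1 = "hochschild_diff A 1"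
  let ?F = "free_space (B \<times> B) :: ('k, 'b \<times> 'b \<Rightarrow> 'k) module"
  let ?s = "\<lambda>(b, c). sigma 1 (e b) [e c]"
  interpret C0: vectorspace class_ring ?C0 by (rule chains_vs)
  interpret C1: vectorspace class_ring ?C1 by (rule chains_vs)
  interpret C2: vectorspace class_ring ?C2 by (rule chains_vs)
  interpret FV: vectorspace class_ring ?F by (rule vectorspace_free_space)
  obtain F G where
    F: "\<And>x y. x \<in> B \<Longrightarrow> y \<in> B \<Longrightarrow> linear_functional ?C1 (F x y)"
    "\<And>x y a b. x \<in> B \<Longrightarrow> y \<in> B \<Longrightarrow> a \<in> carrier A \<Longrightarrow> b \<in> carrier A \<Longrightarrow>
      F x y (sigma 1 a [b]) = coef x a * coef y b"
    and G: "\<And>x. x \<in> B \<Longrightarrow> linear_functional ?C0 (G x)"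
    "\<And>x a. x \<in> B \<Longrightarrow> a \<in> carrier A \<Longrightarrow> G x (sigma 0 a []) = coef x a"
    by (rule coef_functionals) blast
  define \<phi> where "\<phi> u = (\<lambda>(x, y). if x \<in> B \<and> y \<in> B then F x y u else 0)" for u
  have l0: "[] \<in> tensor_lists A 0" and l1: "\<And>b. b \<in> carrier A \<Longrightarrow> [b] \<in> tensor_lists A 1"
    and l2: "\<And>b c. b \<in> carrier A \<Longrightarrow> c \<in> carrier A \<Longrightarrow> [b, c] \<in> tensor_lists A 2"
    by (auto simp: tensor_lists_def)
  have d0: "is_linear ?C1 ?C0 ?d0" using hochschild_diff_spec(1)[of 0] by (simp add: One_nat_def)
  have d1: "is_linear ?C2 ?C1 ?d1" using hochschild_diff_spec(1)[of 1] by (simp add: numeral_2_eq_2)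
  have \<phi>F: "\<phi> u \<in> carrier ?F" for u
  proof -
    have "{p. \<phi> u p \<noteq> 0} \<subseteq> B \<times> B" by (auto simp: \<phi>_def split: if_splits)
    then show ?thesis using finite_B by (auto intro: finite_subset)
  qed
  have \<phi>: "is_linear ?C1 ?F \<phi>"
    unfolding is_linear_def using \<phi>F linear_functionalD[OF F(1)]
    by (auto simp del: free_space_simps(1) simp: \<phi>_def fun_eq_iff)
  have \<phi>_sigma: "\<phi> (sigma 1 a [b]) = (\<lambda>(x, y). if x \<in> B \<and> y \<in> B then coef x a * coef y b else 0)"
    if "a \<in> carrier A" "b \<in> carrier A" for a b
    using F(2) that by (auto simp: \<phi>_def fun_eq_iff)
  have \<phi>_basis: "\<phi> (sigma 1 (e b) [e c]) = unit_fun (b, c)" if "b \<in> B" "c \<in> B" for b c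
    using \<phi>_sigma e_closed coef_e that by (auto simp: unit_fun_def fun_eq_iff)
  have s_sub: "?s ` (B \<times> B) \<subseteq> carrier ?C1"
    using sigma_carrier[OF e_closed l1[OF e_closed]] by auto
  have inj: "inj_on \<phi> (carrier ?C1)"
  proof (rule inj_onI)
    fix u w assume u: "u \<in> carrier ?C1" and w: "w \<in> carrier ?C1" and eq: "\<phi> u = \<phi> w"
    have "u \<ominus>\<^bsub>?C1\<^esub> w = \<zero>\<^bsub>?C1\<^esub>"
    proof (rule zero_if_dual_zero[OF chains_vs _ s_sub chain1_span, where \<kappa> = "\<lambda>(x, y). F x y"])
      show "finite (B \<times> B)" using finite_B by simp
      show "linear_functional ?C1 ((\<lambda>(x, y). F x y) p)" if "p \<in> B \<times> B" for p using F(1) that by auto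
      show "(\<lambda>(x, y). F x y) p (?s q) = (if p = q then 1 else 0)" if "p \<in> B \<times> B" "q \<in> B \<times> B" for p q
        using F(2) e_closed coef_e that by (auto split: if_splits)
      show "u \<ominus>\<^bsub>?C1\<^esub> w \<in> carrier ?C1" using u w by (rule C1.minus_closed)
      fix p assume "p \<in> B \<times> B"
      then obtain x y where p: "p = (x, y)" "x \<in> B" "y \<in> B" by auto
      have "F x y u = F x y w" using fun_cong[OF eq, of p] p by (simp add: \<phi>_def)
      then show "(\<lambda>(x, y). F x y) p (u \<ominus>\<^bsub>?C1\<^esub> w) = 0"
        using linear_functional_minus[OF chains_vs F(1)[OF p(2,3)] u w] p by simp
    qed
    then show "u = w"
      using u w C1.minus_equality[of u "\<ominus>\<^bsub>?C1\<^esub> w"] by (simp add: a_minus_def)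
  qed
  have surj: "\<exists>u\<in>carrier ?C1. \<phi> u = f" if "f \<in> carrier ?F" for f
    using that
  proof (rule free_space_induct)
    show "\<exists>u\<in>carrier ?C1. \<phi> u = 0"
      using is_linear_zero[OF \<phi> chains_vs vectorspace_free_space]
          by (metis C1.zero_closed free_space_simps(4))
  next
    fix f g :: "'b \<times> 'b \<Rightarrow> 'k" assume "\<exists>u\<in>carrier ?C1. \<phi> u = f" "\<exists>u\<in>carrier ?C1. \<phi> u = g"
    then show "\<exists>u\<in>carrier ?C1. \<phi> u = f + g"
      using is_linearD(2)[OF \<phi>] by (metis C1.a_closed free_space_simps(2))
  next
    fix c and p :: "'b \<times> 'b" assume "p \<in> B \<times> B"
    then obtain x y where p: "p = (x, y)" "x \<in> B" "y \<in> B" by auto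
    have "sigma 1 (e x) [e y] \<in> carrier ?C1" using s_sub p by auto
    moreover have "\<phi> (sigma 1 (e x) [e y]) = unit_fun p" using \<phi>_basis p by simp
    ultimately show "\<exists>u\<in>carrier ?C1. \<phi> u = fscale c (unit_fun p)"
      using is_linearD(3)[OF \<phi>] vectorspace_class_ringD(1)[OF chains_vs]
          by (metis free_space_simps(3))
  qed
  have "\<phi> ` carrier ?C1 = carrier ?F" using surj \<phi>F by blast
  have G0: "x = \<zero>\<^bsub>?C0\<^esub> \<longleftrightarrow> (\<forall>b\<in>B. G b x = 0)" if "x \<in> carrier ?C0" for x
  proof
    assume "x = \<zero>\<^bsub>?C0\<^esub>"
    then show "\<forall>b\<in>B. G b x = 0"
      using linear_functionalD(2)[OF G(1) C0.zero_closed, of _ 0]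
          vectorspace_class_ringD(2)[OF chains_vs C0.zero_closed] by auto
  next
    assume z: "\<forall>b\<in>B. G b x = 0"
    show "x = \<zero>\<^bsub>?C0\<^esub>"
    proof (rule zero_if_dual_zero[OF chains_vs finite_B _ chain0_span G(1) _ that])
      show "(\<lambda>b. sigma 0 (e b) []) ` B \<subseteq> carrier ?C0" using sigma_carrier[OF e_closed l0] by auto
      show "G b (sigma 0 (e c) []) = (if b = c then 1 else 0)" if "b \<in> B" "c \<in> B" for b c
        using G(2) e_closed coef_e that by auto
    qed (use z in auto)
  qed
  have Gd: "G x (?d0 u) = functional_ext (\<lambda>(b, c). mu b c x - mu c b x) (\<phi> u)"
    if x: "x \<in> B" and u: "u \<in> carrier ?C1" for x u
  proof -
    let ?f = "functional_ext (\<lambda>(b, c). mu b c x - mu c b x)"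
    have lhs: "linear_functional ?C1 (\<lambda>u. G x (?d0 u))"
      by (rule linear_functional_comp[OF d0 G(1)[OF x]])
    have rhs: "linear_functional ?C1 (\<lambda>u. ?f (\<phi> u))"
      by (rule linear_functional_comp[OF \<phi> linear_functional_ext])
    have "u \<in> C1.span (?s ` (B \<times> B))" using chain1_span u by blast
    then show ?thesis
    proof (rule span_induct_class_ring[OF chains_vs s_sub])
      show "G x (?d0 \<zero>\<^bsub>?C1\<^esub>) = ?f (\<phi> \<zero>\<^bsub>?C1\<^esub>)"
        using linear_functionalD(2)[OF lhs C1.zero_closed, of 0]
            linear_functionalD(2)[OF rhs C1.zero_closed, of 0]
          vectorspace_class_ringD(2)[OF chains_vs C1.zero_closed] by simp
    next
      fix r assume "r \<in> ?s ` (B \<times> B)"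
      then obtain b c where r: "r = sigma 1 (e b) [e c]" "b \<in> B" "c \<in> B" by auto
      have "G x (?d0 r) = mu b c x - mu c b x"
        unfolding r(1) hochschild_diff_0[OF e_closed[OF r(2)] e_closed[OF r(3)]]
        using r(2,3) e_closed mult_closed G[OF x] sigma_carrier[OF _ l0]
        by (simp add: functional_lincomb[OF chains_vs] mu_def)
      moreover have "\<phi> r = unit_fun (b, c)" using \<phi>_basis r by simp
      ultimately show "G x (?d0 r) = ?f (\<phi> r)" by simp
    qed (use linear_functionalD[OF lhs] linear_functionalD[OF rhs] in auto)
  qed
  have cyc: "?d0 u = \<zero>\<^bsub>?C0\<^esub> \<longleftrightarrow> one_cycle (\<phi> u)" if u: "u \<in> carrier ?C1" for u
    unfolding one_cycle_def G0[OF is_linearD(1)[OF d0 u]] using Gd[OF _ u] \<phi>F by auto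
  have gens: "{two_boundary a b c | a b c. a \<in> B \<and> b \<in> B \<and> c \<in> B} \<subseteq> carrier ?F"
  proof safe
    fix a b c
    have "{p. two_boundary a b c p \<noteq> 0} \<subseteq> B \<times> B" by (auto simp: two_boundary_def split: if_splits)
    then show "two_boundary a b c \<in> carrier ?F" using finite_B by (auto intro: finite_subset)
  qed
  note bsp = span_class_ring[OF vectorspace_free_space gens, folded one_boundaries_def]
  interpret FQ: quotient_space ?F one_boundaries
    by (intro quotient_space.intro quotient_space_axioms.intro vectorspace_free_space bsp(1))
  have s2: "sigma 2 (e a) [e b, e c] \<in> carrier ?C2" if "a \<in> B" "b \<in> B" "c \<in> B" for a b c
    using that by (intro sigma_carrier l2 e_closed)
  have \<phi>d: "\<phi> (?d1 (sigma 2 (e a) [e b, e c])) = two_boundary a b c"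
    if abc: "a \<in> B" "b \<in> B" "c \<in> B" for a b c
  proof -
    note E = e_closed[OF abc(1)] e_closed[OF abc(2)] e_closed[OF abc(3)]
    have "F x y (?d1 (sigma 2 (e a) [e b, e c])) = two_boundary a b c (x, y)"
        if xy: "x \<in> B" "y \<in> B" for x y
    proof -
      note s1 = sigma_carrier[OF _ l1] linear_functionalD[OF F(1)[OF xy]]
          vectorspace_class_ringD(1)[OF chains_vs]
      have "F x y (?d1 (sigma 2 (e a) [e b, e c])) =
        coef x (e a \<otimes> e b) * coef y (e c) - coef x (e a) * coef y (e b \<otimes> e c) + coef x (e c \<otimes> e a) * coef y (e b)"
        unfolding hochschild_diff_1[OF E]
        using E mult_closed F(2)[OF xy] by (simp add: s1)
      then show ?thesis using abc xy coef_e by (auto simp: two_boundary_def mu_def)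
    qed
    then show ?thesis by (auto simp: \<phi>_def two_boundary_def fun_eq_iff)
  qed
  have gb: "two_boundary a b c \<in> one_boundaries" if "a \<in> B" "b \<in> B" "c \<in> B" for a b c
    using bsp(2) that by blast
  have bd1: "\<phi> (?d1 w) \<in> one_boundaries" if w: "w \<in> carrier ?C2" for w
  proof -
    have "LinearCombinations.submodule class_ring {w \<in> carrier ?C2. \<phi> (?d1 w) \<in> one_boundaries} ?C2"
    proof (rule submodule_class_ringI[OF chains_vs])
      have "\<phi> (?d1 \<zero>\<^bsub>?C2\<^esub>) = \<zero>\<^bsub>?F\<^esub>"
        using is_linear_zero[OF d1 chains_vs chains_vs]
            is_linear_zero[OF \<phi> chains_vs vectorspace_free_space] by simp
      then show "\<zero>\<^bsub>?C2\<^esub> \<in> {w \<in> carrier ?C2. \<phi> (?d1 w) \<in> one_boundaries}" using FQ.N_zero by simp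
    next
      fix x y assume "x \<in> {w \<in> carrier ?C2. \<phi> (?d1 w) \<in> one_boundaries}"
          "y \<in> {w \<in> carrier ?C2. \<phi> (?d1 w) \<in> one_boundaries}"
      then show "x \<oplus>\<^bsub>?C2\<^esub> y \<in> {w \<in> carrier ?C2. \<phi> (?d1 w) \<in> one_boundaries}"
        using FQ.N_add is_linearD[OF is_linear_comp[OF d1 \<phi>]] by (simp del: free_space_simps)
    next
      fix c x assume "x \<in> {w \<in> carrier ?C2. \<phi> (?d1 w) \<in> one_boundaries}"
      then show "c \<odot>\<^bsub>?C2\<^esub> x \<in> {w \<in> carrier ?C2. \<phi> (?d1 w) \<in> one_boundaries}"
        using FQ.N_smult is_linearD[OF is_linear_comp[OF d1 \<phi>]]
            vectorspace_class_ringD(1)[OF chains_vs]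
        by (simp del: free_space_simps)
    qed auto
    then have "w \<in> {w \<in> carrier ?C2. \<phi> (?d1 w) \<in> one_boundaries}"
      by (rule chain2_induct[OF _ _ w]) (use s2 \<phi>d gb in auto)
    then show ?thesis by simp
  qed
  have bd2: "\<exists>w\<in>carrier ?C2. \<phi> (?d1 w) = f" if f: "f \<in> one_boundaries" for f
    using f[unfolded one_boundaries_def]
  proof (rule span_induct_class_ring[OF vectorspace_free_space gens])
    show "\<exists>w\<in>carrier ?C2. \<phi> (?d1 w) = \<zero>\<^bsub>?F\<^esub>"
      using is_linear_zero[OF d1 chains_vs chains_vs]
          is_linear_zero[OF \<phi> chains_vs vectorspace_free_space]
      by (intro bexI[of _ "\<zero>\<^bsub>?C2\<^esub>"]) (simp_all del: free_space_simps)
  next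
    fix r assume "r \<in> {two_boundary a b c | a b c. a \<in> B \<and> b \<in> B \<and> c \<in> B}"
    then show "\<exists>w\<in>carrier ?C2. \<phi> (?d1 w) = r" using s2 \<phi>d by blast
  next
    fix x y assume "\<exists>w\<in>carrier ?C2. \<phi> (?d1 w) = x" "\<exists>w\<in>carrier ?C2. \<phi> (?d1 w) = y"
    then show "\<exists>w\<in>carrier ?C2. \<phi> (?d1 w) = x \<oplus>\<^bsub>?F\<^esub> y"
      using is_linearD(2)[OF is_linear_comp[OF d1 \<phi>]] C2.a_closed by metis
  next
    fix c x assume "\<exists>w\<in>carrier ?C2. \<phi> (?d1 w) = x"
    then show "\<exists>w\<in>carrier ?C2. \<phi> (?d1 w) = c \<odot>\<^bsub>?F\<^esub> x"
      using is_linearD(3)[OF is_linear_comp[OF d1 \<phi>]] vectorspace_class_ringD(1)[OF chains_vs]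
          by metis
  qed
  have C2: "hochschild_chains A (Suc 1) = ?C2" by (simp add: numeral_2_eq_2)
  have bnd: "u \<in> hochschild_boundaries A 1 \<longleftrightarrow> \<phi> u \<in> one_boundaries" if u: "u \<in> carrier ?C1" for u
  proof
    assume "u \<in> hochschild_boundaries A 1"
    then show "\<phi> u \<in> one_boundaries" using bd1 unfolding hochschild_boundaries_def C2 by blast
  next
    assume "\<phi> u \<in> one_boundaries"
    then obtain w where w: "w \<in> carrier ?C2" "\<phi> (?d1 w) = \<phi> u" using bd2 by blast
    then have "?d1 w = u" using inj u is_linearD(1)[OF d1] by (meson inj_onD)
    then show "u \<in> hochschild_boundaries A 1" using w unfolding hochschild_boundaries_def C2
        by blast
  qed
  \<comment> \<open>The three terms of the boundary of a \<otimes> b \<otimes> c have the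
    differentials abc - cab, abc - bca and cab - bca, which cancel with the signs +, -, +.\<close>
  have dd: "?d0 (?d1 w) = \<zero>\<^bsub>?C0\<^esub>" if w: "w \<in> carrier ?C2" for w
  proof -
    have "G x (?d0 (?d1 w)) = 0" if x: "x \<in> B" for x
    proof -
      note d01 = is_linear_comp[OF d1 d0]
      have lf: "linear_functional ?C2 (\<lambda>w. G x (?d0 (?d1 w)))"
        by (rule linear_functional_comp[OF d01 G(1)[OF x]])
      show ?thesis
        using w
      proof (induction w rule: chain_sigma_induct)
        case zero
        then show ?case
          using linear_functionalD(2)[OF lf C2.zero_closed, of 0]
              vectorspace_class_ringD(2)[OF chains_vs C2.zero_closed] by simp
      next
        case (sigma a bs)
        then obtain b c where bs: "bs = [b, c]" "b \<in> carrier A" "c \<in> carrier A"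
          by (auto simp: tensor_lists_def length_Suc_conv numeral_2_eq_2)
        have Gs: "G x (?d0 (sigma 1 p [q])) = coef x (p \<otimes> q) - coef x (q \<otimes> p)"
            if "p \<in> carrier A" "q \<in> carrier A" for p q
          unfolding hochschild_diff_0[OF that]
          using that mult_closed G[OF x] sigma_carrier[OF _ l0]
              by (simp add: functional_lincomb[OF chains_vs])
        have l: "linear_functional ?C1 (\<lambda>u. G x (?d0 u))"
          by (rule linear_functional_comp[OF d0 G(1)[OF x]])
        show ?case
          unfolding bs(1) hochschild_diff_1[OF sigma(1) bs(2,3)]
          using sigma(1) bs(2,3) mult_closed linear_functionalD[OF l] sigma_carrier[OF _ l1]
            vectorspace_class_ringD(1)[OF chains_vs]
          by (simp add: Gs mult_assoc)
      qed (use linear_functionalD[OF lf] in auto)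
    qed
    then show ?thesis using G0[OF is_linearD(1)[OF d0 is_linearD(1)[OF d1 w]]] by blast
  qed
  show thesis
    by (rule that[OF \<phi> inj \<open>\<phi> ` carrier ?C1 = carrier ?F\<close> cyc bnd])
      (use dd in \<open>auto simp: hochschild_boundaries_def numeral_2_eq_2\<close>)
qed

text \<open>The identity d d = 0, transported to coordinates.\<close>

lemma one_boundaries_cycles: "f \<in> one_boundaries \<Longrightarrow> one_cycle f"
proof -
  assume f: "f \<in> one_boundaries"
  obtain \<phi> where \<phi>: "is_linear (hochschild_chains A 1) (free_space (B \<times> B)) \<phi>"
    "\<phi> ` carrier (hochschild_chains A 1) = carrier (free_space (B \<times> B))"
    "\<And>u. u \<in> carrier (hochschild_chains A 1) \<Longrightarrow>
      hochschild_diff A 0 u = \<zero>\<^bsub>hochschild_chains A 0\<^esub> \<longleftrightarrow> one_cycle (\<phi> u)"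
    "\<And>u. u \<in> carrier (hochschild_chains A 1) \<Longrightarrow>
      u \<in> hochschild_boundaries A 1 \<longleftrightarrow> \<phi> u \<in> one_boundaries"
    "\<And>u. u \<in> hochschild_boundaries A 1 \<Longrightarrow> hochschild_diff A 0 u = \<zero>\<^bsub>hochschild_chains A 0\<^esub>"
    by (rule chain1_coordinates) blast
  have "one_boundaries \<subseteq> carrier (free_space (B \<times> B))"
  proof -
    have "{two_boundary a b c | a b c. a \<in> B \<and> b \<in> B \<and> c \<in> B} \<subseteq> carrier (free_space (B \<times> B))"
    proof safe
      fix a b c
      have "{p. two_boundary a b c p \<noteq> 0} \<subseteq> B \<times> B" by (auto simp: two_boundary_def split: if_splits)
      then show "two_boundary a b c \<in> carrier (free_space (B \<times> B))" using finite_B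
          by (auto intro: finite_subset)
    qed
    from span_class_ring(1)[OF vectorspace_free_space this] show ?thesis
      unfolding one_boundaries_def by (auto simp: LinearCombinations.submodule_def)
  qed
  then obtain u where "u \<in> carrier (hochschild_chains A 1)" "f = \<phi> u" using \<phi>(2) f by blast
  then show ?thesis using \<phi>(3-5) f by blast
qed

text \<open>The \<theta> are linear on all functions, whereas \<open>ker\<close> and
  \<open>dual\<close> speak of one-cycles only. Composed with the coordinates of
  \<open>chain1_coordinates\<close> they become functionals on the space of cycles whose common
  kernel is the space of boundaries.\<close>

theorem hochschild_homology_1_dim:
  fixes \<theta> :: "('b \<times> 'b \<Rightarrow> 'k) \<Rightarrow> 's \<Rightarrow> 'k"
  assumes S: "finite S"
    and \<theta>: "\<And>s. s \<in> S \<Longrightarrow> linear_functional (free_space (B \<times> B)) (\<lambda>f. \<theta> f s)"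
    and ker: "\<And>f. one_cycle f \<Longrightarrow> (\<forall>s\<in>S. \<theta> f s = 0) \<longleftrightarrow> f \<in> one_boundaries"
    and dual: "\<And>s. s \<in> S \<Longrightarrow> \<exists>f. one_cycle f \<and> (\<forall>t\<in>S. \<theta> f t = (if t = s then 1 else 0))"
  shows "vectorspace.fin_dim class_ring (hochschild_homology A 1) \<and>
    vectorspace.dim class_ring (hochschild_homology A 1) = card S"
proof -
  let ?C0 = "hochschild_chains A 0" and ?C1 = "hochschild_chains A 1"
  let ?d0 = "hochschild_diff A 0" and ?Z = "hochschild_cycles A 1" and ?N =
      "hochschild_boundaries A 1"
  interpret C0: vectorspace class_ring ?C0 by (rule chains_vs)
  interpret C1: vectorspace class_ring ?C1 by (rule chains_vs)
  interpret C2: vectorspace class_ring "hochschild_chains A 2" by (rule chains_vs)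
  obtain \<phi> where \<phi>: "is_linear ?C1 (free_space (B \<times> B)) \<phi>"
    "\<phi> ` carrier ?C1 = carrier (free_space (B \<times> B))"
    "\<And>u. u \<in> carrier ?C1 \<Longrightarrow> ?d0 u = \<zero>\<^bsub>?C0\<^esub> \<longleftrightarrow> one_cycle (\<phi> u)"
    "\<And>u. u \<in> carrier ?C1 \<Longrightarrow> u \<in> ?N \<longleftrightarrow> \<phi> u \<in> one_boundaries"
    "\<And>u. u \<in> ?N \<Longrightarrow> ?d0 u = \<zero>\<^bsub>?C0\<^esub>"
    by (rule chain1_coordinates) blast
  have d0: "is_linear ?C1 ?C0 ?d0" using hochschild_diff_spec(1)[of 0] by (simp add: One_nat_def)
  have d1: "is_linear (hochschild_chains A 2) ?C1 (hochschild_diff A 1)"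
    using hochschild_diff_spec(1)[of 1] by (simp add: numeral_2_eq_2)
  have Z: "?Z = {u \<in> carrier ?C1. ?d0 u = \<zero>\<^bsub>?C0\<^esub>}"
    by (auto simp: hochschild_cycles_def a_kernel_def' One_nat_def)
  have N: "?N = hochschild_diff A 1 ` carrier (hochschild_chains A 2)"
    by (simp add: hochschild_boundaries_def numeral_2_eq_2)
  have NZ: "?N \<subseteq> ?Z" using \<phi>(5) is_linearD(1)[OF d1] unfolding Z N by blast
  let ?V = "?C1\<lparr>carrier := ?Z\<rparr>"
  have V: "vectorspace class_ring ?V"
    by (rule vectorspace_class_ringI)
      (auto simp: Z is_linear_zero[OF d0 chains_vs chains_vs] is_linearD[OF d0]
        vectorspace_class_ringD[OF chains_vs] C1.a_ac)
  have sub: "LinearCombinations.submodule class_ring ?N ?V"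
  proof (rule submodule_class_ringI[OF V])
    show "?N \<subseteq> carrier ?V" using NZ by simp
    show "\<zero>\<^bsub>?V\<^esub> \<in> ?N"
      using is_linear_zero[OF d1 chains_vs chains_vs] unfolding N by (auto intro: rev_image_eqI)
    fix x y assume "x \<in> ?N" "y \<in> ?N"
    then obtain v w where "x = hochschild_diff A 1 v" "y = hochschild_diff A 1 w"
      "v \<in> carrier (hochschild_chains A 2)" "w \<in> carrier (hochschild_chains A 2)" unfolding N
          by blast
    then show "x \<oplus>\<^bsub>?V\<^esub> y \<in> ?N"
      using is_linearD(2)[OF d1, of v w] unfolding N
          by (auto intro!: rev_image_eqI[of "v \<oplus>\<^bsub>hochschild_chains A 2\<^esub> w"])
  next
    fix c x assume "x \<in> ?N"
    then obtain v where "x = hochschild_diff A 1 v" "v \<in> carrier (hochschild_chains A 2)"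
        unfolding N by blast
    then show "c \<odot>\<^bsub>?V\<^esub> x \<in> ?N"
      using is_linearD(3)[OF d1, of v c] vectorspace_class_ringD(1)[OF chains_vs]
      unfolding N by (auto intro!: rev_image_eqI[of "c \<odot>\<^bsub>hochschild_chains A 2\<^esub> v"])
  qed
  interpret Q: quotient_space ?V ?N
    by (intro quotient_space.intro quotient_space_axioms.intro V sub)
  have "vectorspace.fin_dim class_ring (quot_module ?V ?N) \<and>
      vectorspace.dim class_ring (quot_module ?V ?N) = card S"
  proof (rule Q.dim_quot_module_dual[OF S, where T = "\<lambda>u. \<theta> (\<phi> u)"])
    fix s assume s: "s \<in> S"
    show "linear_functional ?V (\<lambda>u. \<theta> (\<phi> u) s)"
      using linear_functionalD[OF linear_functional_comp[OF \<phi>(1) \<theta>[OF s]]]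
      by (auto simp: linear_functional_def Z)
    obtain f where f: "one_cycle f" "\<forall>t\<in>S. \<theta> f t = (if t = s then 1 else 0)" using dual[OF s]
        by blast
    then have "f \<in> \<phi> ` carrier ?C1" using \<phi>(2) by (simp add: one_cycle_def)
    then obtain u where u: "u \<in> carrier ?C1" "f = \<phi> u" by blast
    then show "\<exists>u\<in>carrier ?V. \<forall>t\<in>S. \<theta> (\<phi> u) t = (if t = s then 1 else 0)"
      using f \<phi>(3) by (intro bexI[of _ u]) (auto simp: Z)
  next
    fix x assume "x \<in> carrier ?V"
    then show "(\<forall>s\<in>S. \<theta> (\<phi> x) s = 0) \<longleftrightarrow> x \<in> ?N"
      using ker \<phi>(3,4) by (auto simp: Z)
  qed
  then show ?thesis by (simp add: hochschild_homology_def)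
qed

end

end

section \<open>Paths and monomial algebras\<close>

context fin_digraph begin

lemma psource_pair [simp]: "psource (v, es) = v"
  by (simp add: psource_def)

lemma ptarget_Nil [simp]: "ptarget G (v, []) = v"
  by (simp add: ptarget_def)

lemma ptarget_Cons [simp]: "ptarget G (v, a # es) = ptarget G (head G a, es)"
  by (simp add: ptarget_def)

lemma ptarget_append [simp]: "ptarget G (v, xs @ ys) = ptarget G (ptarget G (v, xs), ys)"
  by (induction xs arbitrary: v) auto

lemma paths_Nil [simp]: "(v, []) \<in> paths G \<longleftrightarrow> v \<in> verts G"
  by (simp add: paths_def awalk_def)

lemma paths_Cons [simp]:
    "(v, a # es) \<in> paths G \<longleftrightarrow> a \<in> arcs G \<and> tail G a = v \<and> (head G a, es) \<in> paths G"
  by (auto simp: paths_def awalk_def simp del: ptarget_Cons)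
      (auto simp: ptarget_def split: if_splits)

lemma paths_append [simp]:
  "(v, xs @ ys) \<in> paths G \<longleftrightarrow> (v, xs) \<in> paths G \<and> (ptarget G (v, xs), ys) \<in> paths G"
proof (induction xs arbitrary: v)
  case Nil
  have "(v, ys) \<in> paths G \<Longrightarrow> v \<in> verts G" by (simp add: paths_def awalk_def)
  then show ?case by auto
qed auto

lemma ptarget_verts: "(v, es) \<in> paths G \<Longrightarrow> ptarget G (v, es) \<in> verts G"
  by (induction es arbitrary: v) auto

lemma psource_verts: "(v, es) \<in> paths G \<Longrightarrow> v \<in> verts G"
  by (cases es) (auto dest: tail_in_verts)

lemma composable_iff:
  "composable G (w, ys) (v, xs) \<longleftrightarrow> (v, xs @ ys) \<in> paths G \<and> w = ptarget G (v, xs)"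
  by (auto simp: composable_def)

lemma pcomp_pair [simp]: "pcomp (w, ys) (v, xs) = (v, xs @ ys)"
  by (simp add: pcomp_def)

definition factorizations :: "('a, 'b) qpath \<Rightarrow> (('a, 'b) qpath \<times> ('a, 'b) qpath) set" where
  "factorizations \<gamma> = {(\<alpha>, \<beta>). composable G \<alpha> \<beta> \<and> pcomp \<alpha> \<beta> = \<gamma>}"

text \<open>A factorization is determined by the position of the cut in the list of arrows.\<close>

lemma finite_factorizations: "finite (factorizations \<gamma>)"
proof (rule finite_subset)
  show "factorizations \<gamma> \<subseteq> (\<lambda>i. ((ptarget G (fst \<gamma>, take i (snd \<gamma>)), drop i (snd \<gamma>)), (fst \<gamma>,
      take i (snd \<gamma>)))) ` {..length (snd \<gamma>)}"
  proof
    fix p assume "p \<in> factorizations \<gamma>"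
    then obtain w ys v xs where p: "p = ((w, ys), (v, xs))" "\<gamma> = (v, xs @ ys)"
        "w = ptarget G (v, xs)"
      by (auto simp: factorizations_def composable_iff)
    then show "p \<in> (\<lambda>i. ((ptarget G (fst \<gamma>, take i (snd \<gamma>)), drop i (snd \<gamma>)), (fst \<gamma>,
        take i (snd \<gamma>)))) ` {..length (snd \<gamma>)}"
      by (intro image_eqI[of _ _ "length xs"]) auto
  qed
qed simp

abbreviation PA :: "('k::field, ('a, 'b) qpath \<Rightarrow> 'k) module" where
  "PA \<equiv> path_algebra G"

lemma PA_simps [simp]:
  "carrier PA = carrier (free_space (paths G))" "f \<oplus>\<^bsub>PA\<^esub> g = f + g" "\<zero>\<^bsub>PA\<^esub> = 0"
      "c \<odot>\<^bsub>PA\<^esub> f = fscale c f"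
  by (simp_all add: path_algebra_def free_space_def fun_eq_iff)

lemma PA_mult: "(f \<otimes>\<^bsub>PA\<^esub> g) \<gamma> = (\<Sum>(\<alpha>, \<beta>)\<in>factorizations \<gamma>. f \<alpha> * g \<beta>)"
  by (simp add: path_algebra_def factorizations_def)

lemma PA_one: "\<one>\<^bsub>PA\<^esub> \<gamma> = (if \<gamma> \<in> vertex_paths G then 1 else 0)"
  by (simp add: path_algebra_def)

lemma PA_vs: "vectorspace class_ring PA"
  by (rule vectorspace_fields_cong[OF vectorspace_free_space[of "paths G"]])
      (auto simp: path_algebra_def)

lemma PA_mult_linear:
  "(f + f') \<otimes>\<^bsub>PA\<^esub> g = (f \<otimes>\<^bsub>PA\<^esub> g) + (f' \<otimes>\<^bsub>PA\<^esub> g)"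
  "g \<otimes>\<^bsub>PA\<^esub> (f + f') = (g \<otimes>\<^bsub>PA\<^esub> f) + (g \<otimes>\<^bsub>PA\<^esub> f')"
  "fscale c f \<otimes>\<^bsub>PA\<^esub> g = fscale c (f \<otimes>\<^bsub>PA\<^esub> g)"
  "g \<otimes>\<^bsub>PA\<^esub> fscale c f = fscale c (g \<otimes>\<^bsub>PA\<^esub> f)"
  "0 \<otimes>\<^bsub>PA\<^esub> g = 0" "g \<otimes>\<^bsub>PA\<^esub> 0 = 0"
proof -
  show "(f + f') \<otimes>\<^bsub>PA\<^esub> g = (f \<otimes>\<^bsub>PA\<^esub> g) + (f' \<otimes>\<^bsub>PA\<^esub> g)"
    "g \<otimes>\<^bsub>PA\<^esub> (f + f') = (g \<otimes>\<^bsub>PA\<^esub> f) + (g \<otimes>\<^bsub>PA\<^esub> f')"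
    by (rule ext, simp add: PA_mult case_prod_unfold algebra_simps sum.distrib)+
  show "fscale c f \<otimes>\<^bsub>PA\<^esub> g = fscale c (f \<otimes>\<^bsub>PA\<^esub> g)"
    "g \<otimes>\<^bsub>PA\<^esub> fscale c f = fscale c (g \<otimes>\<^bsub>PA\<^esub> f)"
    by (rule ext, simp add: PA_mult case_prod_unfold sum_distrib_left mult_ac)+
  show "0 \<otimes>\<^bsub>PA\<^esub> g = 0" "g \<otimes>\<^bsub>PA\<^esub> 0 = 0"
    by (rule ext, simp add: PA_mult case_prod_unfold)+
qed

lemma PA_mult_unit:
  "unit_fun \<alpha> \<otimes>\<^bsub>PA\<^esub> unit_fun \<beta> = (if composable G \<alpha> \<beta> then unit_fun (pcomp \<alpha> \<beta>) else 0)"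
proof
  fix \<gamma>
  have "(unit_fun \<alpha> \<otimes>\<^bsub>PA\<^esub> unit_fun \<beta>) \<gamma> = (\<Sum>p\<in>factorizations \<gamma>. if p = (\<alpha>, \<beta>) then 1 else 0 :: 'c)"
    unfolding PA_mult by (rule sum.cong) (auto simp: unit_fun_def split: if_splits)
  also have "\<dots> = (if (\<alpha>, \<beta>) \<in> factorizations \<gamma> then 1 else 0)"
    using finite_factorizations by simp
  finally show
      "(unit_fun \<alpha> \<otimes>\<^bsub>PA\<^esub> unit_fun \<beta>) \<gamma> =
          (if composable G \<alpha> \<beta> then unit_fun (pcomp \<alpha> \<beta>) else 0 :: _ \<Rightarrow> 'c) \<gamma>"
    by (auto simp: factorizations_def unit_fun_def)
qed

lemma composable_pcomp:
  "composable G \<alpha> \<beta> \<Longrightarrow> pcomp \<alpha> \<beta> \<in> paths G"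
  "composable G \<alpha> \<beta> \<Longrightarrow> psource (pcomp \<alpha> \<beta>) = psource \<beta>"
  "composable G \<alpha> \<beta> \<Longrightarrow> ptarget G (pcomp \<alpha> \<beta>) = ptarget G \<alpha>"
  by (cases \<alpha>; cases \<beta>; simp add: composable_iff)+

lemma composable_assoc:
  "composable G \<alpha> \<beta> \<and> composable G (pcomp \<alpha> \<beta>) \<gamma> \<longleftrightarrow> composable G \<beta> \<gamma> \<and> composable G \<alpha> (pcomp \<beta> \<gamma>)"
  "pcomp (pcomp \<alpha> \<beta>) \<gamma> = pcomp \<alpha> (pcomp \<beta> \<gamma>)"
  by (cases \<alpha>; cases \<beta>; cases \<gamma>; auto simp: composable_iff)+

lemma PA_mult_closed:
  fixes f g :: "('a, 'b) qpath \<Rightarrow> 'k::field"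
  assumes f: "f \<in> carrier PA" and g: "g \<in> carrier PA"
  shows "f \<otimes>\<^bsub>PA\<^esub> g \<in> carrier PA"
  using f[unfolded PA_simps]
proof (induction f rule: free_space_induct)
  case (unit c \<alpha>)
  from g[unfolded PA_simps] show ?case
  proof (induction g rule: free_space_induct)
    case (unit d \<beta>)
    have "(if composable G \<alpha> \<beta> then unit_fun (pcomp \<alpha> \<beta>) else 0 :: _ \<Rightarrow>
        'k) \<in> carrier (free_space (paths G))"
      using unit_fun_in_free_space[OF composable_pcomp(1)] zero_in_free_space
      by (cases "composable G \<alpha> \<beta>") (simp_all only: if_True if_False)
    then show ?case
      unfolding PA_mult_linear PA_mult_unit PA_simps by (intro free_space_closed)
  qed (simp_all only: PA_mult_linear PA_simps zero_in_free_space free_space_closed)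
qed (simp_all only: PA_mult_linear PA_simps zero_in_free_space free_space_closed)

lemma PA_mult_assoc:
  fixes f g h :: "('a, 'b) qpath \<Rightarrow> 'k::field"
  assumes f: "f \<in> carrier PA" and g: "g \<in> carrier PA" and h: "h \<in> carrier PA"
  shows "f \<otimes>\<^bsub>PA\<^esub> g \<otimes>\<^bsub>PA\<^esub> h = f \<otimes>\<^bsub>PA\<^esub> (g \<otimes>\<^bsub>PA\<^esub> h)"
  using f[unfolded PA_simps]
proof (induction f rule: free_space_induct)
  case (unit c \<alpha>)
  from g[unfolded PA_simps] show ?case
  proof (induction g rule: free_space_induct)
    case (unit d \<beta>)
    from h[unfolded PA_simps] show ?case
    proof (induction h rule: free_space_induct)
      case (unit c' \<gamma>)
      have "unit_fun \<alpha> \<otimes>\<^bsub>PA\<^esub> unit_fun \<beta> \<otimes>\<^bsub>PA\<^esub> unit_fun \<gamma> =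
          unit_fun \<alpha> \<otimes>\<^bsub>PA\<^esub> (unit_fun \<beta> \<otimes>\<^bsub>PA\<^esub> unit_fun \<gamma> :: _ \<Rightarrow> 'k)"
        using composable_assoc[of \<alpha> \<beta> \<gamma>]
        by (simp add: PA_mult_unit PA_mult_linear del: zero_fun_apply) blast
      then show ?case by (simp only: PA_mult_linear)
    qed (simp_all only: PA_mult_linear)
  qed (simp_all only: PA_mult_linear)
qed (simp_all only: PA_mult_linear)

lemma PA_one_closed: "\<one>\<^bsub>PA\<^esub> \<in> carrier PA"
proof -
  have "finite (vertex_paths G)" "vertex_paths G \<subseteq> paths G" by (auto simp: vertex_paths_def)
  then show ?thesis by (auto simp: PA_one)
qed

lemma PA_one_mult:
  fixes f :: "('a, 'b) qpath \<Rightarrow> 'k::field"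
  assumes f: "f \<in> carrier PA"
  shows "\<one>\<^bsub>PA\<^esub> \<otimes>\<^bsub>PA\<^esub> f = f" "f \<otimes>\<^bsub>PA\<^esub> \<one>\<^bsub>PA\<^esub> = f"
proof -
  have f0: "f \<gamma> = 0" if "\<gamma> \<notin> paths G" for \<gamma> using f that by auto
  show "\<one>\<^bsub>PA\<^esub> \<otimes>\<^bsub>PA\<^esub> f = f"
  proof
    fix \<gamma> :: "('a, 'b) qpath"
    \<comment> \<open>A path has exactly one factorization with a vertex as left factor, the one cut
      at its target. Outside the set of paths both sides are zero by \<open>f0\<close>.\<close>
    have "(\<one>\<^bsub>PA\<^esub> \<otimes>\<^bsub>PA\<^esub> f) \<gamma> = (\<Sum>p\<in>factorizations \<gamma>. if p = ((ptarget G \<gamma>, []), \<gamma>) then f \<gamma> else 0)"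
      unfolding PA_mult
      by (rule sum.cong)
          (auto simp: PA_one vertex_paths_def factorizations_def composable_iff image_iff
              ptarget_verts split: if_splits)
    also have "\<dots> = (if ((ptarget G \<gamma>, []), \<gamma>) \<in> factorizations \<gamma> then f \<gamma> else 0)"
      using finite_factorizations by simp
    also have "\<dots> = f \<gamma>"
      using f0[of \<gamma>] ptarget_verts by (cases \<gamma>) (auto simp: factorizations_def composable_iff)
    finally show "(\<one>\<^bsub>PA\<^esub> \<otimes>\<^bsub>PA\<^esub> f) \<gamma> = f \<gamma>" .
  qed
  show "f \<otimes>\<^bsub>PA\<^esub> \<one>\<^bsub>PA\<^esub> = f"
  proof
    fix \<gamma> :: "('a, 'b) qpath"
    have "(f \<otimes>\<^bsub>PA\<^esub> \<one>\<^bsub>PA\<^esub>) \<gamma> = (\<Sum>p\<in>factorizations \<gamma>. if p = (\<gamma>, (fst \<gamma>, [])) then f \<gamma> else 0)"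
      unfolding PA_mult
      by (rule sum.cong)
          (auto simp: PA_one vertex_paths_def factorizations_def composable_iff image_iff dest:
              psource_verts split: if_splits)
    also have "\<dots> = (if (\<gamma>, (fst \<gamma>, [])) \<in> factorizations \<gamma> then f \<gamma> else 0)"
      using finite_factorizations by simp
    also have "\<dots> = f \<gamma>"
      using f0[of \<gamma>] psource_verts by (cases \<gamma>) (auto simp: factorizations_def composable_iff)
    finally show "(f \<otimes>\<^bsub>PA\<^esub> \<one>\<^bsub>PA\<^esub>) \<gamma> = f \<gamma>" .
  qed
qed

lemma PA_ring: "ring (PA :: ('k::field, _) module)"
proof -
  interpret V: vectorspace class_ring "PA :: ('k, _) module" by (rule PA_vs)
  show ?thesis
  proof (rule ringI)
    show "abelian_group (PA :: ('k, _) module)" by (rule V.abelian_group_axioms)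
    show "Group.monoid (PA :: ('k, _) module)"
      by (rule Group.monoidI)
          (auto intro!: PA_mult_closed PA_one_closed PA_mult_assoc PA_one_mult simp del:
              PA_simps(1))
  qed (simp_all only: PA_simps(2) PA_mult_linear)
qed

end

section \<open>The monomial algebra and its path basis\<close>

locale monomial_quiver = fin_digraph G for G :: "('v, 'e) pre_digraph" +
  fixes Z :: "('v, 'e) qpath set"
  assumes relations: "monomial_relations G Z"
begin

abbreviation "B \<equiv> nonzero_paths G Z"

text \<open>A condition on the bare list of arrows, without endpoints; for paths it is membership in
  \<open>B\<close>. Lists can be cut and rotated freely, which makes it possible to trace zero paths
  through rotations.\<close>

definition nonzero_list :: "'e list \<Rightarrow> bool" where
  "nonzero_list es \<longleftrightarrow> (\<forall>\<zeta>\<in>Z. \<not> sublist (snd \<zeta>) es)"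

lemma nonzero_list_mono: "nonzero_list es \<Longrightarrow> sublist ds es \<Longrightarrow> nonzero_list ds"
  unfolding nonzero_list_def by (meson sublist_order.order_trans)

lemma Z_path: "\<zeta> \<in> Z \<Longrightarrow> \<zeta> \<in> paths G" "\<zeta> \<in> Z \<Longrightarrow> 2 \<le> length (snd \<zeta>)"
  using relations by (auto simp: monomial_relations_def plength_def)

text \<open>A nonempty list of arrows determines the endpoints of its path, so the pieces before and
  after an occurrence of the list compose with \<open>\<zeta>\<close> as soon as the whole is a
  path.\<close>

lemma subpath_iff_sublist:
  assumes "\<zeta> \<in> paths G" "snd \<zeta> \<noteq> []" "\<gamma> \<in> paths G"
  shows "subpath G \<zeta> \<gamma> \<longleftrightarrow> sublist (snd \<zeta>) (snd \<gamma>)"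
proof
  assume "subpath G \<zeta> \<gamma>"
  then obtain \<mu> \<nu> where "\<gamma> = pcomp \<mu> (pcomp \<zeta> \<nu>)" by (auto simp: subpath_def occurrences_def)
  then show "sublist (snd \<zeta>) (snd \<gamma>)" by (auto simp: pcomp_def sublist_def)
next
  assume "sublist (snd \<zeta>) (snd \<gamma>)"
  then obtain xs ys where "snd \<gamma> = xs @ snd \<zeta> @ ys" by (auto simp: sublist_def)
  then obtain v where \<gamma>: "\<gamma> = (v, xs @ snd \<zeta> @ ys)" by (cases \<gamma>) auto
  obtain w a es where \<zeta>: "\<zeta> = (w, a # es)" using assms(2) by (cases \<zeta>; cases "snd \<zeta>") auto
  have "((ptarget G \<zeta>, ys), (v, xs)) \<in> occurrences G \<zeta> \<gamma>"
    using assms(1,3) unfolding \<gamma> \<zeta> by (auto simp: occurrences_def composable_iff)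
  then show "subpath G \<zeta> \<gamma>" by (auto simp: subpath_def)
qed

lemma Z_nonempty: "\<zeta> \<in> Z \<Longrightarrow> snd \<zeta> \<noteq> []"
  using Z_path(2) by fastforce

lemma nonzero_paths_iff: "\<gamma> \<in> B \<longleftrightarrow> \<gamma> \<in> paths G \<and> nonzero_list (snd \<gamma>)"
  using subpath_iff_sublist[OF Z_path(1) Z_nonempty] unfolding nonzero_paths_def nonzero_list_def
      by blast

lemma vertex_in_B: "v \<in> verts G \<Longrightarrow> (v, []) \<in> B"
  using Z_nonempty by (auto simp: nonzero_paths_iff nonzero_list_def)

lemma arrow_in_B: "a \<in> arcs G \<Longrightarrow> (tail G a, [a]) \<in> B"
proof -
  assume a: "a \<in> arcs G"
  have "\<not> sublist (snd \<zeta>) [a]" if "\<zeta> \<in> Z" for \<zeta>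
    using Z_path(2)[OF that] sublist_length_le[of "snd \<zeta>" "[a]"] by auto
  then show ?thesis using a by (auto simp: nonzero_paths_iff nonzero_list_def)
qed

text \<open>The ideal generated by \<open>Z\<close> in explicit form: the combinations of zero
  paths.\<close>

definition monomial_ideal :: "(('v, 'e) qpath \<Rightarrow> 'k::field) set" where
  "monomial_ideal = {f \<in> carrier PA. \<forall>b\<in>B. f b = 0}"

text \<open>This makes \<open>monomial_ideal\<close> two-sided: in the product formula at a path of
  \<open>B\<close>, both factors of every term lie in \<open>B\<close>, where the elements of the
  ideal vanish.\<close>

lemma factorization_nonzero:
  "(\<alpha>, \<beta>) \<in> factorizations \<gamma> \<Longrightarrow> \<gamma> \<in> B \<Longrightarrow> \<alpha> \<in> B \<and> \<beta> \<in> B"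
  by (cases \<alpha>; cases \<beta>; auto simp: factorizations_def composable_iff nonzero_paths_iff
      intro: nonzero_list_mono)

lemma ideal_monomial_ideal: "ideal (monomial_ideal :: (('v, 'e) qpath \<Rightarrow> 'k::field) set) PA"
proof (rule idealI[OF PA_ring])
  interpret V: vectorspace class_ring "PA :: ('k, _) module" by (rule PA_vs)
  let ?I = "monomial_ideal :: (('v, 'e) qpath \<Rightarrow> 'k) set"
  have z: "(0 :: ('v, 'e) qpath \<Rightarrow> 'k) \<in> ?I" using zero_in_free_space
      by (auto simp: monomial_ideal_def)
  have add: "f + g \<in> ?I" if "f \<in> ?I" "g \<in> ?I" for f g
    using that free_space_closed(1)[of f "paths G" g]
        by (auto simp: monomial_ideal_def simp del: free_space_simps)
  have scale: "fscale c f \<in> ?I" if "f \<in> ?I" for c f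
    using that free_space_closed(3)[of f "paths G" c]
        by (auto simp: monomial_ideal_def simp del: free_space_simps)
  have "\<ominus>\<^bsub>PA\<^esub> f = fscale (- 1) f" if "f \<in> ?I" for f
    using vectorspace_class_ringD(4)[OF PA_vs, of f] that by (simp add: monomial_ideal_def)
  then have inv: "inv\<^bsub>add_monoid PA\<^esub> f \<in> ?I" if "f \<in> ?I" for f
    using that scale[OF that, of "- 1"] by (simp add: a_inv_def)
  have sub: "?I \<subseteq> carrier PA" by (auto simp: monomial_ideal_def)
  show "subgroup ?I (add_monoid PA)"
    by (rule subgroup.intro) (use z add sub inv in \<open>auto simp del: free_space_simps PA_simps(1)\<close>)
  fix f g :: "('v, 'e) qpath \<Rightarrow> 'k" assume f: "f \<in> ?I" and g: "g \<in> carrier PA"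
  then have fg: "f \<in> carrier PA" by (simp add: monomial_ideal_def)
  have "(g \<otimes>\<^bsub>PA\<^esub> f) b = 0" if b: "b \<in> B" for b
    unfolding PA_mult
        by (rule sum.neutral)
            (use factorization_nonzero[OF _ b] f in \<open>auto simp: monomial_ideal_def\<close>)
  then show "g \<otimes>\<^bsub>PA\<^esub> f \<in> ?I" using PA_mult_closed[OF g fg] by (simp add: monomial_ideal_def)
  have "(f \<otimes>\<^bsub>PA\<^esub> g) b = 0" if b: "b \<in> B" for b
    unfolding PA_mult
        by (rule sum.neutral)
            (use factorization_nonzero[OF _ b] f in \<open>auto simp: monomial_ideal_def\<close>)
  then show "f \<otimes>\<^bsub>PA\<^esub> g \<in> ?I" using PA_mult_closed[OF fg g] by (simp add: monomial_ideal_def)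
qed

lemma monomial_ideal_eq:
    "Idl\<^bsub>PA\<^esub> (unit_fun ` Z) = (monomial_ideal :: (('v, 'e) qpath \<Rightarrow> 'k::field) set)"
proof
  interpret R: ring "PA :: ('k, _) module" by (rule PA_ring)
  interpret V: vectorspace class_ring "PA :: ('k, _) module" by (rule PA_vs)
  let ?I = "Idl\<^bsub>PA\<^esub> (unit_fun ` Z) :: (('v, 'e) qpath \<Rightarrow> 'k) set"
  have Zc: "unit_fun ` Z \<subseteq> carrier (PA :: ('k, _) module)"
    using Z_path(1) by (auto intro!: unit_fun_in_free_space simp del: free_space_simps)
  show "?I \<subseteq> monomial_ideal"
  proof (rule R.genideal_minimal[OF ideal_monomial_ideal])
    have "\<zeta> \<notin> B" if "\<zeta> \<in> Z" for \<zeta>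
      using that by (auto simp: nonzero_paths_iff nonzero_list_def)
    then show "unit_fun ` Z \<subseteq> (monomial_ideal :: (('v, 'e) qpath \<Rightarrow> 'k) set)"
      using Zc by (auto simp: monomial_ideal_def unit_fun_def simp del: free_space_simps)
  qed
  interpret I: ideal ?I PA by (rule R.genideal_ideal[OF Zc])
  have unit_mem: "fscale c (unit_fun \<gamma>) \<in> ?I" if \<gamma>: "\<gamma> \<in> paths G" "\<gamma> \<notin> B" for c \<gamma>
  proof -
    obtain \<zeta> where \<zeta>: "\<zeta> \<in> Z" "subpath G \<zeta> \<gamma>" using \<gamma> by (auto simp: nonzero_paths_def)
    then obtain \<mu> \<nu> where f: "composable G \<zeta> \<nu>" "composable G \<mu> \<zeta>" "\<gamma> = pcomp \<mu> (pcomp \<zeta> \<nu>)"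
      by (auto simp: subpath_def occurrences_def)
    have "\<mu> \<in> paths G" "\<nu> \<in> paths G" using f by (auto simp: composable_def)
    then have u: "unit_fun \<mu> \<in> carrier (PA :: ('k, _) module)"
        "unit_fun \<nu> \<in> carrier (PA :: ('k, _) module)"
      using unit_fun_in_free_space by (simp_all del: free_space_simps)
    have "(unit_fun \<zeta> :: _ \<Rightarrow> 'k) \<in> ?I" using R.genideal_self[OF Zc] \<zeta> by auto
    then have "unit_fun \<mu> \<otimes>\<^bsub>PA\<^esub> (unit_fun \<zeta> \<otimes>\<^bsub>PA\<^esub> unit_fun \<nu>) \<in> ?I"
      by (intro I.I_l_closed I.I_r_closed u)
    moreover have "unit_fun \<mu> \<otimes>\<^bsub>PA\<^esub> (unit_fun \<zeta> \<otimes>\<^bsub>PA\<^esub> unit_fun \<nu>) = (unit_fun \<gamma> :: _ \<Rightarrow> 'k)"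
      using f composable_assoc[of \<mu> \<zeta> \<nu>] composable_pcomp(2)[of \<mu> \<zeta>]
      by (simp add: PA_mult_unit PA_mult_linear composable_def pcomp_def psource_def del:
          zero_fun_apply)
    ultimately have "unit_fun \<gamma> \<in> ?I" by simp
    \<comment> \<open>Ideals are closed under multiplication by ring elements, so the scalar
      \<open>c\<close> is applied as the ring element c 1.\<close>
    moreover have "fscale c \<one>\<^bsub>PA\<^esub> \<in> carrier (PA :: ('k, _) module)"
      unfolding PA_simps by (rule free_space_closed(3)[OF PA_one_closed[unfolded PA_simps]])
    ultimately have "fscale c \<one>\<^bsub>PA\<^esub> \<otimes>\<^bsub>PA\<^esub> unit_fun \<gamma> \<in> ?I"
      by (rule I.I_l_closed)
    moreover have "unit_fun \<gamma> \<in> carrier (PA :: ('k, _) module)"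
      using unit_fun_in_free_space \<gamma> by (simp del: free_space_simps)
    ultimately show ?thesis by (simp only: PA_mult_linear PA_one_mult)
  qed
  show "monomial_ideal \<subseteq> ?I"
  proof
    fix f :: "('v, 'e) qpath \<Rightarrow> 'k" assume "f \<in> monomial_ideal"
    then have "f \<in> carrier (free_space (paths G - B))" by (auto simp: monomial_ideal_def)
    then show "f \<in> ?I"
    proof (induction f rule: free_space_induct)
      case zero
      then show ?case using I.zero_closed by (simp only: PA_simps)
    next
      case (add f g)
      then show ?case using I.a_closed by (simp only: PA_simps)
    next
      case (unit c \<gamma>)
      then show ?case using unit_mem by blast
    qed
  qed
qed

definition monomial_basis :: "('v, 'e) qpath \<Rightarrow> (('v, 'e) qpath \<Rightarrow> 'k::field) set" where
  "monomial_basis b = monomial_ideal +>\<^bsub>PA\<^esub> unit_fun b"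

lemma monomial_algebra_eq:
  "monomial_algebra G Z = quot_module PA (monomial_ideal :: (('v, 'e) qpath \<Rightarrow> 'k::field) set)"
  by (simp add: monomial_algebra_def monomial_ideal_eq)

lemma monomial_quotient: "quotient_space PA (monomial_ideal :: (('v, 'e) qpath \<Rightarrow> 'k::field) set)"
proof (intro quotient_space.intro quotient_space_axioms.intro PA_vs submodule_class_ringI)
  interpret I: ideal "monomial_ideal :: (('v, 'e) qpath \<Rightarrow> 'k) set" PA by (rule ideal_monomial_ideal)
  let ?I = "monomial_ideal :: (('v, 'e) qpath \<Rightarrow> 'k) set"
  show "?I \<subseteq> carrier PA" by (rule I.a_subset)
  show "\<zero>\<^bsub>PA\<^esub> \<in> ?I"
    by (rule additive_subgroup.zero_closed[OF ideal.axioms(1)[OF ideal_monomial_ideal]])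
  show "x \<oplus>\<^bsub>PA\<^esub> y \<in> ?I" if "x \<in> ?I" "y \<in> ?I" for x y using that
      by (rule additive_subgroup.a_closed[OF ideal.axioms(1)[OF ideal_monomial_ideal]])
  show "c \<odot>\<^bsub>PA\<^esub> x \<in> ?I" if "x \<in> ?I" for c x
    using that free_space_closed(3)[of x "paths G" c]
        by (auto simp: monomial_ideal_def simp del: free_space_simps)
qed

lemma monomial_mult:
  fixes f g :: "('v, 'e) qpath \<Rightarrow> 'k::field"
  assumes "f \<in> carrier PA" "g \<in> carrier PA"
  shows "(monomial_ideal +>\<^bsub>PA\<^esub> f) \<otimes>\<^bsub>monomial_algebra G Z\<^esub> (monomial_ideal +>\<^bsub>PA\<^esub> g) =
    monomial_ideal +>\<^bsub>PA\<^esub> (f \<otimes>\<^bsub>PA\<^esub> g)"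
  using ideal.rcoset_mult_add[OF ideal_monomial_ideal assms]
  by (simp add: monomial_algebra_eq quot_module_def ring.extend_def FactRing_def)

lemma monomial_one:
    "\<one>\<^bsub>monomial_algebra G Z\<^esub> = monomial_ideal +>\<^bsub>PA\<^esub> (\<one>\<^bsub>PA\<^esub> :: ('v, 'e) qpath \<Rightarrow> 'k::field)"
  by (simp add: monomial_algebra_eq quot_module_def ring.extend_def FactRing_def)

lemma monomial_carrierE:
  fixes X :: "(('v, 'e) qpath \<Rightarrow> 'k::field) set"
  assumes "X \<in> carrier (monomial_algebra G Z)"
  obtains f where "X = monomial_ideal +>\<^bsub>PA\<^esub> f" "f \<in> carrier PA"
  using assms unfolding monomial_algebra_eq quotient_space.carrier_quot_module[OF monomial_quotient]
  by (rule imageE)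

lemma monomial_unital_algebra: "unital_algebra (monomial_algebra G Z :: ('k::field, _) module)"
proof -
  interpret Q: quotient_space PA "monomial_ideal :: (('v, 'e) qpath \<Rightarrow> 'k) set"
      by (rule monomial_quotient)
  let ?A = "monomial_algebra G Z :: ('k, (('v, 'e) qpath \<Rightarrow> 'k) set) module"
  let ?cl = "\<lambda>f :: ('v, 'e) qpath \<Rightarrow> 'k. monomial_ideal +>\<^bsub>PA\<^esub> f"
  note A = Q.vectorspace_quot_module[folded monomial_algebra_eq]
  note Ac = Q.carrier_quot_module[folded monomial_algebra_eq]
  note Aa = Q.add_quot_module[folded monomial_algebra_eq]
      Q.smult_quot_module[folded monomial_algebra_eq]
  note mc = PA_mult_closed
  have E: "\<exists>f. X = ?cl f \<and> f \<in> carrier PA" if "X \<in> carrier ?A" for X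
    using that by (rule monomial_carrierE) blast
  show ?thesis
  proof (intro unital_algebra.intro unital_algebra_axioms.intro A)
    fix a b assume "a \<in> carrier ?A" "b \<in> carrier ?A"
    then obtain f g where f: "a = ?cl f" "b = ?cl g" "f \<in> carrier PA" "g \<in> carrier PA" using E
        by metis
    show "a \<otimes>\<^bsub>?A\<^esub> b \<in> carrier ?A"
      unfolding f(1,2) monomial_mult[OF f(3,4)] Ac by (rule imageI[OF mc[OF f(3,4)]])
  next
    show "\<one>\<^bsub>?A\<^esub> \<in> carrier ?A" unfolding monomial_one Ac by (rule imageI[OF PA_one_closed])
  next
    fix a b c assume "a \<in> carrier ?A" "b \<in> carrier ?A" "c \<in> carrier ?A"
    then obtain f g h where "a = ?cl f" "b = ?cl g" "c = ?cl h" "f \<in> carrier PA" "g \<in> carrier PA"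
        "h \<in> carrier PA"
      using E by metis
    then show "a \<otimes>\<^bsub>?A\<^esub> b \<otimes>\<^bsub>?A\<^esub> c = a \<otimes>\<^bsub>?A\<^esub> (b \<otimes>\<^bsub>?A\<^esub> c)"
      by (simp only: monomial_mult PA_mult_assoc PA_mult_closed)
  next
    fix a assume "a \<in> carrier ?A"
    then obtain f where "a = ?cl f" "f \<in> carrier PA" using E by metis
    then show "\<one>\<^bsub>?A\<^esub> \<otimes>\<^bsub>?A\<^esub> a = a" "a \<otimes>\<^bsub>?A\<^esub> \<one>\<^bsub>?A\<^esub> = a"
      by (simp_all only: monomial_mult monomial_one PA_one_mult PA_one_closed)
  next
    fix b assume "b \<in> carrier ?A"
    then obtain g where b: "b = ?cl g" "g \<in> carrier PA" using E by metis
    show "is_linear ?A ?A (\<lambda>a. a \<otimes>\<^bsub>?A\<^esub> b)"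
      unfolding is_linear_def
    proof (intro conjI ballI allI)
      fix x y c assume "x \<in> carrier ?A" "y \<in> carrier ?A"
      then obtain f f' where f: "x = ?cl f" "f \<in> carrier PA" "y = ?cl f'" "f' \<in> carrier PA" using E
          by metis
      show "x \<otimes>\<^bsub>?A\<^esub> b \<in> carrier ?A" unfolding f b monomial_mult[OF f(2) b(2)] Ac
          by (rule imageI[OF mc[OF f(2) b(2)]])
      show "(x \<oplus>\<^bsub>?A\<^esub> y) \<otimes>\<^bsub>?A\<^esub> b = x \<otimes>\<^bsub>?A\<^esub> b \<oplus>\<^bsub>?A\<^esub> y \<otimes>\<^bsub>?A\<^esub> b"
        unfolding f b Aa(1)[OF f(2,4)] monomial_mult[OF f(2) b(2)] monomial_mult[OF f(4) b(2)]
          monomial_mult[OF Q.a_closed[OF f(2,4)] b(2)] Aa(1)[OF mc[OF f(2) b(2)] mc[OF f(4) b(2)]]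
        unfolding PA_simps PA_mult_linear ..
      show "(c \<odot>\<^bsub>?A\<^esub> x) \<otimes>\<^bsub>?A\<^esub> b = c \<odot>\<^bsub>?A\<^esub> (x \<otimes>\<^bsub>?A\<^esub> b)"
        unfolding f b Aa(2)[OF f(2)] monomial_mult[OF f(2) b(2)]
          monomial_mult[OF Q.vs_simps(1)[OF f(2)] b(2)] Aa(2)[OF mc[OF f(2) b(2)]]
        unfolding PA_simps PA_mult_linear ..
    qed
    show "is_linear ?A ?A (\<lambda>a. b \<otimes>\<^bsub>?A\<^esub> a)"
      unfolding is_linear_def
    proof (intro conjI ballI allI)
      fix x y c assume "x \<in> carrier ?A" "y \<in> carrier ?A"
      then obtain f f' where f: "x = ?cl f" "f \<in> carrier PA" "y = ?cl f'" "f' \<in> carrier PA" using E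
          by metis
      show "b \<otimes>\<^bsub>?A\<^esub> x \<in> carrier ?A" unfolding f b monomial_mult[OF b(2) f(2)] Ac
          by (rule imageI[OF mc[OF b(2) f(2)]])
      show "b \<otimes>\<^bsub>?A\<^esub> (x \<oplus>\<^bsub>?A\<^esub> y) = b \<otimes>\<^bsub>?A\<^esub> x \<oplus>\<^bsub>?A\<^esub> b \<otimes>\<^bsub>?A\<^esub> y"
        unfolding f b Aa(1)[OF f(2,4)] monomial_mult[OF b(2) f(2)] monomial_mult[OF b(2) f(4)]
          monomial_mult[OF b(2) Q.a_closed[OF f(2,4)]] Aa(1)[OF mc[OF b(2) f(2)] mc[OF b(2) f(4)]]
        unfolding PA_simps PA_mult_linear ..
      show "b \<otimes>\<^bsub>?A\<^esub> (c \<odot>\<^bsub>?A\<^esub> x) = c \<odot>\<^bsub>?A\<^esub> (b \<otimes>\<^bsub>?A\<^esub> x)"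
        unfolding f b Aa(2)[OF f(2)] monomial_mult[OF b(2) f(2)]
          monomial_mult[OF b(2) Q.vs_simps(1)[OF f(2)]] Aa(2)[OF mc[OF b(2) f(2)]]
        unfolding PA_simps PA_mult_linear ..
    qed
  qed
qed

text \<open>Evaluation at a path of \<open>B\<close> vanishes on the ideal and gives the coordinate
  functional of that path. The classes of the paths in \<open>B\<close> span, because all other
  paths lie in the ideal.\<close>

lemma monomial_based_algebra:
  assumes fin: "vectorspace.fin_dim class_ring (monomial_algebra G Z :: ('k::field, _) module)"
  obtains coef where
    "based_algebra (monomial_algebra G Z :: ('k, _) module) B monomial_basis coef"
    "\<And>b c x. b \<in> B \<Longrightarrow> c \<in> B \<Longrightarrow> x \<in> B \<Longrightarrow>
      coef x (monomial_basis b \<otimes>\<^bsub>monomial_algebra G Z :: ('k, _) module\<^esub> monomial_basis c) =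
      (if composable G b c \<and> pcomp b c = x then 1 else 0)"
proof -
  interpret Q: quotient_space PA "monomial_ideal :: (('v, 'e) qpath \<Rightarrow> 'k) set"
      by (rule monomial_quotient)
  let ?A = "monomial_algebra G Z :: ('k, (('v, 'e) qpath \<Rightarrow> 'k) set) module"
  let ?cl = "\<lambda>f :: ('v, 'e) qpath \<Rightarrow> 'k. monomial_ideal +>\<^bsub>PA\<^esub> f"
  note A = Q.vectorspace_quot_module[folded monomial_algebra_eq]
  note Ac = Q.carrier_quot_module[folded monomial_algebra_eq]
  note Aa = Q.add_quot_module[folded monomial_algebra_eq]
      Q.smult_quot_module[folded monomial_algebra_eq]
  interpret A: vectorspace class_ring ?A by (rule A)
  have unit: "(unit_fun b :: _ \<Rightarrow> 'k) \<in> carrier PA" if "b \<in> B" for b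
    unfolding PA_simps by (rule unit_fun_in_free_space) (use that nonzero_paths_iff in blast)
  have "\<exists>F. linear_functional ?A F \<and> (\<forall>f\<in>carrier PA. F (?cl f) = f b)" if b: "b \<in> B" for b
  proof -
    have "linear_functional PA (\<lambda>f :: _ \<Rightarrow> 'k. f b)" by (simp add: linear_functional_def)
    moreover have "f b = 0" if "f \<in> monomial_ideal" for f :: "_ \<Rightarrow> 'k" using that b
        by (simp add: monomial_ideal_def)
    ultimately show ?thesis
    proof (rule Q.functional_quot_module[of "\<lambda>f. f b"])
      fix F assume "linear_functional (quot_module PA monomial_ideal) F"
        "\<And>x. x \<in> carrier PA \<Longrightarrow> F (?cl x) = x b"
      then show ?thesis unfolding monomial_algebra_eq by (intro exI[of _ F]) blast
    qed
  qed
  then obtain coef where coef: "\<And>b. b \<in> B \<Longrightarrow> linear_functional ?A (coef b)"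
    "\<And>b f. b \<in> B \<Longrightarrow> f \<in> carrier PA \<Longrightarrow> coef b (?cl f) = f b" by metis
  have e: "monomial_basis b \<in> carrier ?A" if "b \<in> B" for b
    unfolding monomial_basis_def Ac by (rule imageI[OF unit[OF that]])
  have coef_e: "coef b (monomial_basis c) = (if b = c then 1 else 0)" if "b \<in> B" "c \<in> B" for b c
    unfolding monomial_basis_def coef(2)[OF that(1) unit[OF that(2)]] by (simp add: unit_fun_def)
  have fin_B: "finite B"
  proof (rule ccontr)
    assume inf: "infinite B"
    obtain S where S: "finite S" "S \<subseteq> carrier ?A" "A.span S = carrier ?A"
      using fin unfolding A.fin_dim_def by blast
    \<comment> \<open>The paths that occur in a finite generating set. There are finitely many of
      them, and the coefficient at a path of \<open>B\<close> outside \<open>U\<close> would be zero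
      on the whole span, including the class of that path.\<close>
    define U where "U = (\<Union>X\<in>S. {b \<in> B. coef b X \<noteq> 0})"
    have "finite {b \<in> B. coef b X \<noteq> 0}" if X: "X \<in> S" for X
    proof -
      obtain f where f: "X = ?cl f" "f \<in> carrier PA" using subsetD[OF S(2) X]
          by (rule monomial_carrierE)
      then have "{b \<in> B. coef b X \<noteq> 0} \<subseteq> {b. f b \<noteq> 0}" using coef(2) by auto
      then show ?thesis using f(2) by (auto intro: finite_subset)
    qed
    then have "finite U" using S(1) by (simp add: U_def)
    then have "infinite (B - U)" using inf by simp
    then have "B - U \<noteq> {}" by (rule infinite_imp_nonempty)
    then obtain b where b: "b \<in> B" "b \<notin> U" by blast
    have "monomial_basis b \<in> A.span S" using e[OF b(1)] S(3) by simp
    then have "coef b (monomial_basis b) = 0"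
    proof (rule span_induct_class_ring[OF A S(2)])
      show "coef b \<zero>\<^bsub>?A\<^esub> = 0"
        using linear_functionalD(2)[OF coef(1)[OF b(1)] A.zero_closed, of 0]
            vectorspace_class_ringD(2)[OF A A.zero_closed] by simp
    qed (use b linear_functionalD[OF coef(1)[OF b(1)]] in \<open>auto simp: U_def\<close>)
    then show False using coef_e[OF b(1) b(1)] by simp
  qed
  have eB: "monomial_basis ` B \<subseteq> carrier ?A" using e by auto
  note sp = span_class_ring[OF A eB]
  interpret S: quotient_space ?A "A.span (monomial_basis ` B)"
    by (intro quotient_space.intro quotient_space_axioms.intro A sp)
  have span: "carrier ?A \<subseteq> A.span (monomial_basis ` B)"
  proof
    fix X assume "X \<in> carrier ?A"
    then obtain f where f: "X = ?cl f" "f \<in> carrier PA" by (rule monomial_carrierE)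
    from f(2)[unfolded PA_simps] have "?cl f \<in> A.span (monomial_basis ` B)"
    proof (rule free_space_induct)
      show "?cl 0 \<in> A.span (monomial_basis ` B)"
        using S.N_zero Q.coset_zero Q.zero_quot_module[folded monomial_algebra_eq]
            by (simp only: PA_simps)
    next
      fix f g :: "('v, 'e) qpath \<Rightarrow> 'k" assume fg: "f \<in> carrier (free_space (paths G))"
          "g \<in> carrier (free_space (paths G))"
        "?cl f \<in> A.span (monomial_basis ` B)" "?cl g \<in> A.span (monomial_basis ` B)"
      show "?cl (f + g) \<in> A.span (monomial_basis ` B)"
        using S.N_add[OF fg(3,4)] Aa(1)[of f g] fg(1,2) by (simp only: PA_simps)
    next
      fix c :: 'k and x assume x: "x \<in> paths G"
      have u: "(unit_fun x :: _ \<Rightarrow> 'k) \<in> carrier PA" unfolding PA_simps using x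
          by (rule unit_fun_in_free_space)
      have "?cl (unit_fun x) \<in> A.span (monomial_basis ` B)"
      proof (cases "x \<in> B")
        case True
        then show ?thesis using subsetD[OF sp(2) imageI[OF True]] by (simp only: monomial_basis_def)
      next
        case False
        then have "\<forall>b\<in>B. (unit_fun x b :: 'k) = 0" by (auto simp: unit_fun_def)
        then have "(unit_fun x :: _ \<Rightarrow> 'k) \<in> monomial_ideal"
          unfolding monomial_ideal_def using u by (intro CollectI conjI)
        then have "?cl (unit_fun x) = \<zero>\<^bsub>?A\<^esub>"
          using Q.coset_zero_iff[OF u, folded monomial_algebra_eq] by simp
        then show ?thesis using S.N_zero by simp
      qed
      from S.N_smult[OF this, of c] show "?cl (fscale c (unit_fun x)) \<in> A.span (monomial_basis ` B)"
        using Aa(2)[OF u, of c] by (simp only: PA_simps)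
    qed
    then show "X \<in> A.span (monomial_basis ` B)" using f by simp
  qed
  show thesis
  proof (rule that)
    show "based_algebra ?A B monomial_basis coef"
      by (intro based_algebra.intro based_algebra_axioms.intro monomial_unital_algebra fin_B e span
          coef(1) coef_e)
    fix b c x assume bcx: "b \<in> B" "c \<in> B" "x \<in> B"
    have "coef x (monomial_basis b \<otimes>\<^bsub>?A\<^esub> monomial_basis c) = (unit_fun b \<otimes>\<^bsub>PA\<^esub> unit_fun c :: _ \<Rightarrow>
        'k) x"
      unfolding monomial_basis_def monomial_mult[OF unit[OF bcx(1)] unit[OF bcx(2)]]
      by (rule coef(2)[OF bcx(3) PA_mult_closed[OF unit[OF bcx(1)] unit[OF bcx(2)]]])
    then show "coef x (monomial_basis b \<otimes>\<^bsub>?A\<^esub> monomial_basis c) = (if composable G b c \<and> pcomp b c =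
        x then 1 else 0)"
      unfolding PA_mult_unit by (cases "composable G b c") (auto simp: unit_fun_def)
  qed
qed

section \<open>Rotation of cycles\<close>

abbreviation "rot \<equiv> rotation G"

lemma snd_rot [simp]: "snd (rot \<gamma>) = rotate1 (snd \<gamma>)"
  by (simp add: rotation_def)

lemma snd_rot_funpow [simp]: "snd ((rot ^^ i) \<gamma>) = rotate i (snd \<gamma>)"
  by (induction i) auto

lemma cycles_iff: "(v, es) \<in> cycles G \<longleftrightarrow> (v, es) \<in> paths G \<and> ptarget G (v, es) = v"
  by (auto simp: cycles_def)

lemma rot_cycles: "\<gamma> \<in> cycles G \<Longrightarrow> rot \<gamma> \<in> cycles G"
  by (cases \<gamma>; cases "snd \<gamma>") (auto simp: rotation_def cycles_iff intro: head_in_verts)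

lemma rot_funpow_cycles: "\<gamma> \<in> cycles G \<Longrightarrow> (rot ^^ i) \<gamma> \<in> cycles G"
  by (induction i) (auto intro: rot_cycles)

lemma path_eqI: "\<gamma> \<in> paths G \<Longrightarrow> \<delta> \<in> paths G \<Longrightarrow> snd \<gamma> \<noteq> [] \<Longrightarrow> snd \<gamma> = snd \<delta> \<Longrightarrow> \<gamma> = \<delta>"
  by (cases \<gamma>; cases \<delta>; cases "snd \<gamma>") auto

lemma cycles_paths: "\<gamma> \<in> cycles G \<Longrightarrow> \<gamma> \<in> paths G"
  by (simp add: cycles_def)

lemma rot_trivial: "snd \<gamma> = [] \<Longrightarrow> (rot ^^ i) \<gamma> = \<gamma>"
  by (induction i) (auto simp: rotation_def)

lemma rot_length:
  assumes "\<gamma> \<in> cycles G"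
  shows "(rot ^^ length (snd \<gamma>)) \<gamma> = \<gamma>"
proof (cases "snd \<gamma> = []")
  case False
  then show ?thesis
    by (intro path_eqI cycles_paths rot_funpow_cycles assms) auto
qed (simp add: rot_trivial)

lemma rot_length_mult:
  assumes "\<gamma> \<in> cycles G"
  shows "(rot ^^ (length (snd \<gamma>) * i)) \<gamma> = \<gamma>"
proof (induction i)
  case (Suc i)
  have "(rot ^^ (length (snd \<gamma>) * Suc i)) \<gamma> =
      (rot ^^ (length (snd \<gamma>) * i)) ((rot ^^ length (snd \<gamma>)) \<gamma>)"
    by (simp only: mult_Suc_right add.commute[of "length (snd \<gamma>)"] funpow_add comp_apply)
  then show ?case using Suc rot_length[OF assms] by simp
qed simp

lemma rot_inverse:
  assumes "\<gamma> \<in> cycles G"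
  obtains j where "(rot ^^ j) ((rot ^^ i) \<gamma>) = \<gamma>"
proof (cases "snd \<gamma> = []")
  case True
  then show thesis using that[of 0] rot_trivial by simp
next
  case False
  \<comment> \<open>After \<open>i\<close> rotations, n i - i more complete \<open>i\<close> full
    turns, where n is the length; as n is positive, the subtraction does not truncate.\<close>
  then have "length (snd \<gamma>) * i - i + i = length (snd \<gamma>) * i" by (cases "snd \<gamma>") auto
  then have "(rot ^^ (length (snd \<gamma>) * i - i)) ((rot ^^ i) \<gamma>) = \<gamma>"
    using rot_length_mult[OF assms, of i] by (metis comp_apply funpow_add)
  then show thesis by (rule that)
qed

text \<open>Rotation of lists is invertible, and a nonempty list determines its path. Vertices,
  whose lists are all empty, are fixed by rotation.\<close>

lemma rot_inj:
  assumes "\<gamma> \<in> cycles G" "\<delta> \<in> cycles G" "(rot ^^ i) \<gamma> = (rot ^^ i) \<delta>"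
  shows "\<gamma> = \<delta>"
proof (cases "snd \<gamma> = []")
  case True
  then have "snd ((rot ^^ i) \<delta>) = []" using assms(3)[symmetric] by simp
  then have "snd \<delta> = []" by simp
  then show ?thesis using assms(3) True by (simp add: rot_trivial)
next
  case False
  have eq: "rotate i (snd \<gamma>) = rotate i (snd \<delta>)" using assms(3) by (metis snd_rot_funpow)
  then have len: "length (snd \<delta>) = length (snd \<gamma>)" by (metis length_rotate)
  let ?n = "length (snd \<gamma>)"
  have "?n * i - i + i = ?n * i" using False by (cases "snd \<gamma>") auto
  then have r: "rotate (?n * i - i) (rotate i zs) = zs" if "length zs = ?n" for zs :: "'e list"
    using that by (simp add: rotate_rotate rotate_conv_mod[of "?n * i"])
  have "snd \<gamma> = rotate (?n * i - i) (rotate i (snd \<gamma>))" by (rule r[OF refl, symmetric])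
  also have "\<dots> = rotate (?n * i - i) (rotate i (snd \<delta>))" by (simp only: eq)
  also have "\<dots> = snd \<delta>" by (rule r[OF len])
  finally have "snd \<gamma> = snd \<delta>" .
  then show ?thesis using False assms by (intro path_eqI cycles_paths) auto
qed

text \<open>Forward rotations already exhaust the equivalence class of a cycle, since it returns
  after as many rotations as it has arrows; see \<open>rotation_class\<close>.\<close>

definition circ :: "('v, 'e) qpath \<Rightarrow> ('v, 'e) qpath set" where
  "circ \<gamma> = range (\<lambda>i. (rot ^^ i) \<gamma>)"

lemma circ_self: "\<gamma> \<in> circ \<gamma>"
  unfolding circ_def by (rule range_eqI[of _ _ 0]) simp

lemma circE:
  assumes "\<delta> \<in> circ \<gamma>"
  obtains i where "\<delta> = (rot ^^ i) \<gamma>"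
  using assms unfolding circ_def by (rule rangeE)

lemma circI: "(rot ^^ i) \<gamma> \<in> circ \<gamma>"
  unfolding circ_def by (rule rangeI)

lemma circ_rot:
  assumes "\<delta> \<in> circ \<gamma>"
  shows "(rot ^^ i) \<delta> \<in> circ \<gamma>"
proof -
  obtain j where "\<delta> = (rot ^^ j) \<gamma>" using assms by (rule circE)
  then have "(rot ^^ i) \<delta> = (rot ^^ (i + j)) \<gamma>" by (simp add: funpow_add)
  then show ?thesis using circI by simp
qed

lemma circ_mono: "\<delta> \<in> circ \<gamma> \<Longrightarrow> circ \<delta> \<subseteq> circ \<gamma>"
  by (rule subsetI) (erule circE, simp add: circ_rot)

lemma circ_eq:
  assumes "\<gamma> \<in> cycles G" "\<delta> \<in> circ \<gamma>"
  shows "circ \<delta> = circ \<gamma>"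
proof
  show "circ \<delta> \<subseteq> circ \<gamma>" using assms(2) by (rule circ_mono)
  obtain i where i: "\<delta> = (rot ^^ i) \<gamma>" using assms(2) by (rule circE)
  obtain j where "(rot ^^ j) ((rot ^^ i) \<gamma>) = \<gamma>" using rot_inverse[OF assms(1)] by metis
  then have "\<gamma> \<in> circ \<delta>" using circI[of j \<delta>] i by simp
  then show "circ \<gamma> \<subseteq> circ \<delta>" by (rule circ_mono)
qed

lemma circ_cycles: "\<gamma> \<in> cycles G \<Longrightarrow> circ \<gamma> \<subseteq> cycles G"
  by (rule subsetI) (erule circE, simp add: rot_funpow_cycles)

lemma circ_length: "\<delta> \<in> circ \<gamma> \<Longrightarrow> length (snd \<delta>) = length (snd \<gamma>)"
  by (erule circE) simp

lemma rotation_class: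
  assumes "\<gamma> \<in> cycles G"
  shows "(rotation_rel G \<union> (rotation_rel G)\<inverse>)\<^sup>* `` {\<gamma>} = circ \<gamma>"
proof
  let ?R = "rotation_rel G \<union> (rotation_rel G)\<inverse>"
  show "?R\<^sup>* `` {\<gamma>} \<subseteq> circ \<gamma>"
  proof
    fix \<delta> assume "\<delta> \<in> ?R\<^sup>* `` {\<gamma>}"
    then have "(\<gamma>, \<delta>) \<in> ?R\<^sup>*" by simp
    then show "\<delta> \<in> circ \<gamma>"
    proof induction
      case base
      show ?case by (rule circ_self)
    next
      case (step \<delta> \<epsilon>)
      from step(2) consider "\<epsilon> = rot \<delta>" | "\<delta> = rot \<epsilon>" "\<epsilon> \<in> cycles G"
        by (auto simp: rotation_rel_def)
      then show ?case
      proof cases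
        case 1
        then show ?thesis using circ_rot[OF step(3), of 1] by simp
      next
        case 2
        \<comment> \<open>A backward step is the same as a suitable number of forward steps.\<close>
        obtain j where "(rot ^^ j) ((rot ^^ 1) \<epsilon>) = \<epsilon>" using rot_inverse[OF 2(2)] by metis
        then show ?thesis using circ_rot[OF step(3), of j] 2 by simp
      qed
    qed
  qed
  show "circ \<gamma> \<subseteq> ?R\<^sup>* `` {\<gamma>}"
  proof
    fix \<delta> assume "\<delta> \<in> circ \<gamma>"
    then obtain i where i: "\<delta> = (rot ^^ i) \<gamma>" by (rule circE)
    have "(\<gamma>, (rot ^^ i) \<gamma>) \<in> ?R\<^sup>*"
    proof (induction i)
      case (Suc i)
      have "((rot ^^ i) \<gamma>, (rot ^^ Suc i) \<gamma>) \<in> ?R"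
        unfolding rotation_rel_def
        by (intro UnI1 CollectI exI[of _ "(rot ^^ i) \<gamma>"]) (simp add: rot_funpow_cycles[OF assms])
      with Suc show ?case by (rule rtrancl_into_rtrancl)
    qed simp
    then show "\<delta> \<in> ?R\<^sup>* `` {\<gamma>}" using i by simp
  qed
qed

lemma circuits_eq: "circuits G = circ ` cycles G"
  unfolding circuits_def quotient_def using rotation_class by auto

lemma circ_eq_iff: "\<gamma> \<in> cycles G \<Longrightarrow> \<delta> \<in> cycles G \<Longrightarrow> circ \<delta> = circ \<gamma> \<longleftrightarrow> \<delta> \<in> circ \<gamma>"
  using circ_eq circ_self by blast

lemma circuit_eq_circ: "C \<in> circuits G \<Longrightarrow> \<gamma> \<in> C \<Longrightarrow> C = circ \<gamma> \<and> \<gamma> \<in> cycles G"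
  unfolding circuits_eq using circ_eq circ_cycles by blast

lemma trivial_circ:
  assumes "\<gamma> \<in> cycles G"
  shows "trivial_circuit G (circ \<gamma>) \<longleftrightarrow> snd \<gamma> = []"
proof
  assume "trivial_circuit G (circ \<gamma>)"
  then obtain v where "circ \<gamma> = {(v, [])}" unfolding trivial_circuit_def by metis
  then have "\<gamma> = (v, [])" using circ_self[of \<gamma>] by (metis singletonD)
  then show "snd \<gamma> = []" by simp
next
  assume t: "snd \<gamma> = []"
  obtain v es where \<gamma>: "\<gamma> = (v, es)" by (rule surj_pair[of \<gamma>, THEN exE]) metis
  have "circ \<gamma> \<subseteq> {\<gamma>}"
    by (rule subsetI) (erule circE, simp add: rot_trivial[OF t])
  then have "circ \<gamma> = {(v, [])}" using circ_self[of \<gamma>] t \<gamma>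
      by (metis empty_iff snd_conv subset_singletonD)
  moreover have "v \<in> verts G" using assms t by (simp add: \<gamma> cycles_iff)
  ultimately show "trivial_circuit G (circ \<gamma>)" unfolding trivial_circuit_def
      by (rule rev_bexI[rotated])
qed

text \<open>
  The cycles \<open>a\<beta>\<close> with \<open>a\<close> an arrow and \<open>\<beta>\<close> in \<open>B\<close>. As \<open>a\<close> is traversed last, it is the last
  entry of the list of arrows.
\<close>

definition gam :: "('v, 'e) qpath set" where
  "gam = {\<gamma> \<in> cycles G. snd \<gamma> \<noteq> [] \<and> nonzero_list (butlast (snd \<gamma>))}"

lemma gamD: "\<gamma> \<in> gam \<Longrightarrow> \<gamma> \<in> cycles G" "\<gamma> \<in> gam \<Longrightarrow> snd \<gamma> \<noteq> []"
  by (auto simp: gam_def)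

text \<open>Without its last arrow, \<delta> is an initial part of \<delta>, and the rotation of
  \<delta> is \<delta> without its first arrow; both are sublists of a nonzero list. These are the
  two cycles at which a one-cycle is compared.\<close>

lemma B_cycle_gam:
  assumes "\<delta> \<in> B" "\<delta> \<in> cycles G" "snd \<delta> \<noteq> []"
  shows "\<delta> \<in> gam" "rot \<delta> \<in> gam"
proof -
  have nz: "nonzero_list (snd \<delta>)" using assms by (simp add: nonzero_paths_iff)
  show "\<delta> \<in> gam" using assms nonzero_list_mono[OF nz, of "butlast (snd \<delta>)"]
    by (auto simp: gam_def intro: prefix_imp_sublist prefixeq_butlast)
  obtain a es where es: "snd \<delta> = a # es" using assms(3) by (cases "snd \<delta>") auto
  have "nonzero_list es" by (rule nonzero_list_mono[OF nz]) (simp add: es sublist_Cons_right)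
  then show "rot \<delta> \<in> gam" using rot_cycles[OF assms(2)] es by (auto simp: gam_def)
qed

text \<open>The order is that of the chain \<beta> \<otimes> a, opposite to that of the pair (a,
  \<beta>) in Q_1 \<odot> B.\<close>

definition arrow_split :: "('v, 'e) qpath \<Rightarrow> ('v, 'e) qpath \<times> ('v, 'e) qpath" where
  "arrow_split \<gamma> = ((fst \<gamma>, butlast (snd \<gamma>)), (tail G (last (snd \<gamma>)), [last (snd \<gamma>)]))"

lemma arrow_split_gam:
  assumes "\<gamma> \<in> gam"
  obtains v es a where "\<gamma> = (v, es @ [a])" "arrow_split \<gamma> = ((v, es), (tail G a, [a]))"
    "(v, es) \<in> B" "a \<in> arcs G" "ptarget G (v, es) = tail G a" "head G a = v"
proof -
  obtain v es a where \<gamma>: "\<gamma> = (v, es @ [a])" using gamD(2)[OF assms]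
      by (cases \<gamma>; cases "snd \<gamma>" rule: rev_cases) auto
  have "(v, es) \<in> paths G" "a \<in> arcs G" "ptarget G (v, es) = tail G a" "head G a = v"
    using gamD(1)[OF assms] by (auto simp: \<gamma> cycles_iff)
  moreover have "nonzero_list es" using assms by (simp add: gam_def \<gamma>)
  ultimately show thesis using that \<gamma> by (auto simp: arrow_split_def nonzero_paths_iff)
qed

lemma odot_arrow:
  "bij_betw (\<lambda>(\<alpha>, \<beta>). pcomp \<alpha> \<beta>) (odot G (arrow_paths G) B) gam"
proof (rule bij_betwI[where g = "\<lambda>\<gamma>. (snd (arrow_split \<gamma>), fst (arrow_split \<gamma>))"])
  show "(\<lambda>(\<alpha>, \<beta>). pcomp \<alpha> \<beta>) \<in> odot G (arrow_paths G) B \<rightarrow> gam"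
    by (auto simp: odot_def arrow_paths_def gam_def cycles_iff nonzero_paths_iff)
  show "(\<lambda>\<gamma>. (snd (arrow_split \<gamma>), fst (arrow_split \<gamma>))) \<in> gam \<rightarrow> odot G (arrow_paths G) B"
    by (auto simp: odot_def arrow_paths_def elim!: arrow_split_gam)
  show "(\<lambda>\<gamma>. (snd (arrow_split \<gamma>), fst (arrow_split \<gamma>))) ((\<lambda>(\<alpha>, \<beta>). pcomp \<alpha> \<beta>) p) = p"
    if "p \<in> odot G (arrow_paths G) B" for p
    using that by (auto simp: odot_def arrow_paths_def arrow_split_def)
  show "(\<lambda>(\<alpha>, \<beta>). pcomp \<alpha> \<beta>) (snd (arrow_split \<gamma>), fst (arrow_split \<gamma>)) = \<gamma>" if "\<gamma> \<in> gam" for \<gamma>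
    using that by (auto elim!: arrow_split_gam)
qed

lemma useful_iff: "useful G Z C \<longleftrightarrow> C \<inter> gam \<noteq> {}"
proof -
  have "odot_at G (arrow_paths G) B C = {p \<in> odot G (arrow_paths G) B. (\<lambda>(\<alpha>, \<beta>). pcomp \<alpha> \<beta>) p \<in> C}"
    by (auto simp: odot_at_def)
  then show ?thesis
    unfolding useful_def bij_betw_imp_surj_on[OF odot_arrow, symmetric] by blast
qed

text \<open>The set \<open>W\<close> in a form that fits rotation: the cycle is a zero path, but
  becomes nonzero when the arrow traversed last is removed. The identification is
  \<open>W_cycles_eq\<close>.\<close>

definition wset :: "('v, 'e) qpath set" where
  "wset = gam - B"

lemma wsetD:
  assumes "w \<in> wset"
  shows "w \<in> gam" "w \<in> cycles G" "snd w \<noteq> []" "w \<notin> B"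
  using assms gamD by (auto simp: wset_def)

text \<open>An occurrence of an element of \<open>Z\<close> that stopped before the last arrow would
  still be present in \<open>butlast\<close>.\<close>

lemma suffix_in_Z:
  assumes "\<gamma> \<in> wset"
  obtains \<zeta> v es where "\<zeta> \<in> Z" "\<gamma> = (v, es @ snd \<zeta>)" "composable G \<zeta> (v, es)" "\<gamma> = pcomp \<zeta> (v, es)"
      "(v, es) \<in> B"
proof -
  have \<gamma>: "\<gamma> \<in> gam" "\<gamma> \<notin> B" "\<gamma> \<in> paths G" using assms gamD(1) cycles_paths by (auto simp: wset_def)
  then obtain \<zeta> where \<zeta>: "\<zeta> \<in> Z" "sublist (snd \<zeta>) (snd \<gamma>)"
    by (auto simp: nonzero_paths_iff nonzero_list_def)
  then obtain xs ys where xs: "snd \<gamma> = xs @ snd \<zeta> @ ys" by (auto simp: sublist_def)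
  have nz: "nonzero_list (butlast (snd \<gamma>))" using \<gamma> by (simp add: gam_def)
  have "ys = []"
  proof (rule ccontr)
    assume "ys \<noteq> []"
    then have "butlast (snd \<gamma>) = xs @ snd \<zeta> @ butlast ys" by (simp add: xs butlast_append)
    then have "sublist (snd \<zeta>) (butlast (snd \<gamma>))" by (metis sublist_appendI)
    then show False using nz \<zeta>(1) by (auto simp: nonzero_list_def)
  qed
  then obtain v where v: "\<gamma> = (v, xs @ snd \<zeta>)" using xs by (cases \<gamma>) auto
  obtain a es where z: "\<zeta> = (tail G a, a # es)"
    using Z_path[OF \<zeta>(1)] by (cases \<zeta>; cases "snd \<zeta>") auto
  have comp: "composable G \<zeta> (v, xs)" using \<gamma>(3) unfolding v z by (auto simp: composable_iff)
  have "butlast (snd \<gamma>) = xs @ butlast (snd \<zeta>)" using Z_nonempty[OF \<zeta>(1)]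
      by (simp add: v butlast_append)
  then have "nonzero_list xs" using nonzero_list_mono[OF nz] by (metis sublist_appendI append_Nil)
  moreover have "(v, xs) \<in> paths G" using \<gamma>(3) v by simp
  ultimately show thesis
    using that[OF \<zeta>(1) v comp] by (simp add: v pcomp_def nonzero_paths_iff)
qed

lemma sublist_Z_eq:
  assumes "\<zeta> \<in> Z" "\<xi> \<in> Z" "sublist (snd \<xi>) (snd \<zeta>)"
  shows "\<xi> = \<zeta>"
  using relations assms
      subpath_iff_sublist[OF Z_path(1)[OF assms(2)] Z_nonempty[OF assms(2)] Z_path(1)[OF assms(1)]]
  by (auto simp: monomial_relations_def)

lemma suffix_append_cases: "xs @ ys = us @ vs \<Longrightarrow> sublist ys vs \<or> sublist vs ys"
  by (auto simp: append_eq_append_conv2 intro: suffix_imp_sublist suffixI)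

text \<open>In a cycle of \<open>gam\<close> every occurrence of an element of \<open>Z\<close> ends
  at the last arrow. Two of them are suffixes of the same list, so one contains the other, and
  minimality of \<open>Z\<close> makes them equal.\<close>

lemma W_cycles_eq: "W_cycles G Z = wset"
proof
  show "W_cycles G Z \<subseteq> wset"
  proof
    fix \<gamma> assume "\<gamma> \<in> W_cycles G Z"
    then have cyc: "\<gamma> \<in> cycles G" and "\<exists>\<xi>\<in>Z. \<exists>\<alpha>. composable G \<xi> \<alpha> \<and> \<gamma> = pcomp \<xi> \<alpha> \<and>
      (\<forall>\<zeta>\<in>Z. \<forall>(\<mu>, \<nu>) \<in> occurrences G \<zeta> \<gamma>. \<zeta> = \<xi> \<and> \<mu> = (ptarget G \<xi>, []) \<and> \<nu> = \<alpha>)"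
      unfolding W_cycles_def by blast+
    from this(2) obtain \<xi> \<alpha> where \<gamma>: "\<gamma> \<in> cycles G" "\<xi> \<in> Z" "composable G \<xi> \<alpha>" "\<gamma> = pcomp \<xi> \<alpha>"
      and u0: "\<forall>\<zeta>\<in>Z. \<forall>(\<mu>, \<nu>) \<in> occurrences G \<zeta> \<gamma>. \<zeta> = \<xi> \<and> \<mu> = (ptarget G \<xi>, []) \<and> \<nu> = \<alpha>"
      using cyc by (elim bexE exE conjE)
    have u: "\<mu> = (ptarget G \<xi>, [])" if "\<zeta> \<in> Z" "(\<mu>, \<nu>) \<in> occurrences G \<zeta> \<gamma>" for \<zeta> \<mu> \<nu>
      using bspec[OF bspec[OF u0 that(1)] that(2)] by simp
    have ne: "snd \<gamma> \<noteq> []" using \<gamma>(4) Z_nonempty[OF \<gamma>(2)] by (simp add: pcomp_def)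
    have "\<gamma> \<notin> B" using \<gamma>(2,4) by (auto simp: nonzero_paths_iff nonzero_list_def pcomp_def)
    moreover have "nonzero_list (butlast (snd \<gamma>))"
      unfolding nonzero_list_def
    proof (intro ballI notI)
      fix \<zeta> assume \<zeta>: "\<zeta> \<in> Z" "sublist (snd \<zeta>) (butlast (snd \<gamma>))"
      then obtain xs ys where xs: "butlast (snd \<gamma>) = xs @ snd \<zeta> @ ys" by (auto simp: sublist_def)
      then have "snd \<gamma> = xs @ snd \<zeta> @ ys @ [last (snd \<gamma>)]" using ne
          by (metis append.assoc append_butlast_last_id)
      then obtain v a where v: "\<gamma> = (v, xs @ snd \<zeta> @ ys @ [a])" by (cases \<gamma>) auto
      obtain b es where z: "\<zeta> = (tail G b, b # es)"
        using Z_path[OF \<zeta>(1)] by (cases \<zeta>; cases "snd \<zeta>") auto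
      have "((ptarget G \<zeta>, ys @ [a]), (v, xs)) \<in> occurrences G \<zeta> \<gamma>"
        using cycles_paths[OF \<gamma>(1)] unfolding v z by (auto simp: occurrences_def composable_iff)
      then have "(ptarget G \<zeta>, ys @ [a]) = (ptarget G \<xi>, [])" by (rule u[OF \<zeta>(1)])
      then show False by simp
    qed
    ultimately show "\<gamma> \<in> wset" using \<gamma>(1) ne by (simp add: wset_def gam_def)
  qed
  show "wset \<subseteq> W_cycles G Z"
  proof
    fix \<gamma> assume g: "\<gamma> \<in> wset"
    then have gg: "\<gamma> \<in> gam" by (simp add: wset_def)
    obtain \<xi> v es where x: "\<xi> \<in> Z" "\<gamma> = (v, es @ snd \<xi>)" "composable G \<xi> (v, es)"
        "\<gamma> = pcomp \<xi> (v, es)" "(v, es) \<in> B"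
      using g by (rule suffix_in_Z)
    have occ: "\<zeta> = \<xi> \<and> \<mu> = (ptarget G \<xi>, []) \<and> \<nu> = (v, es)"
        if \<zeta>: "\<zeta> \<in> Z" "(\<mu>, \<nu>) \<in> occurrences G \<zeta> \<gamma>" for \<zeta> \<mu> \<nu>
    proof -
      have o: "composable G \<zeta> \<nu>" "composable G \<mu> \<zeta>" "\<gamma> = pcomp \<mu> (pcomp \<zeta> \<nu>)"
        using \<zeta>(2) by (auto simp: occurrences_def)
      have l: "snd \<gamma> = snd \<nu> @ snd \<zeta> @ snd \<mu>" using o(3) by (simp add: pcomp_def)
      have "snd \<mu> = []"
      proof (rule ccontr)
        assume "snd \<mu> \<noteq> []"
        then have "butlast (snd \<gamma>) = snd \<nu> @ snd \<zeta> @ butlast (snd \<mu>)"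
            by (simp add: l butlast_append)
        then have "sublist (snd \<zeta>) (butlast (snd \<gamma>))" by (metis sublist_appendI)
        then show False using gg \<zeta>(1) by (auto simp: gam_def nonzero_list_def)
      qed
      then have \<mu>: "\<mu> = (ptarget G \<zeta>, [])" using o(2) by (cases \<mu>) (auto simp: composable_def)
      have eq: "snd \<nu> @ snd \<zeta> = es @ snd \<xi>" using l x(2) \<open>snd \<mu> = []\<close> by simp
      then have "\<zeta> = \<xi>" using suffix_append_cases sublist_Z_eq \<zeta>(1) x(1) by metis
      moreover from this have "\<nu> = (v, es)"
        using eq o(3) x(2) by (cases \<nu>) (auto simp: pcomp_def psource_def)
      ultimately show ?thesis using \<mu> by simp
    qed
    have "\<forall>\<zeta>\<in>Z. \<forall>(\<mu>, \<nu>) \<in> occurrences G \<zeta> \<gamma>. \<zeta> = \<xi> \<and> \<mu> = (ptarget G \<xi>, []) \<and> \<nu> = (v, es)"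
    proof (intro ballI case_prodI2)
      fix \<zeta> p \<mu> \<nu> assume "\<zeta> \<in> Z" "p \<in> occurrences G \<zeta> \<gamma>" "p = (\<mu>, \<nu>)"
      then show "\<zeta> = \<xi> \<and> \<mu> = (ptarget G \<xi>, []) \<and> \<nu> = (v, es)" using occ[of \<zeta> \<mu> \<nu>] by metis
    qed
    then show "\<gamma> \<in> W_cycles G Z"
      unfolding W_cycles_def
      by (intro CollectI conjI bexI[OF _ x(1)] exI[of _ "(v, es)"] x(3,4) gamD(1)[OF gg])
  qed
qed

text \<open>Rotate until \<open>B\<close> is left for the first time. The cycle reached is \<gamma>
  itself or the rotation of a cycle in \<open>B\<close>, hence still in \<open>gam\<close>.
  One-cycles are constant along such runs.\<close>

lemma reach_wset:
  assumes \<gamma>: "\<gamma> \<in> gam" and ns: "\<not> circ \<gamma> \<subseteq> B"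
  obtains i where "(rot ^^ i) \<gamma> \<in> wset" "\<And>j. j < i \<Longrightarrow> (rot ^^ j) \<gamma> \<in> B"
proof -
  define i where "i = (LEAST i. (rot ^^ i) \<gamma> \<notin> B)"
  have "\<exists>i. (rot ^^ i) \<gamma> \<notin> B" using ns by (auto elim!: circE)
  then have i: "(rot ^^ i) \<gamma> \<notin> B" unfolding i_def by (rule LeastI_ex)
  have j: "(rot ^^ j) \<gamma> \<in> B" if "j < i" for j using not_less_Least[OF that[unfolded i_def]] by simp
  have "(rot ^^ i) \<gamma> \<in> gam"
  proof (cases i)
    case (Suc j)
    have "rot ((rot ^^ j) \<gamma>) \<in> gam"
      by (rule B_cycle_gam(2)) (use j Suc gamD[OF \<gamma>] rot_funpow_cycles in auto)
    then show ?thesis using Suc by simp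
  qed (use \<gamma> in simp)
  then show thesis using that i j by (simp add: wset_def)
qed

text \<open>From a cycle of \<open>gam\<close> in a circuit that is not strong, rotation reaches
  \<open>W\<close>. Conversely, an element \<xi>\<alpha> of \<open>W\<close> lies in
  \<open>gam\<close> and outside \<open>B\<close>, and its factors form a pair in Z \<odot>
  B.\<close>

lemma efficient_iff:
  assumes C: "C \<in> circuits G"
  shows "efficient G Z C \<longleftrightarrow> C \<inter> wset \<noteq> {}"
proof
  assume "efficient G Z C"
  then obtain \<gamma> where g: "\<gamma> \<in> C" "\<gamma> \<in> gam" "\<not> C \<subseteq> B"
    unfolding efficient_def useful_iff strong_def by blast
  then have C: "C = circ \<gamma>" using circuit_eq_circ C by blast
  then obtain i where "(rot ^^ i) \<gamma> \<in> wset" using reach_wset g by metis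
  then show "C \<inter> wset \<noteq> {}" unfolding C using circI by blast
next
  assume "C \<inter> wset \<noteq> {}"
  then obtain w where w: "w \<in> C" "w \<in> wset" by blast
  from w(2) obtain \<xi> v es where x: "\<xi> \<in> Z" "w = (v, es @ snd \<xi>)" "composable G \<xi> (v, es)"
      "w = pcomp \<xi> (v, es)" "(v, es) \<in> B"
    by (rule suffix_in_Z)
  have "w \<in> cycles G" using w gamD by (simp add: wset_def)
  then have "(\<xi>, (v, es)) \<in> odot_at G Z B C"
    using x w(1) composable_pcomp[OF x(3)]
        by (auto simp: odot_at_def odot_def composable_def cycles_def)
  then show "efficient G Z C"
    unfolding efficient_def useful_iff strong_def using w by (auto simp: wset_def)
qed

lemma efficient_circuits_eq: "efficient_circuits G Z = circ ` wset"
proof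
  show "efficient_circuits G Z \<subseteq> circ ` wset"
  proof
    fix C assume "C \<in> efficient_circuits G Z"
    then have C: "C \<in> circuits G" "C \<inter> wset \<noteq> {}" using efficient_iff
        by (auto simp: efficient_circuits_def)
    then obtain w where "w \<in> C" "w \<in> wset" by blast
    then show "C \<in> circ ` wset" using circuit_eq_circ[OF C(1)] by blast
  qed
  show "circ ` wset \<subseteq> efficient_circuits G Z"
  proof
    fix C assume "C \<in> circ ` wset"
    then obtain w where w: "w \<in> wset" "C = circ w" by blast
    then have "C \<in> circuits G" "w \<in> C" using gamD(1) circ_self by (auto simp: wset_def circuits_eq)
    then show "C \<in> efficient_circuits G Z" using w efficient_iff
        by (auto simp: efficient_circuits_def)
  qed
qed

section \<open>Period and multiplicity\<close>

lemma period_props: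
  assumes "\<gamma> \<in> cycles G" "snd \<gamma> \<noteq> []"
  shows "0 < period G \<gamma>" "(rot ^^ period G \<gamma>) \<gamma> = \<gamma>" "0 < k \<Longrightarrow> (rot ^^ k) \<gamma> = \<gamma> \<Longrightarrow> period G \<gamma> \<le> k"
proof -
  let ?P = "\<lambda>l. 0 < l \<and> (rot ^^ l) \<gamma> = \<gamma>"
  have "?P (length (snd \<gamma>))" using assms rot_length by simp
  then have "?P (period G \<gamma>)" unfolding period_def by (rule LeastI)
  then show "0 < period G \<gamma>" "(rot ^^ period G \<gamma>) \<gamma> = \<gamma>" by auto
  show "0 < k \<Longrightarrow> (rot ^^ k) \<gamma> = \<gamma> \<Longrightarrow> period G \<gamma> \<le> k" unfolding period_def by (rule Least_le) simp
qed

text \<open>As rotation is injective on cycles, an equality between two different rotations with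
  indices below the period would cancel to a return of \<gamma> before its period.\<close>

lemma rot_eq_iff_mod:
  assumes \<gamma>: "\<gamma> \<in> cycles G" "snd \<gamma> \<noteq> []"
  shows "(rot ^^ i) \<gamma> = (rot ^^ j) \<gamma> \<longleftrightarrow> i mod period G \<gamma> = j mod period G \<gamma>"
proof -
  let ?l = "period G \<gamma>"
  note p = period_props[OF \<gamma>]
  have red: "(rot ^^ (i mod ?l)) \<gamma> = (rot ^^ i) \<gamma>" for i using p(2) by (rule funpow_mod_eq)
  have le: "i = j" if "(rot ^^ i) \<gamma> = (rot ^^ j) \<gamma>" "i \<le> j" "j < ?l" for i j
  proof (rule ccontr)
    assume "i \<noteq> j"
    have "(rot ^^ i) ((rot ^^ (j - i)) \<gamma>) = (rot ^^ i) \<gamma>"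
      using that by (metis comp_apply funpow_add le_add_diff_inverse)
    then have "(rot ^^ (j - i)) \<gamma> = \<gamma>" by (rule rot_inj[OF rot_funpow_cycles[OF \<gamma>(1)] \<gamma>(1)])
    then show False using p(3)[of "j - i"] that \<open>i \<noteq> j\<close> by simp
  qed
  show ?thesis
  proof
    assume "(rot ^^ i) \<gamma> = (rot ^^ j) \<gamma>"
    then have eq: "(rot ^^ (i mod ?l)) \<gamma> = (rot ^^ (j mod ?l)) \<gamma>" by (simp only: red)
    show "i mod ?l = j mod ?l"
      using le[OF eq] le[OF eq[symmetric]] p(1) by (metis mod_less_divisor nat_le_linear)
  next
    assume "i mod ?l = j mod ?l"
    then show "(rot ^^ i) \<gamma> = (rot ^^ j) \<gamma>" using red[of i] red[of j] by simp
  qed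
qed

lemma period_dvd_length: "\<gamma> \<in> cycles G \<Longrightarrow> snd \<gamma> \<noteq> [] \<Longrightarrow> period G \<gamma> dvd length (snd \<gamma>)"
  using rot_eq_iff_mod[of \<gamma> "length (snd \<gamma>)" 0] rot_length by auto

lemma period_circ:
  assumes "\<gamma> \<in> cycles G" "\<delta> \<in> circ \<gamma>"
  shows "period G \<delta> = period G \<gamma>"
proof -
  obtain i where i: "\<delta> = (rot ^^ i) \<gamma>" using assms(2) by (rule circE)
  have "(rot ^^ l) \<delta> = \<delta> \<longleftrightarrow> (rot ^^ l) \<gamma> = \<gamma>" for l
  proof -
    have "(rot ^^ l) \<delta> = (rot ^^ i) ((rot ^^ l) \<gamma>)"
      unfolding i by (metis add.commute comp_apply funpow_add)
    then show ?thesis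
      using rot_inj[OF rot_funpow_cycles[OF assms(1)] assms(1), of i l] i by metis
  qed
  then show ?thesis by (simp add: period_def)
qed

lemma multiplicity_circ:
  assumes "\<gamma> \<in> cycles G"
  shows "multiplicity G (circ \<gamma>) = length (snd \<gamma>) div period G \<gamma>"
proof -
  have "(SOME \<delta>. \<delta> \<in> circ \<gamma>) \<in> circ \<gamma>" using circ_self by (rule someI)
  then show ?thesis
    unfolding multiplicity_def Let_def plength_def using period_circ[OF assms] circ_length by metis
qed

text \<open>The n rotations pass n / l times through the l different cycles, where l is the period:
  the indices that give a fixed cycle are q l + (j mod l) with q < n / l. This count is the origin
  of the multiplicity in the boundaries.\<close>

lemma card_rotations:
  assumes \<gamma>: "\<gamma> \<in> cycles G" "snd \<gamma> \<noteq> []" and \<delta>: "\<delta> \<in> circ \<gamma>"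
  shows "card {i. i < length (snd \<gamma>) \<and> (rot ^^ i) \<gamma> = \<delta>} = multiplicity G (circ \<gamma>)"
proof -
  let ?l = "period G \<gamma>" and ?n = "length (snd \<gamma>)"
  obtain j where j: "\<delta> = (rot ^^ j) \<gamma>" using \<delta> by (rule circE)
  have n: "?n = ?n div ?l * ?l" using period_dvd_length[OF \<gamma>] by simp
  have l: "0 < ?l" by (rule period_props[OF \<gamma>])
  have "{i. i < ?n \<and> (rot ^^ i) \<gamma> = \<delta>} = (\<lambda>q. q * ?l + j mod ?l) ` {..<?n div ?l}"
    unfolding j rot_eq_iff_mod[OF \<gamma>]
  proof (intro equalityI subsetI)
    fix i assume i: "i \<in> {i. i < ?n \<and> i mod ?l = j mod ?l}"
    then have "i div ?l < ?n div ?l" using n l by (metis less_mult_imp_div_less mem_Collect_eq)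
    moreover have "i = i div ?l * ?l + j mod ?l" using i
        by (metis (mono_tags) div_mult_mod_eq mem_Collect_eq)
    ultimately show "i \<in> (\<lambda>q. q * ?l + j mod ?l) ` {..<?n div ?l}" by blast
  next
    fix i assume "i \<in> (\<lambda>q. q * ?l + j mod ?l) ` {..<?n div ?l}"
    then obtain q where q: "i = q * ?l + j mod ?l" "q < ?n div ?l" by blast
    have "Suc q * ?l \<le> ?n div ?l * ?l" using q(2) by (intro mult_le_mono1) simp
    then have "q * ?l + ?l \<le> ?n" using n by simp
    then show "i \<in> {i. i < ?n \<and> i mod ?l = j mod ?l}"
      using q(1) mod_less_divisor[OF l, of j] by simp
  qed
  moreover have "inj_on (\<lambda>q. q * ?l + j mod ?l) {..<?n div ?l}" using l by (auto intro: inj_onI)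
  ultimately show ?thesis by (simp add: card_image multiplicity_circ[OF \<gamma>(1)])
qed

lemma nontrivial_strong_eq:
  "nontrivial_strong_circuits G Z = circ ` {\<gamma> \<in> cycles G. snd \<gamma> \<noteq> [] \<and> circ \<gamma> \<subseteq> B}"
  unfolding nontrivial_strong_circuits_def circuits_eq strong_def using trivial_circ by blast

section \<open>Cardinalities for the two formulas\<close>

lemma finite_gam: "finite B \<Longrightarrow> finite gam"
proof -
  assume fin: "finite B"
  have "finite (odot G (arrow_paths G) B)"
    by (rule finite_subset[of _ "arrow_paths G \<times> B"]) (auto simp: odot_def arrow_paths_def fin)
  then show ?thesis using bij_betw_finite[OF odot_arrow] by blast
qed

lemma vertex_odot: "bij_betw snd (odot G (vertex_paths G) B) (B \<inter> cycles G)"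
proof (rule bij_betwI[where g = "\<lambda>\<beta>. ((fst \<beta>, []), \<beta>)"])
  show "snd \<in> odot G (vertex_paths G) B \<rightarrow> B \<inter> cycles G"
    by (auto simp: odot_def vertex_paths_def cycles_def nonzero_paths_iff)
  have "(v, es) \<in> paths G \<Longrightarrow> (v, []) \<in> vertex_paths G" for v es
    using psource_verts by (auto simp: vertex_paths_def)
  then show "(\<lambda>\<beta>. ((fst \<beta>, []), \<beta>)) \<in> B \<inter> cycles G \<rightarrow> odot G (vertex_paths G) B"
    by (auto simp: odot_def cycles_iff)
qed (auto simp: odot_def vertex_paths_def)

text \<open>The non trivial cycles in \<open>B\<close> are counted in both sets and cancel in the
  difference, which leaves |W| - |Q_0|.\<close>

lemma card_odot:
  assumes fin: "finite B"
  shows "card (odot G (arrow_paths G) B) = card wset + card (gam \<inter> B)"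
    and "card (odot G (vertex_paths G) B) = card (verts G) + card (gam \<inter> B)"
proof -
  have "card gam = card (gam - B) + card (gam \<inter> B)"
    using finite_gam[OF fin]
        by (metis Int_Diff_Un Int_Diff_disjoint add.commute card_Un_disjoint finite_Diff finite_Int)
  then show "card (odot G (arrow_paths G) B) = card wset + card (gam \<inter> B)"
    using bij_betw_same_card[OF odot_arrow] by (simp add: wset_def)
  have "B \<inter> cycles G = (\<lambda>v. (v, [])) ` verts G \<union> (gam \<inter> B)"
  proof (intro equalityI subsetI)
    fix \<gamma> assume g: "\<gamma> \<in> B \<inter> cycles G"
    show "\<gamma> \<in> (\<lambda>v. (v, [])) ` verts G \<union> (gam \<inter> B)"
    proof (cases "snd \<gamma> = []")
      case True
      then show ?thesis using g by (cases \<gamma>) (auto simp: cycles_iff)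
    next
      case False
      then show ?thesis using B_cycle_gam(1) g by blast
    qed
  next
    fix \<gamma> assume "\<gamma> \<in> (\<lambda>v. (v, [])) ` verts G \<union> (gam \<inter> B)"
    then show "\<gamma> \<in> B \<inter> cycles G" by (elim UnE) (auto simp: cycles_iff vertex_in_B dest: gamD(1))
  qed
  moreover have
      "card ((\<lambda>v. (v, [])) ` verts G \<union> (gam \<inter> B)) =
          card ((\<lambda>v. (v, [] :: 'e list)) ` verts G) + card (gam \<inter> B)"
    by (rule card_Un_disjoint) (use fin in \<open>auto dest: gamD(2)\<close>)
  moreover have "card ((\<lambda>v. (v, [] :: 'e list)) ` verts G) = card (verts G)"
    by (rule card_image) (auto intro: inj_onI)
  ultimately show "card (odot G (vertex_paths G) B) = card (verts G) + card (gam \<inter> B)"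
    using bij_betw_same_card[OF vertex_odot] by simp
qed

lemma sum_w_count:
  assumes fin: "finite B"
  shows "(\<Sum>C\<in>efficient_circuits G Z. w_count G Z C) = card wset"
proof -
  have fw: "finite wset" using finite_gam[OF fin] by (simp add: wset_def)
  have cyc: "w \<in> wset \<Longrightarrow> w \<in> cycles G" for w using gamD(1) by (simp add: wset_def)
  have "w_count G Z C = (\<Sum>w\<in>{w \<in> wset. circ w = C}. 1)" if CE: "C \<in> efficient_circuits G Z" for C
  proof -
    obtain v where v: "v \<in> wset" "C = circ v" using CE unfolding efficient_circuits_eq by blast
    have "wset \<inter> C = {w \<in> wset. circ w = C}"
      using v circ_eq_iff[OF cyc[OF v(1)] cyc] by auto
    then show ?thesis by (simp add: w_count_def W_cycles_eq)
  qed
  then have "(\<Sum>C\<in>efficient_circuits G Z. w_count G Z C) =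
      (\<Sum>C\<in>efficient_circuits G Z. \<Sum>w\<in>{w \<in> wset. circ w = C}. 1)"
    by (rule sum.cong[OF refl])
  also have "\<dots> = (\<Sum>w\<in>wset. 1)"
    by (rule sum.group) (auto simp: efficient_circuits_eq fw)
  finally show ?thesis by simp
qed

lemma rot_append:
  assumes "(v, xs @ ys) \<in> cycles G"
  shows "(rot ^^ length xs) (v, xs @ ys) = (ptarget G (v, xs), ys @ xs)"
proof (cases "xs @ ys = []")
  case False
  have "(ptarget G (v, xs), ys @ xs) \<in> paths G" using assms by (auto simp: cycles_iff)
  then show ?thesis
    using False
    by (intro path_eqI[OF cycles_paths[OF rot_funpow_cycles[OF assms]]]) (auto simp: rotate_append)
qed auto

end

text \<open>Cosets are replaced by an abstract basis with the multiplication table of paths: a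
  product of basis elements is the composed path if this exists and lies in \<open>B\<close>, and
  zero otherwise.\<close>

locale monomial_homology = monomial_quiver G Z + based_algebra A "nonzero_paths G Z" e coef
  for G :: "('v, 'e) pre_digraph" and Z and A :: "('k::field, 'a) module" and e and coef +
  assumes coef_mult: "b \<in> nonzero_paths G Z \<Longrightarrow> c \<in> nonzero_paths G Z \<Longrightarrow> x \<in> nonzero_paths G Z \<Longrightarrow>
    coef x (e b \<otimes>\<^bsub>A\<^esub> e c) = (if composable G b c \<and> pcomp b c = x then 1 else 0)"
begin

abbreviation FB :: "('k, ('v, 'e) qpath \<times> ('v, 'e) qpath \<Rightarrow> 'k) module" where
  "FB \<equiv> free_space (B \<times> B)"

abbreviation FG :: "('k, ('v, 'e) qpath \<Rightarrow> 'k) module" where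
  "FG \<equiv> free_space gam"

text \<open>The term ab \<otimes> c of the boundary formula, and in \<open>prod_right\<close> the
  term a \<otimes> bc, with value 0 if the product of the paths does not exist or vanishes in the
  algebra.\<close>

definition prod_left ::
    "('v, 'e) qpath \<Rightarrow> ('v, 'e) qpath \<Rightarrow> ('v, 'e) qpath \<Rightarrow> ('v, 'e) qpath \<times> ('v, 'e) qpath \<Rightarrow> 'k" where
  "prod_left a b c = (if composable G a b \<and> pcomp a b \<in> B then unit_fun (pcomp a b, c) else 0)"

definition prod_right ::
    "('v, 'e) qpath \<Rightarrow> ('v, 'e) qpath \<Rightarrow> ('v, 'e) qpath \<Rightarrow> ('v, 'e) qpath \<times> ('v, 'e) qpath \<Rightarrow> 'k" where
  "prod_right a b c = (if composable G b c \<and> pcomp b c \<in> B then unit_fun (a, pcomp b c) else 0)"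

lemma prod_carrier:
  assumes "a \<in> B" "c \<in> B"
  shows "prod_left b d c \<in> carrier FB" "prod_right a b d \<in> carrier FB"
  unfolding prod_left_def prod_right_def
  using assms by (auto intro!: unit_fun_in_free_space zero_in_free_space simp del: free_space_simps)

lemma two_boundary_eq:
  assumes "a \<in> B" "b \<in> B" "c \<in> B"
  shows "two_boundary a b c = prod_left a b c - prod_right a b c + prod_left c a b"
proof
  fix p :: "('v, 'e) qpath \<times> ('v, 'e) qpath"
  obtain x y where p: "p = (x, y)" by (cases p)
  show "two_boundary a b c p = (prod_left a b c - prod_right a b c + prod_left c a b) p"
  proof (cases "x \<in> B \<and> y \<in> B")
    case False
    then have "prod_left a' b' c' (x, y) = 0" "prod_right a' b' c' (x, y) = 0"
        if "a' \<in> B" "c' \<in> B" for a' b' c'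
      using that by (auto simp: prod_left_def prod_right_def unit_fun_def)
    then show ?thesis using False assms by (auto simp: p two_boundary_def)
  next
    case True
    then have xy: "x \<in> B" "y \<in> B" by auto
    have l: "prod_left a' b' c' (x, y) = (if y = c' then mu a' b' x else 0)"
        if "a' \<in> B" "b' \<in> B" for a' b' c'
      unfolding mu_def coef_mult[OF that xy(1)] using xy by (auto simp: prod_left_def unit_fun_def)
    have r: "prod_right a' b' c' (x, y) = (if x = a' then mu b' c' y else 0)"
        if "b' \<in> B" "c' \<in> B" for a' b' c'
      unfolding mu_def coef_mult[OF that xy(2)] using xy by (auto simp: prod_right_def unit_fun_def)
    have "two_boundary a b c (x, y) =
        (if y = c then mu a b x else 0) - (if x = a then mu b c y else 0) + (if y = b then mu c a x else 0)"
      unfolding two_boundary_def using True by simp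
    then show ?thesis
      unfolding p plus_fun_apply minus_apply l[OF assms(1,2)] l[OF assms(3,1)] r[OF assms(2,3)] .
  qed
qed

lemma two_boundary_memb: "a \<in> B \<Longrightarrow> b \<in> B \<Longrightarrow> c \<in> B \<Longrightarrow> two_boundary a b c \<in> one_boundaries"
  and one_boundaries_sub: "LinearCombinations.submodule class_ring one_boundaries FB"
proof -
  have gens: "{two_boundary a b c | a b c. a \<in> B \<and> b \<in> B \<and> c \<in> B} \<subseteq> carrier FB"
  proof safe
    fix a b c
    have "{p. two_boundary a b c p \<noteq> 0} \<subseteq> B \<times> B" by (auto simp: two_boundary_def split: if_splits)
    then show "two_boundary a b c \<in> carrier FB" using finite_B by (auto intro: finite_subset)
  qed
  note sp = span_class_ring[OF vectorspace_free_space gens, folded one_boundaries_def]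
  show "LinearCombinations.submodule class_ring one_boundaries FB" by (rule sp(1))
  show "a \<in> B \<Longrightarrow> b \<in> B \<Longrightarrow> c \<in> B \<Longrightarrow> two_boundary a b c \<in> one_boundaries" using sp(2) by blast
qed

lemma bnd_closed:
  "0 \<in> one_boundaries"
  "f \<in> one_boundaries \<Longrightarrow> g \<in> one_boundaries \<Longrightarrow> f + g \<in> one_boundaries"
  "f \<in> one_boundaries \<Longrightarrow> fscale c f \<in> one_boundaries"
  "f \<in> one_boundaries \<Longrightarrow> g \<in> one_boundaries \<Longrightarrow> f - g \<in> one_boundaries"
  "f \<in> one_boundaries \<Longrightarrow> f \<in> carrier FB"
proof -
  interpret Q: quotient_space FB one_boundaries
    by (intro quotient_space.intro quotient_space_axioms.intro vectorspace_free_space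
        one_boundaries_sub)
  show z: "0 \<in> one_boundaries" using Q.N_zero by simp
  show a: "f \<in> one_boundaries \<Longrightarrow> g \<in> one_boundaries \<Longrightarrow> f + g \<in> one_boundaries" for f g
    using Q.N_add[of f g] by simp
  show s: "f \<in> one_boundaries \<Longrightarrow> fscale c f \<in> one_boundaries" for c f
    using Q.N_smult[of f c] by simp
  have "f - g = f + fscale (- 1) g" for f g :: "('v, 'e) qpath \<times> ('v, 'e) qpath \<Rightarrow> 'k"
      by (auto simp: fun_eq_iff)
  then show "f \<in> one_boundaries \<Longrightarrow> g \<in> one_boundaries \<Longrightarrow> f - g \<in> one_boundaries" using a s by metis
  show "f \<in> one_boundaries \<Longrightarrow> f \<in> carrier FB" using Q.N_sub by blast
qed

text \<open>A rotation outside \<open>gam\<close> would be read as \<beta> \<otimes> a with a zero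
  path \<beta>, so it contributes 0.\<close>

definition uG :: "('v, 'e) qpath \<Rightarrow> ('v, 'e) qpath \<Rightarrow> 'k" where
  "uG \<gamma> = (if \<gamma> \<in> gam then unit_fun \<gamma> else 0)"

text \<open>
  \<open>psi\<close> reads the cycle \<open>a\<beta>\<close> as the chain \<open>\<beta> \<otimes> a\<close>. By the Leibniz rule, \<open>b \<otimes> a_l ... a_1\<close> is
  homologous to the sum over \<open>i\<close> of \<open>a_{i-1} ... a_1 b a_l ... a_{i+1} \<otimes> a_i\<close>, and \<open>phi\<close> records
  the corresponding rotations of the cycle \<open>b a_l ... a_1\<close>.
\<close>

definition psi :: "(('v, 'e) qpath \<Rightarrow> 'k) \<Rightarrow> ('v, 'e) qpath \<times> ('v, 'e) qpath \<Rightarrow> 'k" where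
  "psi = linear_ext (\<lambda>\<gamma>. unit_fun (arrow_split \<gamma>))"

text \<open>The arrows of \<open>c\<close> come first in the list of the cycle bc, so after
  \<open>i\<close> rotations the i-th arrow of \<open>c\<close> is the last entry; hence the range
  starts at 1. If \<open>c\<close> is a vertex, the sum is empty.\<close>

definition cyc_der :: "('v, 'e) qpath \<Rightarrow> ('v, 'e) qpath \<Rightarrow> ('v, 'e) qpath \<Rightarrow> 'k" where
  "cyc_der b c = (if ptarget G c = psource b \<and> ptarget G b = psource c
    then \<Sum>i\<in>{1..length (snd c)}. uG ((rot ^^ i) (pcomp b c)) else 0)"

definition phi :: "(('v, 'e) qpath \<times> ('v, 'e) qpath \<Rightarrow> 'k) \<Rightarrow> ('v, 'e) qpath \<Rightarrow> 'k" where
  "phi = linear_ext (\<lambda>(b, c). cyc_der b c)"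

lemma uG_carrier: "uG \<gamma> \<in> carrier FG"
  unfolding uG_def
      by (cases "\<gamma> \<in> gam")
          (simp_all only: if_True if_False unit_fun_in_free_space zero_in_free_space)

lemma if_in: "x \<in> S \<Longrightarrow> y \<in> S \<Longrightarrow> (if P then x else y) \<in> S"
  by simp

lemma cyc_der_carrier: "cyc_der b c \<in> carrier FG"
proof -
  have "(\<Sum>i\<in>{1..length (snd c)}. uG ((rot ^^ i) (pcomp b c))) \<in> carrier FG"
    by (rule sum_in_free_space) (rule uG_carrier)
  then show ?thesis
    unfolding cyc_der_def using zero_in_free_space by (rule if_in)
qed

lemma phi_linear: "is_linear FB FG phi"
  unfolding phi_def
      by (rule is_linear_linear_ext) (auto intro: cyc_der_carrier simp del: free_space_simps)

lemma arrow_split_B: "\<gamma> \<in> gam \<Longrightarrow> arrow_split \<gamma> \<in> B \<times> B"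
  by (erule arrow_split_gam) (simp add: arrow_in_B)

lemma psi_linear: "is_linear FG FB psi"
  unfolding psi_def by (rule is_linear_linear_ext) (intro unit_fun_in_free_space arrow_split_B)

lemma phi_unit: "phi (unit_fun (b, c)) = cyc_der b c"
  by (simp add: phi_def)

lemma psi_unit: "psi (unit_fun \<gamma>) = unit_fun (arrow_split \<gamma>)"
  by (simp add: psi_def)

lemma phi_simps:
  "phi 0 = 0" "f \<in> carrier FB \<Longrightarrow> g \<in> carrier FB \<Longrightarrow> phi (f + g) = phi f + phi g"
  "f \<in> carrier FB \<Longrightarrow> g \<in> carrier FB \<Longrightarrow> phi (f - g) = phi f - phi g"
  "phi (fscale c f) = fscale c (phi f)"
  unfolding phi_def
      by (rule linear_ext_zero, erule (1) linear_ext_simps, erule (1) linear_ext_simps, rule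
          linear_ext_fscale)

lemma psi_simps:
  "psi 0 = 0" "f \<in> carrier FG \<Longrightarrow> g \<in> carrier FG \<Longrightarrow> psi (f + g) = psi f + psi g"
  "f \<in> carrier FG \<Longrightarrow> g \<in> carrier FG \<Longrightarrow> psi (f - g) = psi f - psi g"
  "psi (fscale c f) = fscale c (psi f)"
  "(\<And>i. i \<in> J \<Longrightarrow> h i \<in> carrier FG) \<Longrightarrow> psi (\<Sum>i\<in>J. h i) = (\<Sum>i\<in>J. psi (h i))"
  unfolding psi_def
  by (rule linear_ext_zero, erule (1) linear_ext_simps, erule (1) linear_ext_simps, rule
      linear_ext_fscale,
      rule linear_ext_sum)

text \<open>The last arrow after \<open>i\<close> rotations belongs to \<open>xs\<close>, so
  \<open>ys\<close> stays intact when that arrow is removed.\<close>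

lemma uG_zero:
  assumes "snd \<gamma> = xs @ ys" "1 \<le> i" "i \<le> length xs" "\<not> nonzero_list ys"
  shows "uG ((rot ^^ i) \<gamma>) = 0"
proof -
  have t: "take i xs \<noteq> []" using assms by auto
  have "xs @ ys = take i xs @ drop i xs @ ys" by (metis append.assoc append_take_drop_id)
  moreover have "length (take i xs) = i" using assms by simp
  ultimately have "snd ((rot ^^ i) \<gamma>) = rotate (length (take i xs)) (take i xs @ drop i xs @ ys)"
    using assms(1) by (simp only: snd_rot_funpow)
  also have "\<dots> = drop i xs @ ys @ take i xs" by (simp only: rotate_append append.assoc)
  finally have "butlast (snd ((rot ^^ i) \<gamma>)) = drop i xs @ ys @ butlast (take i xs)"
    using t by (simp only: butlast_append append_is_Nil_conv if_False simp_thms)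
  then have "sublist ys (butlast (snd ((rot ^^ i) \<gamma>)))" by (metis sublist_appendI)
  then have "(rot ^^ i) \<gamma> \<notin> gam" using nonzero_list_mono assms(4) unfolding gam_def by blast
  then show ?thesis by (simp add: uG_def)
qed

end

section \<open>Reduction to functions on cycles\<close>

lemma zero_diff_zero_diff: "0 - (0 - x) = (x :: 'c::ab_group_add)"
  by simp

lemma fscale_add: "fscale c (f + g) = fscale c f + fscale (c :: 'k::semiring) g"
  by (simp add: fun_eq_iff algebra_simps)

text \<open>Used with x = b \<otimes> ac, p = ba \<otimes> c, t = cb \<otimes> a and s the sum over
  the arrows of \<open>c\<close>: the first bracket is the induction hypothesis for ba \<otimes> c,
  the second the boundary of b \<otimes> a \<otimes> c.\<close>

lemma leibniz_arith: "x - (s + t) = (p - s) - (p - x + t)" for x s t p :: "'c::ab_group_add"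
  by (simp add: algebra_simps)

context monomial_homology begin

text \<open>Induction on the list from its end: the boundary of b \<otimes> a \<otimes> c trades b
  \<otimes> ac for ba \<otimes> c + cb \<otimes> a, and the last term is the summand for the arrow
  \<open>a\<close>. The path itself may be zero provided that it is nonzero without its last arrow;
  this makes the rule available for elements of \<open>Z\<close>.\<close>

lemma leibniz:
  assumes "b \<in> B" "(v, cs) \<in> paths G" "cs \<noteq> []" "nonzero_list (butlast cs)"
    and "ptarget G (v, cs) = psource b" "ptarget G b = v"
  shows "(if (v, cs) \<in> B then unit_fun (b, (v, cs)) else 0)
    - (\<Sum>i\<in>{1..length cs}. psi (uG ((rot ^^ i) (pcomp b (v, cs))))) \<in> one_boundaries"
  using assms
proof (induction cs arbitrary: b rule: rev_induct)
  case (snoc a cs)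
  obtain w bs where b: "b = (w, bs)" by (cases b)
  let ?a = "(tail G a, [a])" and ?c = "(v, cs)" and ?\<gamma> = "(v, cs @ [a] @ bs)"
  have c: "(v, cs) \<in> paths G" "a \<in> arcs G" "ptarget G (v, cs) = tail G a" "head G a = w"
      "nonzero_list cs"
    "(w, bs) \<in> paths G" "nonzero_list bs" "ptarget G (w, bs) = v"
    using snoc.prems by (auto simp: b nonzero_paths_iff)
  have aB: "?a \<in> B" using arrow_in_B c(2) .
  have cB: "?c \<in> B" using c by (simp add: nonzero_paths_iff)
  have cyc: "?\<gamma> \<in> cycles G" using c by (auto simp: cycles_iff)
  let ?g = "\<lambda>i. psi (uG ((rot ^^ i) ?\<gamma>))"
  have pc: "pcomp b (v, cs @ [a]) = ?\<gamma>" by (simp add: b)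
  have "(rot ^^ length (cs @ [a])) (v, (cs @ [a]) @ bs) =
      (ptarget G (v, cs @ [a]), bs @ (cs @ [a]))"
    by (rule rot_append) (use cyc in simp)
  then have r: "(rot ^^ Suc (length cs)) ?\<gamma> = (w, (bs @ cs) @ [a])" using c by simp
  \<comment> \<open>The index is one more than \<open>length cs\<close>: all arrows of
    \<open>cs\<close> and finally \<open>a\<close> have been rotated to the end.\<close>
  have last: "?g (Suc (length cs)) = prod_left ?c b ?a"
  proof -
    have "(w, (bs @ cs) @ [a]) \<in> cycles G" using rot_funpow_cycles[OF cyc, of "Suc (length cs)"]
        unfolding r .
    then have "(w, (bs @ cs) @ [a]) \<in> gam \<longleftrightarrow> nonzero_list (bs @ cs)"
      unfolding gam_def
          by (simp only: mem_Collect_eq snd_conv butlast_snoc snoc_eq_iff_butlast simp_thms)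
    moreover have "composable G ?c b" "pcomp ?c b = (w, bs @ cs)" using c
        by (auto simp: b composable_iff)
    moreover have "(w, bs @ cs) \<in> B \<longleftrightarrow> nonzero_list (bs @ cs)" using c
        by (simp add: nonzero_paths_iff)
    moreover have "arrow_split (w, (bs @ cs) @ [a]) = ((w, bs @ cs), ?a)"
      by (simp only: arrow_split_def fst_conv snd_conv butlast_snoc last_snoc)
    ultimately show ?thesis
      unfolding r uG_def prod_left_def
          by (cases "nonzero_list (bs @ cs)")
              (simp_all only: if_True if_False simp_thms psi_unit psi_simps(1))
  qed
  have right: "prod_right b ?a ?c = (if (v, cs @ [a]) \<in> B then unit_fun (b, (v, cs @ [a])) else 0)"
  proof -
    have "composable G ?a ?c" "pcomp ?a ?c = (v, cs @ [a])" using c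
        by (auto simp: composable_iff intro: head_in_verts)
    then show ?thesis unfolding prod_right_def by (simp only: simp_thms)
  qed
  have sum: "(\<Sum>i\<in>{1..length (cs @ [a])}. psi (uG ((rot ^^ i) (pcomp b (v, cs @ [a]))))) =
    (\<Sum>i\<in>{1..length cs}. ?g i) + ?g (Suc (length cs))"
    unfolding pc by simp
  have tb: "prod_left b ?a ?c - prod_right b ?a ?c + prod_left ?c b ?a \<in> one_boundaries"
    using two_boundary_memb[OF snoc.prems(1) aB cB]
        unfolding two_boundary_eq[OF snoc.prems(1) aB cB] .
  show ?case
  proof (cases "cs = []")
    \<comment> \<open>The path is the single arrow \<open>a\<close>. Its only summand is b \<otimes>
      a itself, so the difference is zero.\<close>
    case True
    have v: "v = tail G a" using c True by simp
    have "prod_left ?c b ?a = unit_fun (b, ?a)"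
      using c snoc.prems(1) by (simp add: prod_left_def True b composable_iff)
    moreover have
        "(if (v, cs @ [a]) \<in> B then unit_fun (b, (v, cs @ [a])) else 0) = (unit_fun (b, ?a) :: _ \<Rightarrow>
            'k)"
      using aB v True by simp
    moreover have "(\<Sum>i\<in>{1..length cs}. ?g i) = 0" using True by simp
    ultimately show ?thesis
      unfolding sum last by (simp only: add_0_left diff_self bnd_closed(1))
  next
    case False
    have left: "prod_left b ?a ?c - (\<Sum>i\<in>{1..length cs}. ?g i) \<in> one_boundaries"
    proof (cases "nonzero_list (a # bs)")
      case True
      then have ba: "(tail G a, a # bs) \<in> B" using c by (simp add: nonzero_paths_iff)
      have "prod_left b ?a ?c = unit_fun ((tail G a, a # bs), ?c)"
        using c ba by (simp add: prod_left_def b composable_iff)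
      moreover have "(if (v, cs) \<in> B then unit_fun ((tail G a, a # bs), (v, cs)) else 0)
        - (\<Sum>i\<in>{1..length cs}. psi (uG ((rot ^^ i) (pcomp (tail G a, a # bs) (v, cs))))) \<in> one_boundaries"
      proof (rule snoc.IH[OF ba c(1) False])
        show "nonzero_list (butlast cs)"
          using c(5) by (rule nonzero_list_mono) (simp add: prefix_imp_sublist prefixeq_butlast)
      qed (use c in auto)
      ultimately show ?thesis using cB by simp
    next
      \<comment> \<open>Here ba = 0. The term ba \<otimes> c vanishes, and so do the summands for
        the arrows of \<open>c\<close>, since each of them contains ba before its last
        arrow.\<close>
      case F: False
      then have "(tail G a, a # bs) \<notin> B" by (simp add: nonzero_paths_iff)
      then have "prod_left b ?a ?c = 0" by (simp add: prod_left_def b)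
      moreover have "(\<Sum>i\<in>{1..length cs}. ?g i) = 0"
      proof (rule sum.neutral, rule ballI)
        fix i assume "i \<in> {1..length cs}"
        then have "uG ((rot ^^ i) ?\<gamma>) = 0"
          by (intro uG_zero[of _ cs "[a] @ bs"]) (use F in auto)
        then show "?g i = 0" by (simp only: psi_simps(1))
      qed
      ultimately show ?thesis using bnd_closed(1) by simp
    qed
    show ?thesis
      unfolding sum last right[symmetric]
      unfolding leibniz_arith[of "prod_right b ?a ?c" _ _ "prod_left b ?a ?c"]
      by (rule bnd_closed(4)[OF left tb])
  qed
qed simp

text \<open>The rotations repeat with the period, so this is m(C) times the indicator function of
  the part of the circuit in \<open>gam\<close>; see \<open>cyc_sum_apply\<close>.\<close>

definition cyc_sum :: "('v, 'e) qpath \<Rightarrow> ('v, 'e) qpath \<Rightarrow> 'k" where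
  "cyc_sum \<gamma> = (\<Sum>i\<in>{1..length (snd \<gamma>)}. uG ((rot ^^ i) \<gamma>))"

lemma cyc_sum_apply:
  assumes \<gamma>: "\<gamma> \<in> cycles G" "snd \<gamma> \<noteq> []"
  shows "cyc_sum \<gamma> \<delta> = (if \<delta> \<in> circ \<gamma> \<and> \<delta> \<in> gam then of_nat (multiplicity G (circ \<gamma>)) else 0)"
proof -
  let ?n = "length (snd \<gamma>)" and ?r = "rot \<gamma>"
  have r: "?r \<in> cycles G" "snd ?r \<noteq> []" "length (snd ?r) = ?n" using \<gamma> rot_cycles by auto
  have cr: "circ ?r = circ \<gamma>" using circ_eq[OF \<gamma>(1)] circI[of 1 \<gamma>] by simp
  have "cyc_sum \<gamma> \<delta> = (\<Sum>i\<in>{1..?n}. uG ((rot ^^ i) \<gamma>) \<delta>)" by (simp add: cyc_sum_def fun_sum_apply)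
  \<comment> \<open>Counting from 0 at the rotation of \<gamma> instead of from 1 at \<gamma> gives
    the range that \<open>card_rotations\<close> uses.\<close>
  also have "\<dots> = (\<Sum>i\<in>{..<?n}. uG ((rot ^^ Suc i) \<gamma>) \<delta>)"
    by (rule sum.reindex_bij_witness[of _ Suc "\<lambda>i. i - 1"]) auto
  also have "\<dots> = (\<Sum>i\<in>{..<?n}. if (rot ^^ i) ?r = \<delta> \<and> \<delta> \<in> gam then 1 else 0)"
    by (rule sum.cong) (auto simp: uG_def unit_fun_def funpow_swap1)
  also have "\<dots> = (if \<delta> \<in> gam then of_nat (card {i. i < ?n \<and> (rot ^^ i) ?r = \<delta>}) else 0)"
    by (simp add: sum.If_cases Int_def conj_commute)
  also have "\<dots> = (if \<delta> \<in> circ \<gamma> \<and> \<delta> \<in> gam then of_nat (multiplicity G (circ \<gamma>)) else 0)"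
  proof (cases "\<delta> \<in> circ \<gamma>")
    case True
    then show ?thesis using card_rotations[OF r(1,2)] by (simp add: cr r(3))
  next
    case False
    then have "{i. i < ?n \<and> (rot ^^ i) ?r = \<delta>} = {}" using circI[of _ ?r] cr by auto
    then have c0: "card {i. i < ?n \<and> (rot ^^ i) ?r = \<delta>} = 0" by (simp only: card.empty)
    show ?thesis using False by (simp only: c0 simp_thms if_False of_nat_0 if_cancel)
  qed
  finally show ?thesis .
qed

lemma phi_prod_left:
  assumes "c \<in> B"
  shows "phi (prod_left a b c) =
      (if composable G a b \<and> pcomp a b \<in> B then cyc_der (pcomp a b) c else 0)"
  unfolding prod_left_def
  by (simp only: if_distrib[of phi] phi_unit phi_simps(1))

lemma phi_prod_right:
  "phi (prod_right a b c) = (if composable G b c \<and> pcomp b c \<in> B then cyc_der a (pcomp b c) else 0)"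
  unfolding prod_right_def
  by (simp only: if_distrib[of phi] phi_unit phi_simps(1))

text \<open>If abc is not a cycle, all three terms vanish. Otherwise ab \<otimes> c and ca \<otimes>
  b give the rotations that end in an arrow of \<open>c\<close> and of \<open>b\<close>,
  respectively. If bc is nonzero, a \<otimes> bc gives both kinds together and everything cancels.
  If bc = 0, this middle term drops out and the other two add up to the full
  \<open>cyc_sum\<close>.\<close>

lemma phi_two_boundary:
  assumes a: "a \<in> B" and b: "b \<in> B" and c: "c \<in> B"
  shows "phi (two_boundary a b c) = 0 \<or>
    (\<exists>\<gamma>\<in>cycles G. snd \<gamma> \<noteq> [] \<and> \<gamma> \<notin> B \<and> phi (two_boundary a b c) = cyc_sum \<gamma>)"
proof -
  let ?X1 = "phi (prod_left a b c)" and ?X2 = "phi (prod_right a b c)" and ?X3 =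
      "phi (prod_left c a b)"
  have eq: "phi (two_boundary a b c) = ?X1 - ?X2 + ?X3"
    unfolding two_boundary_eq[OF a b c]
    using prod_carrier(1)[OF a c, of a b] prod_carrier(1)[OF c b, of c a]
        prod_carrier(2)[OF a c, of b c] prod_carrier
    by (metis a b c free_space_closed(2) phi_simps(2,3))
  obtain va as vb bs vc cs where abc: "a = (va, as)" "b = (vb, bs)" "c = (vc, cs)"
    by (cases a; cases b; cases c)
  have P: "a \<in> paths G" "b \<in> paths G" "c \<in> paths G" using a b c by (auto simp: nonzero_paths_iff)
  let ?cyc = "ptarget G c = vb \<and> ptarget G b = va \<and> ptarget G a = vc"
  show ?thesis
  proof (cases ?cyc)
    case False
    have "?X1 = 0" unfolding phi_prod_left[OF c] using False
        by (auto simp: cyc_der_def abc composable_iff)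
    moreover have "?X2 = 0" unfolding phi_prod_right using False
        by (auto simp: cyc_der_def abc composable_iff)
    moreover have "?X3 = 0" unfolding phi_prod_left[OF b] using False
        by (auto simp: cyc_der_def abc composable_iff)
    ultimately show ?thesis unfolding eq by simp
  next
    case True
    let ?\<gamma> = "(vc, cs @ bs @ as)"
    have comp: "composable G a b" "composable G b c" "composable G c a" using True P
        by (auto simp: abc composable_iff)
    have T: "ptarget G (vc, cs) = vb" "ptarget G (vb, bs) = va" "ptarget G (va, as) = vc" using True
        by (simp_all add: abc)
    have cyc: "?\<gamma> \<in> cycles G" using P T by (auto simp: abc cycles_iff)
    let ?g = "\<lambda>i. uG ((rot ^^ i) ?\<gamma>)"
    let ?m = "length cs" and ?n = "length bs"
    have r1: "(rot ^^ ?m) ?\<gamma> = (vb, bs @ as @ cs)"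
      using rot_append[of vc cs "bs @ as"] cyc T by simp
    have r2: "(rot ^^ (?m + ?n)) ?\<gamma> = (va, as @ cs @ bs)"
      using rot_append[of vc "cs @ bs" as] cyc T by simp
    have X1: "?X1 = (\<Sum>i\<in>{1..?m}. ?g i)"
    proof (cases "pcomp a b \<in> B")
      case True
      then show ?thesis unfolding phi_prod_left[OF c] using comp T by (simp add: cyc_der_def abc)
    next
      \<comment> \<open>If ab = 0, the sum on the right vanishes too, because ab stays intact in
        every rotation that ends in an arrow of \<open>c\<close>.\<close>
      case False
      then have "\<not> nonzero_list (bs @ as)" using comp composable_pcomp(1)[OF comp(1)]
          by (simp add: nonzero_paths_iff abc)
      then have "(\<Sum>i\<in>{1..?m}. ?g i) = 0"
        by (intro sum.neutral ballI uG_zero[of _ cs "bs @ as"]) auto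
      then show ?thesis unfolding phi_prod_left[OF c] using False by simp
    qed
    have X3: "?X3 = (\<Sum>i\<in>{?m + 1..?m + ?n}. ?g i)"
    proof -
      have sh: "(\<Sum>i\<in>{?m + 1..?m + ?n}. ?g i) = (\<Sum>i\<in>{1..?n}. uG ((rot ^^ i) (vb, bs @ as @ cs)))"
        using sum.shift_bounds_cl_nat_ivl[of ?g 1 ?m ?n] by (simp add: funpow_add r1 add.commute)
      show ?thesis
      proof (cases "pcomp c a \<in> B")
        case True
        then show ?thesis unfolding phi_prod_left[OF b] sh using comp T
            by (simp add: cyc_der_def abc)
      next
        case False
        then have "\<not> nonzero_list (as @ cs)" using comp composable_pcomp(1)[OF comp(3)]
            by (simp add: nonzero_paths_iff abc)
        then have "(\<Sum>i\<in>{1..?n}. uG ((rot ^^ i) (vb, bs @ as @ cs))) = 0"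
          by (intro sum.neutral ballI uG_zero[of _ bs "as @ cs"]) auto
        then show ?thesis unfolding phi_prod_left[OF b] sh using False by simp
      qed
    qed
    have X13: "?X1 + ?X3 = (\<Sum>i\<in>{1..?m + ?n}. ?g i)"
      unfolding X1 X3 using sum.ub_add_nat[of 1 ?m ?g ?n] by simp
    show ?thesis
    proof (cases "pcomp b c \<in> B")
      case True
      then have "?X2 = (\<Sum>i\<in>{1..?m + ?n}. ?g i)"
        unfolding phi_prod_right using comp T by (simp add: cyc_der_def abc)
      then have "phi (two_boundary a b c) = 0" unfolding eq X13[symmetric]
          by (simp add: algebra_simps)
      then show ?thesis ..
    next
      case False
      then have nz: "\<not> nonzero_list (cs @ bs)" using comp composable_pcomp(1)[OF comp(2)]
          by (simp add: nonzero_paths_iff abc)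
      have X2: "?X2 = 0" unfolding phi_prod_right using False by simp
      \<comment> \<open>The rotations that end in an arrow of \<open>a\<close> contain bc before it
        and contribute nothing; including them completes the sum to all rotations.\<close>
      have "(\<Sum>i\<in>{?m + ?n + 1..?m + ?n + length as}. ?g i) =
          (\<Sum>i\<in>{1..length as}. uG ((rot ^^ i) (va, as @ cs @ bs)))"
        using sum.shift_bounds_cl_nat_ivl[of ?g 1 "?m + ?n" "length as"]
        by (simp add: r2[symmetric] funpow_add[symmetric] comp_apply[of "rot ^^ _" "rot ^^ _",
            symmetric] add_ac del: comp_apply)
      also have "\<dots> = 0"
        using nz by (intro sum.neutral ballI uG_zero[of _ as "cs @ bs"]) auto
      finally have "cyc_sum ?\<gamma> = ?X1 + ?X3"
        unfolding X13 cyc_sum_def using sum.ub_add_nat[of 1 "?m + ?n" ?g "length as"]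
            by (simp add: add.assoc)
      then have "phi (two_boundary a b c) = cyc_sum ?\<gamma>" unfolding eq X2 by simp
      moreover have "?\<gamma> \<notin> B"
        using nz nonzero_list_mono[of "cs @ bs @ as" "cs @ bs"]
        by (auto simp: nonzero_paths_iff simp flip: append_assoc)
      moreover have "cs @ bs \<noteq> []" using False vertex_in_B P c b by (auto simp: abc)
      ultimately show ?thesis using cyc by (intro disjI2 bexI[of _ ?\<gamma>]) auto
    qed
  qed
qed

text \<open>
  If \<open>a\<close> is not a cycle and \<open>v\<close> is its source, then the differential maps \<open>a \<otimes> v\<close> to \<open>a\<close>.
  This forces the coefficient of \<open>a \<otimes> v\<close> in a reduced one-cycle to vanish.
\<close>

definition noncycle_pairs :: "(('v, 'e) qpath \<times> ('v, 'e) qpath) set" where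
  "noncycle_pairs = {(a, (psource a, [])) | a. a \<in> B \<and> a \<notin> cycles G}"

lemma source_in_B: "a \<in> B \<Longrightarrow> (psource a, []) \<in> B" "a \<in> B \<Longrightarrow> (ptarget G a, []) \<in> B"
proof -
  assume "a \<in> B"
  moreover obtain v es where "a = (v, es)" by (cases a)
  ultimately have "(v, es) \<in> paths G" "a = (v, es)" by (simp_all add: nonzero_paths_iff)
  then show "(psource a, []) \<in> B" "(ptarget G a, []) \<in> B"
    using vertex_in_B[OF psource_verts] vertex_in_B[OF ptarget_verts] by auto
qed

lemma noncycle_pairs_sub: "noncycle_pairs \<subseteq> B \<times> B"
  using source_in_B by (auto simp: noncycle_pairs_def)

lemma prod_with_vertex:
  assumes "a \<in> B"
  shows "prod_left a (v, []) c = (if v = psource a then unit_fun (a, c) else 0)"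
    "prod_left (v, []) a c = (if v = ptarget G a then unit_fun (a, c) else 0)"
    "prod_right c a (v, []) = (if v = psource a then unit_fun (c, a) else 0)"
    "prod_right c (v, []) a = (if v = ptarget G a then unit_fun (c, a) else 0)"
proof -
  obtain w as where a: "a = (w, as)" by (cases a)
  have "(w, as) \<in> paths G" using assms by (simp add: a nonzero_paths_iff)
  then show "prod_left a (v, []) c = (if v = psource a then unit_fun (a, c) else 0)"
    "prod_left (v, []) a c = (if v = ptarget G a then unit_fun (a, c) else 0)"
    "prod_right c a (v, []) = (if v = psource a then unit_fun (c, a) else 0)"
    "prod_right c (v, []) a = (if v = ptarget G a then unit_fun (c, a) else 0)"
    using assms psource_verts[of w as] by (auto simp: prod_left_def prod_right_def a composable_iff)
qed

text \<open>If \<open>b\<close> and \<open>c\<close> form a cycle, this is the Leibniz rule, except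
  when \<open>c\<close> is a vertex, where b \<otimes> c is the boundary of b \<otimes> c \<otimes>
  c. If they do not form a cycle, a boundary with an added vertex replaces b \<otimes> c by the
  product bc or cb, if nonzero, paired with a vertex; such a product is not a cycle.\<close>

lemma decomposition_unit:
  assumes b: "b \<in> B" and c: "c \<in> B"
  shows "\<exists>i h. i \<in> one_boundaries \<and> h \<in> carrier (free_space noncycle_pairs) \<and>
    unit_fun (b, c) = i + psi (cyc_der b c) + h"
proof -
  have z: "(0 :: _ \<Rightarrow> 'k) \<in> carrier (free_space noncycle_pairs)" by (rule zero_in_free_space)
  have neg: "- f \<in> one_boundaries" if "f \<in> one_boundaries" for f
    using bnd_closed(4)[OF bnd_closed(1) that] by simp
  consider (cyc) "ptarget G c = psource b" "ptarget G b = psource c" "snd c \<noteq> []"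
    | (vertex) "ptarget G c = psource b" "ptarget G b = psource c" "snd c = []"
    | (bc) "ptarget G b \<noteq> psource c" | (cb) "ptarget G b = psource c" "ptarget G c \<noteq> psource b"
        by blast
  then show ?thesis
  proof cases
    case cyc
    obtain v cs where vc: "c = (v, cs)" by (cases c)
    have "nonzero_list (butlast cs)"
      by (rule nonzero_list_mono[of cs])
          (use c in \<open>auto simp: vc nonzero_paths_iff prefix_imp_sublist prefixeq_butlast\<close>)
    then have "unit_fun (b, c) -
        (\<Sum>i\<in>{1..length cs}. psi (uG ((rot ^^ i) (pcomp b c)))) \<in> one_boundaries"
      using leibniz[OF b, of v cs] c cyc by (simp add: vc nonzero_paths_iff)
    moreover have "cyc_der b c = (\<Sum>i\<in>{1..length cs}. uG ((rot ^^ i) (pcomp b c)))"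
      using cyc by (simp add: cyc_der_def vc)
    then have "(\<Sum>i\<in>{1..length cs}. psi (uG ((rot ^^ i) (pcomp b c)))) = psi (cyc_der b c)"
      by (simp only: psi_simps(5)[OF uG_carrier])
    ultimately have "unit_fun (b, c) - psi (cyc_der b c) \<in> one_boundaries" by simp
    then show ?thesis using z
        by (intro exI[of _ "unit_fun (b, c) - psi (cyc_der b c)"] exI[of _ 0])
            (simp only: diff_add_cancel add_0_right simp_thms)
  next
    case vertex
    obtain v where vc: "c = (v, [])" using vertex(3) by (cases c) auto
    have der: "cyc_der b c = 0" by (simp add: cyc_der_def vc)
    have "two_boundary b c c = unit_fun (b, c)"
      unfolding two_boundary_eq[OF b c c]
      unfolding vc prod_with_vertex[OF b] prod_with_vertex[OF c[unfolded vc]]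
      using vertex vc by simp
    then have "unit_fun (b, c) \<in> one_boundaries" using two_boundary_memb[OF b c c] by simp
    then show ?thesis using z
        by (intro exI[of _ "unit_fun (b, c)"] exI[of _ 0])
            (simp only: der psi_simps(1) add_0_right simp_thms)
  next
    case bc
    have der: "cyc_der b c = 0" using bc by (simp add: cyc_der_def)
    let ?e = "(psource c, [])"
    note e = source_in_B(1)[OF c]
    \<comment> \<open>The third term eb \<otimes> c vanishes, because the vertex \<open>?e\<close>
      is the source of \<open>c\<close> and not the target of \<open>b\<close>.\<close>
    have "two_boundary b c ?e = prod_left b c ?e - unit_fun (b, c)"
      unfolding two_boundary_eq[OF b c e] prod_with_vertex[OF b] prod_with_vertex[OF c] using bc
          by simp
    then have "unit_fun (b, c) = - two_boundary b c ?e + 0 + prod_left b c ?e" by simp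
    moreover have "prod_left b c ?e \<in> carrier (free_space noncycle_pairs)"
    proof (cases "composable G b c \<and> pcomp b c \<in> B")
      case True
      then have "(pcomp b c, ?e) \<in> noncycle_pairs"
        using bc composable_pcomp[of b c] unfolding noncycle_pairs_def
        by (intro CollectI exI[of _ "pcomp b c"]) (simp add: cycles_def)
      then show ?thesis using True unfolding prod_left_def
          by (simp only: simp_thms if_True unit_fun_in_free_space)
    next
      case False
      then show ?thesis using z unfolding prod_left_def by (simp only: if_False)
    qed
    ultimately show ?thesis
      using neg[OF two_boundary_memb[OF b c e]] unfolding der psi_simps(1) by (intro exI conjI)
  next
    case cb
    have der: "cyc_der b c = 0" using cb by (simp add: cyc_der_def)
    let ?e = "(ptarget G c, [])" and ?a = "pcomp c b"
    note e = source_in_B(2)[OF c]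
    have tb: "two_boundary b ?e c = prod_left c b ?e - unit_fun (b, c)"
      unfolding two_boundary_eq[OF b e c] prod_with_vertex[OF b] prod_with_vertex[OF c] using cb
          by simp
    have comp: "composable G c b" using b c cb by (auto simp: composable_def nonzero_paths_iff)
    show ?thesis
    proof (cases "?a \<in> B")
      case False
      then have "prod_left c b ?e = 0" by (simp add: prod_left_def)
      then have "unit_fun (b, c) = - two_boundary b ?e c + 0 + 0" using tb by simp
      then show ?thesis
        using neg[OF two_boundary_memb[OF b e c]] z unfolding der psi_simps(1) by (intro exI conjI)
    next
      case True
      let ?s = "(psource ?a, [])"
      have pa: "psource ?a = psource b" "ptarget G ?a = ptarget G c" using composable_pcomp[OF comp]
          by auto
      have ne: "psource ?a \<noteq> ptarget G ?a" using cb pa by simp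
      have l: "prod_left c b ?e = unit_fun (?a, ?e)" using True comp by (simp add: prod_left_def)
      note s = source_in_B(1)[OF True]
      \<comment> \<open>Source s and target e of a = cb differ, so se = 0 and the boundary of a
        \<otimes> s \<otimes> e is a \<otimes> e + a \<otimes> s. It moves the vertex from the
        target to the source at the price of a sign.\<close>
      have "two_boundary ?a ?s ?e = unit_fun (?a, ?e) + unit_fun (?a, ?s)"
        unfolding two_boundary_eq[OF True s e]
        unfolding pa(2)[symmetric] prod_with_vertex[OF True] prod_with_vertex[OF s]
        using ne by simp
      then have "unit_fun (b, c) =
          (two_boundary ?a ?s ?e - two_boundary b ?e c) + 0 + fscale (- 1) (unit_fun (?a, ?s))"
        unfolding tb l by (simp add: fun_eq_iff)
      moreover have "(?a, ?s) \<in> noncycle_pairs"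
        using True ne unfolding noncycle_pairs_def
            by (intro CollectI exI[of _ ?a]) (simp add: cycles_def)
      then have "fscale (- 1 :: 'k) (unit_fun (?a, ?s)) \<in> carrier (free_space noncycle_pairs)"
        by (intro free_space_closed unit_fun_in_free_space)
      moreover have "two_boundary ?a ?s ?e - two_boundary b ?e c \<in> one_boundaries"
        by (intro bnd_closed two_boundary_memb True s e b c)
      ultimately show ?thesis unfolding der psi_simps(1) by (intro exI conjI)
    qed
  qed
qed

lemma decomposition:
  assumes "f \<in> carrier FB"
  shows "\<exists>i h. i \<in> one_boundaries \<and> h \<in> carrier (free_space noncycle_pairs) \<and> f =
      i + psi (phi f) + h"
  using assms
proof (induction f rule: free_space_induct)
  case zero
  show ?case
    by (intro exI[of _ 0] conjI bnd_closed zero_in_free_space)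
        (simp only: phi_simps psi_simps add_0_right)
next
  case (add f g)
  then obtain i h i' h' where 1: "i \<in> one_boundaries" "h \<in> carrier (free_space noncycle_pairs)"
      "f = i + psi (phi f) + h"
    "i' \<in> one_boundaries" "h' \<in> carrier (free_space noncycle_pairs)" "g = i' + psi (phi g) + h'"
        by blast
  have "psi (phi (f + g)) = psi (phi f) + psi (phi g)"
    using phi_simps(2)[OF add(1,2)]
        psi_simps(2)[OF is_linearD(1)[OF phi_linear add(1)] is_linearD(1)[OF phi_linear add(2)]]
    by simp
  then have "f + g = (i + i') + psi (phi (f + g)) + (h + h')"
    using arg_cong2[OF 1(3,6), of "(+)"] by (simp only: add_ac)
  then show ?case
    by (intro exI[of _ "i + i'"] exI[of _ "h + h'"] conjI bnd_closed(2)[OF 1(1,4)]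
        free_space_closed(1)[OF 1(2,5)])
next
  case (unit k p)
  then obtain b c where p: "p = (b, c)" "b \<in> B" "c \<in> B" by auto
  obtain i h where 1: "i \<in> one_boundaries" "h \<in> carrier (free_space noncycle_pairs)"
    "unit_fun p = i + psi (phi (unit_fun p)) + h"
    using decomposition_unit[OF p(2,3)] unfolding p(1) phi_unit by blast
  have "fscale k (unit_fun p) = fscale k (i + psi (phi (unit_fun p)) + h)" using 1(3) by simp
  also have "\<dots> = fscale k i + psi (phi (fscale k (unit_fun p))) + fscale k h"
    unfolding fscale_add phi_simps psi_simps ..
  finally show ?case
    by (intro exI[of _ "fscale k i"] exI[of _ "fscale k h"] conjI bnd_closed(3)[OF 1(1)]
        free_space_closed(3)[OF 1(2)])
qed

section \<open>One-cycles as functions on cycles\<close>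

definition der :: "(('v, 'e) qpath \<times> ('v, 'e) qpath \<Rightarrow> 'k) \<Rightarrow> ('v, 'e) qpath \<Rightarrow> 'k" where
  "der f x = functional_ext (\<lambda>(b, c). mu b c x - mu c b x) f"

lemma one_cycle_iff: "one_cycle f \<longleftrightarrow> f \<in> carrier FB \<and> (\<forall>x\<in>B. der f x = 0)"
  by (simp add: one_cycle_def der_def)

lemma der_simps:
  "f \<in> carrier FB \<Longrightarrow> g \<in> carrier FB \<Longrightarrow> der (f + g) x = der f x + der g x"
  "der (fscale k f) x = k * der f x" "der 0 x = 0"
  "der (unit_fun (b, c)) x = mu b c x - mu c b x"
  unfolding der_def by (erule (1) functional_ext_simps, rule functional_ext_fscale)
    (simp_all add: functional_ext_def[of _ 0] functional_ext_unit)

lemma mu_B: "b \<in> B \<Longrightarrow> c \<in> B \<Longrightarrow> x \<in> B \<Longrightarrow> mu b c x = (if composable G b c \<and> pcomp b c = x then 1 else 0)"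
  unfolding mu_def by (rule coef_mult)

text \<open>The chain \<beta> \<otimes> a is sent to \<beta>a - a\<beta>, and a\<beta> is the
  rotation of \<beta>a. So the coefficient at \<open>x\<close> collects the value of
  \<open>g\<close> at the rotation of \<open>x\<close> with sign + and the value at \<open>x\<close>
  with sign -.\<close>

lemma der_psi:
  assumes "g \<in> carrier FG" and x: "x \<in> B"
  shows "der (psi g) x = (if x \<in> cycles G \<and> snd x \<noteq> [] then g (rot x) - g x else 0)"
  using assms(1)
proof (induction g rule: free_space_induct)
  case zero
  have "der (psi 0) x = 0" by (simp only: psi_simps(1) der_simps(3))
  then show ?case by (simp add: zero_fun_def)
next
  case (add f g)
  have "der (psi (f + g)) x = der (psi f) x + der (psi g) x"
    unfolding psi_simps(2)[OF add(1,2)]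
    by (rule der_simps(1)[OF is_linearD(1)[OF psi_linear add(1)] is_linearD(1)[OF psi_linear
        add(2)]])
  then show ?case using add(3,4) by (simp add: plus_fun_def)
next
  case (unit k \<gamma>)
  then obtain v es a where g: "\<gamma> = (v, es @ [a])" "arrow_split \<gamma> = ((v, es), (tail G a, [a]))"
    "(v, es) \<in> B" "a \<in> arcs G" "ptarget G (v, es) = tail G a" "head G a = v"
    by (rule arrow_split_gam)
  let ?\<alpha> = "(tail G a, [a])" and ?\<beta> = "(v, es)"
  have aB: "?\<alpha> \<in> B" using arrow_in_B[OF g(4)] .
  have P: "(v, es) \<in> paths G" using g(3) by (simp add: nonzero_paths_iff)
  have ba: "composable G ?\<beta> ?\<alpha>" "pcomp ?\<beta> ?\<alpha> = (tail G a, a # es)"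
    using g P by (auto simp: composable_iff)
  have ab: "composable G ?\<alpha> ?\<beta>" "pcomp ?\<alpha> ?\<beta> = \<gamma>"
    using g P psource_verts[OF P] by (auto simp: composable_iff)
  have cyc: "\<gamma> \<in> cycles G" "(tail G a, a # es) \<in> cycles G"
    using g P psource_verts[OF P] by (auto simp: cycles_iff)
  have r: "rot (tail G a, a # es) = \<gamma>" using g by (simp add: rotation_def)
  have "der (unit_fun (?\<beta>, ?\<alpha>)) x = (if (tail G a, a # es) = x then 1 else 0) - (if \<gamma> =
      x then 1 else 0)"
    unfolding der_simps(4) mu_B[OF g(3) aB x] mu_B[OF aB g(3) x] using ab ba by simp
  moreover have "(tail G a, a # es) = x \<longleftrightarrow> x \<in> cycles G \<and> snd x \<noteq> [] \<and> rot x = \<gamma>"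
  proof
    assume "(tail G a, a # es) = x"
    then show "x \<in> cycles G \<and> snd x \<noteq> [] \<and> rot x = \<gamma>" using cyc r by auto
  next
    assume h: "x \<in> cycles G \<and> snd x \<noteq> [] \<and> rot x = \<gamma>"
    show "(tail G a, a # es) = x"
      by (rule rot_inj[of _ _ 1]) (use h cyc r in auto)
  qed
  moreover have "\<gamma> = x \<longleftrightarrow> x \<in> cycles G \<and> snd x \<noteq> [] \<and> x = \<gamma>" using cyc g(1) by auto
  ultimately have "der (unit_fun (arrow_split \<gamma>)) x =
      (if x \<in> cycles G \<and> snd x \<noteq> [] then unit_fun \<gamma> (rot x) - unit_fun \<gamma> x else 0)"
    unfolding g(2) by (auto simp: unit_fun_def)
  then show ?case unfolding psi_simps psi_unit der_simps(2) by (simp add: algebra_simps)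
qed

lemma der_noncycle:
  assumes "h \<in> carrier (free_space noncycle_pairs)" and x: "x \<in> B" "x \<notin> cycles G"
  shows "der h x = h (x, (psource x, []))"
  using assms(1)
proof (induction h rule: free_space_induct)
  case zero
  show ?case using der_simps(3)[of x] by (simp add: zero_fun_def)
next
  case (add f g)
  have "f \<in> carrier FB" "g \<in> carrier FB" using add(1,2) noncycle_pairs_sub by auto
  then show ?case using add(3,4) der_simps(1)[of f g x]
      by (simp add: plus_fun_def del: free_space_simps)
next
  case (unit k p)
  then obtain a where a: "p = (a, (psource a, []))" "a \<in> B" "a \<notin> cycles G"
      by (auto simp: noncycle_pairs_def)
  obtain v es where v: "a = (v, es)" by (cases a)
  have P: "(v, es) \<in> paths G" using a by (simp add: v nonzero_paths_iff)
  have m: "mu a (psource a, []) x = (if a = x then 1 else 0)" "mu (psource a, []) a x = 0"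
    unfolding mu_B[OF a(2) source_in_B(1)[OF a(2)] x(1)] mu_B[OF source_in_B(1)[OF a(2)] a(2) x(1)]
    using P a(3) psource_verts[OF P] by (auto simp: v composable_iff cycles_iff)
  show ?case unfolding a(1) der_simps(2,4) m by (auto simp: unit_fun_def)
qed

text \<open>In the decomposition of \<open>f\<close>, the boundary has zero differential and
  \<open>psi\<close> contributes at cycles only. At a path that is not a cycle the differential thus
  reads off a coefficient of \<open>h\<close>, so h = 0. At a cycle it then gives the invariance, by
  \<open>der_psi\<close>.\<close>

lemma cycle_reduction:
  assumes f: "one_cycle f"
  shows "f - psi (phi f) \<in> one_boundaries"
    and "\<And>x. x \<in> B \<Longrightarrow> x \<in> cycles G \<Longrightarrow> snd x \<noteq> [] \<Longrightarrow> phi f (rot x) = phi f x"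
proof -
  have fF: "f \<in> carrier FB" using f by (simp add: one_cycle_def)
  obtain i h where 1: "i \<in> one_boundaries" "h \<in> carrier (free_space noncycle_pairs)"
      "f = i + psi (phi f) + h"
    using decomposition[OF fF] by blast
  have hF: "h \<in> carrier FB" using 1(2) noncycle_pairs_sub by auto
  have pG: "phi f \<in> carrier FG" by (rule is_linearD(1)[OF phi_linear fF])
  have pF: "psi (phi f) \<in> carrier FB" by (rule is_linearD(1)[OF psi_linear pG])
  have iF: "i \<in> carrier FB" by (rule bnd_closed(5)[OF 1(1)])
  have d: "der f x = der (psi (phi f)) x + der h x" if "x \<in> B" for x
  proof -
    have "der f x = der (i + psi (phi f) + h) x" using 1(3) by simp
    also have "\<dots> = der i x + der (psi (phi f)) x + der h x"
      unfolding der_simps(1)[OF free_space_closed(1)[OF iF pF] hF] der_simps(1)[OF iF pF] ..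
    also have "der i x = 0" using one_boundaries_cycles[OF 1(1)] that by (simp add: one_cycle_iff)
    finally show ?thesis by simp
  qed
  have df: "der f x = 0" if "x \<in> B" for x using f that by (simp add: one_cycle_iff)
  have "h = 0"
  proof
    fix p show "h p = 0 p"
    proof (cases "p \<in> noncycle_pairs")
      case True
      then obtain a where a: "p = (a, (psource a, []))" "a \<in> B" "a \<notin> cycles G"
          by (auto simp: noncycle_pairs_def)
      have "h p = der h a" using der_noncycle[OF 1(2) a(2,3)] a(1) by simp
      also have "\<dots> = 0" using d[OF a(2)] df[OF a(2)] der_psi[OF pG a(2)] a(3) by simp
      finally show ?thesis by simp
    next
      case False
      then show ?thesis using 1(2) by auto
    qed
  qed
  then have fi: "f = i + psi (phi f)" using 1(3) by simp
  have "f - psi (phi f) = i" by (subst (1) fi) (rule add_diff_cancel_right')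
  then show "f - psi (phi f) \<in> one_boundaries" using 1(1) by simp
  fix x assume x: "x \<in> B" "x \<in> cycles G" "snd x \<noteq> []"
  have "der h x = 0" using \<open>h = 0\<close> by (simp only: der_simps(3))
  then show "phi f (rot x) = phi f x"
    using d[OF x(1)] df[OF x(1)] der_psi[OF pG x(1)] x by simp
qed

lemma psi_cycle:
  assumes g: "g \<in> carrier FG" and inv: "\<And>x. x \<in> B \<Longrightarrow> x \<in> cycles G \<Longrightarrow> snd x \<noteq> [] \<Longrightarrow> g (rot x) = g x"
  shows "one_cycle (psi g)"
  unfolding one_cycle_iff using is_linearD(1)[OF psi_linear g] der_psi[OF g] inv
      by (simp del: free_space_simps)

text \<open>The second factor of \<beta> \<otimes> a is a single arrow, so the Leibniz sum has one
  summand, the cycle a\<beta> itself.\<close>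

lemma phi_psi:
  assumes "g \<in> carrier FG"
  shows "phi (psi g) = g"
  using assms
proof (induction g rule: free_space_induct)
  case zero
  then show ?case by (simp only: psi_simps phi_simps)
next
  case (add f g)
  then show ?case
    using phi_simps(2)[OF is_linearD(1)[OF psi_linear add(1)] is_linearD(1)[OF psi_linear add(2)]]
    by (simp only: psi_simps(2)[OF add(1,2)])
next
  case (unit k \<gamma>)
  then obtain v es a where g: "\<gamma> = (v, es @ [a])" "arrow_split \<gamma> = ((v, es), (tail G a, [a]))"
    "(v, es) \<in> B" "a \<in> arcs G" "ptarget G (v, es) = tail G a" "head G a = v"
    by (rule arrow_split_gam)
  have "cyc_der (v, es) (tail G a, [a]) = uG (rot (tail G a, a # es))"
    using g by (simp add: cyc_der_def)
  also have "rot (tail G a, a # es) = \<gamma>" using g by (simp add: rotation_def)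
  finally have "phi (psi (unit_fun \<gamma>)) = unit_fun \<gamma>"
    unfolding psi_unit g(2) phi_unit using unit by (simp only: uG_def if_True)
  then show ?case by (simp only: psi_simps phi_simps)
qed

section \<open>The dimension\<close>

text \<open>Write \<open>w\<close> as \<zeta>\<alpha> with \<zeta> in \<open>Z\<close> and rotate it
  so that \<zeta> is traversed first. In the Leibniz rule for \<alpha> \<otimes> \<zeta> the left
  side is 0 since \<zeta> is a zero path, so the rotations that end in an arrow of \<zeta> sum to a
  boundary. All other rotations contain \<zeta> before their last arrow and vanish.\<close>

lemma psi_cyc_sum:
  assumes w: "w \<in> wset"
  shows "psi (cyc_sum w) \<in> one_boundaries"
proof -
  obtain \<zeta> v es where z: "\<zeta> \<in> Z" "w = (v, es @ snd \<zeta>)" "composable G \<zeta> (v, es)"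
      "w = pcomp \<zeta> (v, es)" "(v, es) \<in> B"
    using w by (rule suffix_in_Z)
  obtain u zs where zz: "\<zeta> = (u, zs)" by (cases \<zeta>)
  have zs: "zs \<noteq> []" using Z_nonempty[OF z(1)] by (simp add: zz)
  have wl: "w = (v, es @ zs)" using z(2) by (simp add: zz)
  have nz: "\<not> nonzero_list zs" using z(1) by (auto simp: nonzero_list_def zz intro!: bexI[of _ \<zeta>])
  have cyc: "(v, es @ zs) \<in> cycles G" using wsetD(2)[OF w] wl by simp
  have P: "(v, es) \<in> paths G" "(u, zs) \<in> paths G" "ptarget G (v, es) = u" "ptarget G (u, zs) = v"
    using cyc z(3) by (auto simp: zz composable_iff cycles_iff)
  let ?\<gamma> = "(u, zs @ es)"
  have r: "(rot ^^ length es) w = ?\<gamma>" using rot_append[OF cyc] P wl by simp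
  have circ: "circ ?\<gamma> = circ w" using circ_eq[OF wsetD(2)[OF w]] circI[of "length es" w] r by simp
  have gc: "?\<gamma> \<in> cycles G" using rot_funpow_cycles[OF wsetD(2)[OF w], of "length es"] r by simp
  have r': "(rot ^^ length zs) ?\<gamma> = w" using rot_append[OF gc] P wl by simp
  have "cyc_sum w \<delta> = cyc_sum ?\<gamma> \<delta>" for \<delta>
    unfolding cyc_sum_apply[OF wsetD(2,3)[OF w]] using cyc_sum_apply[OF gc] zs circ by simp
  then have eq: "cyc_sum w = cyc_sum ?\<gamma>" by (rule ext)
  have "butlast (es @ zs) = es @ butlast zs" using zs by (simp add: butlast_append)
  moreover have "nonzero_list (butlast (es @ zs))" using wsetD(1)[OF w] wl by (simp add: gam_def)
  ultimately have "nonzero_list (butlast zs)"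
      using nonzero_list_mono[of "es @ butlast zs" "butlast zs"] by simp
  then have "(if (u, zs) \<in> B then unit_fun ((v, es), (u, zs)) else 0)
    - (\<Sum>i\<in>{1..length zs}. psi (uG ((rot ^^ i) (pcomp (v, es) (u, zs))))) \<in> one_boundaries"
    by (intro leibniz z(5) P(2) zs) (use P in auto)
  moreover have "(u, zs) \<notin> B" using nz by (simp add: nonzero_paths_iff)
  ultimately have "0 - (\<Sum>i\<in>{1..length zs}. psi (uG ((rot ^^ i) ?\<gamma>))) \<in> one_boundaries" by simp
  from bnd_closed(4)[OF bnd_closed(1) this]
  have 1: "(\<Sum>i\<in>{1..length zs}. psi (uG ((rot ^^ i) ?\<gamma>))) \<in> one_boundaries"
    unfolding zero_diff_zero_diff .
  have "(\<Sum>i\<in>{length zs + 1..length zs + length es}. uG ((rot ^^ i) ?\<gamma>)) = 0"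
  proof (rule sum.neutral, rule ballI)
    fix i assume i: "i \<in> {length zs + 1..length zs + length es}"
    then have "i = (i - length zs) + length zs" by simp
    then have "(rot ^^ i) ?\<gamma> = (rot ^^ (i - length zs)) w" using r' by (metis comp_apply funpow_add)
    moreover have "1 \<le> i - length zs" "i - length zs \<le> length es" using i by auto
    ultimately show "uG ((rot ^^ i) ?\<gamma>) = 0"
      using uG_zero[of w es zs "i - length zs"] nz wl by simp
  qed
  then have "cyc_sum ?\<gamma> = (\<Sum>i\<in>{1..length zs}. uG ((rot ^^ i) ?\<gamma>))"
    unfolding cyc_sum_def
        using sum.ub_add_nat[of 1 "length zs" "\<lambda>i. uG ((rot ^^ i) ?\<gamma>)" "length es"] by simp
  then show ?thesis unfolding eq using 1 by (simp only: psi_simps(5)[OF uG_carrier])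
qed

lemma cyc_sum_carrier: "cyc_sum \<gamma> \<in> carrier FG"
  unfolding cyc_sum_def by (rule sum_in_free_space) (rule uG_carrier)

lemma bnd_sum: "(\<And>i. i \<in> J \<Longrightarrow> f i \<in> one_boundaries) \<Longrightarrow> (\<Sum>i\<in>J. f i) \<in> one_boundaries"
proof (induction J rule: infinite_finite_induct)
  case (infinite J)
  show ?case unfolding sum.infinite[OF infinite(1)] by (rule bnd_closed)
next
  case (insert j J)
  show ?case unfolding sum.insert[OF insert(1,2)] by (rule bnd_closed(2)) (use insert in blast)+
qed (simp only: sum.empty bnd_closed)

lemma indicator_cycle:
  assumes C: "C \<subseteq> gam" and inv: "\<And>x. x \<in> B \<Longrightarrow> x \<in> cycles G \<Longrightarrow> snd x \<noteq> [] \<Longrightarrow> rot x \<in> C \<longleftrightarrow> x \<in> C"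
  obtains f where "one_cycle f" "phi f = (\<lambda>x. if x \<in> C then 1 else 0)"
proof -
  let ?g = "\<lambda>x. if x \<in> C then 1 else 0 :: 'k"
  have "finite C" using finite_gam[OF finite_B] C by (rule finite_subset[rotated])
  then have g: "?g \<in> carrier FG" using C by auto
  show thesis by (rule that[OF psi_cycle[OF g] phi_psi[OF g]]) (simp add: inv)
qed

theorem hochschild_1_monomial:
  fixes p :: nat
  assumes p: "CHAR('k) = p"
  defines "E' \<equiv> {C \<in> efficient_circuits G Z. p'_circuit p G C}"
  shows "vectorspace.fin_dim class_ring (hochschild_homology A 1) \<and>
    int (vectorspace.dim class_ring (hochschild_homology A 1)) =
      int (card (nontrivial_strong_circuits G Z)) + int (card wset) - int (card E')"
proof -
  let ?SC = "nontrivial_strong_circuits G Z"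
  have fg: "finite gam" by (rule finite_gam[OF finite_B])
  have fw: "finite wset" using fg by (simp add: wset_def)
  have E'_sub: "E' \<subseteq> circ ` wset" unfolding E'_def efficient_circuits_eq by blast
  have E'_iff: "circ w \<in> E' \<longleftrightarrow> \<not> p dvd multiplicity G (circ w)" if "w \<in> wset" for w
    using that trivial_circ[OF wsetD(2)[OF that]] wsetD(3)[OF that]
    by (auto simp: E'_def efficient_circuits_eq p'_circuit_def)
  \<comment> \<open>In every efficient p'-circuit one element of \<open>W\<close> is chosen. Its
    value is used up by the boundary, so it leaves the index set \<open>S\<close>.\<close>
  define base where "base C = (SOME w. w \<in> wset \<and> circ w = C)" for C
  have base: "base C \<in> wset \<and> circ (base C) = C" if "C \<in> E'" for C
  proof -
    from subsetD[OF E'_sub that] obtain w where "C = circ w" "w \<in> wset" by (rule imageE)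
    from conjI[OF this(2) this(1)[symmetric]] show ?thesis unfolding base_def by (rule someI)
  qed
  \<comment> \<open>A one-cycle is constant on a strong circuit, so its value at one chosen cycle
    describes it there.\<close>
  define rep where
      "rep C = (SOME \<gamma>. \<gamma> \<in> {\<gamma> \<in> cycles G. snd \<gamma> \<noteq> [] \<and> circ \<gamma> \<subseteq> B} \<and> circ \<gamma> = C)" for C
  have rep_spec: "rep C \<in> {\<gamma> \<in> cycles G. snd \<gamma> \<noteq> [] \<and> circ \<gamma> \<subseteq> B} \<and> circ (rep C) = C"
      if "C \<in> ?SC" for C
  proof -
    from that obtain \<gamma> where "C = circ \<gamma>" "\<gamma> \<in> {\<gamma> \<in> cycles G. snd \<gamma> \<noteq> [] \<and> circ \<gamma> \<subseteq> B}"
      unfolding nontrivial_strong_eq by (rule imageE)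
    from conjI[OF this(2) this(1)[symmetric]] show ?thesis
      unfolding rep_def by (rule someI)
  qed
  have rep: "rep C \<in> cycles G" "snd (rep C) \<noteq> []" "circ (rep C) \<subseteq> B" "circ (rep C) = C"
      if "C \<in> ?SC" for C
    using rep_spec[OF that] unfolding mem_Collect_eq by - (elim conjE, assumption)+
  have repB: "rep C \<in> B" if "C \<in> ?SC" for C by (rule subsetD[OF rep(3)[OF that] circ_self])
  have rep_gam: "rep C \<in> gam" if "C \<in> ?SC" for C
    by (rule B_cycle_gam(1)[OF repB[OF that] rep(1,2)[OF that]])
  define S where "S = rep ` ?SC \<union> (wset - base ` E')"
  \<comment> \<open>A circuit in \<open>E'\<close> contains an element of \<open>W\<close>, which is
    not in \<open>B\<close>. So strong circuits get no correction term in \<theta>.\<close>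
  have strong_E': "circ s \<notin> E'" if "s \<in> cycles G" "circ s \<subseteq> B" for s
  proof
    assume "circ s \<in> E'"
    from base[OF this] have b: "base (circ s) \<in> wset" "circ (base (circ s)) = circ s"
      by - (elim conjE, assumption)+
    have "base (circ s) \<in> circ s" using circ_self[of "base (circ s)"] unfolding b(2) .
    from subsetD[OF that(2) this] show False by (rule notE[OF wsetD(4)[OF b(1)]])
  qed
  \<comment> \<open>The boundaries of the circuit \<open>C\<close> are the multiples of \<open>m\<close> times its indicator function. If \<open>m\<close> is
    invertible, they are detected by the value at \<open>base C\<close>, which is therefore subtracted.\<close>
  define \<theta> where "\<theta> f s = phi f s - (if circ s \<in> E' then phi f (base (circ s)) else 0)" for f s
  have \<theta>_rep: "\<theta> f (rep C) = phi f (rep C)" if "C \<in> ?SC" for f C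
    unfolding \<theta>_def using strong_E'[OF rep(1,3)[OF that]] by simp
  have S_gam: "S \<subseteq> gam" using rep_gam wsetD(1) by (auto simp: S_def)
  have fS: "finite S" using fg S_gam by (rule finite_subset[rotated])
  have inj_rep: "inj_on rep ?SC" using rep(4) by (rule inj_on_inverseI)
  have inj_base: "inj_on base E'" using conjunct2[OF base] by (rule inj_on_inverseI)
  have card_S: "int (card S) = int (card ?SC) + int (card wset) - int (card E')"
  proof -
    have bs: "base ` E' \<subseteq> wset" by (rule image_subsetI) (rule conjunct1[OF base])
    have fr: "finite (rep ` ?SC)" using fS by (simp add: S_def)
    have "rep ` ?SC \<inter> (wset - base ` E') = {}" using repB wsetD(4) by blast
    then have "card S = card (rep ` ?SC) + card (wset - base ` E')"
      unfolding S_def using fr fw by (intro card_Un_disjoint) auto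
    moreover have "card (wset - base ` E') = card wset - card (base ` E')"
      using finite_subset[OF bs fw] bs by (rule card_Diff_subset)
    moreover have "card (base ` E') \<le> card wset" using fw bs by (rule card_mono)
    ultimately show ?thesis using card_image[OF inj_rep] card_image[OF inj_base] by simp
  qed
  have lin: "linear_functional FB (\<lambda>f. \<theta> f s)" for s
    unfolding linear_functional_def \<theta>_def
    by (auto simp: phi_simps algebra_simps simp del: free_space_simps(1))
  have zero: "\<theta> f s = 0" if f: "f \<in> one_boundaries" and s: "s \<in> S" for f s
  proof -
    have gens: "{two_boundary a b c | a b c. a \<in> B \<and> b \<in> B \<and> c \<in> B} \<subseteq> carrier FB"
      using bnd_closed(5) two_boundary_memb by blast
    from f[unfolded one_boundaries_def] show ?thesis
    proof (rule span_induct_class_ring[OF vectorspace_free_space gens])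
      show "\<theta> \<zero>\<^bsub>FB\<^esub> s = 0" using phi_simps(1) by (simp add: \<theta>_def)
    next
      fix r assume "r \<in> {two_boundary a b c | a b c. a \<in> B \<and> b \<in> B \<and> c \<in> B}"
      then obtain a b c where r: "r = two_boundary a b c" "a \<in> B" "b \<in> B" "c \<in> B" by blast
      from phi_two_boundary[OF r(2-4)] consider "phi r = 0"
        | \<gamma> where "\<gamma> \<in> cycles G" "snd \<gamma> \<noteq> []" "\<gamma> \<notin> B" "phi r = cyc_sum \<gamma>" unfolding r(1) by blast
      then show "\<theta> r s = 0"
      proof cases
        case 1
        then show ?thesis by (simp add: \<theta>_def)
      next
        case 2
        let ?m = "multiplicity G (circ \<gamma>)"
        have v: "phi r x = (if x \<in> circ \<gamma> \<and> x \<in> gam then of_nat ?m else 0)" for x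
          unfolding 2(4) by (rule cyc_sum_apply[OF 2(1,2)])
        show ?thesis
        proof (cases "s \<in> circ \<gamma>")
          case True
          have cs: "circ s = circ \<gamma>" by (rule circ_eq[OF 2(1) True])
          have "s \<notin> rep ` ?SC" using rep(3) cs circ_self[of \<gamma>] 2(3) by blast
          then have sw: "s \<in> wset" using s by (simp add: S_def)
          show ?thesis
          proof (cases "circ s \<in> E'")
            case E: True
            \<comment> \<open>Both \<open>s\<close> and the base point lie in \<open>gam\<close> and
              in the circuit of \<gamma>. There \<open>phi r\<close> has the constant value m, so
              the difference \<theta> is zero.\<close>
            have "base (circ s) \<in> circ \<gamma>" using circ_self[of "base (circ s)"]
              unfolding conjunct2[OF base[OF E]] unfolding cs .
            moreover have "base (circ s) \<in> gam" by (rule wsetD(1)[OF conjunct1[OF base[OF E]]])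
            ultimately
            show ?thesis using v True wsetD(1)[OF sw] E by (simp add: \<theta>_def)
          next
            case E: False
            \<comment> \<open>The circuit is efficient but not a p'-circuit, so m is zero in the
              field and \<open>phi r\<close> vanishes altogether.\<close>
            then have "p dvd ?m" using E'_iff[OF sw] cs by simp
            then have "(of_nat ?m :: 'k) = 0" using p by (simp add: of_nat_eq_0_iff_char_dvd)
            then show ?thesis using v E by (simp add: \<theta>_def)
          qed
        next
          case False
          have "base (circ s) \<notin> circ \<gamma>" if E: "circ s \<in> E'"
          proof
            assume "base (circ s) \<in> circ \<gamma>"
            from circ_eq[OF 2(1) this] have "circ s = circ \<gamma>" unfolding conjunct2[OF base[OF E]] .
            then show False using False circ_self[of s] by simp
          qed
          then show ?thesis using v False by (simp add: \<theta>_def)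
        qed
      qed
    next
      fix f g assume "f \<in> carrier FB" "g \<in> carrier FB" "\<theta> f s = 0" "\<theta> g s = 0"
      then show "\<theta> (f \<oplus>\<^bsub>FB\<^esub> g) s = 0" by (simp only: linear_functionalD(1)[OF lin] add_0)
    next
      fix c f assume "f \<in> carrier FB" "\<theta> f s = 0"
      then show "\<theta> (c \<odot>\<^bsub>FB\<^esub> f) s = 0" by (simp only: linear_functionalD(2)[OF lin] mult_zero_right)
    qed
  qed
  have ker: "f \<in> one_boundaries" if f: "one_cycle f" and z: "\<And>s. s \<in> S \<Longrightarrow> \<theta> f s = 0" for f
  proof -
    let ?g = "phi f"
    note red = cycle_reduction[OF f]
    have gF: "?g \<in> carrier FG" using is_linearD(1)[OF phi_linear] f
        by (simp add: one_cycle_def del: free_space_simps)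
    have along: "?g ((rot ^^ i) \<delta>) = ?g \<delta>" if "\<delta> \<in> gam" "\<And>j. j < i \<Longrightarrow> (rot ^^ j) \<delta> \<in> B" for \<delta> i
      using that(2)
    proof (induction i)
      case (Suc i)
      have "?g (rot ((rot ^^ i) \<delta>)) = ?g ((rot ^^ i) \<delta>)"
        by (rule red(2)) (use Suc.prems gamD[OF that(1)] rot_funpow_cycles in auto)
      then show ?case using Suc by simp
    qed simp
    \<comment> \<open>On the circuits in \<open>E'\<close> the multiplicity is invertible in the
      field. The coefficients make \<open>?h\<close> agree with \<open>?g\<close> at the base
      points, and \<open>psi\<close> maps \<open>?h\<close> to a boundary by
      \<open>psi_cyc_sum\<close>.\<close>
    let ?k = "\<lambda>C. ?g (base C) / of_nat (multiplicity G C)"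
    let ?h = "\<Sum>C\<in>E'. fscale (?k C) (cyc_sum (base C))"
    have fE: "finite E'" using E'_sub fw by (auto intro: finite_subset)
    have hv: "?h \<delta> = (if circ \<delta> \<in> E' then ?g (base (circ \<delta>)) else 0)" if d: "\<delta> \<in> gam" for \<delta>
    proof -
      have "fscale (?k C) (cyc_sum (base C)) \<delta> = (if C = circ \<delta> then ?g (base C) else 0)"
          if C: "C \<in> E'" for C
      proof -
        note w = conjunct1[OF base[OF C]] conjunct2[OF base[OF C]]
        have "(of_nat (multiplicity G C) :: 'k) \<noteq> 0"
          using E'_iff[OF w(1)] w(2) C p by (simp add: of_nat_eq_0_iff_char_dvd)
        moreover have "\<delta> \<in> C \<longleftrightarrow> C = circ \<delta>"
          using circ_eq_iff[OF wsetD(2)[OF w(1)] gamD(1)[OF d]] w(2) by auto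
        ultimately show ?thesis using cyc_sum_apply[OF wsetD(2,3)[OF w(1)], of \<delta>, unfolded w(2)] d
          by (cases "C = circ \<delta>") simp_all
      qed
      then have "?h \<delta> = (\<Sum>C\<in>E'. if C = circ \<delta> then ?g (base C) else 0)"
        unfolding fun_sum_apply by (rule sum.cong[OF refl])
      then show ?thesis using fE by simp
    qed
    \<comment> \<open>Constancy along runs reduces \<open>?g\<close> to its values at the chosen
      cycles \<open>rep\<close> and on \<open>W\<close>. There \<theta> = 0 forces the value 0, or
      the value at the base point if the circuit has one.\<close>
    have gv: "?g \<delta> = (if circ \<delta> \<in> E' then ?g (base (circ \<delta>)) else 0)" if d: "\<delta> \<in> gam" for \<delta>
    proof (cases "circ \<delta> \<subseteq> B")
      case True
      have "circ \<delta> \<in> ?SC" unfolding nontrivial_strong_eq using gamD[OF d] True by blast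
      note C = this
      have "\<delta> \<in> circ (rep (circ \<delta>))" using rep(4)[OF C] circ_self by simp
      then obtain i where i: "\<delta> = (rot ^^ i) (rep (circ \<delta>))" by (rule circE)
      have "?g \<delta> = ?g ((rot ^^ i) (rep (circ \<delta>)))" using i by (rule arg_cong)
      also have "\<dots> = ?g (rep (circ \<delta>))"
        by (rule along[OF rep_gam[OF C] subsetD[OF rep(3)[OF C] circI]])
      also have "\<dots> = \<theta> f (rep (circ \<delta>))" using \<theta>_rep[OF C] by simp
      also have "\<dots> = 0" by (rule z) (use C in \<open>simp add: S_def\<close>)
      finally show ?thesis using strong_E'[OF gamD(1)[OF d] True] by simp
    next
      case False
      obtain i where i: "(rot ^^ i) \<delta> \<in> wset" "\<And>j. j < i \<Longrightarrow> (rot ^^ j) \<delta> \<in> B"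
        using d False by (rule reach_wset) blast
      let ?w = "(rot ^^ i) \<delta>"
      have gw: "?g ?w = ?g \<delta>" by (rule along[OF d i(2)])
      have cw: "circ ?w = circ \<delta>" by (rule circ_eq[OF gamD(1)[OF d] circI])
      show ?thesis
      proof (cases "?w \<in> S")
        case True
        then show ?thesis using z[OF True] gw cw by (auto simp: \<theta>_def split: if_splits)
      next
        case F: False
        then obtain C where C: "C \<in> E'" "?w = base C" using i(1) by (auto simp: S_def)
        have "C = circ \<delta>" using conjunct2[OF base[OF C(1)]] unfolding C(2)[symmetric] cw
            by (rule sym)
        then show ?thesis using C gw by simp
      qed
    qed
    have "?g = ?h"
    proof
      fix \<delta> show "?g \<delta> = ?h \<delta>"
      proof (cases "\<delta> \<in> gam")
        case True
        then show ?thesis using gv hv by simp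
      next
        case False
        have out: "h \<delta> = 0" if "h \<in> carrier FG" for h :: "_ \<Rightarrow> 'k" using that False by auto
        have "?h \<in> carrier FG"
          by (intro sum_in_free_space free_space_closed(3) cyc_sum_carrier)
        from out[OF this] out[OF gF] show ?thesis by (simp only:)
      qed
    qed
    then have "psi ?g = psi ?h" by (rule arg_cong)
    also have "\<dots> = (\<Sum>C\<in>E'. fscale (?k C) (psi (cyc_sum (base C))))"
      by (simp only: psi_simps(5)[OF free_space_closed(3)[OF cyc_sum_carrier]] psi_simps(4))
    also have "\<dots> \<in> one_boundaries"
      by (intro bnd_sum bnd_closed(3) psi_cyc_sum conjunct1[OF base])
    finally have "psi ?g \<in> one_boundaries" .
    from bnd_closed(2)[OF red(1) this] show ?thesis by (simp only: diff_add_cancel)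
  qed
  have dual: "\<exists>f. one_cycle f \<and> (\<forall>t\<in>S. \<theta> f t = (if t = s then 1 else 0))" if s: "s \<in> S" for s
  proof -
    from s consider (strong) C where "C \<in> ?SC" "s = rep C" | (weak) "s \<in> wset" "s \<notin> base ` E'"
      by (auto simp: S_def)
    then show ?thesis
    proof cases
      \<comment> \<open>The dual vector comes from the indicator function of the whole circuit. It
        is invariant under rotation, and it vanishes at all base points, since these lie outside
        \<open>B\<close>.\<close>
      case strong
      note r = rep[OF strong(1)]
      have CB: "C \<subseteq> B" "C \<subseteq> cycles G" using r circ_cycles[OF r(1)] by auto
      have ne: "snd x \<noteq> []" if "x \<in> C" for x using circ_length[of x "rep C"] that r by auto
      have "C \<subseteq> gam" using B_cycle_gam(1) CB ne by blast
      moreover have "rot x \<in> C \<longleftrightarrow> x \<in> C" if x: "x \<in> cycles G" for x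
      proof -
        have "circ (rot x) = circ x" using circ_eq[OF x circI[of 1 x]] by simp
        then show ?thesis
          using circ_eq_iff[OF r(1) x] circ_eq_iff[OF r(1) rot_cycles[OF x]] r(4) by simp
      qed
      ultimately obtain f where f: "one_cycle f" "phi f = (\<lambda>x. if x \<in> C then 1 else 0)"
        by (rule indicator_cycle) blast+
      have "\<theta> f t = (if t = s then 1 else 0)" if t: "t \<in> S" for t
      proof -
        have "base (circ t) \<notin> C" if "circ t \<in> E'" using base[OF that] wsetD(4) CB by blast
        then have "\<theta> f t = (if t \<in> C then 1 else 0)" by (simp add: \<theta>_def f(2))
        moreover have "t \<in> C \<longleftrightarrow> t = s"
        proof
          assume tC: "t \<in> C"
          then have "t \<notin> wset" using CB wsetD(4) by blast
          then obtain D where D: "D \<in> ?SC" "t = rep D" using t by (auto simp: S_def)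
          have "circ t = C" using circ_eq[OF r(1)] tC r(4) by simp
          then show "t = s" using D rep(4)[OF D(1)] strong(2) by simp
        next
          assume "t = s"
          then show "t \<in> C" using strong(2) r(4) circ_self[of "rep C"] by simp
        qed
        ultimately show ?thesis by simp
      qed
      then show ?thesis using f(1) by blast
    next
      case weak
      \<comment> \<open>Every cycle outside \<open>B\<close> ends a run of rotations along which one-cycles are constant;
        \<open>arc\<close> is the run that ends in \<open>s\<close>.\<close>
      define arc where "arc = {\<gamma> \<in> gam. \<exists>i. (rot ^^ i) \<gamma> = s \<and> (\<forall>j<i. (rot ^^ j) \<gamma> \<in> B)}"
      have inv: "rot x \<in> arc \<longleftrightarrow> x \<in> arc" if x: "x \<in> B" "x \<in> cycles G" "snd x \<noteq> []" for x
      proof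
        assume "x \<in> arc"
        then obtain i where i: "(rot ^^ i) x = s" "\<And>j. j < i \<Longrightarrow> (rot ^^ j) x \<in> B" unfolding arc_def
            by blast
        have "i \<noteq> 0"
        proof
          assume "i = 0"
          then have "x = s" using i(1) by simp
          then show False using x(1) wsetD(4)[OF weak(1)] by simp
        qed
        then obtain k where k: "i = Suc k" by (cases i) auto
        have sh: "(rot ^^ j) (rot x) = (rot ^^ Suc j) x" for j by (simp add: funpow_swap1)
        have "(rot ^^ k) (rot x) = s" using i(1) unfolding sh k .
        moreover have "\<forall>j<k. (rot ^^ j) (rot x) \<in> B"
          unfolding sh k by (intro allI impI i(2)) (simp add: k)
        ultimately show "rot x \<in> arc" unfolding arc_def using B_cycle_gam(2)[OF x] by blast
      next
        assume "rot x \<in> arc"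
        then obtain i where i: "(rot ^^ i) (rot x) = s" "\<And>j. j < i \<Longrightarrow> (rot ^^ j) (rot x) \<in> B"
            unfolding arc_def by blast
        have sh: "(rot ^^ j) (rot x) = (rot ^^ Suc j) x" for j by (simp add: funpow_swap1)
        have "(rot ^^ Suc i) x = s" using i(1) unfolding sh .
        moreover have "(rot ^^ j) x \<in> B" if "j < Suc i" for j
        proof (cases j)
          case (Suc l)
          then have "l < i" using that by simp
          from i(2)[OF this] show ?thesis unfolding sh Suc .
        qed (use x in simp)
        ultimately show "x \<in> arc" unfolding arc_def using B_cycle_gam(1)[OF x] by blast
      qed
      have "arc \<subseteq> gam" by (auto simp: arc_def)
      then obtain f where f: "one_cycle f" "phi f = (\<lambda>x. if x \<in> arc then 1 else 0)"
        using inv by (rule indicator_cycle)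
      \<comment> \<open>An element of \<open>W\<close> lies outside \<open>B\<close>, so a run ends
        as soon as it meets one; hence \<open>arc\<close> contains no element of \<open>W\<close>
        other than \<open>s\<close>.\<close>
      have arc_w: "t \<in> arc \<longleftrightarrow> t = s" if t: "t \<in> wset" for t
      proof
        assume "t \<in> arc"
        then obtain i where i: "(rot ^^ i) t = s" "\<forall>j<i. (rot ^^ j) t \<in> B" unfolding arc_def
            by blast
        have "i = 0"
        proof (rule ccontr)
          assume "i \<noteq> 0"
          then have "(rot ^^ 0) t \<in> B" using i(2) by blast
          then show False using wsetD(4)[OF t] by simp
        qed
        then show "t = s" using i by simp
      next
        assume "t = s"
        then show "t \<in> arc" unfolding arc_def using wsetD(1)[OF t]
            by (intro CollectI conjI exI[of _ 0]) auto
      qed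
      have "\<theta> f t = (if t = s then 1 else 0)" if t: "t \<in> S" for t
      proof (cases "t \<in> wset")
        case True
        \<comment> \<open>The only element of \<open>W\<close> in \<open>arc\<close> is
          \<open>s\<close>, and by the choice of \<open>S\<close> this is not a base point. So the
          correction term in \<theta> is zero.\<close>
        have "base (circ t) \<notin> arc" if E: "circ t \<in> E'"
          using arc_w base[OF E] weak(2) E by blast
        then show ?thesis using arc_w[OF True] by (simp add: \<theta>_def f(2))
      next
        case False
        then obtain C where C: "C \<in> ?SC" "t = rep C" using t by (auto simp: S_def)
        have "t \<notin> arc"
        proof
          assume "t \<in> arc"
          then obtain i where "(rot ^^ i) t = s" unfolding arc_def by blast
          then have "s \<in> circ t" using circI by metis
          then show False using rep(3)[OF C(1)] C(2) wsetD(4)[OF weak(1)] by blast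
        qed
        moreover have "t \<noteq> s" using False weak(1) by blast
        ultimately show ?thesis using \<theta>_rep[OF C(1)] C(2) by (simp add: f(2))
      qed
      then show ?thesis using f(1) by blast
    qed
  qed
  have "vectorspace.fin_dim class_ring (hochschild_homology A 1) \<and>
    vectorspace.dim class_ring (hochschild_homology A 1) = card S"
    by (rule hochschild_homology_1_dim[OF fS lin _ dual]) (use zero ker in blast)
  then show ?thesis using card_S by simp
qed

end

theorem theorem3p4:
  fixes G :: "('v, 'e) pre_digraph"
    and Z :: "('v, 'e) qpath set"
    and A :: "('k::field, (('v, 'e) qpath \<Rightarrow> 'k) set) module"
    and p :: nat
  assumes char: "CHAR('k) = p" "p > 0"
    and quiver: "fin_digraph G" "Digraph_Component.connected G"
    and relations: "monomial_relations G Z"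
    and A_def: "A = monomial_algebra G Z"
    and fin_dim: "vectorspace.fin_dim (class_ring :: 'k ring) A"
  shows "vectorspace.fin_dim (class_ring :: 'k ring) (hochschild_homology A 1) \<and>
    int (vectorspace.dim (class_ring :: 'k ring) (hochschild_homology A 1)) =
      int (card (nontrivial_strong_circuits G Z))
      + (\<Sum>C\<in>efficient_circuits G Z. int (w_count G Z C))
      - int (card {C \<in> efficient_circuits G Z. p'_circuit p G C}) \<and>
    int (card (nontrivial_strong_circuits G Z))
      + (\<Sum>C\<in>efficient_circuits G Z. int (w_count G Z C))
      - int (card {C \<in> efficient_circuits G Z. p'_circuit p G C}) =
      int (card (odot G (arrow_paths G) (nonzero_paths G Z)))
      - int (card (odot G (vertex_paths G) (nonzero_paths G Z)))
      + int (card (verts G))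
      - int (card {C \<in> efficient_circuits G Z. p'_circuit p G C})
      + int (card (nontrivial_strong_circuits G Z))"
proof -
  interpret Q: monomial_quiver G Z
    by (intro monomial_quiver.intro monomial_quiver_axioms.intro quiver relations)
  obtain coef where coef: "based_algebra A (nonzero_paths G Z) Q.monomial_basis coef"
    "\<And>b c x. b \<in> nonzero_paths G Z \<Longrightarrow> c \<in> nonzero_paths G Z \<Longrightarrow> x \<in> nonzero_paths G Z \<Longrightarrow>
      coef x (Q.monomial_basis b \<otimes>\<^bsub>A\<^esub> Q.monomial_basis c) = (if composable G b c \<and> pcomp b c = x then 1 else 0)"
    using Q.monomial_based_algebra[OF fin_dim[unfolded A_def]] unfolding A_def by metis
  interpret H: monomial_homology G Z A Q.monomial_basis coef
    by (intro monomial_homology.intro monomial_homology_axioms.intro Q.monomial_quiver_axioms coef)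
  have w: "(\<Sum>C\<in>efficient_circuits G Z. int (w_count G Z C)) = int (card Q.wset)"
    using Q.sum_w_count[OF H.finite_B] by (metis of_nat_sum)
  show ?thesis
    using H.hochschild_1_monomial[OF char(1)] Q.card_odot[OF H.finite_B] unfolding w by simp
qed

end
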